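(* Let $A$ and $B$ be sorted arrays of sizes $n$ and $m$ respectively, with $n \geq m$, whose elements come from a totally ordered universe (comparison in constant time), stored in memory (say consecutively as $AB$). There is a parallel algorithm that rearranges the input in place so that it holds the sorted merge of $A$ and $B$, using $O(n)$ work, $O(\log^2 n)$ span with high probability, and $O(\log n)$ sequential stack-allocated memory.
   Context: Model: work-span model with binary forking. Threads share memory and each executes RAM instructions plus a fork instruction (spawning two child threads, with the parent resuming after both finish via a join). Work is the total number of instructions executed; span is the length of the longest chain of dependent instructions. A thread may allocate memory private to it (stack-allocated) or shared (heap-allocated). An algorithm on inputs of size $n$ uses $O(f(n))$ sequential stack-allocated memory if, when scheduled on a single thread, it uses at most $O(f(n))$ stack-allocated memory. "With high probability" means: for every constant $c\ge 1$, the bound holds up to a factor $c$ with probability at least $1-n^{-c}$, where $n$ is the input size. The algorithm may modify (permute) the input array in place; beyond the stated stack memory it uses only $O(1)$ words of shared memory. *)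

theory Defs
  imports "HOL-Probability.Probability"
begin

text \<open>
  A random-access machine with binary fork-join parallelism.  A program is a finite list of
  instructions; all threads run the same program and address the same shared memory, and every
  thread has a private memory (its stack) that no other thread can access.
  A memory cell holds either a machine word or one element of the ordered universe; elements can be
  moved and compared but not otherwise inspected.
\<close>

datatype 'a cell = Word nat | Elem 'a

datatype arith_op = Add | Sub | Mul | Div | Mod

text \<open>
  The arguments of type \<^typ>\<open>nat\<close> are constants of the program text: positions in the private memory
  (\<open>x\<close>, \<open>y\<close>, \<open>z\<close>), numbers of cells or literals (\<open>k\<close>) and program positions (\<open>l\<close>).
  \<open>Peek\<close>/\<open>Poke\<close> are the indirect accesses to private memory, \<open>Read\<close>/\<open>Write\<close> those to shared memory.
\<close>

datatype instr =
    Const nat nat               \<comment> \<open>\<open>x k\<close>\<close>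
  | Move nat nat                \<comment> \<open>\<open>x y\<close>: target, source\<close>
  | Arith arith_op nat nat nat  \<comment> \<open>\<open>op x y z\<close>: target, operands\<close>
  | Peek nat nat                \<comment> \<open>\<open>x y\<close>: target, cell with the address\<close>
  | Poke nat nat                \<comment> \<open>\<open>x y\<close>: cell with the address, source\<close>
  | Read nat nat                \<comment> \<open>\<open>x y\<close>: target, cell with the address\<close>
  | Write nat nat               \<comment> \<open>\<open>x y\<close>: cell with the address, source\<close>
  | Alloc nat                   \<comment> \<open>\<open>k\<close>\<close>
  | Free nat                    \<comment> \<open>\<open>k\<close>\<close>
  | Jump nat                    \<comment> \<open>\<open>l\<close>\<close>
  | Jump_Less nat nat nat       \<comment> \<open>\<open>x y l\<close>\<close>
  | Random nat                  \<comment> \<open>\<open>x\<close>\<close>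
  | Fork nat nat nat            \<comment> \<open>\<open>k l1 l2\<close>\<close>
  | Halt

type_synonym program = "instr list"

text \<open>Arithmetic on \<open>w\<close>-bit words wraps around; as words are below \<open>2 ^ w\<close>, no subtraction truncates.\<close>

fun arith :: "nat \<Rightarrow> arith_op \<Rightarrow> nat \<Rightarrow> nat \<Rightarrow> nat" where
  "arith w Add a b = (a + b) mod 2 ^ w"
| "arith w Sub a b = (a + (2 ^ w - b)) mod 2 ^ w"
| "arith w Mul a b = (a * b) mod 2 ^ w"
| "arith w Div a b = a div b"
| "arith w Mod a b = a mod b"

text \<open>Words and elements are comparable among themselves only.\<close>

fun cell_less :: "'a :: linorder cell \<Rightarrow> 'a cell \<Rightarrow> bool option" where
  "cell_less (Word a) (Word b) = Some (a < b)"
| "cell_less (Elem a) (Elem b) = Some (a < b)"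
| "cell_less _ _ = None"

text \<open>
  Instructions of a single thread (everything but \<open>Fork\<close> and \<open>Halt\<close>), acting on the program
  counter, the private memory \<open>s\<close> and the shared memory \<open>h\<close>.  The parameter \<open>r\<close> is the random word
  supplied in case the instruction is \<open>Random\<close>.  Accesses out of bounds, or to a cell of the wrong
  kind, have no successor: the thread is stuck.
\<close>

inductive exec ::
  "nat \<Rightarrow> nat \<Rightarrow> instr \<Rightarrow> nat \<times> 'a :: linorder cell list \<times> 'a cell list
     \<Rightarrow> nat \<times> 'a cell list \<times> 'a cell list \<Rightarrow> bool"
  for w r where
  Const: "x < length s \<Longrightarrow>
    exec w r (Const x k) (pc, s, h) (Suc pc, s[x := Word (k mod 2 ^ w)], h)"
| Move: "x < length s \<Longrightarrow> y < length s \<Longrightarrow>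
    exec w r (Move x y) (pc, s, h) (Suc pc, s[x := s ! y], h)"
| Arith: "x < length s \<Longrightarrow> y < length s \<Longrightarrow> z < length s \<Longrightarrow>
    s ! y = Word a \<Longrightarrow> s ! z = Word b \<Longrightarrow>
    exec w r (Arith op x y z) (pc, s, h) (Suc pc, s[x := Word (arith w op a b)], h)"
| Peek: "x < length s \<Longrightarrow> y < length s \<Longrightarrow> s ! y = Word a \<Longrightarrow> a < length s \<Longrightarrow>
    exec w r (Peek x y) (pc, s, h) (Suc pc, s[x := s ! a], h)"
| Poke: "x < length s \<Longrightarrow> y < length s \<Longrightarrow> s ! x = Word a \<Longrightarrow> a < length s \<Longrightarrow>
    exec w r (Poke x y) (pc, s, h) (Suc pc, s[a := s ! y], h)"
| Read: "x < length s \<Longrightarrow> y < length s \<Longrightarrow> s ! y = Word a \<Longrightarrow> a < length h \<Longrightarrow>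
    exec w r (Read x y) (pc, s, h) (Suc pc, s[x := h ! a], h)"
| Write: "x < length s \<Longrightarrow> y < length s \<Longrightarrow> s ! x = Word a \<Longrightarrow> a < length h \<Longrightarrow>
    exec w r (Write x y) (pc, s, h) (Suc pc, s, h[a := s ! y])"
| Alloc: "exec w r (Alloc k) (pc, s, h) (Suc pc, s @ replicate k (Word 0), h)"
| Free: "k \<le> length s \<Longrightarrow>
    exec w r (Free k) (pc, s, h) (Suc pc, take (length s - k) s, h)"
| Jump: "exec w r (Jump l) (pc, s, h) (l, s, h)"
| Jump_Less: "x < length s \<Longrightarrow> y < length s \<Longrightarrow> cell_less (s ! x) (s ! y) = Some b \<Longrightarrow>
    exec w r (Jump_Less x y l) (pc, s, h) (if b then l else Suc pc, s, h)"
| Random: "x < length s \<Longrightarrow>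
    exec w r (Random x) (pc, s, h) (Suc pc, s[x := Word r], h)"

text \<open>
  The tree of existing threads.  In \<open>Running q d pc s\<close> the thread has private memory \<open>s\<close>, and \<open>d\<close> is
  the length of the longest chain of dependent instructions executed so far that ends in this
  thread.  The name \<open>q\<close> identifies the thread: it lists, innermost first, the forks it descends from,
  each given by the depth at which it occurred and the side.  A \<open>Waiting\<close> thread is suspended until
  both of its children are \<open>Finished\<close>.  Names and depths are not accessible to the program.
\<close>

type_synonym name = "(nat \<times> bool) list"

datatype 'a thread =
    Running name nat nat "'a cell list"
  | Waiting name nat "'a cell list" "'a thread" "'a thread"
  | Finished nat

text \<open>
  A source of randomness supplies a word for each pair \<open>(q, d)\<close>.  As \<open>d\<close> increases with each
  instruction of thread \<open>q\<close>, no entry is used twice in an execution.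
\<close>

type_synonym tape = "name \<times> nat \<Rightarrow> nat"

definition tapes :: "nat \<Rightarrow> tape measure" where
  "tapes w = (\<Pi>\<^sub>M i\<in>UNIV. uniform_count_measure {..<2 ^ w})"

type_synonym 'a config = "'a thread \<times> 'a cell list"

text \<open>
  One instruction (or join) of one thread.  With \<open>sq = False\<close> the threads are interleaved
  arbitrarily; \<open>sq = True\<close> is the schedule on a single processor, which completes the left child of
  a fork before it starts the right one.  \<open>Fork k l1 l2\<close> passes copies of the first \<open>k\<close> private
  cells to the children, as their initial private memory.
\<close>

inductive step ::
  "bool \<Rightarrow> nat \<Rightarrow> program \<Rightarrow> tape \<Rightarrow> 'a :: linorder config \<Rightarrow> 'a config \<Rightarrow> bool"
  for sq w P \<omega> where
  instr: "pc < length P \<Longrightarrow> exec w (\<omega> (q, d)) (P ! pc) (pc, s, h) (pc', s', h') \<Longrightarrow>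
    step sq w P \<omega> (Running q d pc s, h) (Running q (Suc d) pc' s', h')"
| halt: "pc < length P \<Longrightarrow> P ! pc = Halt \<Longrightarrow>
    step sq w P \<omega> (Running q d pc s, h) (Finished (Suc d), h)"
| fork: "pc < length P \<Longrightarrow> P ! pc = Fork k l1 l2 \<Longrightarrow> k \<le> length s \<Longrightarrow>
    step sq w P \<omega> (Running q d pc s, h)
      (Waiting q (Suc pc) s
        (Running ((d, False) # q) (Suc d) l1 (take k s))
        (Running ((d, True) # q) (Suc d) l2 (take k s)), h)"
| left: "step sq w P \<omega> (t1, h) (t1', h') \<Longrightarrow>
    step sq w P \<omega> (Waiting q pc s t1 t2, h) (Waiting q pc s t1' t2, h')"
| right: "step sq w P \<omega> (t2, h) (t2', h') \<Longrightarrow> sq \<longrightarrow> (\<exists>d. t1 = Finished d) \<Longrightarrow>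
    step sq w P \<omega> (Waiting q pc s t1 t2, h) (Waiting q pc s t1 t2', h')"
| join: "step sq w P \<omega> (Waiting q pc s (Finished d1) (Finished d2), h)
      (Running q (Suc (max d1 d2)) pc s, h)"

text \<open>
  Allocated stack memory in words.  Each thread is charged one word besides its private cells, for
  its program counter.
\<close>

fun stack :: "'a thread \<Rightarrow> nat" where
  "stack (Running q d pc s) = Suc (length s)"
| "stack (Waiting q pc s t1 t2) = Suc (length s) + stack t1 + stack t2"
| "stack (Finished d) = 0"

text \<open>Shared memory is the input \<open>AB\<close> followed by \<open>S\<close> extra cells, and never grows.\<close>

definition init :: "nat \<Rightarrow> 'a list \<Rightarrow> 'a list \<Rightarrow> 'a config" where
  "init S A B =
    (Running [] 0 0 [Word (length A), Word (length B)],
     map Elem (A @ B) @ replicate S (Word 0))"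

text \<open>Words of \<open>\<Theta>(log N)\<close> bits on inputs with \<open>N\<close> elements, large enough for \<open>N\<close> if \<open>\<kappa> \<ge> 1\<close>.\<close>

definition word_bits :: "nat \<Rightarrow> nat \<Rightarrow> nat" where
  "word_bits \<kappa> N = \<kappa> * nat \<lceil>log 2 (real N + 2)\<rceil>"

definition holds_merge :: "'a :: linorder cell list \<Rightarrow> 'a list \<Rightarrow> 'a list \<Rightarrow> bool" where
  "holds_merge h A B \<longleftrightarrow>
    (\<exists>C. sorted C \<and> mset C = mset (A @ B) \<and> take (length A + length B) h = map Elem C)"

text \<open>Every schedule terminates, and only in a configuration with the desired result.\<close>

definition computes_merge ::
  "program \<Rightarrow> nat \<Rightarrow> nat \<Rightarrow> 'a :: linorder list \<Rightarrow> 'a list \<Rightarrow> tape \<Rightarrow> bool" where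
  "computes_merge P S w A B \<omega> \<longleftrightarrow>
    (\<nexists>f. f 0 = init S A B \<and> (\<forall>i. step False w P \<omega> (f i) (f (Suc i)))) \<and>
    (\<forall>t h. (step False w P \<omega>)\<^sup>*\<^sup>* (init S A B) (t, h) \<and> (\<nexists>c. step False w P \<omega> (t, h) c)
       \<longrightarrow> (\<exists>d. t = Finished d) \<and> holds_merge h A B)"

text \<open>Bounds for all schedules (work, span) and for the sequential one (stack memory).\<close>

definition work_le ::
  "program \<Rightarrow> nat \<Rightarrow> nat \<Rightarrow> 'a :: linorder list \<Rightarrow> 'a list \<Rightarrow> real \<Rightarrow> tape \<Rightarrow> bool" where
  "work_le P S w A B b \<omega> \<longleftrightarrow>
    (\<forall>k c. (step False w P \<omega> ^^ k) (init S A B) c \<longrightarrow> real k \<le> b)"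

definition span_le ::
  "program \<Rightarrow> nat \<Rightarrow> nat \<Rightarrow> 'a :: linorder list \<Rightarrow> 'a list \<Rightarrow> real \<Rightarrow> tape \<Rightarrow> bool" where
  "span_le P S w A B b \<omega> \<longleftrightarrow>
    (\<forall>d h. (step False w P \<omega>)\<^sup>*\<^sup>* (init S A B) (Finished d, h) \<longrightarrow> real d \<le> b)"

definition seq_stack_le ::
  "program \<Rightarrow> nat \<Rightarrow> nat \<Rightarrow> 'a :: linorder list \<Rightarrow> 'a list \<Rightarrow> real \<Rightarrow> tape \<Rightarrow> bool" where
  "seq_stack_le P S w A B b \<omega> \<longleftrightarrow>
    (\<forall>t h. (step True w P \<omega>)\<^sup>*\<^sup>* (init S A B) (t, h) \<longrightarrow> real (stack t) \<le> b)"

end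

theory Submission
 imports Defs
begin

text \<open>
  After reversing \<open>B\<close> the input is a valley: seen from the seam between \<open>A\<close> and \<open>B\<close>, elements ascend in
  both directions around a ring.  A binary search finds how many elements of either side are among
  the \<open>h\<close> least, and one parallel swap separates these from the rest; both parts are again rings
  with a valley, whose cells occupy whole blocks, so that recursion with \<open>h\<close> near one half leads to
  blocks each of which holds a contiguous range of the output, though in arbitrary order.  At a leaf
  the block is sorted, and its rank is written into the block itself: a word of \<open>W\<close> bits is encoded
  by the order of \<open>W\<close> pairs of elements (or stored explicitly, if the two middle elements agree and
  one of them is thus redundant).  The blocks are then permuted according to their ranks.

  The scheme is used twice.  Blocks of \<open>2 * W + 3\<close> elements hold one word and are permuted
  sequentially; this sorts regions of at most \<open>(2 * W + 3)\<^sup>2\<close> elements with \<open>O(W)\<close> stack and span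
  \<open>O(W\<^sup>2)\<close>.  Such regions are the blocks of the second level.  They hold ten words each, which
  suffices to permute them in parallel: pointer jumping finds the position of each block relative to
  the least element of its cycle, and a cycle is a product of two reflections, each of which
  consists of disjoint swaps.  No step is randomized, so the span bound holds for every tape.
\<close>


text \<open>The work bound dictates both block sizes. An inner node of the recursion pays
  \<open>O(W)\<close> for its search and less than one block for its exchange, so
  \<open>N div BS\<close> nodes are affordable once \<open>W <= BS\<close>. Pointer jumping runs
  \<open>O(W)\<close> rounds in which every block decodes and encodes a few words at
  \<open>O(W)\<close> each; only blocks of order \<open>W * W\<close> elements can pay for that,
  which is why the smaller blocks are permuted by following cycles. The obstacle to the recursion is
  that a cut leaves neither part block-aligned. It is met by exchanging \<open>lam < BS\<close>
  cells: the cells behind the low elements on the side of \<open>A\<close> trade contents with those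
  at the far end of the low elements on the side of \<open>B\<close>. In a ring of \<open>h\<close>
  cells these places coincide modulo \<open>h\<close>, so the low part is still a ring, merely
  shifted, and the shift can be chosen to align it. The bounds must hold under every interleaving.
  Programs are therefore evaluated by a big-step relation with read and write sets, in which neither
  child of a fork reads what the other writes.\<close>

section \<open>Deterministic evaluation with read and write sets\<close>

text \<open>Counterpart of \<open>exec\<close> on memories given as functions, confined to a
  readable set \<open>R\<close> and a writable set \<open>U\<close>. There is no rule for
  \<open>Random\<close>, so whatever is verified through this relation is independent of the
  tape.\<close>

inductive px ::
 "nat => nat set => nat set => instr => nat \<times> 'a :: linorder cell list \<times> (nat => 'a cell)
   => nat \<times> 'a cell list \<times> (nat => 'a cell) => bool"
 for w R U where
 px_Const: "x < length s ==> px w R U (Const x k) (pc, s, H) (Suc pc, s[x := Word (k mod 2 ^ w)], H)"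
| px_Move: "x < length s ==> y < length s ==> px w R U (Move x y) (pc, s, H) (Suc pc, s[x := s ! y], H)"
| px_Arith: "x < length s ==> y < length s ==> z < length s ==>
  s ! y = Word a ==> s ! z = Word b ==>
  px w R U (Arith op x y z) (pc, s, H) (Suc pc, s[x := Word (arith w op a b)], H)"
| px_Peek: "x < length s ==> y < length s ==> s ! y = Word a ==> a < length s ==>
  px w R U (Peek x y) (pc, s, H) (Suc pc, s[x := s ! a], H)"
| px_Poke: "x < length s ==> y < length s ==> s ! x = Word a ==> a < length s ==>
  px w R U (Poke x y) (pc, s, H) (Suc pc, s[a := s ! y], H)"
| px_Read: "x < length s ==> y < length s ==> s ! y = Word a ==> a \<in> R ==>
  px w R U (Read x y) (pc, s, H) (Suc pc, s[x := H a], H)"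
| px_Write: "x < length s ==> y < length s ==> s ! x = Word a ==> a \<in> U ==>
  px w R U (Write x y) (pc, s, H) (Suc pc, s, H(a := s ! y))"
| px_Alloc: "px w R U (Alloc k) (pc, s, H) (Suc pc, s @ replicate k (Word 0), H)"
| px_Free: "k <= length s ==> px w R U (Free k) (pc, s, H) (Suc pc, take (length s - k) s, H)"
| px_Jump: "px w R U (Jump l) (pc, s, H) (l, s, H)"
| px_Jump_Less: "x < length s ==> y < length s ==> cell_less (s ! x) (s ! y) = Some b ==>
  px w R U (Jump_Less x y l) (pc, s, H) (if b then l else Suc pc, s, H)"

lemma nth_update: "a < length h ==> (!) (h[a := v]) = ((!) h)(a := v)"
 by (auto simp: nth_list_update)

lemma override_on_same: "U <= R ==> (!!a. a \<in> R ==> K a = H a) ==> override_on K H U = K"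
 by (auto simp: override_on_def fun_eq_iff)

text \<open>No instruction covered by \<open>px\<close> consults the random word \<open>r\<close>;
  hence the step exists for every \<open>r\<close>, and it is the only one.\<close>

lemma px_exec:
 assumes "px w R U i (pc, s, (!) h) (pc', s', H')" "R <= {..<length h}" "U <= R"
 shows "\<exists>h'. exec w r i (pc, s, h) (pc', s', h')"
  and "exec w r i (pc, s, h) c ==> \<exists>h'. c = (pc', s', h') & (!) h' = H' & length h' = length h"
proof -
 show "\<exists>h'. exec w r i (pc, s, h) (pc', s', h')"
  using assms(1)
 proof cases
  case (px_Jump_Less x y b l)
  then show ?thesis using exec.Jump_Less[of x s y b w r l pc h] by auto
 qed (use assms(2,3) in \<open>auto intro: exec.intros\<close>)
 show "\<exists>h'. c = (pc', s', h') & (!) h' = H' & length h' = length h" if "exec w r i (pc, s, h) c"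
  using assms(1)
  by cases (use that assms(2,3) in \<open>auto elim!: exec.cases simp: nth_update subset_iff\<close>)
qed

lemma px_out: "px w R U i (pc, s, H) (pc', s', H') ==> a \<notin> U ==> H' a = H a"
 by (erule px.cases) auto

text \<open>An instruction depends on the cells in \<open>R\<close> only and changes those in
  \<open>U\<close> only, so it can be replayed in any memory that agrees on
  \<open>R\<close>.\<close>

lemma px_frame:
 assumes "px w R U i (pc, s, H) (pc', s', H')" "U <= R" "!!a. a \<in> R ==> K a = H a"
 shows "px w R U i (pc, s, K) (pc', s', override_on K H' U)"
proof -
 have eq: "override_on K H U = K"
  using assms(2,3) by (rule override_on_same)
 have eq': "override_on K (H(a := v)) U = K(a := v)" if "a \<in> U" for a v
  using assms(2,3) that by (auto simp: override_on_def fun_eq_iff)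
 show ?thesis
  using assms(1)
 proof cases
  case (px_Read x y a)
  then show ?thesis
   using px.px_Read[of x s y a R w U pc K] assms(3)[of a] by (simp add: eq)
 next
  case (px_Jump_Less x y b l)
  then show ?thesis
   using px.px_Jump_Less[of x s y b w R U l pc K] by (simp add: eq)
 qed (auto simp: eq eq' intro: px.intros)
qed

text \<open>Evaluation of one thread up to its \<open>Halt\<close>. The numbers \<open>n\<close>,
  \<open>d\<close> and \<open>M\<close> are upper bounds for instructions, dependent chain and stack
  in the sequential schedule. Both children of a fork start from the memory at the fork; as neither
  writes what the other reads, their results can be overlaid in either order. The summand 2 counts
  the fork and the join. While the left child runs, the right one already occupies
  \<open>Suc k\<close> words; once the right one runs, the left one occupies none.\<close>

inductive ev ::
 "nat => program => nat set => nat set => nat => nat => 'a :: linorder cell list => (nat => 'a cell)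
   => (nat => 'a cell) => nat => nat => bool"
 for w P where
 ev_halt: "pc < length P ==> P ! pc = Halt ==> Suc (length s) <= M ==> 1 <= n ==> 1 <= d ==>
  ev w P R U M pc s H H n d"
| ev_instr: "pc < length P ==> px w R U (P ! pc) (pc, s, H) (pc', s', H1) ==> Suc (length s) <= M ==>
  ev w P R U M pc' s' H1 H' n d ==> ev w P R U M pc s H H' (Suc n) (Suc d)"
| ev_fork: "pc < length P ==> P ! pc = Fork k l1 l2 ==> k <= length s ==> Suc (length s) <= M ==>
  ev w P R1 U1 M1 l1 (take k s) H H1 n1 d1 ==> ev w P R2 U2 M2 l2 (take k s) H H2 n2 d2 ==>
  U1 <= R1 ==> U2 <= R2 ==> R1 <= R ==> R2 <= R ==> U1 <= U ==> U2 <= U ==>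
  U1 \<inter> R2 = {} ==> U2 \<inter> R1 = {} ==>
  Suc (length s) + M1 + Suc k <= M ==> Suc (length s) + M2 <= M ==>
  ev w P R U M (Suc pc) s (override_on (override_on H H2 U2) H1 U1) H' n3 d3 ==>
  n1 + n2 + n3 + 2 <= n ==> max d1 d2 + d3 + 2 <= d ==>
  ev w P R U M pc s H H' n d"

lemma ev_stack: "ev w P R U M pc s H H' n d ==> Suc (length s) <= M"
 by (erule ev.cases) auto

lemma ev_out: "ev w P R U M pc s H H' n d ==> a \<notin> U ==> H' a = H a"
 by (induction rule: ev.induct) (auto simp: px_out override_on_def)

text \<open>This is what makes concurrency harmless: a step of one child changes only cells that its
  sibling does not read, and the evaluation of the sibling is carried over to the new
  memory.\<close>

lemma ev_frame:
 "ev w P R U M pc s H H' n d ==> U <= R ==> (!!a. a \<in> R ==> K a = H a) ==>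
  ev w P R U M pc s K (override_on K H' U) n d"
proof (induction arbitrary: K rule: ev.induct)
 case (ev_halt pc s M n d R U H)
 have "override_on K H U = K"
  using ev_halt.prems by (rule override_on_same)
 then show ?case
  using ev_halt.hyps by (auto intro: ev.ev_halt)
next
 case (ev_instr pc R U s H pc' s' H1 M H' n d)
 let ?K1 = "override_on K H1 U"
 have "ev w P R U M pc' s' ?K1 (override_on ?K1 H' U) n d"
  using ev_instr.prems ev_instr.hyps(2)
  by (intro ev_instr.IH) (auto simp: override_on_def px_out)
 moreover have "override_on ?K1 H' U = override_on K H' U"
  by (auto simp: override_on_def)
 ultimately show ?case
  using px_frame[OF ev_instr.hyps(2) ev_instr.prems] ev_instr.hyps(1,3)
  by (auto intro: ev.ev_instr)
next
 case (ev_fork pc k l1 l2 s M R1 U1 M1 H H1 n1 d1 R2 U2 M2 H2 n2 d2 R U H' n3 d3 n d)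
 let ?G = "override_on (override_on H H2 U2) H1 U1"
 let ?K1 = "override_on K H1 U1" and ?K2 = "override_on K H2 U2"
 let ?K = "override_on (override_on K ?K2 U2) ?K1 U1"
 have 1: "ev w P R1 U1 M1 l1 (take k s) K ?K1 n1 d1"
  using ev_fork.hyps ev_fork.prems by (intro ev_fork.IH) auto
 have 2: "ev w P R2 U2 M2 l2 (take k s) K ?K2 n2 d2"
  using ev_fork.hyps ev_fork.prems by (intro ev_fork.IH) auto
 have 3: "ev w P R U M (Suc pc) s ?K (override_on ?K H' U) n3 d3"
  using ev_fork.hyps ev_fork.prems by (intro ev_fork.IH) (auto simp: override_on_def)
 have eq: "override_on ?K H' U = override_on K H' U"
  using ev_fork.hyps by (auto simp: override_on_def fun_eq_iff)
 show ?case
  by (rule ev.ev_fork[OF ev_fork.hyps(1-4) 1 2 ev_fork.hyps(7-16) _ ev_fork.hyps(18,19)])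
   (use 3 eq in simp)
qed

definition fin :: "'a thread => bool" where
 "fin t \<longleftrightarrow> (\<exists>d. t = Finished d)"

text \<open>The invariant of the thread tree under arbitrary interleaving. Every running thread
  still has an evaluation from the current memory, and a waiting thread has one from the overlay of
  the final memories of its children. The stack condition on an unfinished left child is demanded
  for the sequential schedule only, where the right child has not moved yet and
  \<open>stack t2\<close> is what it was given at the fork.\<close>

inductive sim ::
 "bool => nat => program => nat set => nat set => nat => 'a :: linorder thread => (nat => 'a cell)
   => (nat => 'a cell) => nat => nat => bool"
 for sq w P where
 sim_finished: "d <= D ==> sim sq w P R U M (Finished d) H H n D"
| sim_running: "ev w P R U M pc s H H' n d ==> d0 + d <= D ==>
  sim sq w P R U M (Running q d0 pc s) H H' n D"
| sim_waiting: "sim sq w P R1 U1 M1 t1 H H1 n1 D1 ==> sim sq w P R2 U2 M2 t2 H H2 n2 D2 ==>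
  U1 <= R1 ==> U2 <= R2 ==> R1 <= R ==> R2 <= R ==> U1 <= U ==> U2 <= U ==>
  U1 \<inter> R2 = {} ==> U2 \<inter> R1 = {} ==>
  (sq ==> \<not> fin t1 ==> Suc (length s) + M1 + stack t2 <= M) ==> Suc (length s) + M2 <= M ==>
  ev w P R U M pc s (override_on (override_on H H2 U2) H1 U1) H' n3 d3 ==>
  n1 + n2 + n3 + 1 <= n ==> max D1 D2 + d3 + 1 <= D ==>
  sim sq w P R U M (Waiting q pc s t1 t2) H H' n D"

lemma sim_stack: "sim sq w P R U M t H H' n D ==> sq ==> stack t <= M"
proof (induction rule: sim.induct)
 case (sim_waiting R1 U1 M1 t1 H H1 n1 D1 R2 U2 M2 t2 H2 n2 D2 R U s M pc H' n3 d3 n D q)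
 show ?case
 proof (cases "fin t1")
  case True
  then show ?thesis using sim_waiting by (auto simp: fin_def)
 next
  case False
  then show ?thesis using sim_waiting by auto
 qed
qed (auto dest: ev_stack)

lemma sim_frame:
 "sim sq w P R U M t H H' n D ==> U <= R ==> (!!a. a \<in> R ==> K a = H a) ==>
  sim sq w P R U M t K (override_on K H' U) n D"
proof (induction arbitrary: K rule: sim.induct)
 case (sim_finished d D R U M H n)
 have "override_on K H U = K"
  using sim_finished.prems by (rule override_on_same)
 then show ?case
  using sim_finished.hyps by (auto intro: sim.sim_finished)
next
 case (sim_running R U M pc s H H' n d d0 D q)
 then show ?case
  by (blast intro: sim.sim_running ev_frame)
next
 case (sim_waiting R1 U1 M1 t1 H H1 n1 D1 R2 U2 M2 t2 H2 n2 D2 R U s M pc H' n3 d3 n D q)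
 let ?K1 = "override_on K H1 U1" and ?K2 = "override_on K H2 U2"
 let ?K = "override_on (override_on K ?K2 U2) ?K1 U1"
 have 1: "sim sq w P R1 U1 M1 t1 K ?K1 n1 D1"
  using sim_waiting.hyps sim_waiting.prems by (intro sim_waiting.IH) auto
 have 2: "sim sq w P R2 U2 M2 t2 K ?K2 n2 D2"
  using sim_waiting.hyps sim_waiting.prems by (intro sim_waiting.IH) auto
 have 3: "ev w P R U M pc s ?K (override_on ?K H' U) n3 d3"
  using sim_waiting.hyps sim_waiting.prems
  by (intro ev_frame[OF sim_waiting.hyps(13)]) (auto simp: override_on_def)
 have eq: "override_on ?K H' U = override_on K H' U"
  using sim_waiting.hyps by (auto simp: override_on_def fun_eq_iff)
 show ?case
  by (rule sim.sim_waiting[where ?n3.0 = n3 and ?d3.0 = d3, OF 1 2 sim_waiting.hyps(3-12) _ sim_waiting.hyps(14,15)])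
   (use 3 eq in simp_all)
qed


text \<open>The final memory \<open>H'\<close> and the depth bound \<open>D\<close> stay fixed while
  \<open>n\<close> strictly decreases. So \<open>n\<close> bounds the number of steps of every
  schedule, which yields termination and the work bound at once.\<close>

lemma sim_step:
 assumes "step sq w P \<omega> (t, h) (t', h')" "sim sq w P R U M t ((!) h) H' n D"
  and "R <= {..<length h}" "U <= R"
 shows "length h' = length h & (\<forall>a. a \<notin> U --> h' ! a = h ! a) &
  (\<exists>n' < n. sim sq w P R U M t' ((!) h') H' n' D)"
 using assms
proof (induction "(t, h)" "(t', h')" arbitrary: t h t' h' R U M H' n D rule: step.induct)
 case (instr pc q d s h pc' s' h')
 from instr(3) obtain n0 d0 where e: "ev w P R U M pc s ((!) h) H' n d0" "d + d0 <= D"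
  by (auto elim: sim.cases)
 from e(1) show ?case
 proof cases
  case ev_halt
  then show ?thesis using instr by (auto elim: exec.cases)
 next
  case (ev_fork k l1 l2)
  then show ?thesis using instr by (auto elim: exec.cases)
 next
  case (ev_instr pc1 s1 H1 n1 d1)
  from px_exec(2)[OF ev_instr(4) instr(4,5) instr(2)]
  have eq: "pc' = pc1" "s' = s1" "(!) h' = H1" "length h' = length h"
   by auto
  have "h' ! a = h ! a" if "a \<notin> U" for a
   using px_out[OF ev_instr(4) that] eq(3) by auto
  moreover have "sim sq w P R U M (Running q (Suc d) pc' s') ((!) h') H' n1 D"
   using ev_instr(6) e(2) ev_instr(2) unfolding eq by (auto intro!: sim_running)
  ultimately show ?thesis
   using eq ev_instr(1) by auto
 qed
next
 case (halt pc q d s h)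
 from halt(3) obtain d0 where e: "ev w P R U M pc s ((!) h) H' n d0" "d + d0 <= D"
  by (auto elim: sim.cases)
 from e(1) show ?case
 proof cases
  case ev_halt
  then show ?thesis using e(2) by (auto intro!: exI[of _ 0] sim_finished)
 next
  case (ev_fork k l1 l2)
  then show ?thesis using halt by auto
 next
  case (ev_instr pc1 s1 H1 n1 d1)
  then show ?thesis using halt by (auto elim: px.cases)
 qed
next
 case (fork pc k l1 l2 s q d h)
 from fork(4) obtain d0 where e: "ev w P R U M pc s ((!) h) H' n d0" "d + d0 <= D"
  by (auto elim: sim.cases)
 from e(1) show ?case
 proof cases
  case ev_halt
  then show ?thesis using fork by auto
 next
  case (ev_instr pc1 s1 H1 n1 d1)
  then show ?thesis using fork by (auto elim: px.cases)
 next
  case (ev_fork k' l1' l2' R1 U1 M1 H1 n1 d1 R2 U2 M2 H2 n2 d2 n3 d3)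
  then have [simp]: "k' = k" "l1' = l1" "l2' = l2"
   using fork by auto
  have "sim sq w P R1 U1 M1 (Running ((d, False) # q) (Suc d) l1 (take k s)) ((!) h) H1 n1 (Suc d + d1)"
   using ev_fork by (auto intro!: sim_running)
  moreover have "sim sq w P R2 U2 M2 (Running ((d, True) # q) (Suc d) l2 (take k s)) ((!) h) H2 n2 (Suc d + d2)"
   using ev_fork by (auto intro!: sim_running)
  ultimately have "sim sq w P R U M (Waiting q (Suc pc) s
    (Running ((d, False) # q) (Suc d) l1 (take k s))
    (Running ((d, True) # q) (Suc d) l2 (take k s))) ((!) h) H' (n1 + n2 + n3 + 1) D"
   by (rule sim_waiting[OF _ _ ev_fork(7-14) _ ev_fork(16,17)])
    (use ev_fork(2-4,15,18,19) e(2) fork(3) in auto)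
  then show ?thesis
   using ev_fork(18) by (auto intro!: exI[of _ "n1 + n2 + n3 + 1"])
 qed
next
 case (left t1 h t1' h' q pc s t2)
 from left(3) show ?case
 proof cases
  case (sim_waiting R1 U1 M1 H1 n1 D1 R2 U2 M2 H2 n2 D2 n3 d3)
  from left(2)[OF sim_waiting(1) _ sim_waiting(3)] obtain n' where
   L: "length h' = length h" "!!a. a \<notin> U1 ==> h' ! a = h ! a" "n' < n1"
    "sim sq w P R1 U1 M1 t1' ((!) h') H1 n' D1"
   using left.prems(2) sim_waiting(5) by auto
  have nf: "\<not> fin t1"
   using left.hyps(1) by (auto simp: fin_def elim: step.cases)
  \<comment> \<open>The right child does not read \<open>U1\<close>; its evaluation is transported
    to the memory after the step, and its final memory is adapted outside \<open>U2\<close>.\<close>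
  let ?H2 = "override_on ((!) h') H2 U2"
  have 2: "sim sq w P R2 U2 M2 t2 ((!) h') ?H2 n2 D2"
   using sim_waiting(4,9) L(2) by (intro sim_frame[OF sim_waiting(2)]) blast+
  have eq: "override_on (override_on ((!) h') ?H2 U2) H1 U1
   = override_on (override_on ((!) h) H2 U2) H1 U1"
   using L(2) by (auto simp: override_on_def fun_eq_iff)
  have "sim sq w P R U M (Waiting q pc s t1' t2) ((!) h') H' (n' + n2 + n3 + 1) D"
   by (rule sim.sim_waiting[where ?n3.0 = n3 and ?d3.0 = d3, OF L(4) 2 sim_waiting(3-10) _ sim_waiting(12)])
    (use sim_waiting(11,13-) eq nf in simp_all)
  moreover have "n' + n2 + n3 + 1 < n"
   using L(3) sim_waiting by simp
  ultimately show ?thesis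
   using L(1,2) sim_waiting(7) by blast
 qed
next
 case (right t2 h t2' h' t1 q pc s)
 from right(4) show ?case
 proof cases
  case (sim_waiting R1 U1 M1 H1 n1 D1 R2 U2 M2 H2 n2 D2 n3 d3)
  from right(2)[OF sim_waiting(2) _ sim_waiting(4)] obtain n' where
   L: "length h' = length h" "!!a. a \<notin> U2 ==> h' ! a = h ! a" "n' < n2"
    "sim sq w P R2 U2 M2 t2' ((!) h') H2 n' D2"
   using right.prems(2) sim_waiting(6) by auto
  let ?H1 = "override_on ((!) h') H1 U1"
  have 1: "sim sq w P R1 U1 M1 t1 ((!) h') ?H1 n1 D1"
   using sim_waiting(3,10) L(2) by (intro sim_frame[OF sim_waiting(1)]) blast+
  have eq: "override_on (override_on ((!) h') H2 U2) ?H1 U1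
   = override_on (override_on ((!) h) H2 U2) H1 U1"
   using L(2) sim_waiting(3,4,9) by (auto simp: override_on_def fun_eq_iff)
  \<comment> \<open>In the sequential schedule the right child moves only after the left one has
    finished, so the stack condition on an unfinished left child holds vacuously.\<close>
  have "sim sq w P R U M (Waiting q pc s t1 t2') ((!) h') H' (n1 + n' + n3 + 1) D"
   by (rule sim.sim_waiting[where ?n3.0 = n3 and ?d3.0 = d3, OF 1 L(4) sim_waiting(3-10) _ sim_waiting(12)])
    (use sim_waiting(11,13-) eq right.hyps(3) in \<open>auto simp: fin_def\<close>)
  moreover have "n1 + n' + n3 + 1 < n"
   using L(3) sim_waiting by simp
  ultimately show ?thesis
   using L(1,2) sim_waiting(8) by blast
 qed
next
 case (join q pc s d1 d2 h)
 from join(1) show ?case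
 proof cases
  case (sim_waiting R1 U1 M1 H1 n1 D1 R2 U2 M2 H2 n2 D2 n3 d3)
  have 1: "H1 = (!) h" "d1 <= D1"
   using sim_waiting(1) by (auto elim: sim.cases)
  have 2: "H2 = (!) h" "d2 <= D2"
   using sim_waiting(2) by (auto elim: sim.cases)
  have "override_on (override_on ((!) h) H2 U2) H1 U1 = (!) h"
   unfolding 1 2 by (auto simp: override_on_def)
  then have "sim sq w P R U M (Running q (Suc (max d1 d2)) pc s) ((!) h) H' n3 D"
   using sim_waiting(13,15) 1(2) 2(2) by (intro sim_running) auto
  then show ?thesis
   using sim_waiting(14) by (auto intro!: exI[of _ n3])
 qed
qed

text \<open>Bounds and kinds of cells were checked when the evaluation was built, so a thread that
  is not finished is never stuck; two finished children can always be joined.\<close>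

lemma sim_progress:
 assumes "sim sq w P R U M t H H' n D" "H = (!) h" "R <= {..<length h}" "U <= R" "\<not> fin t"
 shows "\<exists>c. step sq w P \<omega> (t, h) c"
 using assms
proof (induction rule: sim.induct)
 case (sim_finished d D R U M H n)
 then show ?case by (simp add: fin_def)
next
 case (sim_running R U M pc s H H' n d d0 D q)
 from sim_running(1) show ?case
 proof cases
  case ev_halt
  then show ?thesis by (blast intro: step.halt)
 next
  case (ev_fork k l1 l2)
  then show ?thesis by (blast intro: step.fork)
 next
  case (ev_instr pc1 s1 H1)
  then show ?thesis
   using px_exec(1)[of w R U "P ! pc" pc s h pc1 s1 H1] sim_running
   by (metis step.instr)
 qed
next
 case (sim_waiting R1 U1 M1 t1 H H1 n1 D1 R2 U2 M2 t2 H2 n2 D2 R U s M pc H' n3 d3 n D q)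
 have r: "R1 <= {..<length h}" "R2 <= {..<length h}"
  using sim_waiting by auto
 show ?case
 proof (cases "fin t1")
  case False
  then obtain t h' where "step sq w P \<omega> (t1, h) (t, h')"
   using sim_waiting.IH(1) sim_waiting r by (metis surj_pair)
  then show ?thesis by (blast intro: step.left)
 next
  case t1: True
  show ?thesis
  proof (cases "fin t2")
   case False
   then obtain t h' where "step sq w P \<omega> (t2, h) (t, h')"
    using sim_waiting.IH(2) sim_waiting r by (metis surj_pair)
   then show ?thesis using t1 by (auto simp: fin_def intro: step.right)
  next
   case True
   then show ?thesis using t1 by (auto simp: fin_def intro: step.join)
  qed
 qed
qed

lemma sim_steps:
 assumes "(step sq w P \<omega> ^^ k) (t, h) (t', h')" "sim sq w P R U M t ((!) h) H' n D"
  and "R <= {..<length h}" "U <= R"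
 shows "length h' = length h & (\<exists>n'. n' + k <= n & sim sq w P R U M t' ((!) h') H' n' D)"
 using assms
proof (induction k arbitrary: t' h')
 case (Suc k)
 then obtain t1 h1 where s: "(step sq w P \<omega> ^^ k) (t, h) (t1, h1)" "step sq w P \<omega> (t1, h1) (t', h')"
  by auto
 from Suc.IH[OF s(1) Suc.prems(2-4)] obtain n1 where
  1: "length h1 = length h" "n1 + k <= n" "sim sq w P R U M t1 ((!) h1) H' n1 D" by auto
 have "\<exists>n'<n1. sim sq w P R U M t' ((!) h') H' n' D" "length h' = length h1"
  using sim_step[OF s(2) 1(3)] Suc.prems 1(1) by auto
 then show ?case
  using 1 by (metis Suc_leI add.commute add_Suc_right add_le_mono1 le_trans)
qed auto

text \<open>One evaluation of the whole program gives all four properties: the counter excludes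
  infinite runs and bounds the work, progress shows that a final configuration is finished, and the
  final memory is the same for all schedules.\<close>

theorem ev_sound:
 assumes ev: "ev w P R U M 0 s0 ((!) h0) H' n d" and R: "R <= {..<length h0}" "U <= R"
  and init: "init S A B = (Running [] 0 0 s0, h0)"
  and post: "!!h. length h = length h0 ==> (!) h = H' ==> holds_merge h A B"
 shows "computes_merge P S w A B \<omega>"
  and "real n <= b ==> work_le P S w A B b \<omega>"
  and "real d <= b ==> span_le P S w A B b \<omega>"
  and "real M <= b ==> seq_stack_le P S w A B b \<omega>"
proof -
 have sim0: "sim sq w P R U M (Running [] 0 0 s0) ((!) h0) H' n d" for sq
  using ev by (auto intro: sim_running)
 have reach: "length h = length h0 & (\<exists>n'. n' + k <= n & sim sq w P R U M t ((!) h) H' n' d)"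
  if "(step sq w P \<omega> ^^ k) (init S A B) (t, h)" for k sq t h
  using sim_steps[OF that[unfolded init] sim0 R] .
 have reach': "length h = length h0 & (\<exists>n'. sim sq w P R U M t ((!) h) H' n' d)"
  if "(step sq w P \<omega>)\<^sup>*\<^sup>* (init S A B) (t, h)" for sq t h
  using that reach by (metis rtranclp_imp_relpowp)
 show "computes_merge P S w A B \<omega>"
  unfolding computes_merge_def
 proof (intro conjI allI impI)
  show "\<nexists>f. f 0 = init S A B & (\<forall>i. step False w P \<omega> (f i) (f (Suc i)))"
  proof
   assume "\<exists>f. f 0 = init S A B & (\<forall>i. step False w P \<omega> (f i) (f (Suc i)))"
   then obtain f where f: "f 0 = init S A B" "!!i. step False w P \<omega> (f i) (f (Suc i))"
    by blast
   have "(step False w P \<omega> ^^ i) (f 0) (f i)" for i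
    by (induction i) (use f(2) in auto)
   \<comment> \<open>An infinite run contains \<open>Suc n\<close> steps, one more than the counter
     permits.\<close>
   then have "(step False w P \<omega> ^^ Suc n) (init S A B) (f (Suc n))"
    using f(1) by metis
   then show False
    using reach[of "Suc n" False "fst (f (Suc n))" "snd (f (Suc n))"] by auto
  qed
 next
  fix t h
  assume a: "(step False w P \<omega>)\<^sup>*\<^sup>* (init S A B) (t, h) & (\<nexists>c. step False w P \<omega> (t, h) c)"
  then obtain n' where l: "length h = length h0" and s: "sim False w P R U M t ((!) h) H' n' d"
   using reach' by blast
  have "fin t"
   using sim_progress[OF s refl _ R(2), of \<omega>] a R(1) l by fastforce
  then show "\<exists>d. t = Finished d"
   by (simp add: fin_def)
  then have "(!) h = H'"
   using s by (auto elim: sim.cases)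
  then show "holds_merge h A B"
   using post l by blast
 qed
 show "work_le P S w A B b \<omega>" if "real n <= b"
  unfolding work_le_def
 proof (intro allI impI)
  fix k c assume "(step False w P \<omega> ^^ k) (init S A B) c"
  then have "k <= n"
   using reach[of k False "fst c" "snd c"] by auto
  then show "real k <= b" using that by linarith
 qed
 show "span_le P S w A B b \<omega>" if "real d <= b"
  unfolding span_le_def
 proof (intro allI impI)
  fix k h assume "(step False w P \<omega>)\<^sup>*\<^sup>* (init S A B) (Finished k, h)"
  then have "k <= d"
   using reach' by (force elim: sim.cases)
  then show "real k <= b" using that by linarith
 qed
 show "seq_stack_le P S w A B b \<omega>" if "real M <= b"
  unfolding seq_stack_le_def
 proof (intro allI impI)
  fix t h assume "(step True w P \<omega>)\<^sup>*\<^sup>* (init S A B) (t, h)"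
  then have "stack t <= M"
   using reach' sim_stack by blast
  then show "real (stack t) <= b" using that by linarith
 qed
qed

section \<open>A structured language with costs and footprints\<close>

datatype exp = V nat | C nat | Bin arith_op exp exp

abbreviation add_exp (infixl "[+]" 65) where "a [+] b \<equiv> Bin Add a b"
abbreviation sub_exp (infixl "[-]" 65) where "a [-] b \<equiv> Bin Sub a b"
abbreviation mul_exp (infixl "[*]" 70) where "a [*] b \<equiv> Bin Mul a b"
abbreviation div_exp (infixl "[div]" 70) where "a [div] b \<equiv> Bin Div a b"
abbreviation mod_exp (infixl "[mod]" 70) where "a [mod] b \<equiv> Bin Mod a b"

fun val :: "(nat => nat) => exp => nat" where
 "val e (V x) = e x"
| "val e (C k) = k"
| "val e (Bin Add a b) = val e a + val e b"
| "val e (Bin Sub a b) = val e a - val e b"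
| "val e (Bin Mul a b) = val e a * val e b"
| "val e (Bin Div a b) = val e a div val e b"
| "val e (Bin Mod a b) = val e a mod val e b"

text \<open>No wrap-around occurs when the expression is evaluated with \<open>w\<close>-bit words.\<close>

fun ok :: "nat => (nat => nat) => exp => bool" where
 "ok w e (V x) \<longleftrightarrow> True"
| "ok w e (C k) \<longleftrightarrow> k < 2 ^ w"
| "ok w e (Bin Add a b) \<longleftrightarrow> ok w e a & ok w e b & val e a + val e b < 2 ^ w"
| "ok w e (Bin Sub a b) \<longleftrightarrow> ok w e a & ok w e b & val e b <= val e a & val e a < 2 ^ w"
| "ok w e (Bin Mul a b) \<longleftrightarrow> ok w e a & ok w e b & val e a * val e b < 2 ^ w"
| "ok w e (Bin Div a b) \<longleftrightarrow> ok w e a & ok w e b"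
| "ok w e (Bin Mod a b) \<longleftrightarrow> ok w e a & ok w e b"

text \<open>Registers hold words only. Elements are moved within shared memory by
  \<open>Copy\<close> and \<open>Swap\<close>, to and from the private buffer by \<open>Push\<close>
  and \<open>Pop\<close>, and compared by \<open>IfC\<close>.\<close>

datatype com =
  Skip
 | Assign nat exp        (infix "::=" 61)
 | Get nat exp
 | Put exp exp
 | Copy exp exp
 | Swap exp exp
 | Push exp
 | Pop exp
 | Seq com com           (infixr ";;" 60)
 | If exp exp com com
 | IfC exp exp com com
 | While exp exp com
 | Call nat
 | Par com com

text \<open>
  A thread has \<open>40\<close> word registers, a cell holding the height of its buffer, and temporaries;
  the buffer starts at position \<open>55\<close>.
\<close>

abbreviation "NR \<equiv> 40 :: nat"
abbreviation "TB \<equiv> 41 :: nat"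
abbreviation "FS \<equiv> 55 :: nat"

text \<open>\<open>Call\<close> and \<open>Par\<close> restore the registers of the caller and
  require an empty buffer because both are forks, whose children work on copies of the frame. The
  112 words are the frames of the waiting parent and of the sibling that has not started, 56 words
  each. Costs count commands, not instructions.\<close>

inductive run ::
 "nat => (nat => com) => nat set => nat set => nat => com
   => (nat => nat) => 'a :: linorder cell list => (nat => 'a cell)
   => (nat => nat) => 'a cell list => (nat => 'a cell) => nat => nat => bool"
 for w Pr where
 run_Skip: "run w Pr R U M Skip e b H e b H 0 0"
| run_Assign: "length b <= M ==> ok w e a ==>
  run w Pr R U M (x ::= a) e b H (e(x := val e a)) b H 1 1"
| run_Get: "length b <= M ==> ok w e a ==> val e a \<in> R ==> H (val e a) = Word v ==>
  run w Pr R U M (Get x a) e b H (e(x := v)) b H 1 1"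
| run_Put: "length b <= M ==> ok w e a ==> ok w e a' ==> val e a \<in> U ==>
  run w Pr R U M (Put a a') e b H e b (H(val e a := Word (val e a'))) 1 1"
| run_Copy: "length b <= M ==> ok w e a ==> ok w e a' ==> val e a \<in> U ==> val e a' \<in> R ==>
  run w Pr R U M (Copy a a') e b H e b (H(val e a := H (val e a'))) 1 1"
| run_Swap: "length b <= M ==> ok w e a ==> ok w e a' ==> val e a \<in> U ==> val e a' \<in> U ==>
  run w Pr R U M (Swap a a') e b H e b (H(val e a := H (val e a'), val e a' := H (val e a))) 1 1"
| run_Push: "length b <= M ==> ok w e a ==> val e a \<in> R ==> FS + Suc (length b) < 2 ^ w ==>
  run w Pr R U M (Push a) e b H e (b @ [H (val e a)]) H 1 1"
| run_Pop: "length b <= M ==> ok w e a ==> val e a \<in> U ==> b ~= [] ==>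
  FS + Suc (length b) < 2 ^ w ==>
  run w Pr R U M (Pop a) e b H e (butlast b) (H(val e a := last b)) 1 1"
| run_Seq: "run w Pr R U M c1 e b H e1 b1 H1 n1 d1 ==> run w Pr R U M c2 e1 b1 H1 e2 b2 H2 n2 d2 ==>
  run w Pr R U M (c1 ;; c2) e b H e2 b2 H2 (n1 + n2) (d1 + d2)"
| run_If: "length b <= M ==> ok w e a ==> ok w e a' ==>
  run w Pr R U M (if val e a < val e a' then c1 else c2) e b H e1 b1 H1 n1 d1 ==>
  run w Pr R U M (If a a' c1 c2) e b H e1 b1 H1 (Suc n1) (Suc d1)"
| run_IfC: "length b <= M ==> ok w e a ==> ok w e a' ==> val e a \<in> R ==> val e a' \<in> R ==>
  H (val e a) = Elem x ==> H (val e a') = Elem y ==>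
  run w Pr R U M (if x < y then c1 else c2) e b H e1 b1 H1 n1 d1 ==>
  run w Pr R U M (IfC a a' c1 c2) e b H e1 b1 H1 (Suc n1) (Suc d1)"
| run_While_False: "length b <= M ==> ok w e a ==> ok w e a' ==> \<not> val e a < val e a' ==>
  run w Pr R U M (While a a' c) e b H e b H 1 1"
| run_While_True: "length b <= M ==> ok w e a ==> ok w e a' ==> val e a < val e a' ==>
  run w Pr R U M c e b H e1 b1 H1 n1 d1 ==>
  run w Pr R U M (While a a' c) e1 b1 H1 e2 b2 H2 n2 d2 ==>
  run w Pr R U M (While a a' c) e b H e2 b2 H2 (Suc (n1 + n2)) (Suc (d1 + d2))"
| run_Call: "run w Pr R1 U1 M1 (Pr p) e [] H e1 b1 H1 n1 d1 ==> U1 <= R1 ==> R1 <= R ==> U1 <= U ==>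
  112 + M1 <= M ==> Suc n1 <= n ==> Suc d1 <= d ==>
  run w Pr R U M (Call p) e [] H e [] H1 n d"
| run_Par: "run w Pr R1 U1 M1 c1 e [] H e1 b1 H1 n1 d1 ==> run w Pr R2 U2 M2 c2 e [] H e2 b2 H2 n2 d2 ==>
  U1 <= R1 ==> U2 <= R2 ==> R1 <= R ==> R2 <= R ==> U1 <= U ==> U2 <= U ==>
  U1 \<inter> R2 = {} ==> U2 \<inter> R1 = {} ==> 112 + max M1 M2 <= M ==>
  Suc (n1 + n2) <= n ==> Suc (max d1 d2) <= d ==>
  run w Pr R U M (Par c1 c2) e [] H e [] (override_on (override_on H H2 U2) H1 U1) n d"

lemma run_out: "run w Pr R U M c e b H e' b' H' n d ==> a \<notin> U ==> H' a = H a"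
 by (induction rule: run.induct) (auto simp: override_on_def)

lemma run_buf: "run w Pr R U M c e b H e' b' H' n d ==> length b <= Suc M ==> length b' <= Suc M"
 by (induction rule: run.induct) auto

lemma run_mono:
 "run w Pr R U M c e b H e' b' H' n d ==> R <= R' ==> U <= U' ==> M <= M' ==>
  run w Pr R' U' M' c e b H e' b' H' n d"
proof (induction arbitrary: R' U' M' rule: run.induct)
 case (run_Call R1 U1 M1 p e H e1 b1 H1 n1 d1 R U M n d)
 show ?case
  by (rule run.run_Call[OF run_Call.hyps(1,2)]) (use run_Call.hyps run_Call.prems in auto)
next
 case (run_Par R1 U1 M1 c1 e H e1 b1 H1 n1 d1 R2 U2 M2 c2 e2 b2 H2 n2 d2 R U M n d)
 show ?case
  by (rule run.run_Par[OF run_Par.hyps(1-4)]) (use run_Par.hyps run_Par.prems in auto)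
next
 case (run_IfC b M e a a' R H x y U c1 c2 e1 b1 H1 n1 d1)
 show ?case
  by (rule run.run_IfC[where x = x and y = y])
   (use run_IfC in auto)
next
 case (run_Seq R U M c1 e b H e1 b1 H1 n1 d1 c2 e2 b2 H2 n2 d2)
 then show ?case by (blast intro: run.run_Seq)
next
 case (run_If b M e a a' R U c1 c2 H e1 b1 H1 n1 d1)
 then show ?case by (auto intro: run.run_If)
next
 case (run_While_True b M e a a' R U c H e1 b1 H1 n1 d1 e2 b2 H2 n2 d2)
 show ?case
  by (rule run.run_While_True[OF _ _ _ _ run_While_True.IH[OF run_While_True.prems]])
   (use run_While_True in auto)
qed (rule run.intros; auto)+

subsection \<open>Compilation\<close>

fun comp_e :: "nat => exp => instr list" where
 "comp_e t (V x) = [Move t x]"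
| "comp_e t (C k) = [Const t k]"
| "comp_e t (Bin op a b) = comp_e t a @ comp_e (Suc t) b @ [Arith op t t (Suc t)]"

fun wfe :: "nat => exp => bool" where
 "wfe t (V x) \<longleftrightarrow> x < NR & t < FS"
| "wfe t (C k) \<longleftrightarrow> t < FS"
| "wfe t (Bin op a b) \<longleftrightarrow> wfe t a & wfe (Suc t) b"

fun esize :: "exp => nat" where
 "esize (V x) = 1"
| "esize (C k) = 1"
| "esize (Bin op a b) = esize a + esize b + 1"

text \<open>The size limit makes the cost of evaluating an operand a constant; two operands take at
  most 40 instructions.\<close>

definition wfa :: "exp => bool" where
 "wfa a \<longleftrightarrow> wfe (TB + 3) a & esize a <= 20"

fun wfc :: "com => bool" where
 "wfc Skip \<longleftrightarrow> True"
| "wfc (x ::= a) \<longleftrightarrow> x < NR & wfa a"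
| "wfc (Get x a) \<longleftrightarrow> x < NR & wfa a"
| "wfc (Put a a') \<longleftrightarrow> wfa a & wfa a'"
| "wfc (Copy a a') \<longleftrightarrow> wfa a & wfa a'"
| "wfc (Swap a a') \<longleftrightarrow> wfa a & wfa a'"
| "wfc (Push a) \<longleftrightarrow> wfa a"
| "wfc (Pop a) \<longleftrightarrow> wfa a"
| "wfc (c1 ;; c2) \<longleftrightarrow> wfc c1 & wfc c2"
| "wfc (If a a' c1 c2) \<longleftrightarrow> wfa a & wfa a' & wfc c1 & wfc c2"
| "wfc (IfC a a' c1 c2) \<longleftrightarrow> wfa a & wfa a' & wfc c1 & wfc c2"
| "wfc (While a a' c) \<longleftrightarrow> wfa a & wfa a' & wfc c"
| "wfc (Call p) \<longleftrightarrow> True"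
| "wfc (Par c1 c2) \<longleftrightarrow> wfc c1 & wfc c2"

definition e2 :: "exp => exp => instr list" where
 "e2 a a' = comp_e TB a @ comp_e (Suc TB) a'"

fun clen :: "com => nat" where
 "clen Skip = 0"
| "clen (x ::= a) = esize a + 1"
| "clen (Get x a) = esize a + 1"
| "clen (Put a a') = esize a + esize a' + 1"
| "clen (Copy a a') = esize a + esize a' + 2"
| "clen (Swap a a') = esize a + esize a' + 4"
| "clen (Push a) = esize a + 5"
| "clen (Pop a) = esize a + 5"
| "clen (c1 ;; c2) = clen c1 + clen c2"
| "clen (If a a' c1 c2) = esize a + esize a' + clen c2 + clen c1 + 2"
| "clen (IfC a a' c1 c2) = Suc (Suc (Suc (Suc (esize a + esize a' + clen c2 + clen c1))))"
| "clen (While a a' c) = Suc (Suc (Suc (esize a + esize a' + clen c)))"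
| "clen (Call p) = 1"
| "clen (Par c1 c2) = Suc (Suc (Suc (Suc (clen c1 + clen c2))))"

text \<open>\<open>ent\<close> maps procedures to their entry points, and \<open>hl\<close> is the position of some \<open>Halt\<close>.\<close>

fun comp :: "(nat => nat) => nat => nat => com => instr list" where
 "comp ent hl pc Skip = []"
| "comp ent hl pc (x ::= a) = comp_e TB a @ [Move x TB]"
| "comp ent hl pc (Get x a) = comp_e TB a @ [Read x TB]"
| "comp ent hl pc (Put a a') = e2 a a' @ [Write TB (TB + 1)]"
| "comp ent hl pc (Copy a a') = e2 a a' @ [Read (TB + 2) (TB + 1), Write TB (TB + 2)]"
| "comp ent hl pc (Swap a a') = e2 a a' @
   [Read (TB + 2) (TB + 1), Read (TB + 3) TB, Write TB (TB + 2), Write (TB + 1) (TB + 3)]"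
| "comp ent hl pc (Push a) = comp_e TB a @
   [Read (TB + 1) TB, Alloc 1, Poke NR (TB + 1), Const TB 1, Arith Add NR NR TB]"
| "comp ent hl pc (Pop a) = comp_e TB a @
   [Const (TB + 1) 1, Arith Sub NR NR (TB + 1), Peek (TB + 1) NR, Write TB (TB + 1), Free 1]"
| "comp ent hl pc (c1 ;; c2) = comp ent hl pc c1 @ comp ent hl (pc + clen c1) c2"
| "comp ent hl pc (If a a' c1 c2) =
   (let l2 = pc + esize a + esize a' + 1; l1 = l2 + clen c2 + 1 in
   e2 a a' @ [Jump_Less TB (TB + 1) l1] @ comp ent hl l2 c2 @ [Jump (l1 + clen c1)] @ comp ent hl l1 c1)"
| "comp ent hl pc (IfC a a' c1 c2) =
   (let l2 = Suc (Suc (Suc (pc + esize a + esize a'))); l1 = l2 + clen c2 + 1 in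
   e2 a a' @ [Read TB TB, Read (TB + 1) (TB + 1), Jump_Less TB (TB + 1) l1] @ comp ent hl l2 c2 @
    [Jump (l1 + clen c1)] @ comp ent hl l1 c1)"
| "comp ent hl pc (While a a' c) =
   (let l = Suc (Suc (pc + esize a + esize a')) in
   e2 a a' @ [Jump_Less TB (TB + 1) l, Jump (l + clen c + 1)] @ comp ent hl l c @ [Jump pc])"
| "comp ent hl pc (Call p) = [Fork FS (ent p) hl]"
| "comp ent hl pc (Par c1 c2) =
   (let l1 = Suc (Suc pc); l2 = l1 + clen c1 + 1 in
   [Fork FS l1 l2, Jump (l2 + clen c2 + 1)] @ comp ent hl l1 c1 @ [Halt] @ comp ent hl l2 c2 @ [Halt])"

lemma length_comp_e [simp]: "length (comp_e t a) = esize a"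
 by (induction a arbitrary: t) auto

lemma length_comp [simp]: "length (comp ent hl pc c) = clen c"
 by (induction c arbitrary: pc) (auto simp: e2_def Let_def)

definition code_at :: "program => nat => instr list => bool" where
 "code_at P pc xs \<longleftrightarrow> (\<forall>i < length xs. pc + i < length P & P ! (pc + i) = xs ! i)"

lemma code_at_Nil [simp]: "code_at P pc []"
 by (simp add: code_at_def)

lemma code_at_Cons [simp]:
 "code_at P pc (x # xs) \<longleftrightarrow> pc < length P & P ! pc = x & code_at P (Suc pc) xs"
 by (auto simp: code_at_def All_less_Suc2)

lemma code_at_append [simp]:
 "code_at P pc (xs @ ys) \<longleftrightarrow> code_at P pc xs & code_at P (pc + length xs) ys"
 by (induction xs arbitrary: pc) auto

text \<open>The cell \<open>NR\<close> holds the height of the frame, by which the buffer is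
  addressed indirectly. Nothing is said about the temporaries between \<open>NR\<close> and
  \<open>FS\<close>.\<close>

definition rel :: "'a cell list => (nat => nat) => 'a cell list => bool" where
 "rel s e b \<longleftrightarrow> length s = FS + length b & (\<forall>i < NR. s ! i = Word (e i)) &
   s ! NR = Word (FS + length b) & drop FS s = b"


lemma rel_temp: "rel s e b ==> NR < t ==> t < FS ==> rel (s[t := v]) e b"
 by (auto simp: rel_def nth_list_update drop_update_cancel)

lemma rel_reg: "rel s e b ==> x < NR ==> rel (s[x := Word v]) (e(x := v)) b"
 by (auto simp: rel_def nth_list_update drop_update_cancel)

lemma rel_length: "rel s e b ==> length s = FS + length b"
 by (simp add: rel_def)

lemma rel_nth: "rel s e b ==> i < NR ==> s ! i = Word (e i)"
 by (simp add: rel_def)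

lemma ev_mono: "ev w P R U M pc s H H' n d ==> n <= n' ==> d <= d' ==> ev w P R U M pc s H H' n' d'"
proof (induction arbitrary: n' d' rule: ev.induct)
 case (ev_halt pc s M n d R U H)
 then show ?case by (auto intro: ev.ev_halt)
next
 case (ev_instr pc R U s H pc' s' H1 M H' n d)
 then obtain k l where "n' = Suc k" "d' = Suc l" "n <= k" "d <= l"
  by (metis Suc_le_D Suc_le_mono)
 with ev_instr show ?case by (auto intro: ev.ev_instr)
next
 case (ev_fork pc k l1 l2 s M R1 U1 M1 H H1 n1 d1 R2 U2 M2 H2 n2 d2 R U H' n3 d3 n d)
 show ?case
  by (rule ev.ev_fork[OF ev_fork.hyps(1-17)]) (use ev_fork in auto)
qed

lemma wfe_mono: "wfe t a ==> t' <= t ==> wfe t' a"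
 by (induction a arbitrary: t t') auto

lemma wfe_less: "wfe t a ==> t < FS"
 by (induction a arbitrary: t) auto

lemma arith_val: "ok w e (Bin op a b) ==> arith w op (val e a) (val e b) = val e (Bin op a b)"
 by (cases op) (auto simp: mod_if)

lemma ok_sub: "ok w e (Bin op a b) ==> ok w e a" "ok w e (Bin op a b) ==> ok w e b"
 by (cases op; auto)+

text \<open>Stated in continuation form: an evaluation from every state that the code may leave
  gives one from the state before it. Cells below \<open>t\<close> survive, so the first operand is
  still there when the second has been computed at \<open>Suc t\<close>.\<close>

lemma ev_exp:
 assumes "wfe t a" "TB <= t" "ok w e a" "code_at P pc (comp_e t a)" "rel s e b" "FS + Suc (length b) <= M"
  and "!!s'. rel s' e b ==> s' ! t = Word (val e a) ==> (!!i. i < t ==> s' ! i = s ! i) ==>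
   ev w P R U M (pc + esize a) s' H H' n d"
 shows "ev w P R U M pc s H H' (esize a + n) (esize a + d)"
 using assms
proof (induction a arbitrary: t pc s n d)
 case (V x)
 have l: "t < length s" "x < length s" using V(1,5) by (auto simp: rel_def)
 have "ev w P R U M (Suc pc) (s[t := s ! x]) H H' n d"
  using V(7)[of "s[t := s ! x]"] V(1,2,5) l
  by (auto simp: rel_temp rel_nth)
 with V l show ?case
  using px_Move[OF l, of w R U pc H] by (auto intro!: ev_instr simp: rel_length)
next
 case (C k)
 have l: "t < length s" using C(1,5) by (auto simp: rel_def)
 have "ev w P R U M (Suc pc) (s[t := Word (k mod 2 ^ w)]) H H' n d"
  using C(7)[of "s[t := Word k]"] C(1,2,3,5) l
  by (auto simp: rel_temp)
 with C l show ?case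
  using px_Const[OF l, of w R U k pc H] by (auto intro!: ev_instr simp: rel_length)
next
 case (Bin op a b')
 let ?pc2 = "pc + esize a" and ?pc3 = "pc + esize a + esize b'"
 have step3: "ev w P R U M ?pc3 s2 H H' (Suc n) (Suc d)"
  if s2: "rel s2 e b" "s2 ! t = Word (val e a)" "s2 ! Suc t = Word (val e b')" "!!i. i < t ==> s2 ! i = s ! i" for s2
 proof -
  have l: "Suc t < length s2" using s2(1) Bin.prems(1) wfe_less by (force simp: rel_def)
  have p: "px w R U (Arith op t t (Suc t)) (?pc3, s2, H)
    (Suc ?pc3, s2[t := Word (arith w op (val e a) (val e b'))], H)"
   using l s2 by (intro px_Arith) auto
  have t: "t < FS" using Bin.prems(1) wfe_less[of t a] by simp
  have "ev w P R U M (pc + esize (Bin op a b')) (s2[t := Word (arith w op (val e a) (val e b'))]) H H' n d"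
  proof (rule Bin.prems(7))
   show "rel (s2[t := Word (arith w op (val e a) (val e b'))]) e b"
    using s2(1) Bin.prems(2) t by (intro rel_temp) auto
  qed (use l s2 arith_val[OF Bin.prems(3)] in auto)
  then have "ev w P R U M (Suc ?pc3) (s2[t := Word (arith w op (val e a) (val e b'))]) H H' n d"
   by (simp add: add.assoc)
  with p show ?thesis
   using Bin.prems(4,6) s2(1) by (auto intro!: ev_instr simp: rel_length add.assoc)
 qed
 have step2: "ev w P R U M ?pc2 s1 H H' (esize b' + Suc n) (esize b' + Suc d)"
  if s1: "rel s1 e b" "s1 ! t = Word (val e a)" "!!i. i < t ==> s1 ! i = s ! i" for s1
 proof (rule Bin.IH(2)[where t = "Suc t" and s = s1])
  fix s' assume "rel s' e b" "s' ! Suc t = Word (val e b')" "!!i. i < Suc t ==> s' ! i = s1 ! i"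
  then show "ev w P R U M (?pc2 + esize b') s' H H' (Suc n) (Suc d)"
   using s1 by (intro step3) auto
 qed (use Bin.prems ok_sub(2)[OF Bin.prems(3)] s1 in auto)
 have "ev w P R U M pc s H H' (esize a + (esize b' + Suc n)) (esize a + (esize b' + Suc d))"
 proof (rule Bin.IH(1)[where t = t and s = s])
  fix s' assume "rel s' e b" "s' ! t = Word (val e a)" "!!i. i < t ==> s' ! i = s ! i"
  then show "ev w P R U M (pc + esize a) s' H H' (esize b' + Suc n) (esize b' + Suc d)"
   by (rule step2)
 qed (use Bin.prems ok_sub(1)[OF Bin.prems(3)] in auto)
 then show ?case by (simp add: add.assoc)
qed

lemma ev_exp1:
 assumes "wfa a" "ok w e a" "code_at P pc (comp_e TB a)" "rel s e b" "FS + Suc (length b) <= M"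
  and "!!s'. rel s' e b ==> s' ! TB = Word (val e a) ==> ev w P R U M (pc + esize a) s' H H' n d"
 shows "ev w P R U M pc s H H' (20 + n) (20 + d)"
 by (rule ev_mono, rule ev_exp[where t = TB and n = n and d = d])
  (use assms in \<open>auto simp: wfa_def intro: wfe_mono\<close>)

lemma ev_exp2:
 assumes "wfa a" "wfa a'" "ok w e a" "ok w e a'" "code_at P pc (e2 a a')" "rel s e b" "FS + Suc (length b) <= M"
  and "!!s'. rel s' e b ==> s' ! TB = Word (val e a) ==> s' ! Suc TB = Word (val e a') ==>
    ev w P R U M (pc + esize a + esize a') s' H H' n d"
 shows "ev w P R U M pc s H H' (40 + n) (40 + d)"
proof -
 have 2: "ev w P R U M (pc + esize a) s' H H' (20 + n) (20 + d)"
  if s': "rel s' e b" "s' ! TB = Word (val e a)" for s'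
  by (rule ev_mono, rule ev_exp[where t = "Suc TB" and a = a' and n = n and d = d])
   (use assms s' in \<open>auto simp: wfa_def e2_def intro: wfe_mono\<close>)
 have "ev w P R U M pc s H H' (20 + (20 + n)) (20 + (20 + d))"
  by (rule ev_exp1[OF assms(1,3) _ assms(6,7)]) (use assms(5) 2 in \<open>auto simp: e2_def\<close>)
 then show ?thesis by simp
qed


lemma ev_I:
 assumes "px w R U i (pc, s, H) (pc', s', H1)" "pc < length P" "P ! pc = i" "length s < M"
  and "ev w P R U M pc' s' H1 H' n d"
 shows "ev w P R U M pc s H H' (Suc n) (Suc d)"
 using assms by (auto intro: ev_instr)

lemma ev_Read:
 assumes "pc < length P" "P ! pc = Read x y" "length s < M" "x < length s" "y < length s"
  and "s ! y = Word a" "a \<in> R" "ev w P R U M (Suc pc) (s[x := H a]) H H' n d"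
 shows "ev w P R U M pc s H H' (Suc n) (Suc d)"
 by (rule ev_I[OF px_Read[of x s y a]]) (use assms in auto)

lemma ev_Write:
 assumes "pc < length P" "P ! pc = Write x y" "length s < M" "x < length s" "y < length s"
  and "s ! x = Word a" "a \<in> U" "ev w P R U M (Suc pc) s (H(a := s ! y)) H' n d"
 shows "ev w P R U M pc s H H' (Suc n) (Suc d)"
 by (rule ev_I[OF px_Write[of x s y a]]) (use assms in auto)

lemma ev_Jump:
 assumes "pc < length P" "P ! pc = Jump l" "length s < M" "ev w P R U M l s H H' n d"
 shows "ev w P R U M pc s H H' (Suc n) (Suc d)"
 by (rule ev_I[OF px_Jump]) (use assms in auto)

lemma ev_Jump_Less:
 assumes "pc < length P" "P ! pc = Jump_Less x y l" "length s < M" "x < length s" "y < length s"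
  and "cell_less (s ! x) (s ! y) = Some c" "ev w P R U M (if c then l else Suc pc) s H H' n d"
 shows "ev w P R U M pc s H H' (Suc n) (Suc d)"
 by (rule ev_I[OF px_Jump_Less[of x s y c]]) (use assms in auto)

lemma numeral_5_Suc: "k + 5 = Suc (Suc (Suc (Suc (Suc k))))"
 by simp

lemma numeral_4_Suc: "k + 4 = Suc (Suc (Suc (Suc k)))"
 by simp

text \<open>Before it is incremented, \<open>NR\<close> holds the old length of the frame, which is
  the position of the cell just allocated.\<close>

lemma ev_Push:
 assumes c: "code_at P pc [Read (TB + 1) TB, Alloc 1, Poke NR (TB + 1), Const TB 1, Arith Add NR NR TB]"
  and r: "rel s e b" "s ! TB = Word a" "a \<in> R" "FS + Suc (length b) < 2 ^ w" "FS + Suc (length b) < M"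
  and k: "!!s'. rel s' e (b @ [H a]) ==> ev w P R U M (Suc (Suc (Suc (Suc (Suc pc))))) s' H H' n d"
 shows "ev w P R U M pc s H H' (5 + n) (5 + d)"
proof -
 have len: "length s = FS + length b" and top: "s ! NR = Word (FS + length b)"
  using r(1) by (auto simp: rel_def)
 define s1 where "s1 = s[42 := H a]"
 define s2 where "s2 = s1 @ [Word 0]"
 define s3 where "s3 = s2[FS + length b := H a]"
 define s4 where "s4 = s3[41 := Word 1]"
 define s5 where "s5 = s4[40 := Word (FS + length b + 1)]"
 have s5: "rel s5 e (b @ [H a])"
  using r(1) len by (auto simp: rel_def s5_def s4_def s3_def s2_def s1_def nth_list_update nth_append
    drop_update_cancel drop_update_swap list_update_append)
 have "2 <= (2::nat) ^ w" using r(4) by simp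
 have 5: "ev w P R U M (Suc (Suc (Suc (Suc pc)))) s4 H H' (Suc n) (Suc d)"
  by (rule ev_I[OF px_Arith[of 40 s4 40 41 "FS + length b" 1 w R U Add]])
   (use c r(4,5) k[OF s5] len top in \<open>auto simp: s5_def s4_def s3_def s2_def s1_def nth_append\<close>)
 have 4: "ev w P R U M (Suc (Suc (Suc pc))) s3 H H' (Suc (Suc n)) (Suc (Suc d))"
  by (rule ev_I[OF px_Const[of 41 s3 w R U 1]])
   (use c r(4,5) 5 len \<open>2 <= 2 ^ w\<close> in \<open>auto simp: s4_def s3_def s2_def s1_def\<close>)
 have 3: "ev w P R U M (Suc (Suc pc)) s2 H H' (Suc (Suc (Suc n))) (Suc (Suc (Suc d)))"
  by (rule ev_I[OF px_Poke[of 40 s2 42 "FS + length b"]])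
   (use c r(5) 4 len top in \<open>auto simp: s3_def s2_def s1_def nth_append\<close>)
 have 2: "ev w P R U M (Suc pc) s1 H H' (Suc (Suc (Suc (Suc n)))) (Suc (Suc (Suc (Suc d))))"
  by (rule ev_I[OF px_Alloc[of w R U 1]])
   (use c r(5) 3 len in \<open>auto simp: s2_def s1_def\<close>)
 have "ev w P R U M pc s H H' (Suc (Suc (Suc (Suc (Suc n))))) (Suc (Suc (Suc (Suc (Suc d)))))"
  by (rule ev_Read[where x = 42 and y = 41 and a = a])
   (use c r 2 len in \<open>auto simp: s1_def\<close>)
 then show ?thesis by (simp add: eval_nat_numeral)
qed

lemma ev_Pop:
 assumes c: "code_at P pc [Const (TB + 1) 1, Arith Sub NR NR (TB + 1), Peek (TB + 1) NR, Write TB (TB + 1), Free 1]"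
  and r: "rel s e b" "s ! TB = Word a" "a \<in> U" "FS + Suc (length b) < 2 ^ w" "FS + Suc (length b) < M" "b ~= []"
  and k: "!!s'. rel s' e (butlast b) ==> ev w P R U M (Suc (Suc (Suc (Suc (Suc pc))))) s' (H(a := last b)) H' n d"
 shows "ev w P R U M pc s H H' (5 + n) (5 + d)"
proof -
 obtain b' v where b: "b = b' @ [v]" using r(6) by (metis rev_exhaust)
 have len: "length s = FS + Suc (length b')" and top: "s ! NR = Word (FS + Suc (length b'))"
  and dr: "drop FS s = b' @ [v]"
  using r(1) by (auto simp: rel_def b)
 have v: "s ! (FS + length b') = v"
  using arg_cong[OF dr, of "%l. l ! length b'"] len by (simp add: nth_append)
 define s1 where "s1 = s[42 := Word 1]"
 define s2 where "s2 = s1[40 := Word (FS + length b')]"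
 define s3 where "s3 = s2[42 := v]"
 define s5 where "s5 = take (FS + length b') s3"
 have "drop FS (take (FS + length b') s) = b'"
  using dr by (simp add: drop_take)
 then have s5: "rel s5 e (butlast b)"
  using r(1) len by (auto simp: rel_def s5_def s3_def s2_def s1_def nth_list_update
    drop_update_cancel drop_update_swap b take_update_swap)
 have "2 <= (2::nat) ^ w" using r(4) by simp
 have ar: "arith w Sub (Suc (FS + length b')) 1 = FS + length b'"
  using r(4) by (simp add: b mod_if)
 have 5: "ev w P R U M (Suc (Suc (Suc (Suc pc)))) s3 (H(a := v)) H' (Suc n) (Suc d)"
  by (rule ev_I[OF px_Free[of 1 s3]])
   (use c r(4,5) k[OF s5] len in \<open>auto simp: s5_def s3_def s2_def s1_def b\<close>)
 have 4: "ev w P R U M (Suc (Suc (Suc pc))) s3 H H' (Suc (Suc n)) (Suc (Suc d))"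
  by (rule ev_Write[where x = 41 and y = 42 and a = a])
   (use c r 5 len in \<open>auto simp: s3_def s2_def s1_def b\<close>)
 have 3: "ev w P R U M (Suc (Suc pc)) s2 H H' (Suc (Suc (Suc n))) (Suc (Suc (Suc d)))"
  by (rule ev_I[OF px_Peek[of 42 s2 40 "FS + length b'"]])
   (use c r(5) 4 len v in \<open>auto simp: s3_def s2_def s1_def b\<close>)
 have 2: "ev w P R U M (Suc pc) s1 H H' (Suc (Suc (Suc (Suc n)))) (Suc (Suc (Suc (Suc d))))"
  by (rule ev_I[OF px_Arith[of 40 s1 40 42 "Suc (FS + length b')" 1 w R U Sub]])
   (use c r(5) 3 len top ar in \<open>auto simp: s2_def s1_def b\<close>)
 have "ev w P R U M pc s H H' (Suc (Suc (Suc (Suc (Suc n))))) (Suc (Suc (Suc (Suc (Suc d)))))"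
  by (rule ev_I[OF px_Const[of 42 s w R U 1]])
   (use c r(4,5) 2 len \<open>2 <= 2 ^ w\<close> in \<open>auto simp: s1_def b\<close>)
 then show ?thesis by (simp add: eval_nat_numeral)
qed

locale compiled =
 fixes w :: nat and P :: program and Pr :: "nat => com" and ent :: "nat => nat" and hl :: nat
 assumes code: "!!p. code_at P (ent p) (comp ent hl (ent p) (Pr p) @ [Halt])"
  and wf: "!!p. wfc (Pr p)"
  and hl: "hl < length P" "P ! hl = Halt"
begin

text \<open>The factor 50 leaves 40 instructions for two operands and at most ten for the command
  itself and its jumps. The stack bound is composed of the frame, one word for the program counter,
  and \<open>Suc M\<close> buffer cells, as a \<open>Push\<close> may start with a buffer of length
  \<open>M\<close>.\<close>

lemma comp_correct:
 assumes "run w Pr R U M c e b H e' b' H' n d"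
  and "U <= R" "wfc c" "code_at P pc (comp ent hl pc c)" "rel s e b" "length b <= Suc M"
  and "!!s'. rel s' e' b' ==> ev w P R U (FS + 2 + M) (pc + clen c) s' H' Hf n2 d2"
 shows "ev w P R U (FS + 2 + M) pc s H Hf (50 * n + n2) (50 * d + d2)"
 using assms
proof (induction arbitrary: pc s Hf n2 d2 rule: run.induct)
 case (run_Skip R U M e b H)
 then show ?case by simp
next
 case (run_Assign b M e a R U x H)
 have "ev w P R U (FS + 2 + M) pc s H Hf (20 + Suc n2) (20 + Suc d2)"
 proof (rule ev_exp1[where a = a and e = e and b = b])
  fix s' assume s': "rel s' e b" "s' ! TB = Word (val e a)"
  show "ev w P R U (FS + 2 + M) (pc + esize a) s' H Hf (Suc n2) (Suc d2)"
   by (rule ev_I[OF px_Move[of x s' 41]])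
    (use s' run_Assign run_Assign.prems(6)[OF rel_reg[OF s'(1)]] in \<open>auto simp: rel_length add.assoc\<close>)
 qed (use run_Assign in auto)
 then show ?case by (rule ev_mono) auto
next
 case (run_Get b M e a R H v U x)
 have "ev w P R U (FS + 2 + M) pc s H Hf (20 + Suc n2) (20 + Suc d2)"
 proof (rule ev_exp1[where a = a and e = e and b = b])
  fix s' assume s': "rel s' e b" "s' ! TB = Word (val e a)"
  show "ev w P R U (FS + 2 + M) (pc + esize a) s' H Hf (Suc n2) (Suc d2)"
   by (rule ev_Read[where x = x and y = 41 and a = "val e a"])
    (use s' run_Get run_Get.prems(6)[OF rel_reg[OF s'(1)]] in \<open>auto simp: rel_length add.assoc\<close>)
 qed (use run_Get in auto)
 then show ?case by (rule ev_mono) auto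
next
 case (run_Put b M e a a' U R H)
 have "ev w P R U (FS + 2 + M) pc s H Hf (40 + Suc n2) (40 + Suc d2)"
 proof (rule ev_exp2[where a = a and a' = a' and e = e and b = b])
  fix s' assume s': "rel s' e b" "s' ! TB = Word (val e a)" "s' ! Suc TB = Word (val e a')"
  have "ev w P R U (FS + 2 + M) (Suc (pc + esize a + esize a')) s' (H(val e a := s' ! 42)) Hf n2 d2"
   using run_Put.prems(6)[OF s'(1)] s'(3) by (simp add: fun_upd_def add.assoc)
  then show "ev w P R U (FS + 2 + M) (pc + esize a + esize a') s' H Hf (Suc n2) (Suc d2)"
   by (rule ev_Write[rotated 7]) (use s' run_Put in \<open>auto simp: rel_length add.assoc e2_def\<close>)
 qed (use run_Put in auto)
 then show ?case by (rule ev_mono) auto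
next
 case (run_Copy b M e a a' U R H)
 have "ev w P R U (FS + 2 + M) pc s H Hf (40 + Suc (Suc n2)) (40 + Suc (Suc d2))"
 proof (rule ev_exp2[where a = a and a' = a' and e = e and b = b])
  fix s' assume s': "rel s' e b" "s' ! TB = Word (val e a)" "s' ! Suc TB = Word (val e a')"
  define s1 where "s1 = s'[43 := H (val e a')]"
  have s1: "rel s1 e b" unfolding s1_def by (rule rel_temp[OF s'(1)]) auto
  have 1: "ev w P R U (FS + 2 + M) (Suc (pc + esize a + esize a')) s1 H Hf (Suc n2) (Suc d2)"
   by (rule ev_Write[where x = 41 and y = 43 and a = "val e a"])
    (use s1 s' run_Copy run_Copy.prems(6)[OF s1] in \<open>auto simp: fun_upd_def rel_length add.assoc e2_def s1_def\<close>)
  show "ev w P R U (FS + 2 + M) (pc + esize a + esize a') s' H Hf (Suc (Suc n2)) (Suc (Suc d2))"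
   by (rule ev_Read[where x = 43 and y = 42 and a = "val e a'"])
    (use 1 s' run_Copy in \<open>auto simp: rel_length add.assoc e2_def s1_def\<close>)
 qed (use run_Copy in auto)
 then show ?case by (rule ev_mono) auto
next
 case (run_Swap b M e a a' U R H)
 let ?Q = "ev w P R U (FS + 2 + M)" and ?pc = "pc + esize a + esize a'"
 have "?Q pc s H Hf (40 + Suc (Suc (Suc (Suc n2)))) (40 + Suc (Suc (Suc (Suc d2))))"
 proof (rule ev_exp2[where a = a and a' = a' and e = e and b = b])
  fix s' assume s': "rel s' e b" "s' ! TB = Word (val e a)" "s' ! Suc TB = Word (val e a')"
  define s1 where "s1 = s'[43 := H (val e a')]"
  define s2 where "s2 = s1[44 := H (val e a)]"
  have s1: "rel s1 e b" unfolding s1_def by (rule rel_temp[OF s'(1)]) auto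
  have s2: "rel s2 e b" unfolding s2_def by (rule rel_temp[OF s1]) auto
  have c: "code_at P ?pc [Read 43 42, Read 44 41, Write 41 43, Write 42 44]"
   using run_Swap.prems by (simp add: e2_def add.assoc)
  have "pc + clen (Swap a a') = Suc (Suc (Suc (Suc ?pc)))" by simp
  with run_Swap.prems(6)[OF s2]
  have k: "?Q (Suc (Suc (Suc (Suc ?pc)))) s2 (H(val e a := H (val e a'), val e a' := H (val e a))) Hf n2 d2"
   by (simp only: fun_upd_def)
  have 4: "?Q (Suc (Suc (Suc ?pc))) s2 (H(val e a := H (val e a'))) Hf (Suc n2) (Suc d2)"
   by (rule ev_Write[where x = 42 and y = 44 and a = "val e a'"])
    (use s1 s2 s' c run_Swap.prems(1) run_Swap.hyps k in \<open>auto simp: rel_length add.assoc s1_def s2_def\<close>)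
  have 3: "?Q (Suc (Suc ?pc)) s2 H Hf (Suc (Suc n2)) (Suc (Suc d2))"
   by (rule ev_Write[where x = 41 and y = 43 and a = "val e a"])
    (use 4 c s1 s2 s' run_Swap in \<open>auto simp: rel_length s1_def s2_def\<close>)
  have 2: "?Q (Suc ?pc) s1 H Hf (Suc (Suc (Suc n2))) (Suc (Suc (Suc d2)))"
   by (rule ev_Read[where x = 44 and y = 41 and a = "val e a"])
    (use 3 c s1 s' run_Swap in \<open>auto simp: rel_length s1_def s2_def\<close>)
  show "?Q ?pc s' H Hf (Suc (Suc (Suc (Suc n2)))) (Suc (Suc (Suc (Suc d2))))"
   by (rule ev_Read[where x = 43 and y = 42 and a = "val e a'"])
    (use 2 c s' run_Swap in \<open>auto simp: rel_length s1_def\<close>)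
 qed (use run_Swap in auto)
 then show ?case by (rule ev_mono) auto
next
 case (run_Push b M e a R U H)
 have "ev w P R U (FS + 2 + M) pc s H Hf (20 + (5 + n2)) (20 + (5 + d2))"
 proof (rule ev_exp1[where a = a and e = e and b = b])
  fix s' assume s': "rel s' e b" "s' ! TB = Word (val e a)"
  show "ev w P R U (FS + 2 + M) (pc + esize a) s' H Hf (5 + n2) (5 + d2)"
   by (rule ev_Push[OF _ s'])
    (use run_Push run_Push.prems(6) in \<open>auto simp: add.assoc numeral_5_Suc\<close>)
 qed (use run_Push in auto)
 then show ?case by (rule ev_mono) auto
next
 case (run_Pop b M e a U R H)
 have "ev w P R U (FS + 2 + M) pc s H Hf (20 + (5 + n2)) (20 + (5 + d2))"
 proof (rule ev_exp1[where a = a and e = e and b = b])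
  fix s' assume s': "rel s' e b" "s' ! TB = Word (val e a)"
  show "ev w P R U (FS + 2 + M) (pc + esize a) s' H Hf (5 + n2) (5 + d2)"
   by (rule ev_Pop[OF _ s'])
    (use run_Pop run_Pop.prems(6) in \<open>auto simp: fun_upd_def add.assoc numeral_5_Suc\<close>)
 qed (use run_Pop in auto)
 then show ?case by (rule ev_mono) auto
next
 case (run_Seq R U M c1 e b H e1 b1 H1 n1 d1 c2 e2 b2 H2 n2' d2')
 have b1: "length b1 <= Suc M"
  using run_buf[OF run_Seq.hyps(1)] run_Seq.prems by auto
 have "ev w P R U (FS + 2 + M) pc s H Hf (50 * n1 + (50 * n2' + n2)) (50 * d1 + (50 * d2' + d2))"
 proof (rule run_Seq.IH(1))
  fix s' assume s': "rel s' e1 b1"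
  show "ev w P R U (FS + 2 + M) (pc + clen c1) s' H1 Hf (50 * n2' + n2) (50 * d2' + d2)"
   by (rule run_Seq.IH(2)) (use run_Seq.prems b1 s' in \<open>auto simp: add.assoc\<close>)
 qed (use run_Seq.prems in auto)
 then show ?case by (simp add: algebra_simps)
next
 case (run_If b M e a a' R U c1 c2 H e1 b1 H1 n1 d1)
 let ?Q = "ev w P R U (FS + 2 + M)" and ?pc = "pc + esize a + esize a'"
 let ?n = "50 * n1 + n2" and ?d = "50 * d1 + d2"
 have "?Q pc s H Hf (40 + Suc (Suc ?n)) (40 + Suc (Suc ?d))"
 proof (rule ev_exp2[where a = a and a' = a' and e = e and b = b])
  fix s' assume s': "rel s' e b" "s' ! TB = Word (val e a)" "s' ! Suc TB = Word (val e a')"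
  show "?Q ?pc s' H Hf (Suc (Suc ?n)) (Suc (Suc ?d))"
  proof (cases "val e a < val e a'")
   case True
   have "?Q (?pc + 2 + clen c2) s' H Hf ?n ?d"
    by (rule run_If.IH) (use True run_If.prems s' in \<open>auto simp: Let_def e2_def add_ac\<close>)
   then have "?Q (?pc + 2 + clen c2) s' H Hf (Suc ?n) (Suc ?d)"
    by (rule ev_mono) auto
   note j = this
    show ?thesis
    by (rule ev_Jump_Less[where x = 41 and y = 42 and c = True])
     (use j True s' run_If in \<open>auto simp: rel_length add_ac Let_def e2_def\<close>)
  next
   case False
   have "?Q (?pc + 1) s' H Hf (50 * n1 + Suc n2) (50 * d1 + Suc d2)"
   proof (rule run_If.IH)
    fix s'' assume s'': "rel s'' e1 b1"
    have "length s'' < FS + 2 + M"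
     using run_buf[OF run_If.hyps(4)] run_If.prems rel_length[OF s''] by auto
    note j = this
     show "?Q (?pc + 1 + clen (if val e a < val e a' then c1 else c2)) s'' H1 Hf (Suc n2) (Suc d2)"
     by (rule ev_Jump)
      (use j False run_If.prems s'' in \<open>auto simp: add_ac Let_def e2_def\<close>)
   qed (use False run_If.prems s' in \<open>auto simp: add_ac Let_def e2_def\<close>)
   note j = this
    show ?thesis
    by (rule ev_Jump_Less[where x = 41 and y = 42 and c = False])
     (use j False s' run_If in \<open>auto simp: rel_length add_ac Let_def e2_def\<close>)
  qed
 qed (use run_If in \<open>auto simp: Let_def\<close>)
 then show ?case by (rule ev_mono) auto
next
 case (run_IfC b M e a a' R H x y U c1 c2 e1 b1 H1 n1 d1)
 let ?Q = "ev w P R U (FS + 2 + M)" and ?pc = "pc + esize a + esize a'"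
 let ?n = "50 * n1 + n2" and ?d = "50 * d1 + d2"
 have "?Q pc s H Hf (40 + Suc (Suc (Suc (Suc ?n)))) (40 + Suc (Suc (Suc (Suc ?d))))"
 proof (rule ev_exp2[where a = a and a' = a' and e = e and b = b])
  fix s' assume s': "rel s' e b" "s' ! TB = Word (val e a)" "s' ! Suc TB = Word (val e a')"
  define s1 where "s1 = s'[41 := Elem x]"
  define s2 where "s2 = s1[42 := Elem y]"
  have s1: "rel s1 e b" unfolding s1_def by (rule rel_temp[OF s'(1)]) auto
  have s2: "rel s2 e b" unfolding s2_def by (rule rel_temp[OF s1]) auto
  have 3: "?Q (Suc (Suc ?pc)) s2 H Hf (Suc (Suc ?n)) (Suc (Suc ?d))"
  proof (cases "x < y")
   case True
   have "?Q (Suc (Suc (Suc (Suc (?pc + clen c2))))) s2 H Hf ?n ?d"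
    by (rule run_IfC.IH) (use True run_IfC.prems s2 in \<open>auto simp: Let_def e2_def add_ac\<close>)
   then have "?Q (Suc (Suc (Suc (Suc (?pc + clen c2))))) s2 H Hf (Suc ?n) (Suc ?d)"
    by (rule ev_mono) auto
   note j = this
    show ?thesis
    by (rule ev_Jump_Less[where x = 41 and y = 42 and c = True])
     (use j True s' s2 run_IfC in \<open>auto simp: rel_length add_ac Let_def e2_def s2_def s1_def\<close>)
  next
   case False
   have "?Q (Suc (Suc (Suc ?pc))) s2 H Hf (50 * n1 + Suc n2) (50 * d1 + Suc d2)"
   proof (rule run_IfC.IH)
    fix s'' assume s'': "rel s'' e1 b1"
    have "length s'' < FS + 2 + M"
     using run_buf[OF run_IfC.hyps(8)] run_IfC.prems rel_length[OF s''] by auto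
    note j = this
     show "?Q (Suc (Suc (Suc ?pc)) + clen (if x < y then c1 else c2)) s'' H1 Hf (Suc n2) (Suc d2)"
     by (rule ev_Jump)
      (use j False run_IfC.prems s'' in \<open>auto simp: add_ac Let_def e2_def\<close>)
   qed (use False run_IfC.prems s2 in \<open>auto simp: add_ac Let_def e2_def\<close>)
   note j = this
    show ?thesis
    by (rule ev_Jump_Less[where x = 41 and y = 42 and c = False])
     (use j False s' s2 run_IfC in \<open>auto simp: rel_length add_ac Let_def e2_def s2_def s1_def\<close>)
  qed
  have 2: "?Q (Suc ?pc) s1 H Hf (Suc (Suc (Suc ?n))) (Suc (Suc (Suc ?d)))"
   by (rule ev_Read[where x = 42 and y = 42 and a = "val e a'"])
    (use 3 s1 s' run_IfC in \<open>auto simp: rel_length add_ac Let_def e2_def s1_def s2_def\<close>)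
  show "?Q ?pc s' H Hf (Suc (Suc (Suc (Suc ?n)))) (Suc (Suc (Suc (Suc ?d))))"
   by (rule ev_Read[where x = 41 and y = 41 and a = "val e a"])
    (use 2 s' run_IfC in \<open>auto simp: rel_length add_ac Let_def e2_def s1_def\<close>)
 qed (use run_IfC in \<open>auto simp: Let_def\<close>)
 then show ?case by (rule ev_mono) auto
next
 case (run_While_False b M e a a' R U c H)
 let ?Q = "ev w P R U (FS + 2 + M)" and ?pc = "pc + esize a + esize a'"
 have "?Q pc s H Hf (40 + Suc (Suc n2)) (40 + Suc (Suc d2))"
 proof (rule ev_exp2[where a = a and a' = a' and e = e and b = b])
  fix s' assume s': "rel s' e b" "s' ! TB = Word (val e a)" "s' ! Suc TB = Word (val e a')"
  have "?Q (Suc ?pc) s' H Hf (Suc n2) (Suc d2)"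
   by (rule ev_Jump) (use s' run_While_False in \<open>auto simp: rel_length add_ac Let_def e2_def\<close>)
  note j = this
   show "?Q ?pc s' H Hf (Suc (Suc n2)) (Suc (Suc d2))"
   by (rule ev_Jump_Less[where x = 41 and y = 42 and c = False])
    (use j s' run_While_False in \<open>auto simp: rel_length add_ac Let_def e2_def\<close>)
 qed (use run_While_False in \<open>auto simp: Let_def\<close>)
 then show ?case by (rule ev_mono) auto
next
 case (run_While_True b M e a a' R U c H e1 b1 H1 n1 d1 e2 b2 H2 n2' d2')
 let ?Q = "ev w P R U (FS + 2 + M)" and ?pc = "pc + esize a + esize a'"
 let ?n = "50 * n2' + n2" and ?d = "50 * d2' + d2"
 have b1: "length b1 <= Suc M"
  using run_buf[OF run_While_True.hyps(5)] run_While_True.prems by auto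
 have "?Q pc s H Hf (40 + Suc (50 * n1 + Suc ?n)) (40 + Suc (50 * d1 + Suc ?d))"
 proof (rule ev_exp2[where a = a and a' = a' and e = e and b = b])
  fix s' assume s': "rel s' e b" "s' ! TB = Word (val e a)" "s' ! Suc TB = Word (val e a')"
  have "?Q (Suc (Suc ?pc)) s' H Hf (50 * n1 + Suc ?n) (50 * d1 + Suc ?d)"
  proof (rule run_While_True.IH(1))
   fix s'' assume s'': "rel s'' e1 b1"
   have "?Q pc s'' H1 Hf ?n ?d"
    by (rule run_While_True.IH(2)) (use run_While_True.prems s'' b1 in auto)
   note j = this
    show "?Q (Suc (Suc ?pc) + clen c) s'' H1 Hf (Suc ?n) (Suc ?d)"
    by (rule ev_Jump)
     (use j run_While_True.prems s'' b1 in \<open>auto simp: rel_length add_ac Let_def e2_def\<close>)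
  qed (use run_While_True.prems s' in \<open>auto simp: add_ac Let_def e2_def\<close>)
  note j = this
   show "?Q ?pc s' H Hf (Suc (50 * n1 + Suc ?n)) (Suc (50 * d1 + Suc ?d))"
   by (rule ev_Jump_Less[where x = 41 and y = 42 and c = True])
    (use j s' run_While_True.hyps(1,4) run_While_True.prems in \<open>auto simp: rel_length add_ac Let_def e2_def\<close>)
 qed (use run_While_True.prems run_While_True.hyps in \<open>auto simp: Let_def\<close>)
 then show ?case by (rule ev_mono) auto
next
 case (run_Call R1 U1 M1 p e H e1 b1 H1 n1 d1 R U M n d)
 have s: "length s = FS" using rel_length[OF run_Call.prems(4)] by simp
 then have tk: "take FS s = s" by simp
 have b1: "length b1 <= Suc M1"
  using run_buf[OF run_Call.hyps(1)] by auto
 have 1: "ev w P R1 U1 (FS + 2 + M1) (ent p) (take FS s) H H1 (50 * n1 + 1) (50 * d1 + 1)"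
  unfolding tk by (rule run_Call.IH)
   (use run_Call.prems run_Call.hyps code[of p] wf b1 in \<open>auto intro!: ev_halt simp: rel_length\<close>)
 \<comment> \<open>A call is a fork whose second child goes straight to a \<open>Halt\<close> and
   touches no cell.\<close>
 have 2: "ev w P {} {} (FS + 2) hl (take FS s) H H 1 1"
  unfolding tk using hl s by (auto intro: ev_halt)
 have eq: "override_on (override_on H H {}) H1 U1 = H1"
  using run_out[OF run_Call.hyps(1)] by (auto simp: override_on_def fun_eq_iff)
 have 3: "ev w P R U (FS + 2 + M) (Suc pc) s H1 Hf n2 d2"
  using run_Call.prems by auto
 show ?case
  by (rule ev_fork[where k = FS and ?l1.0 = "ent p" and ?l2.0 = hl and ?n3.0 = n2 and ?d3.0 = d2,
     OF _ _ _ _ 1 2])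
   (use run_Call.hyps run_Call.prems s 3 eq in auto)
next
 case (run_Par R1 U1 M1 c1 e H e1 b1 H1 n1 d1 R2 U2 M2 c2 e2 b2 H2 n2' d2' R U M n d)
 have s: "length s = FS" using rel_length[OF run_Par.prems(4)] by simp
 then have tk: "take FS s = s" by simp
 have b1: "length b1 <= Suc M1" "length b2 <= Suc M2"
  using run_buf[OF run_Par.hyps(1)] run_buf[OF run_Par.hyps(2)] by auto
 let ?l2 = "Suc (Suc (Suc (pc + clen c1)))"
 have 1: "ev w P R1 U1 (FS + 2 + M1) (Suc (Suc pc)) (take FS s) H H1 (50 * n1 + 1) (50 * d1 + 1)"
  unfolding tk by (rule run_Par.IH(1))
   (use run_Par.prems run_Par.hyps b1 in \<open>auto intro!: ev_halt simp: rel_length Let_def\<close>)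
 have 2: "ev w P R2 U2 (FS + 2 + M2) ?l2 (take FS s) H H2 (50 * n2' + 1) (50 * d2' + 1)"
  unfolding tk by (rule run_Par.IH(2))
   (use run_Par.prems run_Par.hyps b1 in \<open>auto intro!: ev_halt simp: rel_length Let_def add_ac\<close>)
 have 3: "ev w P R U (FS + 2 + M) (Suc pc) s (override_on (override_on H H2 U2) H1 U1) Hf (Suc n2) (Suc d2)"
  by (rule ev_Jump) (use run_Par.prems s in \<open>auto simp: Let_def add_ac\<close>)
 show ?case
  by (rule ev_fork[where k = FS and ?l1.0 = "Suc (Suc pc)" and ?l2.0 = ?l2 and ?n3.0 = "Suc n2" and ?d3.0 = "Suc d2",
     OF _ _ _ _ 1 2])
   (use run_Par.hyps run_Par.prems s 3 in \<open>auto simp: Let_def\<close>)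
qed

end

section \<open>A program logic, and parallel loops by binary splitting\<close>

text \<open>Register 3 holds the first index and register 4 the number of iterations. The halves are
  recursive calls, so each iteration works on its own copy of the registers.\<close>

definition pfor :: "nat => com => com" where
 "pfor p body = If (V 4) (C 1) Skip (If (C 1) (V 4)
   (Par (4 ::= V 4 [div] C 2 ;; Call p)
     (3 ::= V 3 [+] V 4 [div] C 2 ;; 4 ::= V 4 [-] V 4 [div] C 2 ;; Call p))
   body)"

locale prog =
 fixes w :: nat and Pr :: "nat => com"
 assumes w8: "256 <= (2 :: nat) ^ w"
begin

text \<open>The costs incurred so far are passed through, so that the postcondition sees the totals.
  The existence of one run is enough, since \<open>ev_sound\<close> extends an evaluation to all
  schedules.\<close>

definition wp ::
 "nat set => nat set => nat => com
   => ((nat => nat) => 'a :: linorder cell list => (nat => 'a cell) => nat => nat => bool)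
   => (nat => nat) => 'a cell list => (nat => 'a cell) => nat => nat => bool" where
 "wp R U M c Q e b H n d \<longleftrightarrow>
   (\<exists>e' b' H' n' d'. run w Pr R U M c e b H e' b' H' n' d' & Q e' b' H' (n + n') (d + d'))"

text \<open>The interface of procedures: it starts with an empty buffer, and its postcondition
  speaks of shared memory alone, because the registers of the callee are discarded by the
  join.\<close>

definition tri ::
 "nat set => nat set => nat => com => (nat => nat) => (nat => 'a :: linorder cell)
   => ((nat => 'a cell) => bool) => nat => nat => bool" where
 "tri R U M c e H Q n d \<longleftrightarrow>
   (\<exists>e' b' H' n' d'. run w Pr R U M c e [] H e' b' H' n' d' & n' <= n & d' <= d & Q H')"

lemma wp_mono:
 assumes "wp R U M c Q e b H n d"
  and "!!e' b' H' n' d'. Q e' b' H' n' d' ==> (!!a. a \<notin> U ==> H' a = H a) ==> Q' e' b' H' n' d'"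
 shows "wp R U M c Q' e b H n d"
 using assms unfolding wp_def by (meson run_out)

lemma wp_Skip: "wp R U M Skip Q e b H n d \<longleftrightarrow> Q e b H n d"
 by (auto simp: wp_def elim: run.cases intro: run_Skip) (metis add.right_neutral run_Skip)

lemma wp_Assign: "wp R U M (x ::= a) Q e b H n d \<longleftrightarrow>
  length b <= M & ok w e a & Q (e(x := val e a)) b H (Suc n) (Suc d)"
 unfolding wp_def
proof
 assume "length b <= M & ok w e a & Q (e(x := val e a)) b H (Suc n) (Suc d)"
 then show "\<exists>e' b' H' n' d'. run w Pr R U M (x ::= a) e b H e' b' H' n' d' & Q e' b' H' (n + n') (d + d')"
  using run_Assign[of b M w e a Pr R U x H] by force
qed (auto elim: run.cases)

lemma wp_Get: "wp R U M (Get x a) Q e b H n d \<longleftrightarrow>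
  length b <= M & ok w e a & val e a \<in> R &
  (\<exists>v. H (val e a) = Word v & Q (e(x := v)) b H (Suc n) (Suc d))"
 unfolding wp_def
proof
 assume "length b <= M & ok w e a & val e a \<in> R &
  (\<exists>v. H (val e a) = Word v & Q (e(x := v)) b H (Suc n) (Suc d))"
 then show "\<exists>e' b' H' n' d'. run w Pr R U M (Get x a) e b H e' b' H' n' d' & Q e' b' H' (n + n') (d + d')"
  using run_Get[of b M w e a R H _ Pr U x] by force
qed (auto elim: run.cases)

lemma wp_Put: "wp R U M (Put a a') Q e b H n d \<longleftrightarrow>
  length b <= M & ok w e a & ok w e a' & val e a \<in> U &
  Q e b (H(val e a := Word (val e a'))) (Suc n) (Suc d)"
 unfolding wp_def
proof
 assume "length b <= M & ok w e a & ok w e a' & val e a \<in> U &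
  Q e b (H(val e a := Word (val e a'))) (Suc n) (Suc d)"
 then show "\<exists>e' b' H' n' d'. run w Pr R U M (Put a a') e b H e' b' H' n' d' & Q e' b' H' (n + n') (d + d')"
  using run_Put[of b M w e a a' U Pr R H] by force
qed (auto elim: run.cases)

lemma wp_Copy: "wp R U M (Copy a a') Q e b H n d \<longleftrightarrow>
  length b <= M & ok w e a & ok w e a' & val e a \<in> U & val e a' \<in> R &
  Q e b (H(val e a := H (val e a'))) (Suc n) (Suc d)"
 unfolding wp_def
proof
 assume "length b <= M & ok w e a & ok w e a' & val e a \<in> U & val e a' \<in> R &
  Q e b (H(val e a := H (val e a'))) (Suc n) (Suc d)"
 then show "\<exists>e' b' H' n' d'. run w Pr R U M (Copy a a') e b H e' b' H' n' d' & Q e' b' H' (n + n') (d + d')"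
  using run_Copy[of b M w e a a' U R Pr H] by force
qed (auto elim: run.cases)

lemma wp_Swap: "wp R U M (Swap a a') Q e b H n d \<longleftrightarrow>
  length b <= M & ok w e a & ok w e a' & val e a \<in> U & val e a' \<in> U &
  Q e b (H(val e a := H (val e a'), val e a' := H (val e a))) (Suc n) (Suc d)"
 unfolding wp_def
proof
 assume "length b <= M & ok w e a & ok w e a' & val e a \<in> U & val e a' \<in> U &
  Q e b (H(val e a := H (val e a'), val e a' := H (val e a))) (Suc n) (Suc d)"
 then show "\<exists>e' b' H' n' d'. run w Pr R U M (Swap a a') e b H e' b' H' n' d' & Q e' b' H' (n + n') (d + d')"
  using run_Swap[of b M w e a a' U Pr R H] by force
qed (auto elim: run.cases)

lemma wp_Push: "wp R U M (Push a) Q e b H n d \<longleftrightarrow>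
  length b <= M & ok w e a & val e a \<in> R & FS + Suc (length b) < 2 ^ w &
  Q e (b @ [H (val e a)]) H (Suc n) (Suc d)"
 unfolding wp_def
proof
 assume "length b <= M & ok w e a & val e a \<in> R & FS + Suc (length b) < 2 ^ w &
  Q e (b @ [H (val e a)]) H (Suc n) (Suc d)"
 then show "\<exists>e' b' H' n' d'. run w Pr R U M (Push a) e b H e' b' H' n' d' & Q e' b' H' (n + n') (d + d')"
  using run_Push[of b M w e a R Pr U H] by force
qed (auto elim: run.cases)

lemma wp_Pop: "wp R U M (Pop a) Q e b H n d \<longleftrightarrow>
  length b <= M & ok w e a & val e a \<in> U & b ~= [] & FS + Suc (length b) < 2 ^ w &
  Q e (butlast b) (H(val e a := last b)) (Suc n) (Suc d)"
 unfolding wp_def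
proof
 assume "length b <= M & ok w e a & val e a \<in> U & b ~= [] & FS + Suc (length b) < 2 ^ w &
  Q e (butlast b) (H(val e a := last b)) (Suc n) (Suc d)"
 then show "\<exists>e' b' H' n' d'. run w Pr R U M (Pop a) e b H e' b' H' n' d' & Q e' b' H' (n + n') (d + d')"
  using run_Pop[of b M w e a U Pr R H] by force
qed (auto elim: run.cases)

lemma wp_Seq: "wp R U M (c1 ;; c2) Q e b H n d \<longleftrightarrow> wp R U M c1 (wp R U M c2 Q) e b H n d"
 unfolding wp_def
proof
 assume "\<exists>e' b' H' n' d'. run w Pr R U M (c1 ;; c2) e b H e' b' H' n' d' & Q e' b' H' (n + n') (d + d')"
 then show "\<exists>e' b' H' n' d'. run w Pr R U M c1 e b H e' b' H' n' d' &
   (\<exists>e'' b'' H'' n'' d''. run w Pr R U M c2 e' b' H' e'' b'' H'' n'' d'' &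
    Q e'' b'' H'' (n + n' + n'') (d + d' + d''))"
  by (auto elim!: run.cases[of _ _ _ _ _ "c1 ;; c2"] simp: add.assoc) blast
next
 assume "\<exists>e' b' H' n' d'. run w Pr R U M c1 e b H e' b' H' n' d' &
   (\<exists>e'' b'' H'' n'' d''. run w Pr R U M c2 e' b' H' e'' b'' H'' n'' d'' &
    Q e'' b'' H'' (n + n' + n'') (d + d' + d''))"
 then show "\<exists>e' b' H' n' d'. run w Pr R U M (c1 ;; c2) e b H e' b' H' n' d' & Q e' b' H' (n + n') (d + d')"
  by (metis add.assoc run_Seq)
qed

lemma wp_If: "wp R U M (If a a' c1 c2) Q e b H n d \<longleftrightarrow>
  length b <= M & ok w e a & ok w e a' &
  (if val e a < val e a' then wp R U M c1 Q e b H (Suc n) (Suc d) else wp R U M c2 Q e b H (Suc n) (Suc d))"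
 unfolding wp_def add_Suc
proof
 assume "length b <= M & ok w e a & ok w e a' &
  (if val e a < val e a'
   then \<exists>e' b' H' n' d'. run w Pr R U M c1 e b H e' b' H' n' d' & Q e' b' H' (Suc (n + n')) (Suc (d + d'))
   else \<exists>e' b' H' n' d'. run w Pr R U M c2 e b H e' b' H' n' d' & Q e' b' H' (Suc (n + n')) (Suc (d + d')))"
 then show "\<exists>e' b' H' n' d'. run w Pr R U M (If a a' c1 c2) e b H e' b' H' n' d' & Q e' b' H' (n + n') (d + d')"
  using run_If[of b M w e a a' Pr R U c1 c2 H]
  by (cases "val e a < val e a'") (simp, metis add_Suc_right)+
next
 assume "\<exists>e' b' H' n' d'. run w Pr R U M (If a a' c1 c2) e b H e' b' H' n' d' & Q e' b' H' (n + n') (d + d')"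
 then obtain e' b' H' n' d' where *: "run w Pr R U M (If a a' c1 c2) e b H e' b' H' n' d'" "Q e' b' H' (n + n') (d + d')"
  by blast
 from *(1) show "length b <= M & ok w e a & ok w e a' &
  (if val e a < val e a'
   then \<exists>e' b' H' n' d'. run w Pr R U M c1 e b H e' b' H' n' d' & Q e' b' H' (Suc (n + n')) (Suc (d + d'))
   else \<exists>e' b' H' n' d'. run w Pr R U M c2 e b H e' b' H' n' d' & Q e' b' H' (Suc (n + n')) (Suc (d + d')))"
 proof cases
  case (run_If n1 d1)
  with *(2) show ?thesis by (cases "val e a < val e a'") (simp, blast)+
 qed
qed

lemma wp_IfC: "wp R U M (IfC a a' c1 c2) Q e b H n d \<longleftrightarrow>
  length b <= M & ok w e a & ok w e a' & val e a \<in> R & val e a' \<in> R &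
  (\<exists>x y. H (val e a) = Elem x & H (val e a') = Elem y &
  wp R U M (if x < y then c1 else c2) Q e b H (Suc n) (Suc d))"
 unfolding wp_def add_Suc
proof
 assume "length b <= M & ok w e a & ok w e a' & val e a \<in> R & val e a' \<in> R &
  (\<exists>x y. H (val e a) = Elem x & H (val e a') = Elem y & (\<exists>e' b' H' n' d'.
   run w Pr R U M (if x < y then c1 else c2) e b H e' b' H' n' d' & Q e' b' H' (Suc (n + n')) (Suc (d + d'))))"
 then obtain x y e' b' H' n' d' where
  "run w Pr R U M (IfC a a' c1 c2) e b H e' b' H' (Suc n') (Suc d')" "Q e' b' H' (Suc (n + n')) (Suc (d + d'))"
  using run_IfC[of b M w e a a' R H] by blast
 then show "\<exists>e' b' H' n' d'. run w Pr R U M (IfC a a' c1 c2) e b H e' b' H' n' d' & Q e' b' H' (n + n') (d + d')"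
  by (metis add_Suc_right)
next
 assume "\<exists>e' b' H' n' d'. run w Pr R U M (IfC a a' c1 c2) e b H e' b' H' n' d' & Q e' b' H' (n + n') (d + d')"
 then obtain e' b' H' n' d' where *: "run w Pr R U M (IfC a a' c1 c2) e b H e' b' H' n' d'" "Q e' b' H' (n + n') (d + d')"
  by blast
 from *(1) show "length b <= M & ok w e a & ok w e a' & val e a \<in> R & val e a' \<in> R &
  (\<exists>x y. H (val e a) = Elem x & H (val e a') = Elem y & (\<exists>e' b' H' n' d'.
   run w Pr R U M (if x < y then c1 else c2) e b H e' b' H' n' d' & Q e' b' H' (Suc (n + n')) (Suc (d + d'))))"
 proof cases
  case (run_IfC x y n1 d1)
  with *(2) show ?thesis by (cases "x < y") (simp, blast)+
 qed
qed

lemmas wps = wp_Skip wp_Assign wp_Get wp_Put wp_Copy wp_Swap wp_Push wp_Pop wp_Seq wp_If wp_IfC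

lemma wp_While:
 fixes f :: "(nat => nat) => 'a :: linorder cell list => (nat => 'a cell) => nat"
 assumes "I e b H n d"
  and step: "!!e b H n d. I e b H n d ==> length b <= M & ok w e a & ok w e a' &
   (if val e a < val e a'
    then wp R U M c (%e' b' H' n' d'. I e' b' H' n' d' & f e' b' H' < f e b H) e b H (Suc n) (Suc d)
    else Q e b H (Suc n) (Suc d))"
 shows "wp R U M (While a a' c) Q e b H n d"
 using assms(1)
proof (induction "f e b H" arbitrary: e b H n d rule: less_induct)
 case less
 show ?case
 proof (cases "val e a < val e a'")
  case False
  then show ?thesis
   using step[OF less.prems] run_While_False[of b M w e a a' Pr R U c H] unfolding wp_def by force
 next
  case True
  then obtain e1 b1 H1 n1 d1 where 1: "run w Pr R U M c e b H e1 b1 H1 n1 d1"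
   "I e1 b1 H1 (Suc n + n1) (Suc d + d1)" "f e1 b1 H1 < f e b H" "length b <= M" "ok w e a" "ok w e a'"
   using step[OF less.prems] unfolding wp_def by auto
  from less.hyps[OF 1(3,2)] obtain e2 b2 H2 n2 d2 where
   "run w Pr R U M (While a a' c) e1 b1 H1 e2 b2 H2 n2 d2"
   "Q e2 b2 H2 (Suc n + n1 + n2) (Suc d + d1 + d2)"
   unfolding wp_def by auto
  then show ?thesis
   using run_While_True[OF 1(4-6) True 1(1)] unfolding wp_def by (metis add.assoc add_Suc add_Suc_right)
 qed
qed

lemma wp_Call:
 assumes "tri R1 U1 M1 (Pr p) e H Q1 n1 d1" "U1 <= R1" "R1 <= R" "U1 <= U" "112 + M1 <= M"
  and "!!H'. Q1 H' ==> (!!a. a \<notin> U1 ==> H' a = H a) ==> Q e [] H' (n + Suc n1) (d + Suc d1)"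
 shows "wp R U M (Call p) Q e [] H n d"
proof -
 from assms(1) obtain e' b' H' n' d' where r: "run w Pr R1 U1 M1 (Pr p) e [] H e' b' H' n' d'"
  "n' <= n1" "d' <= d1" "Q1 H'"
  unfolding tri_def by auto
 have "run w Pr R U M (Call p) e [] H e [] H' (Suc n1) (Suc d1)"
  by (rule run_Call[OF r(1)]) (use assms r in auto)
 moreover have "Q e [] H' (n + Suc n1) (d + Suc d1)"
  using assms(6) r run_out[OF r(1)] by blast
 ultimately show ?thesis unfolding wp_def by blast
qed

lemma wp_Par:
 assumes "tri R1 U1 M1 c1 e H Q1 n1 d1" "tri R2 U2 M2 c2 e H Q2 n2 d2" "U1 <= R1" "U2 <= R2"
  and "R1 <= R" "R2 <= R" "U1 <= U" "U2 <= U" "U1 \<inter> R2 = {}" "U2 \<inter> R1 = {}" "112 + max M1 M2 <= M"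
  and "!!H1 H2 H'. Q1 H1 ==> Q2 H2 ==> (!!a. a \<in> U1 ==> H' a = H1 a) ==> (!!a. a \<in> U2 ==> H' a = H2 a) ==>
   (!!a. a \<notin> U1 \<union> U2 ==> H' a = H a) ==> Q e [] H' (n + Suc (n1 + n2)) (d + Suc (max d1 d2))"
 shows "wp R U M (Par c1 c2) Q e [] H n d"
proof -
 from assms(1) obtain e' b' H1 n' d' where 1: "run w Pr R1 U1 M1 c1 e [] H e' b' H1 n' d'"
  "n' <= n1" "d' <= d1" "Q1 H1"
  unfolding tri_def by auto
 from assms(2) obtain e'' b'' H2 n'' d'' where 2: "run w Pr R2 U2 M2 c2 e [] H e'' b'' H2 n'' d''"
  "n'' <= n2" "d'' <= d2" "Q2 H2"
  unfolding tri_def by auto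
 let ?H = "override_on (override_on H H2 U2) H1 U1"
 have "run w Pr R U M (Par c1 c2) e [] H e [] ?H (Suc (n1 + n2)) (Suc (max d1 d2))"
  by (rule run_Par[OF 1(1) 2(1)]) (use assms 1 2 in auto)
 moreover have "Q e [] ?H (n + Suc (n1 + n2)) (d + Suc (max d1 d2))"
  by (rule assms(12)[OF 1(4) 2(4)]) (use assms(3,4,9) in \<open>auto simp: override_on_def\<close>)
 ultimately show ?thesis unfolding wp_def by blast
qed

lemma tri_wpI:
 "wp R U M c (%e' b' H' n' d'. n' <= n & d' <= d & Q H') e [] H 0 0 ==> tri R U M c e H Q n d"
 unfolding wp_def tri_def by auto

lemma tri_mono:
 assumes "tri R U M c e H Q n d" "R <= R'" "U <= U'" "M <= M'" "n <= n'" "d <= d'"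
  and "!!H'. Q H' ==> (!!a. a \<notin> U ==> H' a = H a) ==> Q' H'"
 shows "tri R' U' M' c e H Q' n' d'"
 using assms unfolding tri_def by (meson le_trans run_mono run_out)

lemma wp_tri:
 assumes "tri R1 U1 M1 c e H Q1 n1 d1" "R1 <= R" "U1 <= U" "M1 <= M"
  and "!!e' b' H' n' d'. Q1 H' ==> n' <= n + n1 ==> d' <= d + d1 ==>
   (!!a. a \<notin> U1 ==> H' a = H a) ==> Q e' b' H' n' d'"
 shows "wp R U M c Q e [] H n d"
proof -
 from assms(1) obtain e' b' H' n' d' where 1: "run w Pr R1 U1 M1 c e [] H e' b' H' n' d'"
  "n' <= n1" "d' <= d1" "Q1 H'"
  unfolding tri_def by auto
 have "Q e' b' H' (n + n') (d + d')"
  by (rule assms(5)) (use 1 run_out[OF 1(1)] in auto)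
 then show ?thesis
  unfolding wp_def using run_mono[OF 1(1) assms(2-4)] by blast
qed

text \<open>Every iteration may be specified from the initial memory \<open>H\<close>, because no
  other one writes what it reads. The condition on \<open>Q\<close> transfers its result to the
  overlay of both halves. Subtracting 12 from the work lets the induction close: both halves
  contribute this deficit, and one of the two pays for the split. A level of the recursion occupies
  224 words, for one \<open>Par\<close> and one \<open>Call\<close>.\<close>

lemma pfor_tri:
 fixes H :: "nat => 'a :: linorder cell"
 assumes p: "Pr p = pfor p body"
  and env: "e 3 = x" "e 4 = l" "x + l < 2 ^ w" "l <= 2 ^ t"
  and UR: "!!i. U i <= R i" and disj: "!!i j. i ~= j ==> i \<in> {x..<x+l} ==> j \<in> {x..<x+l} ==> U i \<inter> R j = {}"
  and body: "!!i e'. i \<in> {x..<x+l} ==> e' 3 = i ==> (!!r. r ~= 3 ==> r ~= 4 ==> e' r = e r) ==>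
    tri (R i) (U i) M0 body e' H (Q i) (nn i) d0"
  and loc: "!!i K K'. i \<in> {x..<x+l} ==> Q i K ==> (!!a. a \<in> U i ==> K' a = K a) ==> Q i K'"
 shows "tri (\<Union>i\<in>{x..<x+l}. R i) (\<Union>i\<in>{x..<x+l}. U i) (M0 + 224 * t) (Pr p) e H
   (%H'. \<forall>i\<in>{x..<x+l}. Q i H') (sum nn {x..<x+l} + (20 * l - 12) + 2) (d0 + 10 * t + 10)"
 using env disj body loc
proof (induction t arbitrary: e x l)
 case 0
 have w: "1 < (2::nat) ^ w" using w8 by simp
 show ?case
 proof (cases "l = 0")
  case True
  show ?thesis
   unfolding p pfor_def by (rule tri_wpI) (use True "0.prems"(2) w in \<open>simp add: wps\<close>)
 next
  case False
  then have l: "l = 1" using "0.prems"(4) by simp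
  have bd: "tri (R x) (U x) M0 body e H (Q x) (nn x) d0"
   using l "0.prems"(1) by (intro "0.prems"(6)[of x e]) simp_all
  show ?thesis
   unfolding p pfor_def
  proof (rule tri_wpI)
   have one: "{x..<x + l} = {x}" using l by auto
   have "wp (R x) (U x) (M0 + 224 * 0) body
     (%e' b' H' n' d'. n' <= nn x + 8 + 2 & d' <= d0 + 10 * 0 + 10 & Q x H') e [] H 2 2"
    by (rule wp_tri[OF bd]) simp_all
   then show "wp (\<Union>i\<in>{x..<x+l}. R i) (\<Union>i\<in>{x..<x+l}. U i) (M0 + 224 * 0)
     (If (V 4) (C 1) Skip (If (C 1) (V 4)
     (Par (4 ::= V 4 [div] C 2 ;; Call p)
      (3 ::= V 3 [+] V 4 [div] C 2 ;; 4 ::= V 4 [-] V 4 [div] C 2 ;; Call p)) body))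
     (%e' b' H' n' d'. n' <= sum nn {x..<x+l} + (20 * l - 12) + 2 & d' <= d0 + 10 * 0 + 10 &
      (\<forall>i\<in>{x..<x+l}. Q i H')) e [] H 0 0"
    unfolding one using "0.prems"(2) l w by (simp add: wps numeral_2_eq_2)
  qed
 qed
next
 case (Suc t)
 have w: "2 < (2::nat) ^ w" using w8 by simp
 consider "l <= 1" | "2 <= l" by linarith
 then show ?case
 proof cases
  case 1
  have "tri (\<Union>i\<in>{x..<x+l}. R i) (\<Union>i\<in>{x..<x+l}. U i) (M0 + 224 * t) (Pr p) e H
    (%H'. \<forall>i\<in>{x..<x+l}. Q i H') (sum nn {x..<x+l} + (20 * l - 12) + 2) (d0 + 10 * t + 10)"
   by (rule Suc.IH[OF Suc.prems(1-3) _ Suc.prems(5-7)]) (use 1 in \<open>auto intro: order_trans[of l 1]\<close>)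
  then show ?thesis by (rule tri_mono) auto
 next
  case 2
  define h where "h = l div 2"
  have h: "1 <= h" "h < l" "h <= 2 ^ t" "l - h <= 2 ^ t" using 2 Suc.prems(4) by (auto simp: h_def)
  define e1 where "e1 = e(4 := h)"
  define e2 where "e2 = e(3 := x + h, 4 := l - h)"
  let ?I1 = "{x..<x+h}" and ?I2 = "{x+h..<x+h+(l-h)}"
  have I: "?I1 <= {x..<x+l}" "?I2 <= {x..<x+l}" "?I1 \<union> ?I2 = {x..<x+l}" "?I1 \<inter> ?I2 = {}"
   using h by auto
  have 1: "tri (\<Union>i\<in>?I1. R i) (\<Union>i\<in>?I1. U i) (M0 + 224 * t) (Pr p) e1 H
    (%H'. \<forall>i\<in>?I1. Q i H') (sum nn ?I1 + (20 * h - 12) + 2) (d0 + 10 * t + 10)"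
  proof (rule Suc.IH)
   fix i e' assume a: "i \<in> ?I1" "e' 3 = i" "!!r. r ~= 3 ==> r ~= 4 ==> e' r = e1 r"
   show "tri (R i) (U i) M0 body e' H (Q i) (nn i) d0"
    by (rule Suc.prems(6)[of i e', OF subsetD[OF I(1) a(1)] a(2)]) (simp add: a(3) e1_def)
  next
   fix i K K' assume a: "i \<in> ?I1" "Q i K" "!!a. a \<in> U i ==> K' a = K a"
   show "Q i K'" by (rule Suc.prems(7)[OF subsetD[OF I(1) a(1)] a(2,3)])
  next
   fix i j assume "i ~= j" "i \<in> ?I1" "j \<in> ?I1"
   then show "U i \<inter> R j = {}" using I(1) by (intro Suc.prems(5)) auto
  qed (use Suc.prems(1-3) h in \<open>auto simp: e1_def\<close>)
  have 2: "tri (\<Union>i\<in>?I2. R i) (\<Union>i\<in>?I2. U i) (M0 + 224 * t) (Pr p) e2 H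
    (%H'. \<forall>i\<in>?I2. Q i H') (sum nn ?I2 + (20 * (l - h) - 12) + 2) (d0 + 10 * t + 10)"
  proof (rule Suc.IH)
   fix i e' assume a: "i \<in> ?I2" "e' 3 = i" "!!r. r ~= 3 ==> r ~= 4 ==> e' r = e2 r"
   show "tri (R i) (U i) M0 body e' H (Q i) (nn i) d0"
    by (rule Suc.prems(6)[of i e', OF subsetD[OF I(2) a(1)] a(2)]) (simp add: a(3) e2_def)
  next
   fix i K K' assume a: "i \<in> ?I2" "Q i K" "!!a. a \<in> U i ==> K' a = K a"
   show "Q i K'" by (rule Suc.prems(7)[OF subsetD[OF I(2) a(1)] a(2,3)])
  next
   fix i j assume "i ~= j" "i \<in> ?I2" "j \<in> ?I2"
   then show "U i \<inter> R j = {}" using I(2) by (intro Suc.prems(5)) auto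
  qed (use Suc.prems(1-3) h in \<open>auto simp: e2_def\<close>)
  let ?R = "%I. \<Union>i\<in>I. R i" and ?U = "%I. \<Union>i\<in>I. U i"
  have UR': "?U J <= ?R J" for J using UR by blast
  have c1: "tri (?R ?I1) (?U ?I1) (112 + (M0 + 224 * t)) (4 ::= V 4 [div] C 2 ;; Call p) e H
   (%H'. \<forall>i\<in>?I1. Q i H') (sum nn ?I1 + (20 * h - 12) + 4) (d0 + 10 * t + 13)"
  proof (rule tri_wpI)
   have "wp (?R ?I1) (?U ?I1) (112 + (M0 + 224 * t)) (Call p)
    (%e' b' H' n' d'. n' <= sum nn ?I1 + (20 * h - 12) + 4 & d' <= d0 + 10 * t + 13 & (\<forall>i\<in>?I1. Q i H')) e1 [] H 1 1"
    by (rule wp_Call[OF 1 UR']) auto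
   then show "wp (?R ?I1) (?U ?I1) (112 + (M0 + 224 * t)) (4 ::= V 4 [div] C 2 ;; Call p)
    (%e' b' H' n' d'. n' <= sum nn ?I1 + (20 * h - 12) + 4 & d' <= d0 + 10 * t + 13 & (\<forall>i\<in>?I1. Q i H')) e [] H 0 0"
    using w Suc.prems(2) by (simp add: wps e1_def h_def)
  qed
  have c2: "tri (?R ?I2) (?U ?I2) (112 + (M0 + 224 * t))
   (3 ::= V 3 [+] V 4 [div] C 2 ;; 4 ::= V 4 [-] V 4 [div] C 2 ;; Call p) e H
   (%H'. \<forall>i\<in>?I2. Q i H') (sum nn ?I2 + (20 * (l - h) - 12) + 5) (d0 + 10 * t + 13)"
  proof (rule tri_wpI)
   have "wp (?R ?I2) (?U ?I2) (112 + (M0 + 224 * t)) (Call p)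
    (%e' b' H' n' d'. n' <= sum nn ?I2 + (20 * (l - h) - 12) + 5 & d' <= d0 + 10 * t + 13 & (\<forall>i\<in>?I2. Q i H')) e2 [] H 2 2"
    by (rule wp_Call[OF 2 UR']) auto
   then show "wp (?R ?I2) (?U ?I2) (112 + (M0 + 224 * t))
    (3 ::= V 3 [+] V 4 [div] C 2 ;; 4 ::= V 4 [-] V 4 [div] C 2 ;; Call p)
    (%e' b' H' n' d'. n' <= sum nn ?I2 + (20 * (l - h) - 12) + 5 & d' <= d0 + 10 * t + 13 & (\<forall>i\<in>?I2. Q i H')) e [] H 0 0"
    using w Suc.prems(1,2,3) h by (simp add: wps e2_def h_def numeral_2_eq_2)
  qed
  have s: "sum nn {x..<x+l} = sum nn ?I1 + sum nn ?I2"
   unfolding I(3)[symmetric] by (rule sum.union_disjoint) (use I in auto)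
  have dj: "?U ?I1 \<inter> ?R ?I2 = {}" "?U ?I2 \<inter> ?R ?I1 = {}"
  proof -
   have "U i \<inter> R j = {}" "U j \<inter> R i = {}" if "i \<in> ?I1" "j \<in> ?I2" for i j
    using that I by (intro Suc.prems(5); force)+
   then show "?U ?I1 \<inter> ?R ?I2 = {}" "?U ?I2 \<inter> ?R ?I1 = {}" by blast+
  qed
  show ?thesis
   unfolding p pfor_def
  proof (rule tri_wpI)
   show "wp (?R {x..<x+l}) (?U {x..<x+l}) (M0 + 224 * Suc t)
     (If (V 4) (C 1) Skip (If (C 1) (V 4)
     (Par (4 ::= V 4 [div] C 2 ;; Call p)
      (3 ::= V 3 [+] V 4 [div] C 2 ;; 4 ::= V 4 [-] V 4 [div] C 2 ;; Call p)) body))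
     (%e' b' H' n' d'. n' <= sum nn {x..<x+l} + (20 * l - 12) + 2 & d' <= d0 + 10 * Suc t + 10 &
      (\<forall>i\<in>{x..<x+l}. Q i H')) e [] H 0 0"
   proof -
    have sub: "?R ?I1 <= ?R {x..<x+l}" "?R ?I2 <= ?R {x..<x+l}" "?U ?I1 <= ?U {x..<x+l}" "?U ?I2 <= ?U {x..<x+l}"
     by (rule UN_mono[OF I(1) subset_refl], rule UN_mono[OF I(2) subset_refl],
      rule UN_mono[OF I(1) subset_refl], rule UN_mono[OF I(2) subset_refl])
    have "wp (?R {x..<x+l}) (?U {x..<x+l}) (M0 + 224 * Suc t)
     (Par (4 ::= V 4 [div] C 2 ;; Call p)
      (3 ::= V 3 [+] V 4 [div] C 2 ;; 4 ::= V 4 [-] V 4 [div] C 2 ;; Call p))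
     (%e' b' H' n' d'. n' <= sum nn {x..<x+l} + (20 * l - 12) + 2 & d' <= d0 + 10 * Suc t + 10 &
      (\<forall>i\<in>{x..<x+l}. Q i H')) e [] H 2 2"
    proof (rule wp_Par[OF c1 c2 UR' UR' sub dj])
     fix H1 H2 H' assume 1: "\<forall>i\<in>?I1. Q i H1" and 2: "\<forall>i\<in>?I2. Q i H2"
      and e1: "!!a. a \<in> ?U ?I1 ==> H' a = H1 a" and e2: "!!a. a \<in> ?U ?I2 ==> H' a = H2 a"
     have "Q i H'" if i: "i \<in> {x..<x+l}" for i
     proof (cases "i \<in> ?I1")
      case True
      show ?thesis
       by (rule Suc.prems(7)[OF i bspec[OF 1 True]], rule e1) (use True in blast)
     next
      case False
      then have i2: "i \<in> ?I2" using i I by blast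
      show ?thesis
       by (rule Suc.prems(7)[OF i bspec[OF 2 i2]], rule e2) (use i2 in blast)
     qed
     then show "2 + Suc (sum nn ?I1 + (20 * h - 12) + 4 + (sum nn ?I2 + (20 * (l - h) - 12) + 5))
       <= sum nn {x..<x+l} + (20 * l - 12) + 2 &
      2 + Suc (max (d0 + 10 * t + 13) (d0 + 10 * t + 13)) <= d0 + 10 * Suc t + 10 &
      (\<forall>i\<in>{x..<x+l}. Q i H')"
      using h s by auto
    qed auto
    then show ?thesis
     using \<open>2 <= l\<close> w Suc.prems(2) by (simp add: wps numeral_2_eq_2)
   qed
  qed
 qed
qed

end

subsection \<open>Words stored in sorted groups of elements\<close>

definition penc :: "nat => (nat => 'a cell) => nat => 'a list => nat => bool => bool" where
 "penc W H p xs k c \<longleftrightarrow> H (p + k) = Elem (xs ! (if c then W + 3 + k else k)) &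
   H (p + (W + 3) + k) = Elem (xs ! (if c then k else W + 3 + k))"

text \<open>A group without a word is encoded as if all bits were zero, that is, with all pairs in
  order.\<close>

definition obit :: "nat option => nat => bool" where
 "obit vo k = (case vo of None => False | Some v => odd (v div 2 ^ k))"

text \<open>The cells at \<open>W\<close> and \<open>W + 2\<close> never change, so their comparison
  tells the mode to everyone. If they differ, each pair straddles the gap between them and its order
  is visible. If they agree, the three middle elements are equal; the cell at \<open>W + 1\<close>
  can then hold the word itself and be restored from its neighbour.\<close>

definition grp :: "nat => (nat => 'a :: linorder cell) => nat => 'a list => nat option => bool" where
 "grp W H p xs vo \<longleftrightarrow>
  H (p + W) = Elem (xs ! W) & H (p + (W + 2)) = Elem (xs ! (W + 2)) &
  (if xs ! W < xs ! (W + 2)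
   then (\<forall>k<W. penc W H p xs k (obit vo k)) & H (p + (W + 1)) = Elem (xs ! (W + 1))
   else (\<forall>k<W. penc W H p xs k False) &
    H (p + (W + 1)) = (case vo of None => Elem (xs ! (W + 1)) | Some v => Word v))"

lemma grp_cong:
 assumes "grp W H p xs vo" "!!i. i < 2 * W + 3 ==> H' (p' + i) = H (p + i)"
 shows "grp W H' p' xs vo"
proof -
 have "H' (p' + k) = H (p + k) & H' (p' + (W + 3) + k) = H (p + (W + 3) + k)" if "k < W" for k
  using assms(2)[of k] assms(2)[of "W + 3 + k"] that by (simp add: add.assoc)
 moreover have "H' (p' + W) = H (p + W)" "H' (p' + (W + 1)) = H (p + (W + 1))" "H' (p' + (W + 2)) = H (p + (W + 2))"
  using assms(2)[of W] assms(2)[of "W + 1"] assms(2)[of "W + 2"] by simp_all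
 ultimately show ?thesis
  using assms(1) unfolding grp_def penc_def by (simp split: if_splits)
qed

text \<open>Hence sorted cells are a group as they stand, before a first word is written and after
  the last one is erased.\<close>

lemma grp_None_iff: "grp W H p xs None \<longleftrightarrow> (\<forall>i<2 * W + 3. H (p + i) = Elem (xs ! i))"
proof
 assume g: "grp W H p xs None"
 then have p: "penc W H p xs k False" if "k < W" for k
  using that by (auto simp: grp_def obit_def split: if_splits)
 show "\<forall>i<2 * W + 3. H (p + i) = Elem (xs ! i)"
 proof (intro allI impI)
  fix i assume "i < 2 * W + 3"
  then consider "i < W" | "i = W" | "i = W + 1" | "i = W + 2" | "W + 3 <= i" by linarith
  then show "H (p + i) = Elem (xs ! i)"
  proof cases
   case 5
   then obtain k where k: "i = W + 3 + k" by (metis le_Suc_ex)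
   then have "k < W" using \<open>i < 2 * W + 3\<close> by simp
   from p[OF this] show ?thesis by (simp add: k penc_def add.assoc)
  qed (use g p in \<open>auto simp: grp_def penc_def split: if_splits\<close>)
 qed
next
 assume "\<forall>i<2 * W + 3. H (p + i) = Elem (xs ! i)"
 then show "grp W H p xs None"
  unfolding grp_def penc_def obit_def by (simp add: add.assoc del: add_Suc_right add_2_eq_Suc' One_nat_def)
qed

lemma sorted_ends:
 assumes "sorted xs" "length xs = 2 * W + 3" "xs ! W < xs ! (W + 2)" "k < W"
 shows "xs ! k < xs ! (W + 3 + k)"
proof -
 have "xs ! k <= xs ! W" "xs ! (W + 2) <= xs ! (W + 3 + k)"
  using assms by (auto intro!: sorted_nth_mono)
 then show ?thesis using assms(3) by simp
qed

definition rd :: com where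
 "rd = IfC (V 7 [+] V 0) (V 7 [+] (V 0 [+] C 2))
   (8 ::= C 0 ;; 9 ::= V 0 ;; While (C 0) (V 9)
    (9 ::= V 9 [-] C 1 ;; 8 ::= V 8 [+] V 8 ;;
    IfC (V 7 [+] (V 0 [+] C 3) [+] V 9) (V 7 [+] V 9) (8 ::= V 8 [+] C 1) Skip))
   (Get 8 (V 7 [+] (V 0 [+] C 1)))"

definition wr :: com where
 "wr = IfC (V 7 [+] V 0) (V 7 [+] (V 0 [+] C 2))
   (9 ::= C 0 ;; While (V 9) (V 0)
    (10 ::= V 8 [mod] C 2 ;; 8 ::= V 8 [div] C 2 ;;
    IfC (V 7 [+] (V 0 [+] C 3) [+] V 9) (V 7 [+] V 9)
     (Swap (V 7 [+] (V 0 [+] C 3) [+] V 9) (V 7 [+] V 9)) Skip ;;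
    If (C 0) (V 10) (Swap (V 7 [+] (V 0 [+] C 3) [+] V 9) (V 7 [+] V 9)) Skip ;;
    9 ::= V 9 [+] C 1))
   (Put (V 7 [+] (V 0 [+] C 1)) (V 8))"

definition clr :: com where
 "clr = IfC (V 7 [+] V 0) (V 7 [+] (V 0 [+] C 2))
   (9 ::= C 0 ;; While (V 9) (V 0)
    (IfC (V 7 [+] (V 0 [+] C 3) [+] V 9) (V 7 [+] V 9)
     (Swap (V 7 [+] (V 0 [+] C 3) [+] V 9) (V 7 [+] V 9)) Skip ;;
    9 ::= V 9 [+] C 1))
   (Copy (V 7 [+] (V 0 [+] C 1)) (V 7 [+] V 0))"

text \<open>Ranks of blocks are less than \<open>N\<close> and therefore fit into a group of
  \<open>W\<close> bits; the last assumption keeps all addresses and the intermediate sums of the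
  program below \<open>2 ^ w\<close>. With \<open>4 <= W\<close> a first-level block has at least 11
  elements.\<close>

locale alg = prog +
 fixes W N :: nat
 assumes W4: "4 <= W" and NW: "N < 2 ^ W" and WW: "2 * 2 ^ W <= (2 :: nat) ^ w"
  and big: "16 * (N + (2 * W + 3) * (2 * W + 3) + 300) <= (2 :: nat) ^ w"
begin

lemma W_big: "W + 300 < 2 ^ w" "2 * W + 300 < 2 ^ w"
proof -
 define x where "x = (2 * W + 3) * (2 * W + 3)"
 have "2 * W + 3 <= x" by (simp add: x_def)
 moreover have "16 * (N + x + 300) <= 2 ^ w" using big by (simp only: x_def)
 ultimately show 2: "2 * W + 300 < 2 ^ w" by (intro less_le_trans[of _ "16 * (N + x + 300)" "2 ^ w"]) simp_all
 then show "W + 300 < 2 ^ w" by linarith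
qed

lemma wp_rd:
 assumes e: "e 0 = W" "e 7 = p" and g: "grp W H p xs (Some v)" and xs: "sorted xs" "length xs = 2 * W + 3"
  and v: "v < 2 ^ W" and p: "p + (2 * W + 3) < 2 ^ w" and R: "{p..<p + (2 * W + 3)} <= R" and M: "length b <= M"
  and Q: "!!e' n' d'. (!!r. r \<notin> {8, 9} ==> e' r = e r) ==> e' 8 = v ==> n' <= n + 5 * W + 6 ==>
   d' <= d + 5 * W + 6 ==> Q e' b H n' d'"
 shows "wp R U M rd Q e b H n d"
proof (cases "xs ! W < xs ! (W + 2)")
 case False
 then have "xs ! W = xs ! (W + 2)"
  using False sorted_nth_mono[of xs W "W + 2"] xs by simp
 then show ?thesis
  using False g p R M W_big unfolding rd_def
  by (auto simp: wps e grp_def subset_iff intro!: Q)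
next
 case True
 have pe: "penc W H p xs k (odd (v div 2 ^ k))" if "k < W" for k
  using g True that by (auto simp: grp_def obit_def)
 have lt: "xs ! k < xs ! (W + 3 + k)" if "k < W" for k
  by (rule sorted_ends[OF xs True that])
 \<comment> \<open>Bits are read from the top: register 8 holds the bits of \<open>v\<close> from
   position \<open>e' 9\<close> upwards.\<close>
 let ?I = "%e' b' H' n' d'. e' 9 <= W & e' 8 = v div 2 ^ e' 9 & (\<forall>r. r \<notin> {8, 9} --> e' r = e r) & b' = b & H' = H &
   n' + 5 * e' 9 <= n + 5 * W + 3 & d' + 5 * e' 9 <= d + 5 * W + 3"
 have loop: "wp R U M (While (C 0) (V 9)
    (9 ::= V 9 [-] C 1 ;; 8 ::= V 8 [+] V 8 ;;
    IfC (V 7 [+] (V 0 [+] C 3) [+] V 9) (V 7 [+] V 9) (8 ::= V 8 [+] C 1) Skip)) Q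
    (e(8 := 0, 9 := W)) b H (Suc (Suc (Suc n))) (Suc (Suc (Suc d)))"
 proof (rule wp_While[where I = ?I and f = "%e b H. e 9"], goal_cases)
  case 1
  then show ?case using v by simp
 next
  case (2 e' b' H' n' d')
  then have e'0: "e' 0 = W" "e' 7 = p" using e by auto
  show ?case
  proof (cases "e' 9")
   case 0
   then show ?thesis using 2 M W_big by (auto intro!: Q)
  next
   case (Suc i)
   then have i: "i < W" using 2 by simp
   have dv: "v div 2 ^ i = 2 * (v div 2 ^ Suc i) + (v div 2 ^ i) mod 2"
    using div_mult_mod_eq[of "v div 2 ^ i" 2] by (simp add: div_mult2_eq mult.commute[of 2])
   have dv_le: "v div 2 ^ i <= v" "v div 2 ^ Suc i <= v" by (rule div_le_dividend)+
   have sz: "v div 2 ^ Suc i + v div 2 ^ Suc i < 2 ^ w" "Suc (v div 2 ^ Suc i + v div 2 ^ Suc i) < 2 ^ w"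
    using dv_le v WW W4 by linarith+
   have inR: "p + (W + 3) + i \<in> R" "p + i \<in> R"
    using R i by auto
   show ?thesis
    using 2 M W_big pe[OF i] lt[OF i] i dv sz inR p Suc
    by (auto simp: wps e'0 penc_def odd_iff_mod_2_eq_one split: if_splits)
  qed
 qed
 show ?thesis
  using True g p R M W_big loop unfolding rd_def
  by (auto simp: wps e grp_def subset_iff)
qed

lemma penc_swap:
 "penc W H p xs k c ==> k < W ==>
  penc W (H(p + (W + 3) + k := H (p + k), p + k := H (p + (W + 3) + k))) p xs k (\<not> c)"
 by (auto simp: penc_def)

text \<open>Each pair is brought into order before the new bit is applied, so it does not matter
  which word, if any, was stored before.\<close>

lemma wp_wr:
 assumes e: "e 0 = W" "e 7 = p" "e 8 = v" and g: "grp W H p xs vo" and xs: "sorted xs" "length xs = 2 * W + 3"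
  and v: "v < 2 ^ W" and p: "p + (2 * W + 3) < 2 ^ w" and U: "{p..<p + (2 * W + 3)} <= U" and UR: "U <= R" and M: "length b <= M"
  and Q: "!!e' H' n' d'. (!!r. r \<notin> {8, 9, 10} ==> e' r = e r) ==> grp W H' p xs (Some v) ==>
   (!!a. a \<notin> {p..<p + (2 * W + 3)} ==> H' a = H a) ==> n' <= n + 8 * W + 6 ==>
   d' <= d + 8 * W + 6 ==> Q e' b H' n' d'"
 shows "wp R U M wr Q e b H n d"
proof (cases "xs ! W < xs ! (W + 2)")
 case False
 then have "xs ! W = xs ! (W + 2)"
  using False sorted_nth_mono[of xs W "W + 2"] xs by simp
 have "p + (W + 1) \<in> U" "p + W \<in> R" "p + (W + 2) \<in> R"
  by (auto intro!: subsetD[OF UR] subsetD[OF U])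
 moreover have "grp W (H(p + (W + 1) := Word v)) p xs (Some v)"
  using False g by (auto simp: grp_def penc_def)
 ultimately show ?thesis
  using False g p M W_big unfolding wr_def
  by (auto simp: wps e grp_def intro!: Q)
next
 case True
 have pe: "\<exists>c. penc W H p xs k c" if "k < W" for k
  using g True that by (auto simp: grp_def)
 have mid: "H (p + W) = Elem (xs ! W)" "H (p + (W + 1)) = Elem (xs ! (W + 1))" "H (p + (W + 2)) = Elem (xs ! (W + 2))"
  using g True by (auto simp: grp_def)
 have lt: "xs ! k < xs ! (W + 3 + k)" if "k < W" for k
  by (rule sorted_ends[OF xs True that])
 let ?I = "%e' b' H' n' d'. e' 9 <= W & e' 8 = v div 2 ^ e' 9 & (\<forall>r. r \<notin> {8, 9, 10} --> e' r = e r) & b' = b &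
   (\<forall>k<e' 9. penc W H' p xs k (odd (v div 2 ^ k))) & (\<forall>k<W. e' 9 <= k --> (\<exists>c. penc W H' p xs k c)) &
   H' (p + W) = Elem (xs ! W) & H' (p + (W + 1)) = Elem (xs ! (W + 1)) & H' (p + (W + 2)) = Elem (xs ! (W + 2)) &
   (\<forall>a. a \<notin> {p..<p + (2 * W + 3)} --> H' a = H a) &
   n' <= n + 8 * e' 9 + 2 & d' <= d + 8 * e' 9 + 2"
 let ?sw = "Swap (V 7 [+] (V 0 [+] C 3) [+] V 9) (V 7 [+] V 9)"
 have loop: "wp R U M (While (V 9) (V 0)
    (10 ::= V 8 [mod] C 2 ;; 8 ::= V 8 [div] C 2 ;;
    IfC (V 7 [+] (V 0 [+] C 3) [+] V 9) (V 7 [+] V 9) ?sw Skip ;;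
    If (C 0) (V 10) ?sw Skip ;; 9 ::= V 9 [+] C 1)) Q
    (e(9 := 0)) b H (Suc (Suc n)) (Suc (Suc d))"
 proof (rule wp_While[where I = ?I and f = "%e b H. W - e 9"], goal_cases)
  case 1
  then show ?case using v e pe mid by auto
 next
  case (2 e' b' H' n' d')
  then have e'0: "e' 0 = W" "e' 7 = p" using e by auto
  show ?case
  proof (cases "e' 9 < W")
   case False
   then have "e' 9 = W" using 2 by simp
   moreover have "grp W H' p xs (Some v)"
    using 2 \<open>e' 9 = W\<close> True unfolding grp_def obit_def by simp
   ultimately show ?thesis using 2 M W_big e'0 by (auto intro!: Q)
  next
   case i: True
   define i where "i = e' 9"
   have e8: "e' 8 = v div 2 ^ i" using 2 by (simp add: i_def)
   obtain c where c: "penc W H' p xs i c" using 2 i by (auto simp: i_def)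
   \<comment> \<open>\<open>H0\<close> is the memory with the old bit erased; \<open>H1\<close>
     below has the new bit in place.\<close>
   define H0 where "H0 = (if c then H'(p + (W + 3) + i := H' (p + i), p + i := H' (p + (W + 3) + i)) else H')"
   have c0: "penc W H0 p xs i False" using penc_swap[OF c] c i by (auto simp: H0_def i_def)
   define c' where "c' = odd (v div 2 ^ i)"
   define H1 where "H1 = (if c' then H0(p + (W + 3) + i := H0 (p + i), p + i := H0 (p + (W + 3) + i)) else H0)"
   have c1: "penc W H1 p xs i c'" using penc_swap[OF c0] c0 i by (auto simp: H1_def i_def)
   have same: "H1 a = H' a" if "a ~= p + i" "a ~= p + (W + 3) + i" for a
    using that by (auto simp: H1_def H0_def)
   have oth: "penc W H1 p xs k cc \<longleftrightarrow> penc W H' p xs k cc" if "k ~= i" "k < W" for k cc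
    using that i same[of "p + k"] same[of "p + (W + 3) + k"] by (auto simp: penc_def i_def)
   have inU: "p + (W + 3) + i \<in> U" "p + i \<in> U"
    using U i by (auto simp: i_def)
   have inR: "p + (W + 3) + i \<in> R" "p + i \<in> R"
    using inU UR by blast+
   have cmp: "\<exists>x y. H' (p + (W + 3) + i) = Elem x & H' (p + i) = Elem y & (x < y \<longleftrightarrow> c)"
    using c lt[of i] i by (auto simp: penc_def i_def)
   let ?I2 = "%e'' b'' H'' n'' d''. ?I e'' b'' H'' n'' d'' & W - e'' 9 < W - e' 9"
   let ?e1 = "e'(10 := v div 2 ^ i mod 2, 8 := v div 2 ^ i div 2)"
   have h0: "?I2 (?e1(9 := Suc i)) b H1 (n' + 8) (d' + 8)"
    using 2 i c1 oth same by (auto simp: i_def[symmetric] div_mult2_eq[symmetric] mult.commute less_Suc_eq c'_def)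
   define J where "J = ?I2"
   have fin: "J (?e1(9 := Suc i)) b H1 n'' d''" if "n'' <= n' + 8" "d'' <= d' + 8" for n'' d''
    using that h0 unfolding J_def by auto
   have ok: "p + (W + 3) + i < 2 ^ w" "p + i < 2 ^ w" "p + (W + 3) < 2 ^ w" "i + 1 < 2 ^ w"
    using p i W_big by (auto simp: i_def)
   have wp2: "wp R U M (If (C 0) (V 10) ?sw Skip ;; 9 ::= V 9 [+] C 1) J ?e1 b H0 n'' d''"
    if "n'' <= n' + 5" "d'' <= d' + 5" for n'' d''
   proof -
    have f: "J (?e1(9 := Suc i)) b H1 m dd" if "m <= n'' + 3" "dd <= d'' + 3" for m dd
     using that \<open>n'' <= n' + 5\<close> \<open>d'' <= d' + 5\<close> by (intro fin) auto
    show ?thesis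
    proof (cases c')
     case True
     then have "v div 2 ^ i mod 2 = 1" by (simp add: c'_def odd_iff_mod_2_eq_one)
     then show ?thesis
      using True inU ok M W_big f[of "Suc (Suc (Suc n''))" "Suc (Suc (Suc d''))"]
      by (simp add: wps e'0 i_def[symmetric] H1_def)
    next
     case False
     then have "v div 2 ^ i mod 2 = 0" by (simp add: c'_def even_iff_mod_2_eq_zero)
     then show ?thesis
      using False ok M W_big f[of "Suc (Suc n'')" "Suc (Suc d'')"]
      by (simp add: wps e'0 i_def[symmetric] H1_def)
    qed
   qed
   from cmp obtain x y where xy: "H' (p + (W + 3) + i) = Elem x" "H' (p + i) = Elem y" "x < y \<longleftrightarrow> c" by auto
   have "wp R U M (10 ::= V 8 [mod] C 2 ;; 8 ::= V 8 [div] C 2 ;;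
    IfC (V 7 [+] (V 0 [+] C 3) [+] V 9) (V 7 [+] V 9) ?sw Skip ;;
    If (C 0) (V 10) ?sw Skip ;; 9 ::= V 9 [+] C 1) J e' b H' (Suc n') (Suc d')"
   proof (cases c)
    case True
    have "wp R U M (If (C 0) (V 10) ?sw Skip ;; 9 ::= V 9 [+] C 1) J ?e1 b H0 (n' + 5) (d' + 5)"
     by (rule wp2) auto
    then show ?thesis
     using True xy inU inR ok M W_big
     by (simp add: wp_Seq wp_Assign wp_IfC wp_Swap wp_Skip e'0 e8 i_def[symmetric] H0_def numeral_5_Suc)
   next
    case False
    have "wp R U M (If (C 0) (V 10) ?sw Skip ;; 9 ::= V 9 [+] C 1) J ?e1 b H0 (n' + 4) (d' + 4)"
     by (rule wp2) auto
    then show ?thesis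
     using False xy inU inR ok M W_big
     by (simp add: wp_Seq wp_Assign wp_IfC wp_Swap wp_Skip e'0 e8 i_def[symmetric] H0_def numeral_4_Suc)
   qed
   then show ?thesis unfolding J_def using 2 i e'0 M by simp
  qed
 qed
 have "p + W \<in> R" "p + (W + 2) \<in> R"
  by (auto intro!: subsetD[OF UR] subsetD[OF U])
 then show ?thesis
  using True mid p M W_big loop unfolding wr_def
  by (simp add: wp_Seq wp_Assign wp_IfC e)
qed

text \<open>If the word was stored explicitly, the lost element equals its neighbour by sortedness.
  Otherwise ordering the pairs suffices.\<close>

lemma wp_clr:
 assumes e: "e 0 = W" "e 7 = p" and g: "grp W H p xs vo" and xs: "sorted xs" "length xs = 2 * W + 3"
  and p: "p + (2 * W + 3) < 2 ^ w" and U: "{p..<p + (2 * W + 3)} <= U" and UR: "U <= R" and M: "length b <= M"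
  and Q: "!!e' H' n' d'. (!!r. r \<notin> {9} ==> e' r = e r) ==> grp W H' p xs None ==>
   (!!a. a \<notin> {p..<p + (2 * W + 3)} ==> H' a = H a) ==> n' <= n + 4 * W + 6 ==>
   d' <= d + 4 * W + 6 ==> Q e' b H' n' d'"
 shows "wp R U M clr Q e b H n d"
proof (cases "xs ! W < xs ! (W + 2)")
 case False
 have eq: "xs ! W = xs ! (W + 1)"
 proof (rule antisym)
  show "xs ! W <= xs ! (W + 1)" using xs by (intro sorted_nth_mono) auto
  have "xs ! (W + 1) <= xs ! (W + 2)" using xs by (intro sorted_nth_mono) auto
  then show "xs ! (W + 1) <= xs ! W" using False by simp
 qed
 have "p + (W + 1) \<in> U" "p + W \<in> R" "p + (W + 2) \<in> R"
  by (auto intro!: subsetD[OF UR] subsetD[OF U])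
 moreover have "grp W (H(p + (W + 1) := Elem (xs ! W))) p xs None"
  using False g eq by (auto simp: grp_def penc_def)
 moreover have "H (p + W) = Elem (xs ! W)" "H (p + (W + 2)) = Elem (xs ! (W + 2))"
  using g by (auto simp: grp_def)
 ultimately show ?thesis
  using False p M W_big unfolding clr_def
  by (auto simp: wps e intro!: Q)
next
 case True
 have pe: "\<exists>c. penc W H p xs k c" if "k < W" for k
  using g True that by (auto simp: grp_def)
 have mid: "H (p + W) = Elem (xs ! W)" "H (p + (W + 1)) = Elem (xs ! (W + 1))" "H (p + (W + 2)) = Elem (xs ! (W + 2))"
  using g True by (auto simp: grp_def)
 have lt: "xs ! k < xs ! (W + 3 + k)" if "k < W" for k
  by (rule sorted_ends[OF xs True that])
 let ?I = "%e' b' H' n' d'. e' 9 <= W & (\<forall>r. r \<notin> {9} --> e' r = e r) & b' = b &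
   (\<forall>k<e' 9. penc W H' p xs k False) & (\<forall>k<W. e' 9 <= k --> (\<exists>c. penc W H' p xs k c)) &
   H' (p + W) = Elem (xs ! W) & H' (p + (W + 1)) = Elem (xs ! (W + 1)) & H' (p + (W + 2)) = Elem (xs ! (W + 2)) &
   (\<forall>a. a \<notin> {p..<p + (2 * W + 3)} --> H' a = H a) &
   n' <= n + 4 * e' 9 + 2 & d' <= d + 4 * e' 9 + 2"
 let ?sw = "Swap (V 7 [+] (V 0 [+] C 3) [+] V 9) (V 7 [+] V 9)"
 have loop: "wp R U M (While (V 9) (V 0)
    (IfC (V 7 [+] (V 0 [+] C 3) [+] V 9) (V 7 [+] V 9) ?sw Skip ;; 9 ::= V 9 [+] C 1)) Q
    (e(9 := 0)) b H (Suc (Suc n)) (Suc (Suc d))"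
 proof (rule wp_While[where I = ?I and f = "%e b H. W - e 9"], goal_cases)
  case 1
  then show ?case using e pe mid by auto
 next
  case (2 e' b' H' n' d')
  then have e'0: "e' 0 = W" "e' 7 = p" using e by auto
  show ?case
  proof (cases "e' 9 < W")
   case False
   then have "e' 9 = W" using 2 by simp
   moreover have "grp W H' p xs None"
    using 2 \<open>e' 9 = W\<close> True unfolding grp_def obit_def by simp
   ultimately show ?thesis using 2 M W_big e'0 by (auto intro!: Q)
  next
   case i: True
   define i where "i = e' 9"
   obtain c where c: "penc W H' p xs i c" using 2 i by (auto simp: i_def)
   define H0 where "H0 = (if c then H'(p + (W + 3) + i := H' (p + i), p + i := H' (p + (W + 3) + i)) else H')"
   have c0: "penc W H0 p xs i False" using penc_swap[OF c] c i by (auto simp: H0_def i_def)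
   have same: "H0 a = H' a" if "a ~= p + i" "a ~= p + (W + 3) + i" for a
    using that by (auto simp: H0_def)
   have oth: "penc W H0 p xs k cc \<longleftrightarrow> penc W H' p xs k cc" if "k ~= i" "k < W" for k cc
    using that i same[of "p + k"] same[of "p + (W + 3) + k"] by (auto simp: penc_def i_def)
   have inU: "p + (W + 3) + i \<in> U" "p + i \<in> U"
    using U i by (auto simp: i_def)
   have inR: "p + (W + 3) + i \<in> R" "p + i \<in> R"
    using inU UR by blast+
   have cmp: "\<exists>x y. H' (p + (W + 3) + i) = Elem x & H' (p + i) = Elem y & (x < y \<longleftrightarrow> c)"
    using c lt[of i] i by (auto simp: penc_def i_def)
   let ?I2 = "%e'' b'' H'' n'' d''. ?I e'' b'' H'' n'' d'' & W - e'' 9 < W - e' 9"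
   have h0: "?I2 (e'(9 := Suc i)) b H0 (n' + 4) (d' + 4)"
    using 2 i c0 oth same by (auto simp: i_def[symmetric] less_Suc_eq)
   define J where "J = ?I2"
   have fin: "J (e'(9 := Suc i)) b H0 n'' d''" if "n'' <= n' + 4" "d'' <= d' + 4" for n'' d''
    using that h0 unfolding J_def by auto
   have ok: "p + (W + 3) + i < 2 ^ w" "p + i < 2 ^ w" "p + (W + 3) < 2 ^ w" "i + 1 < 2 ^ w"
    using p i W_big by (auto simp: i_def)
   from cmp obtain x y where xy: "H' (p + (W + 3) + i) = Elem x" "H' (p + i) = Elem y" "x < y \<longleftrightarrow> c" by auto
   have "wp R U M (IfC (V 7 [+] (V 0 [+] C 3) [+] V 9) (V 7 [+] V 9) ?sw Skip ;; 9 ::= V 9 [+] C 1) J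
    e' b H' (Suc n') (Suc d')"
   proof (cases c)
    case True
    show ?thesis
     using True xy inU inR ok M W_big fin[of "n' + 4" "d' + 4"]
     by (simp add: wps e'0 i_def[symmetric] H0_def numeral_4_Suc)
   next
    case False
    show ?thesis
     using False xy inU inR ok M W_big fin[of "Suc (Suc (Suc n'))" "Suc (Suc (Suc d'))"]
     by (simp add: wps e'0 i_def[symmetric] H0_def)
   qed
   then show ?thesis unfolding J_def using 2 i e'0 M by simp
  qed
 qed
 have "p + W \<in> R" "p + (W + 2) \<in> R"
  by (auto intro!: subsetD[OF UR] subsetD[OF U])
 then show ?thesis
  using True mid p M W_big loop unfolding clr_def
  by (simp add: wp_Seq wp_Assign wp_IfC e)
qed

end

subsection \<open>Cyclic valleys\<close>

text \<open>
  A valley is a sequence indexed by \<open>{-b..<a}\<close> that ascends on the nonnegative indices (the rest of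
  \<open>A\<close>) and descends on the negative ones (the rest of \<open>B\<close>, reversed).
\<close>

definition valley :: "(int => 'a :: linorder) => int => int => bool" where
 "valley c a b \<longleftrightarrow> (\<forall>z z'. 0 <= z --> z <= z' --> z' < a --> c z <= c z') &
   (\<forall>z z'. - b <= z --> z <= z' --> z' < 0 --> c z' <= c z)"

definition vmset :: "(int => 'a) => int => int => 'a multiset" where
 "vmset c a b = image_mset c (mset_set {- b..<a})"

text \<open>After \<open>i\<close> elements of one side and \<open>j\<close> of the other have been
  removed at the bottom, the remaining ones are renumbered from the new seam.\<close>

definition upper :: "(int => 'a) => int => int => int => 'a" where
 "upper c i j z = (if 0 <= z then c (z + i) else c (z - j))"

text \<open>The ring is the interval \<open>R\<close>, ending at \<open>Rb\<close>, followed by the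
  interval \<open>L\<close>, starting at \<open>La\<close>. \<open>L\<close> starts with index
  \<open>F\<close> and the indices just below \<open>F\<close> end \<open>R\<close>; those below
  \<open>F - lR\<close> wrap to the end of \<open>L\<close>. The offset \<open>F\<close> is the
  price of block alignment: without it \<open>L\<close> would start with index 0.\<close>

definition cell_of :: "int => int => int => int => int => int => nat" where
 "cell_of La Rb F lR tot z =
   (let z' = if z < F - lR then z + tot else z in nat ((if F <= z' then La else Rb) + z' - F))"

definition layout :: "(nat => 'a cell) => int => int => int => int => int => (int => 'a) => int => int => bool" where
 "layout H La Rb F lR tot c a b \<longleftrightarrow> (\<forall>z. - b <= z --> z < a --> H (cell_of La Rb F lR tot z) = Elem (c z))"

text \<open>The two inequalities that relate \<open>a\<close> and \<open>F\<close> to the length of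
  \<open>L\<close> say that \<open>L\<close> is \<open>a - F\<close> cells rounded up to whole
  blocks. In particular no index wraps at the upper end.\<close>

definition ninv :: "int => int => int => int => int => int => int => int => bool" where
 "ninv BS La Lb Ra Rb F a b \<longleftrightarrow> 0 < BS & 0 <= La & La <= Lb & Lb <= Ra & Ra <= Rb &
   BS dvd Lb - La & BS dvd Rb - Ra & 0 <= F & F < BS & 0 <= a & 0 <= b &
   a <= Lb - La + F & Lb - La + F < a + BS & a + b = Lb - La + (Rb - Ra)"

text \<open>Converts an estimate that is off by less than a block into an exact one, provided that
  the quantity is a multiple of the block size.\<close>

lemma dvd_nonneg: "(k :: int) dvd x ==> - k < x ==> 0 < k ==> 0 <= x"
 using zdvd_imp_le[of k "- x"] by (cases "0 <= x") auto

locale ring_cut =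
 fixes BS La Lb Ra Rb F a b h i j :: int
 assumes inv: "ninv BS La Lb Ra Rb F a b"
  and h: "BS dvd h" "BS <= h" "h + BS <= a + b"
  and ij: "i + j = h" "0 <= i" "i <= a" "0 <= j" "j <= b"
begin

definition "lL = Lb - La"
definition "lR = Rb - Ra"
definition "tot = a + b"
text \<open>The shift that moves the upper end \<open>i\<close> of the low part to a block boundary,
  which are the indices congruent to \<open>F\<close>. It becomes the offset of the high
  part.\<close>

definition "lam = (F - i) mod BS"
definition "Lv = La + i + lam - F"
definition "Rv = Rb + lam - F - j"

lemma inv': "0 < BS" "0 <= La" "La <= Lb" "Lb <= Ra" "Ra <= Rb" "BS dvd lL" "BS dvd lR" "0 <= F" "F < BS"
  "0 <= a" "0 <= b" "a <= lL + F" "lL + F < a + BS" "tot = lL + lR" "BS dvd tot"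
 using inv by (auto simp: ninv_def lL_def lR_def tot_def)

lemma lam: "0 <= lam" "lam < BS" "BS dvd i + lam - F"
proof -
 show "0 <= lam" "lam < BS" using inv'(1) by (auto simp: lam_def)
 have eq: "i + lam - F = lam - (F - i)" by simp
 show "BS dvd i + lam - F"
  unfolding eq using dvd_minus_mod[of BS "F - i"] by (simp add: lam_def dvd_diff_commute)
qed

text \<open>The cut points lie inside \<open>L\<close> and \<open>R\<close>: each of the four
  differences is a multiple of \<open>BS\<close> that exceeds \<open>- BS\<close>.\<close>

lemma bounds: "F <= i + lam" "i + lam <= F + lL" "lam - j <= F" "F - lR <= lam - j"
proof -
 have d1: "BS dvd lL + F - i - lam"
  using dvd_diff[OF inv'(6) lam(3)] by (simp add: algebra_simps)
 have "h - (i + lam - F) = F + j - lam" using ij(1) by simp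
 then have d2: "BS dvd F + j - lam"
  using dvd_diff[OF h(1) lam(3)] by metis
 have d3: "BS dvd lR - (F + j - lam)"
  by (rule dvd_diff[OF inv'(7) d2])
 show "F <= i + lam" using dvd_nonneg[OF lam(3)] inv' ij lam by linarith
 show "i + lam <= F + lL" using dvd_nonneg[OF d1] inv' ij lam by linarith
 show "lam - j <= F" using dvd_nonneg[OF d2] inv' ij lam by linarith
 show "F - lR <= lam - j" using dvd_nonneg[OF d3] inv' ij lam tot_def by linarith
qed

lemma lens: "Lv - La + (Rb - Rv) = h" "Lb - Lv + (Rv - Ra) = tot - h"
 using ij inv'(14) by (auto simp: Lv_def Rv_def lL_def lR_def)

lemma order: "La <= Lv" "Lv <= Lb" "Ra <= Rv" "Rv <= Rb"
 using bounds by (auto simp: Lv_def Rv_def lL_def lR_def)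

lemma dvds: "BS dvd Lv - La" "BS dvd Rb - Rv" "BS dvd Lb - Lv" "BS dvd Rv - Ra"
proof -
 show 1: "BS dvd Lv - La" using lam(3) by (simp add: Lv_def algebra_simps)
 have "Rb - Rv = h - (Lv - La)" using lens by simp
 then show 2: "BS dvd Rb - Rv" using dvd_diff[OF h(1) 1] by metis
 have "Lb - Lv = lL - (Lv - La)" by (simp add: lL_def)
 then show "BS dvd Lb - Lv" using dvd_diff[OF inv'(6) 1] by metis
 have "Rv - Ra = lR - (Rb - Rv)" by (simp add: lR_def)
 then show "BS dvd Rv - Ra" using dvd_diff[OF inv'(7) 2] by metis
qed

lemma low_inv: "ninv BS La Lv Rv Rb F i j"
 using inv' order lens dvds lam ij unfolding ninv_def by (auto simp: Lv_def)

lemma high_inv: "ninv BS Lv Lb Ra Rv lam (a - i) (b - j)"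
 using inv' order lens dvds lam ij tot_def unfolding ninv_def by (auto simp: Lv_def lL_def)

text \<open>If anything is exchanged at all, the upper run \<open>i ..< i + lam\<close> does not
  wrap; otherwise the low part would be shorter than a block.\<close>

lemma lam_blk: "0 < lam ==> F - lR <= i" "0 < lam ==> i < F + lL" "0 < lam ==> 0 < tot"
proof -
 assume l: "0 < lam"
 show "i < F + lL" using bounds(2) l by simp
 show "0 < tot" using ij h inv'(1) tot_def by linarith
 show "F - lR <= i"
 proof (rule ccontr)
  assume "\<not> F - lR <= i"
  then have "h < BS" using bounds lam ij by linarith
  then show False using h by simp
 qed
qed

lemma F_le: "F <= a + lR"
proof (cases "lR = 0")
 case True
 have "BS <= tot" using h inv' tot_def by linarith
 then show ?thesis using True inv' by linarith
next
 case False
 then have "0 < lR" using inv' by (simp add: lR_def)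
 then have "BS <= lR" using inv'(7) zdvd_imp_le by blast
 then show ?thesis using inv' by linarith
qed

text \<open>The run ends at a block boundary and is shorter than a block, while the ring is
  interrupted at block boundaries only. So consecutive indices are consecutive cells.\<close>

lemma cell_run:
 assumes "BS dvd F - z - l" "0 <= l" "l < BS" "0 <= t" "t < l" "- b <= z" "z < F + lL"
 shows "cell_of La Rb F lR tot (z + t) = cell_of La Rb F lR tot z + nat t"
proof -
 have nc: "\<not> (y < x & x <= y + t)" if "BS dvd F - x" "BS dvd z - y" for x y
 proof
  assume a: "y < x & x <= y + t"
  have "BS dvd (F - z - l) - (F - x) + (z - y)"
   by (rule dvd_add[OF dvd_diff[OF assms(1) that(1)] that(2)])
  then have "BS dvd x - y - l" by (simp add: algebra_simps)
  then have "0 <= x - y - l" by (rule dvd_nonneg) (use a assms inv'(1) in auto)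
  then show False using a assms by auto
 qed
 have 1: "z + t < F - lR \<longleftrightarrow> z < F - lR"
  using nc[of "F - lR" z] inv'(7) assms(4) by auto
 have 2: "F <= z + t \<longleftrightarrow> F <= z" using nc[of F z] assms(4) by auto
 have 3: "F <= z + tot + t \<longleftrightarrow> F <= z + tot" using nc[of F "z + tot"] inv'(15) assms(4) by auto
 have g: "0 <= Ra" "F - lR <= a" "Rb = Ra + lR"
  using inv' F_le by (auto simp: lR_def)
 show ?thesis
 proof (cases "z < F - lR")
  case True
  have "0 <= (if F <= z + tot then La else Rb) + (z + tot) - F"
   using True assms(6) g inv'(2) tot_def by auto
  then show ?thesis
   using True 1 3 assms(4) by (auto simp: cell_of_def Let_def nat_add_distrib[symmetric] algebra_simps)
 next
  case False
  have "0 <= (if F <= z then La else Rb) + z - F"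
   using False assms(6) g inv'(2) tot_def by auto
  then show ?thesis
   using False 1 2 assms(4) by (auto simp: cell_of_def Let_def nat_add_distrib[symmetric] algebra_simps)
 qed
qed


abbreviation "cell \<equiv> cell_of La Rb F lR tot"
abbreviation "X \<equiv> cell i"
abbreviation "Y \<equiv> cell (- j)"

text \<open>Factors \<open>cell\<close> into the reduction \<open>nrm\<close> of an index to the
  window of one turn and the placement \<open>ph\<close> of that window, which is injective.\<close>

definition ph :: "int => int" where "ph z = (if F <= z then La else Rb) + z - F"
definition nrm :: "int => int" where "nrm z = (if z < F - lR then z + tot else z)"

lemma cell_ph: "cell z = nat (ph (nrm z))"
 by (simp add: cell_of_def ph_def nrm_def Let_def)

lemma ph_inj:
 assumes "F - lR <= z" "z < F + lL" "F - lR <= z'" "z' < F + lL" "nat (ph z) = nat (ph z')"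
 shows "z = z'"
 using assms inv' unfolding ph_def lL_def lR_def by (auto split: if_splits)

lemma nrm_range: "- b <= z ==> z < F + lL ==> F - lR <= nrm z & nrm z < F + lL"
 using F_le inv' tot_def unfolding nrm_def by auto

lemma X_run: "0 <= t ==> t < lam ==> cell (i + t) = X + nat t"
 by (rule cell_run[where l = lam]) (use lam lam_blk ij inv' in \<open>auto simp: lam_def intro: dvd_minus_mod\<close>)

lemma Y_run: "0 <= t ==> t < lam ==> cell (- j + t) = Y + nat t"
proof (rule cell_run[where l = lam])
 have "F - - j - lam = h - (i + lam - F)" using ij by simp
 then show "BS dvd F - - j - lam" using dvd_diff[OF h(1) lam(3)] by metis
qed (use lam bounds ij inv' in auto)

lemma nrm_low: "- j + t < lam - j ==> 0 <= t ==> nrm (- j + t) < lam - j \<or> nrm (- j + t) = tot - j + t"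
 by (auto simp: nrm_def)

text \<open>
  The exchange of \<open>lam\<close> cells completes the block split between low and high elements on either end
  of the low part: both parts are again cyclic valleys, on block-aligned regions.
\<close>

lemma split_layout:
 assumes lay: "layout H La Rb F lR tot c a b"
  and sw: "!!t. t < nat lam ==> H' (X + t) = H (Y + t) & H' (Y + t) = H (X + t)"
  and out: "!!x. x \<notin> {X..<X + nat lam} ==> x \<notin> {Y..<Y + nat lam} ==> H' x = H x"
 shows "layout H' La Rb F (Rb - Rv) h c i j"
  and "layout H' Lv Rv lam (Rv - Ra) (tot - h) (upper c i j) (a - i) (b - j)"
proof -
 have lay': "H (cell z) = Elem (c z)" if "- b <= z" "z < a" for z
  using lay that by (auto simp: layout_def)
 have swX: "H' (cell (i + t)) = H (cell (- j + t))" "H' (cell (- j + t)) = H (cell (i + t))"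
  if "0 <= t" "t < lam" for t
  using sw[of "nat t"] that X_run[of t] Y_run[of t] lam by auto
 \<comment> \<open>Cells are identified by their index in the window. The reduction
   \<open>nrm\<close> is applied to the lower run only, as the upper one lies in the window
   already.\<close>
 have unsw: "H' (nat (ph z)) = H (nat (ph z))"
  if z: "F - lR <= z" "z < F + lL" "\<not> (i <= z & z < i + lam)" "!!t. 0 <= t ==> t < lam ==> z ~= nrm (- j + t)" for z
 proof (rule out)
  show "nat (ph z) \<notin> {X..<X + nat lam}"
  proof
   assume "nat (ph z) \<in> {X..<X + nat lam}"
   note m = this
   define t where "t = int (nat (ph z)) - int X"
   have t: "nat (ph z) = X + nat t" "0 <= t" "t < lam" using m by (auto simp: t_def)
   have eq: "nat (ph z) = nat (ph (nrm (i + t)))" using X_run[OF t(2,3)] t(1) by (simp add: cell_ph)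
   have r: "nrm (i + t) = i + t" using lam_blk t by (auto simp: nrm_def)
   have "z = i + t"
    by (rule ph_inj) (use z eq r lam_blk t bounds in auto)
   then show False using z(3) t by auto
  qed
  show "nat (ph z) \<notin> {Y..<Y + nat lam}"
  proof
   assume "nat (ph z) \<in> {Y..<Y + nat lam}"
   note m = this
   define t where "t = int (nat (ph z)) - int Y"
   have t: "nat (ph z) = Y + nat t" "0 <= t" "t < lam" using m by (auto simp: t_def)
   have eq: "nat (ph z) = nat (ph (nrm (- j + t)))" using Y_run[OF t(2,3)] t(1) by (simp add: cell_ph)
   have "z = nrm (- j + t)"
    by (rule ph_inj[OF z(1,2) _ _ eq]) (use nrm_range[of "- j + t"] ij t bounds inv' in auto)
   then show False using z(4) t by blast
  qed
 qed
 have hb: "lam < h" "h < tot" using h lam inv' tot_def by auto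
 have lo: "Rb - Rv = F + j - lam" "Rv - Ra = lR - (F + j - lam)"
  by (auto simp: Rv_def lR_def)
 show "layout H' La Rb F (Rb - Rv) h c i j"
  unfolding layout_def
 proof (intro allI impI)
  fix z assume z: "- j <= z" "z < i"
  show "H' (cell_of La Rb F (Rb - Rv) h z) = Elem (c z)"
  proof (cases "z < lam - j")
   case False
   have n: "nrm z = z" using False bounds by (auto simp: nrm_def)
   have "cell_of La Rb F (Rb - Rv) h z = nat (ph z)"
    using False by (simp add: cell_of_def lo ph_def)
   moreover have "H' (nat (ph z)) = H (nat (ph z))"
   proof (rule unsw)
    fix t assume "0 <= t" "t < lam"
    then show "z ~= nrm (- j + t)" using nrm_low[of t] False z hb ij by auto
   qed (use z False bounds lam in auto)
   ultimately show ?thesis using lay'[of z] z ij n by (simp add: cell_ph)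
  next
   case True
   \<comment> \<open>These are the low elements that were moved. In the ring of \<open>h\<close>
     cells the index wraps to \<open>z + h\<close>, which is \<open>i + t\<close> because
     \<open>i + j = h\<close>, and this is the place that the exchange gave them.\<close>
   define t where "t = z + j"
   have t: "0 <= t" "t < lam" "z + h = i + t" "z = - j + t" using z True ij by (auto simp: t_def)
   have n: "nrm (i + t) = i + t" using lam_blk t by (auto simp: nrm_def)
   have "cell_of La Rb F (Rb - Rv) h z = nat (ph (i + t))"
    using True t(3) by (simp add: cell_of_def lo ph_def)
   also have "\<dots> = cell (i + t)" by (simp add: cell_ph n)
   finally show ?thesis using swX(1)[OF t(1,2)] lay'[of z] z ij t by simp
  qed
 qed
 have ph2: "(if lam <= z then Lv else Rv) + z - lam = (if lam <= z then ph (z + i) else ph (z - j))" for z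
  using bounds lam by (auto simp: ph_def Lv_def Rv_def)
 have lo2: "lam - (Rv - Ra) = F - lR + j" using lo by simp
 have cell2: "cell_of Lv Rv lam (Rv - Ra) (tot - h) z =
   (let z' = if z - j < F - lR then z + tot - h else z in nat (if lam <= z' then ph (z' + i) else ph (z' - j)))" for z
  unfolding cell_of_def lo2 ph2 Let_def by (simp add: algebra_simps)
 \<comment> \<open>In the old numbering a high index is \<open>z + i\<close> or
   \<open>z - j\<close>. Only the elements at \<open>i ..< i + lam\<close> have moved; they are the
   first \<open>lam\<close> of the new nonnegative indices and lie where the low part has left, just
   below the new start of \<open>L\<close> in the ring.\<close>
 show "layout H' Lv Rv lam (Rv - Ra) (tot - h) (upper c i j) (a - i) (b - j)"
  unfolding layout_def
 proof (intro allI impI)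
  fix z assume z: "- (b - j) <= z" "z < a - i"
  show "H' (cell_of Lv Rv lam (Rv - Ra) (tot - h) z) = Elem (upper c i j z)"
  proof (cases "0 <= z")
   case True
   show ?thesis
   proof (cases "lam <= z")
    case False
    then have n: "nrm (i + z) = i + z" using lam_blk True by (auto simp: nrm_def)
    have "lam <= z + tot - h" using True h tot_def lam by auto
    then have "cell_of Lv Rv lam (Rv - Ra) (tot - h) z = cell (- j + z)"
     unfolding cell2 cell_ph using False ij by (auto simp: nrm_def Let_def algebra_simps)
    then show ?thesis using swX(2)[of z] True False lay'[of "i + z"] z ij inv'
     by (simp add: upper_def add.commute)
   next
    case l: True
    have n: "nrm (z + i) = z + i" using bounds l inv'(5) lR_def inv'(14) unfolding nrm_def
     by (smt (verit) inv'(4,5) lR_def)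
    have nl: "\<not> z - j < F - lR" using bounds l by auto
    have "H' (nat (ph (z + i))) = H (nat (ph (z + i)))"
    proof (rule unsw)
     show "F - lR <= z + i" "z + i < F + lL" using nl z inv' ij by auto
     fix t assume "0 <= t" "t < lam"
     then show "z + i ~= nrm (- j + t)" using nrm_low[of t] l z hb ij tot_def by auto
    qed (use l in auto)
    then show ?thesis
     unfolding cell2 using nl l lay'[of "z + i"] z ij(2,4) inv'(11) True
     by (simp add: upper_def Let_def cell_ph n)
   qed
  next
   case False
   have r: "- b <= z - j" "z - j < a" using z False ij inv' by auto
   note l = lay'[OF r]
   show ?thesis
   proof (cases "z - j < F - lR")
    case nl: False
    then have n: "nrm (z - j) = z - j" by (simp add: nrm_def)
    have "H' (nat (ph (z - j))) = H (nat (ph (z - j)))"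
    proof (rule unsw)
     show "F - lR <= z - j" "z - j < F + lL" using nl r inv' by auto
     fix t assume t: "0 <= t" "t < lam"
     then show "z - j ~= nrm (- j + t)" using False hb by (auto simp: nrm_def)
    qed (use False ij in auto)
    then show ?thesis
     unfolding cell2 using nl False lam l by (simp add: upper_def Let_def cell_ph n)
   next
    case w: True
    define z' where "z' = z + tot - h"
    have z'0: "0 <= z'" using z ij tot_def by (auto simp: z'_def)
    have n: "nrm (z - j) = z' + i" using w ij by (simp add: nrm_def z'_def)
    show ?thesis
    proof (cases "lam <= z'")
     case True
     have "H' (nat (ph (z' + i))) = H (nat (ph (z' + i)))"
     proof (rule unsw)
      show "F - lR <= z' + i" "z' + i < F + lL" using nrm_range[OF r(1)] r inv' n by auto
      fix t assume t: "0 <= t" "t < lam"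
      then show "z' + i ~= nrm (- j + t)" using False hb ij True by (auto simp: nrm_def z'_def)
     qed (use True in auto)
     then show ?thesis
      unfolding cell2 using w True False l by (simp add: upper_def Let_def cell_ph n z'_def)
    next
     case c: False
     have nl: "\<not> z' - j < F - lR"
     proof -
      have "F - lR + tot <= F + lL" "F - lR <= lam - j" using inv' bounds by auto
      have "F - lR <= z - j + (tot - h)"
       using nrm_range[OF r(1)] r inv' n z'_def F_le h tot_def z ij
       by (smt (verit))
      then show ?thesis by (simp add: z'_def)
     qed
     have n2: "nrm (z' - j) = z' - j" using nl by (simp add: nrm_def)
     have "H' (cell (- j + z')) = H (cell (i + z'))"
      using swX(2)[of z'] z'0 c by auto
     moreover have "nrm (i + z') = z' + i" using lam_blk c z'0 by (auto simp: nrm_def)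
     ultimately show ?thesis
      unfolding cell2 using w c False l n
      by (simp add: upper_def Let_def cell_ph n n2 z'_def[symmetric])
    qed
   qed
  qed
 qed
qed

text \<open>The starts of the runs are \<open>h\<close> apart in one direction of the ring and
  \<open>tot - h\<close> in the other; both distances are at least \<open>BS\<close>, which exceeds
  \<open>lam\<close>.\<close>

lemma split_disjoint: "0 < lam ==> {X..<X + nat lam} \<inter> {Y..<Y + nat lam} = {}"
proof (rule ccontr)
 assume l: "0 < lam" and "{X..<X + nat lam} \<inter> {Y..<Y + nat lam} ~= {}"
 then obtain x where "x \<in> {X..<X + nat lam}" "x \<in> {Y..<Y + nat lam}" by blast
 define t where "t = int x - int X"
 define t' where "t' = int x - int Y"
 have t: "x = X + nat t" "0 <= t" "t < lam" "x = Y + nat t'" "0 <= t'" "t' < lam"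
  using \<open>x \<in> {X..<X + nat lam}\<close> \<open>x \<in> {Y..<Y + nat lam}\<close> by (auto simp: t_def t'_def)
 have "nat (ph (nrm (i + t))) = nat (ph (nrm (- j + t')))"
  using X_run[OF t(2,3)] Y_run[OF t(5,6)] t(1,4) by (simp add: cell_ph)
 moreover have n: "nrm (i + t) = i + t" using lam_blk t by (auto simp: nrm_def)
 ultimately have "i + t = nrm (- j + t')"
  using nrm_range[of "- j + t'"] ij t bounds inv' lam_blk by (intro ph_inj) auto
 moreover have "i + h < i + tot" "lam < h" using h lam inv' tot_def by auto
 ultimately show False
  using nrm_low[of t'] t ij bounds h tot_def inv' lam by (auto simp: nrm_def split: if_splits)
qed

end


lemma valley_low: "valley c a b ==> i <= a ==> j <= b ==> valley c i j"
 unfolding valley_def by auto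

lemma valley_high: "valley c a b ==> 0 <= i ==> 0 <= j ==> valley (upper c i j) (a - i) (b - j)"
 unfolding valley_def upper_def by auto

lemma image_mset_shift:
 "image_mset (%z. c (z + k)) (mset_set {l..<u}) = image_mset c (mset_set {l + k..<u + (k :: int)})"
proof -
 have "mset_set {l + k..<u + k} = image_mset (%z. z + k) (mset_set {l..<u})"
  by (subst image_mset_mset_set) (auto simp: inj_on_def)
 then show ?thesis by (simp add: multiset.map_comp comp_def)
qed

lemma mset_set_ivl_split: "l <= m ==> m <= u ==> mset_set {l..<u} = mset_set {l..<m} + mset_set {m..<u :: int}"
 by (subst mset_set_Union[symmetric]) (auto simp: ivl_disj_un)

lemma vmset_split:
 assumes "0 <= i" "i <= a" "0 <= j" "j <= b"
 shows "vmset c a b = vmset c i j + vmset (upper c i j) (a - i) (b - j)"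
proof -
 have 1: "image_mset (upper c i j) (mset_set {- (b - j)..<0}) = image_mset c (mset_set {- b..<- j})"
 proof -
  have "image_mset (upper c i j) (mset_set {- (b - j)..<0}) = image_mset (%z. c (z + - j)) (mset_set {- (b - j)..<0})"
   by (rule image_mset_cong) (auto simp: upper_def)
  then show ?thesis unfolding image_mset_shift by (simp add: algebra_simps)
 qed
 have 2: "image_mset (upper c i j) (mset_set {0..<a - i}) = image_mset c (mset_set {i..<a})"
 proof -
  have "image_mset (upper c i j) (mset_set {0..<a - i}) = image_mset (%z. c (z + i)) (mset_set {0..<a - i})"
   by (rule image_mset_cong) (auto simp: upper_def)
  then show ?thesis unfolding image_mset_shift by (simp add: algebra_simps)
 qed
 have "vmset (upper c i j) (a - i) (b - j) = image_mset c (mset_set {- b..<- j}) + image_mset c (mset_set {i..<a})"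
  unfolding vmset_def using assms
  by (subst mset_set_ivl_split[of _ 0]) (auto simp: 1[simplified] 2)
 moreover have "vmset c a b = image_mset c (mset_set {- b..<- j}) + (vmset c i j + image_mset c (mset_set {i..<a}))"
  unfolding vmset_def using assms
  by (subst mset_set_ivl_split[of "- b" "- j" a], auto) (subst mset_set_ivl_split[of "- j" i a], auto)
 ultimately show ?thesis by simp
qed

text \<open>On one side the claim is monotonicity. Across the sides it is enough to compare the
  greatest low element of either side with the least high element of the other.\<close>

lemma vmset_split_le:
 assumes v: "valley c a b" and ij: "0 <= i" "i <= a" "0 <= j" "j <= b"
  and c1: "0 < i ==> j < b ==> c (i - 1) <= c (- j - 1)" and c2: "0 < j ==> i < a ==> c (- j) <= c i"
  and x: "x \<in># vmset c i j" and y: "y \<in># vmset (upper c i j) (a - i) (b - j)"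
 shows "x <= y"
proof -
 obtain z where z: "- j <= z" "z < i" "x = c z" using x by (auto simp: vmset_def)
 obtain u where u: "- (b - j) <= u" "u < a - i" "y = upper c i j u" using y by (auto simp: vmset_def)
 have up: "c z <= c z'" if "0 <= z" "z <= z'" "z' < a" for z z' using v that by (auto simp: valley_def)
 have dn: "c z' <= c z" if "- b <= z" "z <= z'" "z' < 0" for z z' using v that by (auto simp: valley_def)
 show ?thesis
 proof (cases "0 <= z")
  case zp: True
  show ?thesis
  proof (cases "0 <= u")
   case True
   then show ?thesis using zp z u ij up[of z "u + i"] by (auto simp: upper_def)
  next
   case False
   have "c z <= c (i - 1)" "c (- j - 1) <= c (u - j)" using zp z u ij False by (auto intro: up dn)
   then show ?thesis using c1 z u zp False ij by (auto simp: upper_def)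
  qed
 next
  case zn: False
  have 1: "c z <= c (- j)" using zn z ij by (auto intro: dn)
  show ?thesis
  proof (cases "0 <= u")
   case True
   have "c i <= c (u + i)" using u ij True by (auto intro: up)
   then show ?thesis using 1 c2 z u zn True ij by (auto simp: upper_def)
  next
   case False
   then show ?thesis using zn z u ij dn[of "u - j" z] by (auto simp: upper_def)
  qed
 qed
qed

text \<open>A single block cannot be divided between \<open>L\<close> and \<open>R\<close>, so the
  recursion ends with one contiguous block that holds a rotation of its valley.\<close>

lemma single_block:
 assumes "ninv BS La Lb Ra Rb F a b" "a + b = BS" "0 <= x" "x < BS"
 shows "cell_of La Rb F (Rb - Ra) BS (- b + x) = nat ((if La < Lb then La else Ra) + (a - F + x) mod BS)"
  and "La < Lb ==> Lb = La + BS & Ra = Rb" and "\<not> La < Lb ==> Lb = La & Rb = Ra + BS"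
proof -
 note i = assms(1)[unfolded ninv_def]
 have L: "Lb = La + BS & Ra = Rb" if "La < Lb"
  using i that assms(2) zdvd_imp_le[of BS "Lb - La"] by linarith
 have R: "Lb = La & Rb = Ra + BS" if "\<not> La < Lb"
  using i that assms(2) by linarith
 show "La < Lb ==> Lb = La + BS & Ra = Rb" "\<not> La < Lb ==> Lb = La & Rb = Ra + BS"
  using L R by auto
 have m: "(a - F + x) mod BS = y" if "0 <= y" "y < BS" "- b + x - F = y + k * BS" for y k
 proof -
  have "a - F + x = y + (k + 1) * BS" using that(3) assms(2) by (simp add: algebra_simps)
  then show ?thesis using that by simp
 qed
 show "cell_of La Rb F (Rb - Ra) BS (- b + x) = nat ((if La < Lb then La else Ra) + (a - F + x) mod BS)"
 proof (cases "La < Lb")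
  case True
  note l = L[OF True]
  show ?thesis
  proof (cases "- b + x < F")
   case t: True
   then have "(a - F + x) mod BS = - b + x + BS - F"
    using i l assms by (intro m[where k = "-1"]) auto
   then show ?thesis using True t l i assms by (auto simp: cell_of_def)
  next
   case f: False
   then have "(a - F + x) mod BS = - b + x - F"
    using i l assms by (intro m[where k = 0]) auto
   then show ?thesis using True f l i assms by (auto simp: cell_of_def)
  qed
 next
  case False
  note r = R[OF False]
  show ?thesis
  proof (cases "- b + x < F - BS")
   case t: True
   then have "(a - F + x) mod BS = - b + x + BS - F + BS"
    using i r assms by (intro m[where k = "-2"]) auto
   then show ?thesis using False t r i assms by (auto simp: cell_of_def)
  next
   case f: False
   then have "(a - F + x) mod BS = - b + x - F + BS"
    using i r assms by (intro m[where k = "-1"]) auto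
   then show ?thesis using False f r i assms by (auto simp: cell_of_def)
  qed
 qed
qed

section \<open>Parallel swaps, sorting a small block, and the search for a cut\<close>

definition swap_body :: com where "swap_body = Swap (V 5 [+] V 3) (V 6 [+] V 3)"
definition mirror_body :: com where "mirror_body = Swap (V 5 [+] V 3) (V 6 [-] (V 3 [+] C 1))"

text \<open>The greatest element of a valley is at one of its two ends. Taking the greater end
  repeatedly fills the buffer in descending order, so that popping yields the ascending
  order.\<close>

definition bufsort :: com where
 "bufsort = 22 ::= C 0 ;; 23 ::= V 38 ;;
  While (V 22) (V 23)
   (27 ::= V 37 [+] (V 39 [+] V 22) [mod] V 38 ;;
   31 ::= V 37 [+] (V 39 [+] V 23 [-] C 1) [mod] V 38 ;;
   IfC (V 27) (V 31) (Push (V 31) ;; 23 ::= V 23 [-] C 1) (Push (V 27) ;; 22 ::= V 22 [+] C 1)) ;;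
  22 ::= C 0 ;; While (V 22) (V 38) (Pop (V 37 [+] V 22) ;; 22 ::= V 22 [+] C 1)"

text \<open>The address of the cell with ring index \<open>V 26\<close>; the ring is \<open>R @ L\<close>.\<close>

definition adr :: "nat => com" where
 "adr t = 32 ::= V 26 [mod] V 25 ;;
  If (V 32) (V 28) (t ::= V 16 [+] V 32) (t ::= V 14 [+] V 32 [-] V 28)"

text \<open>Registers 22 and 23 enclose the number of low elements taken from \<open>A\<close>. The
  element \<open>mid\<close> of \<open>A\<close> competes with the element
  \<open>h - 1 - mid\<close> of \<open>B\<close>, whose index is \<open>mid - h\<close>. Register 29
  is the position of index 0 in the ring, increased by \<open>tot\<close> so that it is not
  negative; the second address adds \<open>tot\<close> once more before \<open>h\<close> is
  subtracted.\<close>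

definition cut :: com where
 "cut = 28 ::= V 17 [-] V 16 ;; 29 ::= V 28 [+] V 25 [-] V 18 ;; 30 ::= V 25 [-] V 13 ;;
  If (V 30) (V 21) (22 ::= V 21 [-] V 30) (22 ::= C 0) ;;
  If (V 13) (V 21) (23 ::= V 13) (23 ::= V 21) ;;
  While (V 22) (V 23)
   (24 ::= (V 22 [+] V 23) [div] C 2 ;;
    26 ::= V 29 [+] V 24 ;; adr 27 ;;
    26 ::= V 29 [+] V 25 [+] V 24 [-] V 21 ;; adr 31 ;;
    IfC (V 27) (V 31) (22 ::= V 24 [+] C 1) (23 ::= V 24))"

text \<open>The address that \<open>adr\<close> computes, for a position \<open>r\<close> counted
  from the start of \<open>R\<close>.\<close>

definition adrv :: "nat => nat => nat => nat => nat" where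
 "adrv lR Ra La r = (if r < lR then Ra + r else La + r - lR)"

locale alg2 = alg +
 assumes P1: "Pr 1 = pfor 1 swap_body" and P2: "Pr 2 = pfor 2 mirror_body"
begin

lemma small: "k < 16 * (N + 300) ==> k < 2 ^ w"
proof -
 define x where "x = (2 * W + 3) * (2 * W + 3)"
 have "16 * (N + x + 300) <= 2 ^ w" using big by (simp only: x_def)
 then show "k < 16 * (N + 300) ==> k < 2 ^ w"
  by (intro less_le_trans[of k "16 * (N + x + 300)" "2 ^ w"]) simp_all
qed

lemma swap_tri:
 assumes e: "e 3 = 0" "e 4 = l" "e 5 = x" "e 6 = y" and b: "x + l <= N" "y + l <= N" and t: "l <= 2 ^ t"
  and dj: "{x..<x + l} \<inter> {y..<y + l} = {}"
 shows "tri ({x..<x + l} \<union> {y..<y + l}) ({x..<x + l} \<union> {y..<y + l}) (224 * t) (Pr 1) e H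
  (%H'. \<forall>i<l. H' (x + i) = H (y + i) & H' (y + i) = H (x + i)) (21 * l + 2) (10 * t + 11)"
proof -
 let ?U = "%i. {x + i, y + i}"
 have ne: "x + i ~= y + j" if "i < l" "j < l" for i j
  using dj that by (metis IntI atLeastLessThan_iff empty_iff le_add1 nat_add_left_cancel_less)
 have "tri (\<Union>i\<in>{0..<0+l}. ?U i) (\<Union>i\<in>{0..<0+l}. ?U i) (0 + 224 * t) (Pr 1) e H
   (%H'. \<forall>i\<in>{0..<0+l}. H' (x + i) = H (y + i) & H' (y + i) = H (x + i))
   (sum (%_. 1) {0..<0+l} + (20 * l - 12) + 2) (1 + 10 * t + 10)"
 proof (rule pfor_tri[OF P1 e(1,2)])
  show "0 + l < 2 ^ w" using b by (intro small) simp
  show "?U i \<inter> ?U j = {}" if "i ~= j" "i \<in> {0..<0+l}" "j \<in> {0..<0+l}" for i j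
   using that ne[of i j] ne[of j i] by auto
 next
  fix i e' assume i: "i \<in> {0..<0 + l}" and e': "e' 3 = i" "!!r. r ~= 3 ==> r ~= 4 ==> e' r = e r"
  have "x + i < 2 ^ w" "y + i < 2 ^ w" using b i by (auto intro!: small)
  then show "tri (?U i) (?U i) 0 swap_body e' H (%H'. H' (x + i) = H (y + i) & H' (y + i) = H (x + i)) 1 1"
   unfolding swap_body_def
   by (intro tri_wpI) (use ne[of i i] i e'(1) e'(2)[of 5] e'(2)[of 6] in \<open>simp add: wps e\<close>)
 qed (use t in auto)
 then show ?thesis
  by (rule tri_mono) auto
qed

lemma mirror_tri:
 assumes e: "e 3 = 0" "e 4 = l" "e 5 = x" "e 6 = y" and b: "x + l + l <= y" "y <= N" and t: "l <= 2 ^ t"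
 shows "tri {x..<y} {x..<y} (224 * t) (Pr 2) e H
  (%H'. (\<forall>i<l. H' (x + i) = H (y - (i + 1)) & H' (y - (i + 1)) = H (x + i)) &
   (\<forall>a. x + l <= a --> a + l < y --> H' a = H a)) (21 * l + 2) (10 * t + 11)"
proof -
 let ?U = "%i. {x + i, y - (i + 1)}"
 have "tri (\<Union>i\<in>{0..<0+l}. ?U i) (\<Union>i\<in>{0..<0+l}. ?U i) (0 + 224 * t) (Pr 2) e H
   (%H'. \<forall>i\<in>{0..<0+l}. H' (x + i) = H (y - (i + 1)) & H' (y - (i + 1)) = H (x + i))
   (sum (%_. 1) {0..<0+l} + (20 * l - 12) + 2) (1 + 10 * t + 10)"
 proof (rule pfor_tri[OF P2 e(1,2)])
  show "0 + l < 2 ^ w" using b by (intro small) simp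
  show "?U i \<inter> ?U j = {}" if "i ~= j" "i \<in> {0..<0+l}" "j \<in> {0..<0+l}" for i j
   using that b by auto
 next
  fix i e' assume i: "i \<in> {0..<0 + l}" and e': "e' 3 = i" "!!r. r ~= 3 ==> r ~= 4 ==> e' r = e r"
  have "x + i < 2 ^ w" "y < 2 ^ w" "i + 1 < 2 ^ w" "1 < (2::nat) ^ w" "i + 1 <= y" "x + i ~= y - (i + 1)"
   using b i by (auto intro!: small)
  then show "tri (?U i) (?U i) 0 mirror_body e' H (%H'. H' (x + i) = H (y - (i + 1)) & H' (y - (i + 1)) = H (x + i)) 1 1"
   unfolding mirror_body_def
   by (intro tri_wpI) (use e'(1) e'(2)[of 5] e'(2)[of 6] in \<open>simp add: wps e\<close>)
 qed (use t in auto)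
 then show ?thesis
 proof (rule tri_mono, goal_cases)
  case (6 H')
  have "H' a = H a" if "x + l <= a" "a + l < y" for a
  proof (rule 6(2))
   show "a \<notin> (\<Union>i\<in>{0..<0 + l}. {x + i, y - (i + 1)})" using that b by auto
  qed
  with 6(1) show ?case by simp
 qed (use b in auto)
qed

lemma reverse_tri:
 assumes e: "e 3 = 0" "e 4 = l div 2" "e 5 = x" "e 6 = x + l" and b: "x + l <= N" and t: "l <= 2 ^ t"
 shows "tri {x..<x + l} {x..<x + l} (224 * t) (Pr 2) e H
  (%H'. \<forall>i<l. H' (x + i) = H (x + (l - Suc i))) (11 * l + 2) (10 * t + 11)"
proof -
 have "tri {x..<x + l} {x..<x + l} (224 * t) (Pr 2) e H
  (%H'. (\<forall>i<l div 2. H' (x + i) = H (x + l - (i + 1)) & H' (x + l - (i + 1)) = H (x + i)) &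
   (\<forall>a. x + l div 2 <= a --> a + l div 2 < x + l --> H' a = H a)) (21 * (l div 2) + 2) (10 * t + 11)"
  by (rule mirror_tri[OF e]) (use b t in auto)
 then show ?thesis
 proof (rule tri_mono)
  fix H' assume H': "(\<forall>i<l div 2. H' (x + i) = H (x + l - (i + 1)) & H' (x + l - (i + 1)) = H (x + i)) &
   (\<forall>a. x + l div 2 <= a --> a + l div 2 < x + l --> H' a = H a)"
  show "\<forall>i<l. H' (x + i) = H (x + (l - Suc i))"
  proof (intro allI impI)
   fix i assume i: "i < l"
   consider "i < l div 2" | "l - Suc i < l div 2" | "l div 2 <= i" "l div 2 <= l - Suc i" by linarith
   then show "H' (x + i) = H (x + (l - Suc i))"
   proof cases
    case 1
    then show ?thesis using H' i by auto
   next
    case 2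
    have "x + l - (l - Suc i + 1) = x + i" using i by simp
    then show ?thesis using H' 2 by metis
   next
    case 3
    \<comment> \<open>The middle cell of an odd length is its own mirror image and is not
      touched.\<close>
    then have "i = l - Suc i" using i by linarith
    moreover have "x + i + l div 2 < x + l" using 3 i by linarith
    ultimately show ?thesis using H' 3 by (metis add_le_cancel_left)
   qed
  qed
 qed auto
qed

text \<open>The valley enters through the condition that no element exceeds both ends of a range
  around it, a property inherited by every remaining range.\<close>

lemma bufsort_tri:
 fixes u :: "nat => 'a :: linorder"
 assumes e: "e 37 = p" "e 38 = l" "e 39 = o'" and b: "p + l <= N" "o' <= N" and M: "l <= M"
  and u: "!!x. x < l ==> H (p + (o' + x) mod l) = Elem (u x)"
  and val: "!!x y z. x <= y ==> y <= z ==> z < l ==> u y <= max (u x) (u z)"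
 shows "tri {p..<p + l} {p..<p + l} M bufsort e H
  (%H'. \<exists>xs. sorted xs & length xs = l & mset xs = image_mset u (mset_set {0..<l}) &
   (\<forall>i<l. H' (p + i) = Elem (xs ! i))) (9 * l + 8) (9 * l + 8)"
proof -
 let ?R = "{p..<p + l}"
 define J where "J = (%(e' :: nat => nat) (b' :: 'a cell list) H' n' d'. n' <= 9 * l + 8 & d' <= 9 * l + 8 &
  (\<exists>xs. sorted xs & length xs = l & mset xs = image_mset u (mset_set {0..<l}) &
   (\<forall>i<l. H' (p + i) = Elem (xs ! i))))"
 have lw: "p + l < 2 ^ w" "o' + l < 2 ^ w" "FS + Suc l < 2 ^ w" "o' + l < 2 ^ w" "1 < (2::nat) ^ w"
  using b by (auto intro!: small)
 let ?L2 = "While (V 22) (V 38) (Pop (V 37 [+] V 22) ;; 22 ::= V 22 [+] C 1)"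
 have loop2: "wp ?R ?R M ?L2 J e' (map Elem ys) H n' d'"
  if e': "e' 22 = 0" "e' 38 = l" "e' 37 = p" and n': "n' <= 6 * l + 5" "d' <= 6 * l + 5"
   and ys: "sorted (rev ys)" "length ys = l" "mset ys = image_mset u (mset_set {0..<l})" for e' ys n' d'
 proof (rule wp_While[where I = "%e'' b'' H'' n'' d''. \<exists>k\<le>l. e'' 22 = k & e'' 38 = l & e'' 37 = p &
    b'' = map Elem (take (l - k) ys) & (\<forall>i<k. H'' (p + i) = Elem (rev ys ! i)) &
    n'' <= 6 * l + 5 + 3 * k & d'' <= 6 * l + 5 + 3 * k" and f = "%e b H. l - e 22"], goal_cases)
  case 1
  then show ?case using e' n' ys(2) by (intro exI[of _ 0]) auto
 next
  case (2 e'' b'' H'' n'' d'')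
  then obtain k where k: "k <= l" "e'' 22 = k" "e'' 38 = l" "e'' 37 = p" "b'' = map Elem (take (l - k) ys)"
   "\<forall>i<k. H'' (p + i) = Elem (rev ys ! i)" "n'' <= 6 * l + 5 + 3 * k" "d'' <= 6 * l + 5 + 3 * k"
   by blast
  show ?case
  proof (cases "k < l")
   case False
   then have "J e'' b'' H'' (Suc n'') (Suc d'')"
    using k ys unfolding J_def by (intro conjI exI[of _ "rev ys"]) auto
   then show ?thesis using False k M ys(2) by simp
  next
   case True
   have ne: "take (l - k) ys ~= []" using True ys(2) by auto
   have bl: "butlast (take (l - k) ys) = take (l - Suc k) ys"
    using True ys(2) by (simp add: butlast_take)
   have la: "last (take (l - k) ys) = rev ys ! k"
    using True ys(2) ne by (cases k) (auto simp: last_conv_nth rev_nth min_def)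
   have "length (take (l - k) ys) <= M" "FS + Suc (length (take (l - k) ys)) < 2 ^ w" "p + k < 2 ^ w" "k + 1 < 2 ^ w"
    using M lw True by auto
   then show ?thesis
    using True k ne lw(5) ys(2)
    by (auto simp: wps last_map map_butlast[symmetric] bl la less_Suc_eq nth_append)
  qed
 qed
 let ?L1 = "While (V 22) (V 23)
   (27 ::= V 37 [+] (V 39 [+] V 22) [mod] V 38 ;;
   31 ::= V 37 [+] (V 39 [+] V 23 [-] C 1) [mod] V 38 ;;
   IfC (V 27) (V 31) (Push (V 31) ;; 23 ::= V 23 [-] C 1) (Push (V 27) ;; 22 ::= V 22 [+] C 1))"
 \<comment> \<open>The range \<open>{x..<y}\<close> is still to be processed; the buffer
   \<open>ys\<close> is descending and all of it lies above that range.\<close>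
 let ?I = "%e'' b'' H'' n'' d''. \<exists>x y ys. x <= y & y <= l & e'' 22 = x & e'' 23 = y & e'' 38 = l & e'' 37 = p & e'' 39 = o' &
    H'' = H & b'' = map Elem ys & sorted (rev ys) & length ys + (y - x) = l &
    mset ys + image_mset u (mset_set {x..<y}) = image_mset u (mset_set {0..<l}) &
    (\<forall>v\<in>set ys. \<forall>z. x <= z --> z < y --> u z <= v) &
    n'' + 6 * (y - x) <= 6 * l + 3 & d'' + 6 * (y - x) <= 6 * l + 3"
 have loop1: "wp ?R ?R M ?L1 (wp ?R ?R M (22 ::= C 0 ;; ?L2) J) (e(22 := 0, 23 := l)) [] H (Suc (Suc 0)) (Suc (Suc 0))"
 proof (rule wp_While[where I = ?I and f = "%e b H. e 23 - e 22"], goal_cases)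
  case 1
  then show ?case using e by (intro exI[of _ 0] exI[of _ l] exI[of _ "[]"]) auto
 next
  case (2 e'' b'' H'' n'' d'')
  then obtain x y ys where I: "x <= y" "y <= l" "e'' 22 = x" "e'' 23 = y" "e'' 38 = l" "e'' 37 = p" "e'' 39 = o'"
    "H'' = H" "b'' = map Elem ys" "sorted (rev ys)" "length ys + (y - x) = l"
    "mset ys + image_mset u (mset_set {x..<y}) = image_mset u (mset_set {0..<l})"
    "\<forall>v\<in>set ys. \<forall>z. x <= z --> z < y --> u z <= v"
    "n'' + 6 * (y - x) <= 6 * l + 3" "d'' + 6 * (y - x) <= 6 * l + 3" by blast
  have lys: "length ys <= l" using I(11) by simp
  show ?case
  proof (cases "x < y")
   case False
   have "wp ?R ?R M ?L2 J (e''(22 := 0)) (map Elem ys) H (Suc (Suc n'')) (Suc (Suc d''))"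
    by (rule loop2) (use I False in auto)
   then show ?thesis using False I M lw lys by (simp add: wps)
  next
   case True
   have l0: "0 < l" using True I by simp
   have mods: "p + (o' + x) mod l < p + l" "p + (o' + (y - 1)) mod l < p + l" using l0 by auto
   have oks: "o' + x < 2 ^ w" "o' + y < 2 ^ w" "p + (o' + x) mod l < 2 ^ w" "p + (o' + (y - 1)) mod l < 2 ^ w"
    "FS + Suc (length ys) < 2 ^ w" "y < 2 ^ w" "x + 1 < 2 ^ w" "length ys <= M" "o' + y - 1 = o' + (y - 1)"
    using lw I(2) True less_trans[OF mods(1) lw(1)] less_trans[OF mods(2) lw(1)] lys M by auto
   have ux: "H (p + (o' + x) mod l) = Elem (u x)" and uy: "H (p + (o' + (y - 1)) mod l) = Elem (u (y - 1))"
    using u[of x] u[of "y - 1"] True I(2) by auto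
   define J2 where "J2 = (%(e' :: nat => nat) b' H' n' d'. ?I e' b' H' n' d' & e' 23 - e' 22 < e'' 23 - e'' 22)"
   have c1: "J2 (e''(27 := q1, 31 := q2, 23 := y - 1)) (map Elem ys @ [Elem (u (y - 1))]) H (n'' + 6) (d'' + 6)"
    if "u x < u (y - 1)" for q1 q2
   proof -
    have all: "u z <= u (y - 1)" if "x <= z" "z < y" for z
    proof -
     have "u z <= max (u x) (u (y - 1))" by (rule val) (use that True I(2) in auto)
     then show ?thesis using \<open>u x < u (y - 1)\<close> by (simp add: max_def split: if_splits)
    qed
    have s: "{x..<y} = insert (y - 1) {x..<y - 1}" using True by auto
    show ?thesis unfolding J2_def
     using I True all
     by (intro conjI exI[of _ x] exI[of _ "y - 1"] exI[of _ "ys @ [u (y - 1)]"])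
      (auto simp: s)
   qed
   have c2: "J2 (e''(27 := q1, 31 := q2, 22 := Suc x)) (map Elem ys @ [Elem (u x)]) H (n'' + 6) (d'' + 6)"
    if "\<not> u x < u (y - 1)" for q1 q2
   proof -
    have all: "u z <= u x" if "x <= z" "z < y" for z
    proof -
     have "u z <= max (u x) (u (y - 1))" by (rule val) (use that True I(2) in auto)
     then show ?thesis using \<open>\<not> u x < u (y - 1)\<close> by (simp add: max_def split: if_splits)
    qed
    have s: "{x..<y} = insert x {Suc x..<y}" using True by auto
    show ?thesis unfolding J2_def
     using I True all
     by (intro conjI exI[of _ "Suc x"] exI[of _ y] exI[of _ "ys @ [u x]"])
      (auto simp: s)
   qed
   have six: "n'' + 6 = Suc (Suc (Suc (Suc (Suc (Suc n'')))))" "d'' + 6 = Suc (Suc (Suc (Suc (Suc (Suc d'')))))"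
    by simp_all
   have Sl: "Suc (length ys) <= M" using I(11) True M by simp
   have "wp ?R ?R M (27 ::= V 37 [+] (V 39 [+] V 22) [mod] V 38 ;;
    31 ::= V 37 [+] (V 39 [+] V 23 [-] C 1) [mod] V 38 ;;
    IfC (V 27) (V 31) (Push (V 31) ;; 23 ::= V 23 [-] C 1) (Push (V 27) ;; 22 ::= V 22 [+] C 1))
    J2 e'' b'' H'' (Suc n'') (Suc d'')"
    using c1[unfolded six] c2[unfolded six] I(3-9) oks(3) oks ux uy lw True Sl l0
    by (simp add: wps)
   then show ?thesis using True I(3,4,9) oks(8) by (simp add: J2_def)
  qed
 qed
 have "wp ?R ?R M bufsort J e [] H 0 0"
  unfolding bufsort_def using loop1 lw by (simp add: wp_Seq wp_Assign e)
 then show ?thesis unfolding J_def by (rule tri_wpI)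
qed

lemma wp_adr:
 assumes "e 25 = tot" "0 < tot" "e 28 = lR" "e 14 = La" "e 16 = Ra" "La + tot < 2 ^ w" "Ra + tot < 2 ^ w" "length b <= M"
  and "Q (e(32 := e 26 mod tot, t := adrv lR Ra La (e 26 mod tot)))
   b H (Suc (Suc (Suc n))) (Suc (Suc (Suc d)))"
 shows "wp R U M (adr t) Q e b H n d"
proof -
 have "e 26 mod tot < tot" using assms(2) by simp
 then have "La + e 26 mod tot < 2 ^ w" "Ra + e 26 mod tot < 2 ^ w" using assms(6,7) by linarith+
 then show ?thesis
  using assms unfolding adr_def adrv_def by (auto simp: wps)
qed

text \<open>Connects the natural arithmetic of the program with \<open>cell_of\<close>: the ring
  starts with index \<open>F - lR\<close>, so positions and indices differ by this amount modulo
  \<open>tot\<close>.\<close>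

lemma cell_adr:
 assumes "0 < tot" "F - lR - tot <= z" "z < F - lR + tot" "Ra = Rb - lR" "lR <= Rb"
  and "int r = (z - (F - lR)) mod tot" "0 <= La" "0 <= lR" "lR = int lR'" "La = int La'" "Ra = int Ra'"
 shows "adrv lR' Ra' La' r = cell_of La Rb F lR tot z"
proof -
 define z' where "z' = (if z < F - lR then z + tot else z)"
 have "(z - (F - lR)) mod tot = z' - (F - lR)"
 proof (cases "z < F - lR")
  case True
  have "(z - (F - lR)) mod tot = (z - (F - lR) + tot) mod tot" by simp
  also have "\<dots> = z - (F - lR) + tot" using True assms by (intro mod_pos_pos_trivial) auto
  finally show ?thesis using True by (simp add: z'_def)
 next
  case False
  then show ?thesis using assms by (simp add: z'_def)
 qed
 then have r: "int r = z' - F + lR" using assms(6) by simp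
 show ?thesis
  unfolding adrv_def cell_of_def Let_def z'_def[symmetric] using r assms by (auto simp: nat_eq_iff)
qed

lemma wp_cut:
 fixes c :: "int => 'a :: linorder"
 assumes e: "e 13 = a" "e 14 = La" "e 16 = Ra" "e 17 = Rb" "e 18 = F" "e 21 = h" "e 25 = a + bb"
  and lay: "layout H (int La) (int Rb) (int F) (int Rb - int Ra) (int a + int bb) c (int a) (int bb)"
  and rng: "!!z. - int bb <= z ==> z < int a ==> cell_of (int La) (int Rb) (int F) (int Rb - int Ra) (int a + int bb) z \<in> R"
  and b: "h <= a + bb" "Ra <= Rb" "Rb <= N" "La <= N" "a + bb <= N" "F <= a + (Rb - Ra)" "Rb - Ra <= F + bb"
  and M: "length b <= M"
  and Q: "!!e' n' d' i. i <= a ==> i <= h ==> h - i <= bb ==>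
   (0 < i ==> h - i < bb ==> c (int i - 1) <= c (- int (h - i) - 1)) ==>
   (0 < h - i ==> i < a ==> c (- int (h - i)) <= c (int i)) ==>
   e' 22 = i ==> e' 28 = Rb - Ra ==> e' 29 = Rb - Ra + (a + bb) - F ==>
   (!!r. r < 22 \<or> r = 25 \<or> 32 < r ==> e' r = e r) ==>
   n' <= n + 12 * W + 8 ==> d' <= d + 12 * W + 8 ==> Q e' b H n' d'"
 shows "wp R U M cut Q e b H n d"
proof -
 define lR where "lR = Rb - Ra"
 define tot where "tot = a + bb"
 define lo0 where "lo0 = h - bb"
 define hi0 where "hi0 = min a h"
 define og where "og = lR + tot - F"
 have og: "int og = int lR + int tot - int F" using b unfolding og_def lR_def tot_def by linarith
 have hi0: "hi0 <= a" "hi0 <= h" "lo0 <= hi0" using b by (auto simp: hi0_def lo0_def)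
 have totN: "tot <= N" "lR <= N" "a <= N" "bb <= N" "h <= N" "og <= 2 * N" using b by (auto simp: tot_def lR_def og_def)
 have cA: "adrv lR Ra La ((og + z) mod tot)
   = cell_of (int La) (int Rb) (int F) (int Rb - int Ra) (int a + int bb) (int z)" if "z < a" for z
 proof (intro cell_adr[where Ra = "int Ra"])
  have "int (og + z) = (int z - (int F - (int Rb - int Ra))) + int tot"
   using b og by (simp add: lR_def of_nat_diff)
  then have "int ((og + z) mod tot) = (int z - (int F - (int Rb - int Ra))) mod int tot"
   by (metis mod_add_self2 zmod_int)
  then show "int ((og + z) mod tot) = (int z - (int F - (int Rb - int Ra))) mod (int a + int bb)"
   by (simp add: tot_def)
 qed (use that b og in \<open>auto simp: lR_def tot_def of_nat_diff\<close>)
 have cB: "adrv lR Ra La ((og + tot + z - h) mod tot)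
   = cell_of (int La) (int Rb) (int F) (int Rb - int Ra) (int a + int bb) (int z - int h)" if "z < h" "h <= z + bb" for z
 proof (intro cell_adr[where Ra = "int Ra"])
  have "int (og + tot + z - h) = (int z - int h - (int F - (int Rb - int Ra))) + int tot + int tot"
   using b og by (simp add: lR_def of_nat_diff tot_def)
  then have "int ((og + tot + z - h) mod tot) = (int z - int h - (int F - (int Rb - int Ra))) mod int tot"
   by (metis mod_add_self2 zmod_int)
  then show "int ((og + tot + z - h) mod tot) = (int z - int h - (int F - (int Rb - int Ra))) mod (int a + int bb)"
   by (simp add: tot_def)
 qed (use that b og in \<open>auto simp: lR_def tot_def of_nat_diff\<close>)
 \<comment> \<open>The initial ends are exempt from the comparisons: at \<open>lo0\<close> and
   \<open>hi0\<close> one of the sides is exhausted, and the corresponding condition on the result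
   is vacuous. The exponent \<open>k\<close> bounds the remaining rounds, at 12 commands
   each.\<close>
 let ?I = "%e' b' H' n' d'. \<exists>k lo hi. e' 22 = lo & e' 23 = hi & lo0 <= lo & lo <= hi & hi <= hi0 & hi - lo < 2 ^ k &
   (lo = lo0 \<or> c (int lo - 1) < c (- int (h - lo) - 1)) & (hi = hi0 \<or> c (- int (h - hi)) <= c (int hi)) &
   b' = b & H' = H & e' 28 = lR & e' 29 = og & (\<forall>r. r < 22 \<or> r = 25 \<or> 32 < r --> e' r = e r) &
   n' + 12 * k <= n + 12 * W + 7 & d' + 12 * k <= d + 12 * W + 7"
 let ?body = "24 ::= (V 22 [+] V 23) [div] C 2 ;;
    26 ::= V 29 [+] V 24 ;; adr 27 ;;
    26 ::= V 29 [+] V 25 [+] V 24 [-] V 21 ;; adr 31 ;;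
    IfC (V 27) (V 31) (22 ::= V 24 [+] C 1) (23 ::= V 24)"
 have loop: "wp R U M (While (V 22) (V 23) ?body) Q e1 b H n1 d1" if "?I e1 b H n1 d1" for e1 n1 d1
 proof (rule wp_While[where I = ?I and f = "%e b H. e 23 - e 22", OF that], goal_cases)
  case (1 e' b' H' n' d')
  then obtain k lo hi where I: "e' 22 = lo" "e' 23 = hi" "lo0 <= lo" "lo <= hi" "hi <= hi0" "hi - lo < 2 ^ k"
   "lo = lo0 \<or> c (int lo - 1) < c (- int (h - lo) - 1)" "hi = hi0 \<or> c (- int (h - hi)) <= c (int hi)"
   "b' = b" "H' = H" "e' 28 = lR" "e' 29 = og" "\<forall>r. r < 22 \<or> r = 25 \<or> 32 < r --> e' r = e r"
   "n' + 12 * k <= n + 12 * W + 7" "d' + 12 * k <= d + 12 * W + 7" by blast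
  show ?case
  proof (cases "lo < hi")
   case False
   then have [simp]: "hi = lo" using I by simp
   have "Q e' b H (Suc n') (Suc d')"
   proof (rule Q)
    show "0 < lo ==> h - lo < bb ==> c (int lo - 1) <= c (- int (h - lo) - 1)"
     using I(7) by (auto simp: lo0_def)
    show "0 < h - lo ==> lo < a ==> c (- int (h - lo)) <= c (int lo)"
     using I(8) by (auto simp: hi0_def min_def split: if_splits)
   qed (use I hi0 in \<open>auto simp: lo0_def lR_def og_def tot_def\<close>)
   then show ?thesis using False I M by simp
  next
   case True
   then obtain k' where k: "k = Suc k'" using I(6) by (cases k) auto
   define mid where "mid = (lo + hi) div 2"
   have mid: "lo <= mid" "mid < hi" "mid - lo < 2 ^ k'" "hi - Suc mid < 2 ^ k'"
    using True I(6) unfolding mid_def k by auto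
   have midr: "mid < a" "mid < h" "h <= mid + bb" "mid <= N" "hi <= N" using mid I hi0 totN by (auto simp: lo0_def)
   define A1 where "A1 = cell_of (int La) (int Rb) (int F) (int Rb - int Ra) (int a + int bb) (int mid)"
   define A2 where "A2 = cell_of (int La) (int Rb) (int F) (int Rb - int Ra) (int a + int bb) (int mid - int h)"
   have A: "A1 \<in> R" "A2 \<in> R" "H A1 = Elem (c (int mid))" "H A2 = Elem (c (int mid - int h))"
    using lay rng midr unfolding A1_def A2_def layout_def by auto
   have t0: "0 < tot" using midr by (auto simp: tot_def)
   have oks: "lo + hi < 2 ^ w" "2 < (2::nat) ^ w" "og + mid < 2 ^ w" "og + tot + mid < 2 ^ w" "mid + 1 < 2 ^ w"
    "La + tot < 2 ^ w" "Ra + tot < 2 ^ w" "og + tot < 2 ^ w" "1 < (2::nat) ^ w"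
    using I(4) midr totN b by (auto intro!: small)
   have hle: "h <= og + tot + mid" using b by (simp add: tot_def)
   define J where "J = (%(e'' :: nat => nat) b'' H'' n'' d''. ?I e'' b'' H'' n'' d'' & e'' 23 - e'' 22 < e' 23 - e' 22)"
   have eqh: "- int (h - Suc mid) - 1 = int mid - int h" "- int (h - mid) = int mid - int h"
    using midr by (auto simp: of_nat_diff)
   have J1: "J (e''(22 := Suc mid)) b H (n' + 12) (d' + 12)" if "c (int mid) < c (int mid - int h)"
    "!!r. r < 24 \<or> r = 25 \<or> r = 28 \<or> r = 29 \<or> 32 < r ==> e'' r = e' r" for e''
   proof -
    have v: "e'' 22 = lo" "e'' 23 = hi" "e'' 28 = lR" "e'' 29 = og"
     using that(2)[of 22] that(2)[of 23] that(2)[of 28] that(2)[of 29] I by auto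
    have r: "(e''(22 := Suc mid)) r = e r" if "r < 22 \<or> r = 25 \<or> 32 < r" for r
     using that I(13) \<open>!!r. r < 24 \<or> r = 25 \<or> r = 28 \<or> r = 29 \<or> 32 < r ==> e'' r = e' r\<close>[of r] by auto
    let ?e = "e''(22 := Suc mid)"
    have r': "\<forall>r. r < 22 \<or> r = 25 \<or> 32 < r --> ?e r = e r" using r by blast
    have f: "?e 22 = Suc mid" "?e 23 = hi" "?e 28 = lR" "?e 29 = og" using v by simp_all
    have g: "lo0 <= Suc mid" "Suc mid <= hi" "hi <= hi0" "hi - Suc mid < 2 ^ k'" using I(3-5) mid by simp_all
    have d: "Suc mid = lo0 \<or> c (int (Suc mid) - 1) < c (- int (h - Suc mid) - 1)" "hi = hi0 \<or> c (- int (h - hi)) <= c (int hi)" using I(7,8) that(1) eqh by (auto simp: not_less)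
    have m: "n' + 12 + 12 * k' <= n + 12 * W + 7" "d' + 12 + 12 * k' <= d + 12 * W + 7"
     using I(14,15) k by simp_all
    have "?e 23 - ?e 22 < e' 23 - e' 22" using f mid I(1,2) by simp
    then show ?thesis
     unfolding J_def using r' f g d m by blast
   qed
   have J2: "J (e''(23 := mid)) b H (n' + 12) (d' + 12)" if "\<not> c (int mid) < c (int mid - int h)"
    "!!r. r < 24 \<or> r = 25 \<or> r = 28 \<or> r = 29 \<or> 32 < r ==> e'' r = e' r" for e''
   proof -
    have v: "e'' 22 = lo" "e'' 23 = hi" "e'' 28 = lR" "e'' 29 = og"
     using that(2)[of 22] that(2)[of 23] that(2)[of 28] that(2)[of 29] I by auto
    have r: "(e''(23 := mid)) r = e r" if "r < 22 \<or> r = 25 \<or> 32 < r" for r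
     using that I(13) \<open>!!r. r < 24 \<or> r = 25 \<or> r = 28 \<or> r = 29 \<or> 32 < r ==> e'' r = e' r\<close>[of r] by auto
    let ?e = "e''(23 := mid)"
    have r': "\<forall>r. r < 22 \<or> r = 25 \<or> 32 < r --> ?e r = e r" using r by blast
    have f: "?e 22 = lo" "?e 23 = mid" "?e 28 = lR" "?e 29 = og" using v by simp_all
    have g: "lo0 <= lo" "lo <= mid" "mid <= hi0" "mid - lo < 2 ^ k'" using I(3-5) mid by simp_all
    have d: "lo = lo0 \<or> c (int lo - 1) < c (- int (h - lo) - 1)" "mid = hi0 \<or> c (- int (h - mid)) <= c (int mid)" using I(7,8) that(1) eqh by (auto simp: not_less)
    have m: "n' + 12 + 12 * k' <= n + 12 * W + 7" "d' + 12 + 12 * k' <= d + 12 * W + 7"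
     using I(14,15) k by simp_all
    have "?e 23 - ?e 22 < e' 23 - e' 22" using f mid I(1,2) by simp
    then show ?thesis
     unfolding J_def using r' f g d m by blast
   qed
   have twelve: "n' + 12 = Suc (Suc (Suc (Suc (Suc (Suc (Suc (Suc (Suc (Suc (Suc (Suc n')))))))))))"
    "d' + 12 = Suc (Suc (Suc (Suc (Suc (Suc (Suc (Suc (Suc (Suc (Suc (Suc d')))))))))))" by simp_all
   define e3 where "e3 = e'(24 := mid, 26 := og + mid, 32 := (og + mid) mod tot, 27 := A1)"
   define e4 where "e4 = e3(26 := og + tot + mid - h, 32 := (og + tot + mid - h) mod tot, 31 := A2)"
   have e4: "e4 22 = lo" "e4 24 = mid" "e4 27 = A1" "e4 31 = A2" "!!r. r < 24 \<or> r = 25 \<or> r = 28 \<or> r = 29 \<or> 32 < r ==> e4 r = e' r"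
    using I(1,2) by (auto simp: e4_def e3_def)
   have s3: "wp R U M (IfC (V 27) (V 31) (22 ::= V 24 [+] C 1) (23 ::= V 24)) J e4 b H
     (Suc (Suc (Suc (Suc (Suc (Suc (Suc (Suc (Suc (Suc n')))))))))) (Suc (Suc (Suc (Suc (Suc (Suc (Suc (Suc (Suc (Suc d'))))))))))"
    using A M oks J1[unfolded twelve, OF _ e4(5)] J2[unfolded twelve, OF _ e4(5)] e4(1-4) by (simp add: wps)
   have s2: "wp R U M (26 ::= V 29 [+] V 25 [+] V 24 [-] V 21 ;; adr 31 ;;
     IfC (V 27) (V 31) (22 ::= V 24 [+] C 1) (23 ::= V 24)) J e3 b H
     (Suc (Suc (Suc (Suc (Suc (Suc n')))))) (Suc (Suc (Suc (Suc (Suc (Suc d'))))))"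
   proof -
    have r: "e3 29 = og" "e3 25 = tot" "e3 24 = mid" "e3 21 = h" "e3 28 = lR" "e3 14 = La" "e3 16 = Ra"
     using I e by (auto simp: e3_def tot_def)
    have "wp R U M (adr 31) (wp R U M (IfC (V 27) (V 31) (22 ::= V 24 [+] C 1) (23 ::= V 24)) J)
     (e3(26 := og + tot + mid - h)) b H (Suc (Suc (Suc (Suc (Suc (Suc (Suc n'))))))) (Suc (Suc (Suc (Suc (Suc (Suc (Suc d')))))))"
    proof (rule wp_adr[where tot = tot and lR = lR and La = La and Ra = Ra])
     show "wp R U M (IfC (V 27) (V 31) (22 ::= V 24 [+] C 1) (23 ::= V 24)) J
      (e3(26 := og + tot + mid - h, 32 := (e3(26 := og + tot + mid - h)) 26 mod tot,
       31 := adrv lR Ra La ((e3(26 := og + tot + mid - h)) 26 mod tot))) b H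
      (Suc (Suc (Suc (Suc (Suc (Suc (Suc (Suc (Suc (Suc n')))))))))) (Suc (Suc (Suc (Suc (Suc (Suc (Suc (Suc (Suc (Suc d'))))))))))"
      using s3 cB[of mid] midr by (simp add: e4_def A2_def)
    qed (use t0 oks M r in simp_all)
    then show ?thesis
     using M oks hle r by (simp add: wp_Seq wp_Assign)
   qed
   have "wp R U M ?body J e' b H (Suc n') (Suc d')"
   proof -
    have r: "e' 29 = og" "e' 25 = tot" "e' 21 = h" "e' 28 = lR" "e' 14 = La" "e' 16 = Ra" "e' 22 = lo" "e' 23 = hi"
     using I e by (auto simp: tot_def)
    let ?c2 = "26 ::= V 29 [+] V 25 [+] V 24 [-] V 21 ;; adr 31 ;;
     IfC (V 27) (V 31) (22 ::= V 24 [+] C 1) (23 ::= V 24)"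
    have "wp R U M (adr 27) (wp R U M ?c2 J) (e'(24 := mid, 26 := og + mid)) b H (Suc (Suc (Suc n'))) (Suc (Suc (Suc d')))"
    proof (rule wp_adr[where tot = tot and lR = lR and La = La and Ra = Ra])
     show "wp R U M ?c2 J
      (e'(24 := mid, 26 := og + mid, 32 := (e'(24 := mid, 26 := og + mid)) 26 mod tot,
       27 := adrv lR Ra La ((e'(24 := mid, 26 := og + mid)) 26 mod tot))) b H
      (Suc (Suc (Suc (Suc (Suc (Suc n')))))) (Suc (Suc (Suc (Suc (Suc (Suc d'))))))"
      using s2 cA[of mid] midr by (simp add: e3_def A1_def)
    qed (use t0 oks M r in simp_all)
    then show ?thesis
     using M oks r by (simp add: wp_Seq wp_Assign mid_def)
   qed
   then show ?thesis using True I M by (simp add: J_def)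
  qed
 qed
 have W0: "hi0 - lo0 < 2 ^ W" using hi0 totN NW by linarith
 define e5 where "e5 = e(28 := lR, 29 := og, 30 := bb, 22 := lo0, 23 := hi0)"
 have fin: "wp R U M (While (V 22) (V 23) ?body) Q e5 b H (Suc (Suc (Suc (Suc (Suc (Suc (Suc n)))))))
  (Suc (Suc (Suc (Suc (Suc (Suc (Suc d)))))))"
  by (rule loop) (use hi0 W0 in \<open>auto simp: e5_def intro!: exI[of _ W]\<close>)
 have oks: "lR + tot < 2 ^ w" "0 < (2::nat) ^ w" "Rb < 2 ^ w" "tot < 2 ^ w" "h < 2 ^ w" "F <= lR + tot"
  using totN b by (auto intro!: small simp: lR_def tot_def)
 have de: "Rb - Ra = lR" "lR + tot - F = og" "a + bb = tot" "tot - a = bb" "a <= tot"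
  by (auto simp: lR_def tot_def og_def)
 have lh: "lo0 = (if bb < h then h - bb else 0)" "hi0 = (if a < h then a else h)"
  by (auto simp: lo0_def hi0_def)
 show ?thesis
  unfolding cut_def
  using fin[unfolded e5_def lh] M oks b(2)
  by (cases "bb < h"; cases "a < h") (simp_all add: wp_Seq wp_If wp_Assign e de)
qed

end

section \<open>Recursive splitting into blocks with contiguous ranges of the output\<close>

text \<open>Registers 14 to 17 hold the bounds of \<open>L\<close> and \<open>R\<close>, 18 the
  offset \<open>F\<close>, 13 the length \<open>a\<close>, 19 the rank of the first block and 20 the
  block size. The shift in register 34 is obtained from the ring position of index \<open>i\<close>,
  which is congruent to \<open>i - F\<close> modulo the block size.\<close>

definition purify :: "nat => com => com" where
 "purify self leaf =
  25 ::= V 15 [-] V 14 [+] (V 17 [-] V 16) ;;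
  If (V 20) (V 25)
   (21 ::= V 25 [div] V 20 [div] C 2 [*] V 20 ;; cut ;; 33 ::= V 21 [-] V 22 ;;
   34 ::= (V 20 [-] (V 29 [+] V 22) [mod] V 20) [mod] V 20 ;;
   26 ::= V 29 [+] V 22 ;; adr 5 ;; 26 ::= V 29 [+] V 25 [-] V 33 ;; adr 6 ;;
   4 ::= V 34 ;; 3 ::= C 0 ;; Call 1 ;;
   35 ::= V 14 [+] V 22 [+] V 34 [-] V 18 ;; 36 ::= V 17 [+] V 34 [-] (V 18 [+] V 33) ;;
   Par (15 ::= V 35 ;; 16 ::= V 36 ;; 13 ::= V 22 ;; Call self)
     (14 ::= V 35 ;; 17 ::= V 36 ;; 18 ::= V 34 ;; 13 ::= V 13 [-] V 22 ;;
      19 ::= V 19 [+] V 21 [div] V 20 ;; Call self))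
   leaf"

definition blks :: "nat => nat => nat => nat => nat => nat set" where
 "blks BS La Lb Ra Rb = {p. (La <= p & p < Lb & BS dvd p - La) \<or> (Ra <= p & p < Rb & BS dvd p - Ra)}"

lemma blks_split:
 assumes "BS dvd Lv - La" "La <= Lv" "Lv <= Lb" "BS dvd Rv - Ra" "Ra <= Rv" "Rv <= Rb" "Lb <= Ra"
 shows "blks BS La Lb Ra Rb = blks BS La Lv Rv Rb \<union> blks BS Lv Lb Ra Rv"
  and "blks BS La Lv Rv Rb \<inter> blks BS Lv Lb Ra Rv = {}"
proof -
 have 1: "BS dvd p - La \<longleftrightarrow> BS dvd p - Lv" if "Lv <= p" for p
  using dvd_add_right_iff[OF assms(1), of "p - Lv"] that assms(2) by simp
 have 2: "BS dvd p - Ra \<longleftrightarrow> BS dvd p - Rv" if "Rv <= p" for p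
  using dvd_add_right_iff[OF assms(4), of "p - Rv"] that assms(5) by simp
 show "blks BS La Lb Ra Rb = blks BS La Lv Rv Rb \<union> blks BS Lv Lb Ra Rv"
 proof (rule set_eqI)
  fix p
  show "p \<in> blks BS La Lb Ra Rb \<longleftrightarrow> p \<in> blks BS La Lv Rv Rb \<union> blks BS Lv Lb Ra Rv"
   unfolding blks_def using 1[of p] 2[of p] assms
   by (cases "Lv <= p"; cases "Rv <= p") auto
 qed
 show "blks BS La Lv Rv Rb \<inter> blks BS Lv Lb Ra Rv = {}"
  using assms unfolding blks_def by auto
qed

text \<open>\<open>f k\<close> is the place of the block that comes \<open>k\<close>-th in the
  output. How a block stores its elements \<open>Xs k\<close> together with the rank
  \<open>T + k\<close> is left to \<open>LP\<close>, which differs between the two levels.\<close>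

definition PP :: "((nat => 'a cell) => nat => 'a list => nat => bool) => nat => (nat => 'a :: linorder cell)
  => nat set => nat => nat => 'a multiset => bool" where
 "PP LP BS H BL T cnt ms \<longleftrightarrow> (\<exists>f Xs. bij_betw f {..<cnt} BL &
   (\<forall>k<cnt. LP H (f k) (Xs k) (T + k) & length (Xs k) = BS) &
   sorted (concat (map Xs [0..<cnt])) & mset (concat (map Xs [0..<cnt])) = ms)"

lemma int_dvd_diff: "int k dvd int x - int y ==> y <= x ==> k dvd x - y"
 by (metis int_dvd_int_iff of_nat_diff)

text \<open>The ranks of the high part continue where those of the low part end, so the numberings
  are glued with a shift by \<open>c1\<close>.\<close>

lemma PP_join:
 assumes "PP LP BS H BL1 T c1 ms1" "PP LP BS H BL2 (T + c1) c2 ms2" "BL1 \<inter> BL2 = {}"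
  and "!!x y. x \<in># ms1 ==> y \<in># ms2 ==> x <= y"
 shows "PP LP BS H (BL1 \<union> BL2) T (c1 + c2) (ms1 + ms2)"
proof -
 obtain f1 X1 where 1: "bij_betw f1 {..<c1} BL1"
   "!!k. k < c1 ==> LP H (f1 k) (X1 k) (T + k) & length (X1 k) = BS"
   "sorted (concat (map X1 [0..<c1]))" "mset (concat (map X1 [0..<c1])) = ms1"
  using assms(1) unfolding PP_def by blast
 obtain f2 X2 where 2: "bij_betw f2 {..<c2} BL2"
   "!!k. k < c2 ==> LP H (f2 k) (X2 k) (T + c1 + k) & length (X2 k) = BS"
   "sorted (concat (map X2 [0..<c2]))" "mset (concat (map X2 [0..<c2])) = ms2"
  using assms(2) unfolding PP_def by blast
 define f where "f k = (if k < c1 then f1 k else f2 (k - c1))" for k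
 define X where "X k = (if k < c1 then X1 k else X2 (k - c1))" for k
 have b1: "bij_betw f {..<c1} BL1" using 1(1) by (rule bij_betw_cong[THEN iffD1, rotated]) (simp add: f_def)
 have "bij_betw (%k. k - c1) {c1..<c1 + c2} {..<c2}"
  by (rule bij_betwI[where g = "%k. k + c1"]) auto
 then have "bij_betw (f2 \<circ> (%k. k - c1)) {c1..<c1 + c2} BL2"
  using 2(1) by (rule bij_betw_trans)
 then have b2: "bij_betw f {c1..<c1 + c2} BL2"
  by (rule bij_betw_cong[THEN iffD1, rotated]) (simp add: f_def)
 have "{..<c1 + c2} = {..<c1} \<union> {c1..<c1 + c2}" by auto
 then have b: "bij_betw f {..<c1 + c2} (BL1 \<union> BL2)"
  using bij_betw_combine[OF b1 b2 assms(3)] by simp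
 have m1: "map X [0..<c1] = map X1 [0..<c1]" by (simp add: X_def)
 have m2: "map X [c1..<c1 + c2] = map X2 [0..<c2]"
  by (rule nth_equalityI) (auto simp: X_def)
 have cc: "concat (map X [0..<c1 + c2]) = concat (map X1 [0..<c1]) @ concat (map X2 [0..<c2])"
  using upt_add_eq_append[of 0 c1 c2, simplified] by (simp only: map_append concat_append m1 m2)
 show ?thesis
  unfolding PP_def
 proof (intro exI[of _ f] exI[of _ X] conjI)
  show "\<forall>k<c1 + c2. LP H (f k) (X k) (T + k) & length (X k) = BS"
  proof (intro allI impI)
   fix k assume "k < c1 + c2"
   then show "LP H (f k) (X k) (T + k) & length (X k) = BS"
    using 1(2)[of k] 2(2)[of "k - c1"] by (cases "k < c1") (auto simp: f_def X_def)
  qed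
  show "sorted (concat (map X [0..<c1 + c2]))"
   unfolding cc sorted_append using 1(3,4) 2(3,4) assms(4) by (metis set_mset_mset)
 qed (use b cc 1(4) 2(4) in auto)
qed

lemma PP_cong:
 assumes "PP LP BS H BL T cnt ms" "!!p a. p \<in> BL ==> a \<in> {p..<p + BS} ==> H' a = H a"
  and "!!H H' p xs t. LP H p xs t ==> (!!a. a \<in> {p..<p + BS} ==> H' a = H a) ==> LP H' p xs t"
 shows "PP LP BS H' BL T cnt ms"
proof -
 obtain f Xs where 1: "bij_betw f {..<cnt} BL"
   "!!k. k < cnt ==> LP H (f k) (Xs k) (T + k) & length (Xs k) = BS"
   "sorted (concat (map Xs [0..<cnt]))" "mset (concat (map Xs [0..<cnt])) = ms"
  using assms(1) unfolding PP_def by blast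
 have "LP H' (f k) (Xs k) (T + k) & length (Xs k) = BS" if "k < cnt" for k
 proof -
  have "f k \<in> BL" using 1(1) that by (auto simp: bij_betw_def inj_on_def)
  then show ?thesis using 1(2)[OF that] assms(2)[of "f k"] assms(3)[of H "f k" "Xs k" "T + k" H'] by blast
 qed
 then show ?thesis unfolding PP_def using 1 by blast
qed

text \<open>Guarantees that subtracting \<open>F\<close> in the natural arithmetic of the program
  does not truncate. If \<open>R\<close> is empty, \<open>L\<close> consists of at least one block
  and then \<open>F < a\<close>.\<close>

lemma ninv_F: "ninv BS La Lb Ra Rb F a b ==> 0 < a + b ==> F <= a + (Rb - Ra)"
proof -
 assume i: "ninv BS La Lb Ra Rb F a b" and t: "0 < a + b"
 note i' = i[unfolded ninv_def]
 show ?thesis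
 proof (cases "Rb = Ra")
  case True
  then have "BS <= Lb - La" using i' t by (intro zdvd_imp_le) auto
  then show ?thesis using i' True by linarith
 next
  case False
  then have "BS <= Rb - Ra" using i' by (intro zdvd_imp_le) auto
  then show ?thesis using i' by linarith
 qed
qed

lemma cell_range:
 assumes "ninv BS La Lb Ra Rb F a b" "- b <= z" "z < a"
 shows "cell_of La Rb F (Rb - Ra) (a + b) z \<in> {nat La..<nat Lb} \<union> {nat Ra..<nat Rb}"
proof -
 have "F <= a + (Rb - Ra)" using ninv_F[OF assms(1)] assms(2,3) by linarith
 then show ?thesis
  using assms unfolding ninv_def cell_of_def Let_def by auto
qed

context alg2
begin

definition glob :: "nat => (nat => nat) => bool" where
 "glob BS e \<longleftrightarrow> e 0 = W & e 1 = 2 * W + 3 & e 2 = (2 * W + 3) * (2 * W + 3) & e 20 = BS"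

definition node :: "(nat => nat) => nat => nat => nat => nat => nat => nat => nat => bool" where
 "node e La Lb Ra Rb F a T \<longleftrightarrow> e 14 = La & e 15 = Lb & e 16 = Ra & e 17 = Rb & e 18 = F & e 13 = a & e 19 = T"

definition ninvn :: "nat => nat => nat => nat => nat => nat => nat => nat => bool" where
 "ninvn BS La Lb Ra Rb F a b \<longleftrightarrow> ninv (int BS) (int La) (int Lb) (int Ra) (int Rb) (int F) (int a) (int b)"

definition layn :: "(nat => 'a cell) => nat => nat => nat => nat => (int => 'a) => nat => nat => bool" where
 "layn H La Ra Rb F c a b \<longleftrightarrow>
   layout H (int La) (int Rb) (int F) (int Rb - int Ra) (int a + int b) c (int a) (int b)"

text \<open>What a leaf has to achieve on either level: sort the single block of its ring in place
  and attach the rank \<open>T\<close> to it.\<close>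

definition leaf_ok :: "nat => ((nat => 'a :: linorder cell) => nat => 'a list => nat => bool) => com => nat => nat => nat => bool" where
 "leaf_ok BS LP leaf M0 nl dl \<longleftrightarrow> (\<forall>e La Lb Ra Rb F a b T (c :: int => 'a) H p.
   glob BS e --> node e La Lb Ra Rb F a T --> ninvn BS La Lb Ra Rb F a b --> a + b = BS --> Rb <= N --> T < N -->
   layn H La Ra Rb F c a b --> valley c (int a) (int b) --> p = (if La < Lb then La else Ra) -->
   tri {p..<p + BS} {p..<p + BS} M0 leaf e H
    (%H'. \<exists>xs. LP H' p xs T & sorted xs & length xs = BS & mset xs = vmset c (int a) (int b)) nl dl)"

lemma purify_leaf:
 fixes LP :: "(nat => 'a :: linorder cell) => nat => 'a list => nat => bool"
 assumes leaf: "leaf_ok BS LP leaf M0 nl dl"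
  and e: "glob BS e" "node e La Lb Ra Rb F a T" and inv: "ninvn BS La Lb Ra Rb F a b"
  and cnt: "a + b = BS" "Rb <= N" "T + 1 <= N"
  and lay: "layn H La Ra Rb F c a b" and val: "valley c (int a) (int b)"
 shows "tri ({La..<Lb} \<union> {Ra..<Rb}) ({La..<Lb} \<union> {Ra..<Rb}) M0 (purify self leaf) e H
  (%H'. PP LP BS H' (blks BS La Lb Ra Rb) T 1 (vmset c (int a) (int b))) (nl + 2) (dl + 2)"
proof -
 define p where "p = (if La < Lb then La else Ra)"
 have ii: "ninv (int BS) (int La) (int Lb) (int Ra) (int Rb) (int F) (int a) (int b)"
  using inv by (simp add: ninvn_def)
 have B0: "0 < BS" and ord: "La <= Lb" "Lb <= Ra" "Ra <= Rb" using ii by (auto simp: ninv_def)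
 have sb: "La < Lb ==> Lb = La + BS & Ra = Rb" "\<not> La < Lb ==> Lb = La & Rb = Ra + BS"
  using single_block(2,3)[OF ii, of 0] cnt(1) B0 by auto
 have reg: "{La..<Lb} \<union> {Ra..<Rb} = {p..<p + BS}"
  using sb by (cases "La < Lb") (auto simp: p_def)
 have dv: "k = 0" if "BS dvd k" "k < BS" for k using that by (auto dest: dvd_imp_le)
 have bl: "blks BS La Lb Ra Rb = {p}"
 proof (cases "La < Lb")
  case True
  then show ?thesis using sb(1)[OF True] B0 unfolding blks_def p_def by (auto dest!: dv)
 next
  case False
  then show ?thesis using sb(2)[OF False] B0 unfolding blks_def p_def by (auto dest!: dv)
 qed
 define e1 where "e1 = e(25 := BS)"
 have "tri {p..<p + BS} {p..<p + BS} M0 leaf e1 H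
    (%H'. \<exists>xs. LP H' p xs T & sorted xs & length xs = BS & mset xs = vmset c (int a) (int b)) nl dl"
  using leaf[unfolded leaf_ok_def, rule_format, of e1 La Lb Ra Rb F a T b H c p] e inv cnt lay val
  by (auto simp: e1_def glob_def node_def p_def)
 then have lf: "wp {p..<p + BS} {p..<p + BS} M0 leaf (%e' b' H' n' d'. n' <= nl + 2 & d' <= dl + 2 &
   PP LP BS H' {p} T 1 (vmset c (int a) (int b))) e1 [] H (Suc (Suc 0)) (Suc (Suc 0))"
 proof (rule wp_tri)
  fix H' assume "\<exists>xs. LP H' p xs T & sorted xs & length xs = BS & mset xs = vmset c (int a) (int b)"
  then obtain xs where "LP H' p xs T" "sorted xs" "length xs = BS" "mset xs = vmset c (int a) (int b)" by blast
  then have "PP LP BS H' {p} T 1 (vmset c (int a) (int b))"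
   unfolding PP_def
   by (intro exI[of _ "%_. p"] exI[of _ "%_. xs"]) (auto simp: bij_betw_def inj_on_def)
  then show "n' <= Suc (Suc 0) + nl ==> d' <= Suc (Suc 0) + dl ==>
   n' <= nl + 2 & d' <= dl + 2 & PP LP BS H' {p} T 1 (vmset c (int a) (int b))" for n' d'
   by simp
 qed auto
 have tot: "Lb - La + (Rb - Ra) = BS" using sb by (cases "La < Lb") auto
 have sm: "Lb < 2 ^ w" "Rb < 2 ^ w" "BS < 2 ^ w"
  using cnt ord tot by (auto intro!: small)
 show ?thesis
  unfolding reg bl
 proof (rule tri_wpI)
  show "wp {p..<p + BS} {p..<p + BS} M0 (purify self leaf) (%e' b' H' n' d'. n' <= nl + 2 & d' <= dl + 2 &
    PP LP BS H' {p} T 1 (vmset c (int a) (int b))) e [] H 0 0"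
   unfolding purify_def using lf e ord sm tot
   by (simp add: wp_Seq wp_Assign wp_If glob_def node_def e1_def)
 qed
qed

text \<open>A binary tree with \<open>cnt\<close> leaves has \<open>cnt - 1\<close> inner nodes,
  which explains the subtracted term. Of the \<open>33 * BS\<close> for an inner node,
  \<open>12 * W\<close> is the search and \<open>21 * lam\<close> the exchange, using
  \<open>W <= BS\<close> and \<open>lam < BS\<close>. A level adds \<open>12 * W\<close> for the
  search and \<open>10 * W\<close> for the swap loop to the depth, and one \<open>Par\<close> and
  one \<open>Call\<close> to the stack.\<close>

lemma purify_tri:
 fixes LP :: "(nat => 'a :: linorder cell) => nat => 'a list => nat => bool"
 assumes ps: "Pr self = purify self leaf" and leaf: "leaf_ok BS LP leaf M0 nl dl"
  and loc: "!!H H' p xs t. LP H p xs t ==> (!!a. a \<in> {p..<p + BS} ==> H' a = H a) ==> LP H' p xs t"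
  and BS: "W <= BS"
  and e: "glob BS e" "node e La Lb Ra Rb F a T" and inv: "ninvn BS La Lb Ra Rb F a b"
  and cnt: "a + b = cnt * BS" "1 <= cnt" "cnt <= 2 ^ t" "Rb <= N" "T + cnt <= N"
  and lay: "layn H La Ra Rb F c a b" and val: "valley c (int a) (int b)"
 shows "tri ({La..<Lb} \<union> {Ra..<Rb}) ({La..<Lb} \<union> {Ra..<Rb}) (max M0 (112 + 224 * W) + 224 * t) (Pr self) e H
  (%H'. PP LP BS H' (blks BS La Lb Ra Rb) T cnt (vmset c (int a) (int b)))
  (cnt * (nl + 42 + 33 * BS) - (39 + 33 * BS)) (dl + 3 + t * (22 * W + 70))"
 using e inv cnt lay val
proof (induction t arbitrary: e La Lb Ra Rb F a b T cnt H c)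
 case (0 e La Lb Ra Rb F a b T cnt H c)
 then have c1: "cnt = 1" by simp
 show ?case
  unfolding ps c1
  by (rule tri_mono[OF purify_leaf[OF leaf "0.prems"(1-3) _ "0.prems"(7) _ "0.prems"(9,10)]])
   (use "0.prems"(4,8) c1 in auto)
next
 case (Suc t e La Lb Ra Rb F a b T cnt H c)
 show ?case
 proof (cases "cnt = 1")
  case True
  show ?thesis
   unfolding ps True
   by (rule tri_mono[OF purify_leaf[OF leaf Suc.prems(1-3) _ Suc.prems(7) _ Suc.prems(9,10)]])
    (use Suc.prems(4,8) True in auto)
 next
  case False
  define c1 where "c1 = cnt div 2"
  define c2 where "c2 = cnt - c1"
  have cc: "1 <= c1" "1 <= c2" "c1 + c2 = cnt" "c1 <= 2 ^ t" "c2 <= 2 ^ t"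
   using False Suc.prems(5,6) by (auto simp: c1_def c2_def)
  define h where "h = c1 * BS"
  define tot where "tot = cnt * BS"
  note inv = Suc.prems(3)[unfolded ninvn_def]
  have B0: "0 < BS" and ord: "La <= Lb" "Lb <= Ra" "Ra <= Rb" and FB: "F < BS"
   using inv by (auto simp: ninv_def)
  have ab: "a + b = tot" using Suc.prems(4) by (simp add: tot_def)
  have lens: "Lb - La + (Rb - Ra) = tot"
   using inv ab ord by (auto simp: ninv_def)
  have totN: "tot <= N" using lens ord Suc.prems(7) by linarith
  have hBS: "BS <= h" "h + BS <= tot"
  proof -
   show "BS <= h" using cc by (simp add: h_def)
   have "h + BS <= c1 * BS + c2 * BS" using cc by (simp add: h_def)
   also have "\<dots> = tot" using cc by (simp add: tot_def add_mult_distrib[symmetric])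
   finally show "h + BS <= tot" .
  qed
  have Fle: "F <= a + (Rb - Ra)" "Rb - Ra <= F + b"
   using ninv_F[OF inv] ab hBS B0 ord inv by (auto simp: ninv_def)
  define lR where "lR = Rb - Ra"
  define og where "og = lR + tot - F"
  have ogi: "int og = int lR + int tot - int F"
   using Fle ab by (simp add: og_def lR_def of_nat_diff)
  have BSd: "BS dvd tot" "BS dvd h" by (auto simp: tot_def h_def)
  have BSl: "BS dvd lR"
   using inv ord unfolding ninv_def lR_def by (intro int_dvd_diff) auto
  let ?Rg = "{La..<Lb} \<union> {Ra..<Rb}"
  let ?M = "max M0 (112 + 224 * W) + 224 * Suc t"
  let ?n = "cnt * (nl + 42 + 33 * BS) - (39 + 33 * BS)" and ?d = "dl + 3 + Suc t * (22 * W + 70)"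
  let ?post = "%H'. PP LP BS H' (blks BS La Lb Ra Rb) T cnt (vmset c (int a) (int b))"
  define J where "J = (%(e' :: nat => nat) (b' :: 'a cell list) H' n' d'. n' <= ?n & d' <= ?d & ?post H')"
  let ?cl = "15 ::= V 35 ;; 16 ::= V 36 ;; 13 ::= V 22 ;; Call self"
  let ?cr = "14 ::= V 35 ;; 17 ::= V 36 ;; 18 ::= V 34 ;; 13 ::= V 13 [-] V 22 ;;
      19 ::= V 19 [+] V 21 [div] V 20 ;; Call self"
  let ?tl = "33 ::= V 21 [-] V 22 ;;
   34 ::= (V 20 [-] (V 29 [+] V 22) [mod] V 20) [mod] V 20 ;;
   26 ::= V 29 [+] V 22 ;; adr 5 ;; 26 ::= V 29 [+] V 25 [-] V 33 ;; adr 6 ;;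
   4 ::= V 34 ;; 3 ::= C 0 ;; Call 1 ;;
   35 ::= V 14 [+] V 22 [+] V 34 [-] V 18 ;; 36 ::= V 17 [+] V 34 [-] (V 18 [+] V 33) ;;
   Par (?cl) (?cr)"
  define e1 where "e1 = e(25 := tot, 21 := h)"
  have e1: "e1 13 = a" "e1 14 = La" "e1 15 = Lb" "e1 16 = Ra" "e1 17 = Rb" "e1 18 = F" "e1 19 = T" "e1 20 = BS"
    "e1 21 = h" "e1 25 = tot"
   using Suc.prems(1,2) by (auto simp: e1_def glob_def node_def)
  have g1: "glob BS e1" using Suc.prems(1) by (auto simp: e1_def glob_def)
  have main: "wp ?Rg ?Rg ?M ?tl J e2 [] H n2 d2"
   if i: "i <= a" "i <= h" "h - i <= b" and
    sep: "0 < i ==> h - i < b ==> c (int i - 1) <= c (- int (h - i) - 1)"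
    "0 < h - i ==> i < a ==> c (- int (h - i)) <= c (int i)"
    and e2: "e2 22 = i" "e2 28 = Rb - Ra" "e2 29 = Rb - Ra + (a + b) - F"
    "!!r. r < 22 \<or> r = 25 \<or> 32 < r ==> e2 r = e1 r"
    and n2: "n2 <= 3 + 12 * W + 8" "d2 <= 3 + 12 * W + 8" for i e2 n2 d2
  proof -
   define j where "j = h - i"
   interpret rc: ring_cut "int BS" "int La" "int Lb" "int Ra" "int Rb" "int F" "int a" "int b" "int h" "int i" "int j"
    by unfold_locales (use inv hBS ab BSd i in \<open>auto simp: j_def\<close>)
   define lam where "lam = nat rc.lam"
   have lam: "int lam = rc.lam" "lam < BS" using rc.lam B0 by (auto simp: lam_def)
   define Lv where "Lv = La + i + lam - F"
   define Rv where "Rv = Rb + lam - (F + j)"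
   have LR: "int Lv = rc.Lv" "int Rv = rc.Rv"
   proof -
    have "0 <= rc.Lv" "0 <= rc.Rv" using rc.order rc.inv' by linarith+
    then show "int Lv = rc.Lv" "int Rv = rc.Rv"
     unfolding Lv_def Rv_def rc.Lv_def rc.Rv_def lam(1)[symmetric] by linarith+
   qed
   have order: "La <= Lv" "Lv <= Lb" "Ra <= Rv" "Rv <= Rb" using rc.order LR by linarith+
   \<comment> \<open>The lengths \<open>lR\<close> and \<open>tot\<close> are multiples of
     \<open>BS\<close> and vanish from \<open>og\<close>, leaving \<open>F - i\<close> modulo
     \<open>BS\<close>.\<close>
   have lamv: "(BS - (og + i) mod BS) mod BS = lam"
   proof -
    have "int ((BS - (og + i) mod BS) mod BS) = (int BS - (int og + int i) mod int BS) mod int BS"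
     using B0 by (simp add: zmod_int of_nat_diff less_imp_le)
    also have "\<dots> = (- (int og + int i)) mod int BS"
    proof (rule mod_eq_dvd_iff[THEN iffD2])
     let ?x = "int og + int i"
     have eq: "(int BS - ?x mod int BS) - (- ?x) = int BS + (?x - ?x mod int BS)" by simp
     show "int BS dvd (int BS - ?x mod int BS) - (- ?x)"
      unfolding eq by (intro dvd_add dvd_refl dvd_minus_mod)
    qed
    also have "- (int og + int i) = int F - int i - (int lR + int tot)" using ogi by simp
    also have "(int F - int i - (int lR + int tot)) mod int BS = (int F - int i) mod int BS"
    proof (rule mod_eq_dvd_iff[THEN iffD2])
     have eq: "(int F - int i - (int lR + int tot)) - (int F - int i) = - int (lR + tot)" by simp
     show "int BS dvd (int F - int i - (int lR + int tot)) - (int F - int i)"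
      unfolding eq using BSd(1) BSl by simp
    qed
    finally show ?thesis using lam by (simp add: rc.lam_def)
   qed
   have t0: "0 < tot" using hBS B0 by simp
   define X where "X = adrv lR Ra La ((og + i) mod tot)"
   define Y where "Y = adrv lR Ra La ((og + tot - j) mod tot)"
   have jh: "j <= tot" using hBS by (simp add: j_def)
   have rr: "rc.lR = int lR" "rc.tot = int tot" "int Rb - int Ra = int lR" "int a + int b = int tot"
    using ord ab by (auto simp: rc.lR_def rc.tot_def lR_def of_nat_diff)
   have XN: "X <= N" "Y <= N"
   proof -
    have "adrv lR Ra La r <= N" if "r < tot" for r
     using that lens ord Suc.prems(7) by (auto simp: adrv_def lR_def)
    then show "X <= N" "Y <= N" using t0 by (auto simp: X_def Y_def)
   qed
   have lRi: "int lR = int Rb - int Ra" using ord by (simp add: lR_def of_nat_diff)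
   have "int a <= int Lb - int La + int F" "int Lb - int La + int lR = int tot"
    using inv lRi ab by (auto simp: ninv_def)
   then have ai: "int a <= int F - int lR + int tot" by linarith
   have ai2: "0 < h" using hBS B0 by linarith
   have Yc: "Y = cell_of (int La) (int Rb) (int F) (int lR) (int tot) (- int j)"
    unfolding Y_def
   proof (rule cell_adr[where Ra = "int Ra"])
    have "int (og + tot - j) = (- int j - (int F - int lR)) + int tot + int tot"
     using ogi jh by (simp add: of_nat_diff)
    then show "int ((og + tot - j) mod tot) = (- int j - (int F - int lR)) mod int tot"
     by (metis mod_add_self2 zmod_int)
   qed (use t0 i Fle ab ord ai ai2 in \<open>auto simp: lR_def of_nat_diff j_def\<close>)
   \<comment> \<open>For \<open>lam = 0\<close> the index \<open>i\<close> may lie just behind the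
     window; then no cell is exchanged and the address is of no consequence.\<close>
   have Xc: "X = cell_of (int La) (int Rb) (int F) (int lR) (int tot) (int i)" if "0 < lam"
    unfolding X_def
   proof (rule cell_adr[where Ra = "int Ra"])
    have "int (og + i) = (int i - (int F - int lR)) + int tot"
     using ogi by simp
    then show "int ((og + i) mod tot) = (int i - (int F - int lR)) mod int tot"
     by (metis mod_add_self2 zmod_int)
    have "int i < int F + rc.lL" using rc.lam_blk(2) that lam by simp
    moreover have "rc.lL + int lR = int tot" using rc.inv'(14) rr by simp
    ultimately show "int i < int F - int lR + int tot" by linarith
   qed (use t0 i Fle ab ord in \<open>auto simp: lR_def of_nat_diff j_def\<close>)
   have runs: "X + t = rc.cell (int i + int t)" "Y + t = rc.cell (- int j + int t)" if "t < lam" for t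
    using rc.X_run[of "int t"] rc.Y_run[of "int t"] that lam Xc Yc rr by auto
   have win: "rc.cell z \<in> ?Rg" if "- int b <= z" "z < int F + rc.lL" for z
   proof -
    have "int F - rc.lR <= rc.nrm z & rc.nrm z < int F + rc.lL" by (rule rc.nrm_range[OF that])
    then have "0 <= rc.ph (rc.nrm z) & nat (rc.ph (rc.nrm z)) \<in> ?Rg"
     unfolding rc.ph_def rc.lL_def rc.lR_def using ord by auto
    then show ?thesis by (simp add: rc.cell_ph)
   qed
   have XYin: "{X..<X + lam} <= ?Rg" "{Y..<Y + lam} <= ?Rg"
   proof -
    have "X + t \<in> ?Rg" "Y + t \<in> ?Rg" if "t < lam" for t
     unfolding runs[OF that] using that rc.bounds lam i rc.inv'
     by (intro win; simp add: j_def)+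
    then show "{X..<X + lam} <= ?Rg" "{Y..<Y + lam} <= ?Rg"
     by (metis atLeastLessThan_iff le_iff_add nat_add_left_cancel_less subsetI)+
   qed
   have XYdj: "{X..<X + lam} \<inter> {Y..<Y + lam} = {}"
   proof (cases "lam = 0")
    case False
    then show ?thesis using rc.split_disjoint lam Xc Yc rr by (simp add: lam_def)
   qed simp
   have XYN: "X + lam <= N" "Y + lam <= N"
   proof -
    have "z + lam <= N" if "{z..<z + lam} <= ?Rg" "z <= N" for z
    proof (cases "lam = 0")
     case False
     then have "z + lam - 1 \<in> ?Rg" using that by (intro subsetD[OF that(1)]) auto
     then show ?thesis using ord Suc.prems(7) by auto
    qed (use that in simp)
    then show "X + lam <= N" "Y + lam <= N" using XYin XN by auto
   qed
   define e5 where "e5 = e2(33 := j, 34 := lam, 26 := og + i, 32 := (og + i) mod tot, 5 := X)"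
   define e6 where "e6 = e5(26 := og + tot - j, 32 := (og + tot - j) mod tot, 6 := Y, 4 := lam, 3 := 0)"
   define e7 where "e7 = e6(35 := Lv, 36 := Rv)"
   have e2v: "e2 13 = a" "e2 14 = La" "e2 15 = Lb" "e2 16 = Ra" "e2 17 = Rb" "e2 18 = F" "e2 19 = T" "e2 20 = BS"
    "e2 21 = h" "e2 25 = tot" "e2 22 = i" "e2 28 = lR" "e2 29 = og"
    using e2 e1 by (auto simp: lR_def og_def ab)
   have e7v: "e7 13 = a" "e7 14 = La" "e7 15 = Lb" "e7 16 = Ra" "e7 17 = Rb" "e7 18 = F" "e7 19 = T" "e7 20 = BS"
    "e7 21 = h" "e7 22 = i" "e7 34 = lam" "e7 35 = Lv" "e7 36 = Rv" "e7 0 = e1 0" "e7 1 = e1 1" "e7 2 = e1 2"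
    using e2v e2(4) by (auto simp: e7_def e6_def e5_def)
   have par: "wp ?Rg ?Rg ?M (Par (?cl) (?cr)) J e7 [] H1 n7 d7"
    if H1: "\<forall>t<lam. H1 (X + t) = H (Y + t) & H1 (Y + t) = H (X + t)"
     "!!x. x \<notin> {X..<X + lam} \<union> {Y..<Y + lam} ==> H1 x = H x"
     and n7: "n7 <= n2 + 21 * lam + 17" "d7 <= d2 + 10 * W + 26" for H1 n7 d7
   proof -
    have lay0: "layout H (int La) (int Rb) (int F) rc.lR rc.tot c (int a) (int b)"
     using Suc.prems(9) rr by (simp add: layn_def)
    have sw: "H1 (rc.X + t) = H (rc.Y + t) & H1 (rc.Y + t) = H (rc.X + t)" if "t < nat rc.lam" for t
     using that H1(1) Xc Yc rr by (auto simp: lam_def[symmetric])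
    have out: "H1 x = H x" if "x \<notin> {rc.X..<rc.X + nat rc.lam}" "x \<notin> {rc.Y..<rc.Y + nat rc.lam}" for x
     using that H1(2)[of x] Xc Yc rr by (cases "lam = 0") (auto simp: lam_def[symmetric])
    note sl = rc.split_layout[OF lay0 sw out]
    have RbRv: "int Rb - int Rv = int Rb - rc.Rv" using LR by simp
    have ij: "int i + int j = int h" using i by (simp add: j_def)
    have lay1: "layn H1 La Rv Rb F c i j"
     using sl(1) LR ij by (simp add: layn_def)
    define c' where "c' = upper c (int i) (int j)"
    have hab: "int (a - i) + int (b - j) = rc.tot - int h" "int (a - i) = int a - int i" "int (b - j) = int b - int j"
     using i ij by (auto simp: rc.tot_def j_def of_nat_diff)
    have lay2: "layn H1 Lv Ra Rv lam c' (a - i) (b - j)"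
     using sl(2) LR hab lam unfolding layn_def c'_def by simp
    have inv1: "ninvn BS La Lv Rv Rb F i j" using rc.low_inv LR by (simp add: ninvn_def)
    have inv2: "ninvn BS Lv Lb Ra Rv lam (a - i) (b - j)"
     using rc.high_inv LR lam hab by (simp add: ninvn_def)
    define el where "el = e7(15 := Lv, 16 := Rv, 13 := i)"
    define er where "er = e7(14 := Lv, 17 := Rv, 18 := lam, 13 := a - i, 19 := T + c1)"
    have gl: "glob BS el" "glob BS er" using g1 e7v by (auto simp: glob_def el_def er_def)
    have nl: "node el La Lv Rv Rb F i T" "node er Lv Lb Ra Rv lam (a - i) (T + c1)"
     using e7v by (auto simp: node_def el_def er_def)
    have v1: "valley c (int i) (int j)" using valley_low[OF Suc.prems(10)] i by (simp add: j_def)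
    have v2: "valley c' (int (a - i)) (int (b - j))"
     using valley_high[OF Suc.prems(10), of "int i" "int j"] hab by (simp add: c'_def)
    have s1: "i + j = c1 * BS" using i by (simp add: j_def h_def)
    have s2: "(a - i) + (b - j) = c2 * BS"
    proof -
     have "(a - i) + (b - j) + (i + j) = tot" using i ab by (simp add: j_def)
     moreover have "tot = c1 * BS + c2 * BS" using cc by (simp add: tot_def add_mult_distrib[symmetric])
     ultimately show ?thesis using s1 by simp
    qed
    let ?M' = "max M0 (112 + 224 * W) + 224 * t"
    let ?A = "{La..<Lv} \<union> {Rv..<Rb}" and ?B = "{Lv..<Lb} \<union> {Ra..<Rv}"
    let ?k = "nl + 42 + 33 * BS" and ?x = "39 + 33 * BS"
    have I1: "tri ?A ?A ?M' (Pr self) el H1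
     (%H'. PP LP BS H' (blks BS La Lv Rv Rb) T c1 (vmset c (int i) (int j)))
     (c1 * ?k - ?x) (dl + 3 + t * (22 * W + 70))"
     by (rule Suc.IH[OF gl(1) nl(1) inv1 s1 cc(1,4) _ _ lay1 v1]) (use Suc.prems(7,8) cc in auto)
    have I2: "tri ?B ?B ?M' (Pr self) er H1
     (%H'. PP LP BS H' (blks BS Lv Lb Ra Rv) (T + c1) c2 (vmset c' (int (a - i)) (int (b - j))))
     (c2 * ?k - ?x) (dl + 3 + t * (22 * W + 70))"
     by (rule Suc.IH[OF gl(2) nl(2) inv2 s2 cc(2,5) _ _ lay2 v2]) (use Suc.prems(7,8) cc order in auto)
    have cl: "tri ?A ?A (112 + ?M') ?cl e7 H1
     (%H'. PP LP BS H' (blks BS La Lv Rv Rb) T c1 (vmset c (int i) (int j)))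
     (c1 * ?k - ?x + 4) (dl + 3 + t * (22 * W + 70) + 4)"
    proof (rule tri_wpI)
     have "wp ?A ?A (112 + ?M') (Call self) (%e' b' H' n' d'. n' <= c1 * ?k - ?x + 4 &
       d' <= dl + 3 + t * (22 * W + 70) + 4 & PP LP BS H' (blks BS La Lv Rv Rb) T c1 (vmset c (int i) (int j)))
       el [] H1 (Suc (Suc (Suc 0))) (Suc (Suc (Suc 0)))"
      by (rule wp_Call[OF I1]) auto
     then show "wp ?A ?A (112 + ?M') ?cl (%e' b' H' n' d'. n' <= c1 * ?k - ?x + 4 &
       d' <= dl + 3 + t * (22 * W + 70) + 4 & PP LP BS H' (blks BS La Lv Rv Rb) T c1 (vmset c (int i) (int j)))
       e7 [] H1 0 0"
      using e7v by (simp add: wp_Seq wp_Assign el_def)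
    qed
    have cr: "tri ?B ?B (112 + ?M') ?cr e7 H1
     (%H'. PP LP BS H' (blks BS Lv Lb Ra Rv) (T + c1) c2 (vmset c' (int (a - i)) (int (b - j))))
     (c2 * ?k - ?x + 6) (dl + 3 + t * (22 * W + 70) + 6)"
    proof (rule tri_wpI)
     have "wp ?B ?B (112 + ?M') (Call self) (%e' b' H' n' d'. n' <= c2 * ?k - ?x + 6 &
       d' <= dl + 3 + t * (22 * W + 70) + 6 &
       PP LP BS H' (blks BS Lv Lb Ra Rv) (T + c1) c2 (vmset c' (int (a - i)) (int (b - j))))
       er [] H1 (Suc (Suc (Suc (Suc (Suc 0))))) (Suc (Suc (Suc (Suc (Suc 0)))))"
      by (rule wp_Call[OF I2]) auto
     moreover have "a < 2 ^ w" "T + c1 < 2 ^ w" "h div BS = c1"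
      using totN ab Suc.prems(8) cc B0 by (auto intro!: small simp: h_def)
     ultimately show "wp ?B ?B (112 + ?M') ?cr (%e' b' H' n' d'. n' <= c2 * ?k - ?x + 6 &
       d' <= dl + 3 + t * (22 * W + 70) + 6 &
       PP LP BS H' (blks BS Lv Lb Ra Rv) (T + c1) c2 (vmset c' (int (a - i)) (int (b - j))))
       e7 [] H1 0 0"
      using e7v i by (simp add: wp_Seq wp_Assign er_def)
    qed
    have dvdn: "BS dvd Lv - La" "BS dvd Rv - Ra"
     using rc.dvds LR order dvd_diff_commute[of "int BS" "int Ra" "int Rv"] by (auto intro!: int_dvd_diff)
    note bs = blks_split[OF dvdn(1) order(1,2) dvdn(2) order(3,4) ord(2)]
    have blin: "{p..<p + BS} <= ?A" if "p \<in> blks BS La Lv Rv Rb" for p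
    proof -
     have dd: "p + BS <= u" if "l <= p" "p < u" "BS dvd p - l" "BS dvd u - l" for l u
     proof -
      have "BS dvd (u - l) - (p - l)" by (rule dvd_diff_nat[OF that(4,3)])
      then have "BS <= u - p" using that by (intro dvd_imp_le) auto
      then show ?thesis using that by linarith
     qed
     have "BS dvd Rb - Rv" using rc.dvds(2) LR order by (intro int_dvd_diff) auto
     then show ?thesis using that dd[of La Lv] dd[of Rv Rb] dvdn unfolding blks_def by auto
    qed
    have blin2: "{p..<p + BS} <= ?B" if "p \<in> blks BS Lv Lb Ra Rv" for p
    proof -
     have dd: "p + BS <= u" if "l <= p" "p < u" "BS dvd p - l" "BS dvd u - l" for l u
     proof -
      have "BS dvd (u - l) - (p - l)" by (rule dvd_diff_nat[OF that(4,3)])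
      then have "BS <= u - p" using that by (intro dvd_imp_le) auto
      then show ?thesis using that by linarith
     qed
     have "BS dvd Lb - Lv" using rc.dvds(3) LR order by (intro int_dvd_diff) auto
     then show ?thesis using that dd[of Lv Lb] dd[of Ra Rv] dvdn unfolding blks_def by auto
    qed
    show ?thesis
    proof (rule wp_Par[OF cl cr])
     show "?A <= ?Rg" "?A <= ?Rg" "?B <= ?Rg" "?B <= ?Rg" using order by auto
     show "?A \<inter> ?B = {}" "?B \<inter> ?A = {}" using order ord by auto
     fix Ha Hb H'
     assume a: "PP LP BS Ha (blks BS La Lv Rv Rb) T c1 (vmset c (int i) (int j))"
       "PP LP BS Hb (blks BS Lv Lb Ra Rv) (T + c1) c2 (vmset c' (int (a - i)) (int (b - j)))"
       "!!x. x \<in> ?A ==> H' x = Ha x" "!!x. x \<in> ?B ==> H' x = Hb x"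
     have p1: "PP LP BS H' (blks BS La Lv Rv Rb) T c1 (vmset c (int i) (int j))"
      by (rule PP_cong[OF a(1) _ loc]) (use blin a(3) in blast)
     have p2: "PP LP BS H' (blks BS Lv Lb Ra Rv) (T + c1) c2 (vmset c' (int (a - i)) (int (b - j)))"
      by (rule PP_cong[OF a(2) _ loc]) (use blin2 a(4) in blast)
     have "?post H'"
     proof -
      have m: "vmset c (int a) (int b) = vmset c (int i) (int j) + vmset c' (int (a - i)) (int (b - j))"
       unfolding c'_def hab by (rule vmset_split) (use i in \<open>auto simp: j_def\<close>)
      show ?thesis
       unfolding bs(1) m cc(3)[symmetric]
      proof (rule PP_join[OF p1 p2 bs(2)])
       fix x y assume "x \<in># vmset c (int i) (int j)" "y \<in># vmset c' (int (a - i)) (int (b - j))"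
       note xy = this[unfolded c'_def hab]
       have ib: "0 <= int i" "int i <= int a" "0 <= int j" "int j <= int b" using i by (auto simp: j_def)
       have s1: "c (int i - 1) <= c (- int j - 1)" if "0 < int i" "int j < int b"
        using sep(1) that by (simp add: j_def)
       have s2: "c (- int j) <= c (int i)" if "0 < int j" "int i < int a"
        using sep(2) that by (simp add: j_def)
       show "x <= y" by (rule vmset_split_le[OF Suc.prems(10) ib s1 s2 xy])
      qed
     qed
     moreover have "n7 + Suc (c1 * ?k - ?x + 4 + (c2 * ?k - ?x + 6)) <= ?n"
     proof -
      have "?x <= c1 * ?k" "?x <= c2 * ?k" using cc by (auto intro: order_trans[of _ ?k])
      moreover have "cnt * ?k = c1 * ?k + c2 * ?k" using cc by (simp add: add_mult_distrib[symmetric])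
      moreover have "12 * W + 21 * lam <= 33 * BS" using BS lam(2) by simp
      moreover have "n7 <= 12 * W + 21 * lam + 28" using n7(1) n2(1) by linarith
      ultimately show ?thesis by linarith
     qed
     moreover have "d7 + Suc (max (dl + 3 + t * (22 * W + 70) + 4) (dl + 3 + t * (22 * W + 70) + 6)) <= ?d"
      using n7(2) n2(2) by simp
     ultimately show "J e7 [] H' (n7 + Suc (c1 * ?k - ?x + 4 + (c2 * ?k - ?x + 6)))
      (d7 + Suc (max (dl + 3 + t * (22 * W + 70) + 4) (dl + 3 + t * (22 * W + 70) + 6)))"
      by (simp add: J_def)
    qed auto
   qed
   have lt: "lam <= 2 ^ W"
    using lam hBS totN NW by linarith
   have Bw: "BS < 2 ^ w" "og + i < 2 ^ w" "og + tot < 2 ^ w" "La + tot < 2 ^ w" "Ra + tot < 2 ^ w" "h < 2 ^ w"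
     "La + i < 2 ^ w" "La + i + lam < 2 ^ w" "Rb + lam < 2 ^ w" "F + j < 2 ^ w" "j <= og + tot" "0 < (2::nat) ^ w"
    using totN hBS ab i ord Suc.prems(7) lam FB jh by (auto intro!: small simp: og_def lR_def j_def)
   have ge: "F <= La + i + lam" "F + j <= Rb + lam"
    using rc.bounds rc.inv' lam by (linarith | simp add: rc.lR_def)+
   let ?t6 = "35 ::= V 14 [+] V 22 [+] V 34 [-] V 18 ;; 36 ::= V 17 [+] V 34 [-] (V 18 [+] V 33) ;;
    Par (?cl) (?cr)"
   have c6: "wp ?Rg ?Rg ?M (Call 1) (wp ?Rg ?Rg ?M ?t6 J) e6 [] H n6 d6"
    if n6: "n6 <= n2 + 12" "d6 <= d2 + 12" for n6 d6
   proof (rule wp_Call[OF swap_tri[where l = lam and x = X and y = Y and t = W]])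
    show "e6 3 = 0" "e6 4 = lam" "e6 5 = X" "e6 6 = Y" by (auto simp: e6_def e5_def)
    fix H1
    assume a: "\<forall>t<lam. H1 (X + t) = H (Y + t) & H1 (Y + t) = H (X + t)"
      "!!x. x \<notin> {X..<X + lam} \<union> {Y..<Y + lam} ==> H1 x = H x"
    have "wp ?Rg ?Rg ?M (Par (?cl) (?cr)) J e7 [] H1 (Suc (Suc (n6 + Suc (21 * lam + 2)))) (Suc (Suc (d6 + Suc (10 * W + 11))))"
     by (rule par[OF a]) (use n6 in auto)
    then show "wp ?Rg ?Rg ?M ?t6 J e6 [] H1 (n6 + Suc (21 * lam + 2)) (d6 + Suc (10 * W + 11))"
     using e7v Bw ge e2v
     by (simp add: wp_Seq wp_Assign e7_def e6_def e5_def Lv_def[symmetric] Rv_def[symmetric])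
   qed (use XYN lt XYdj XYin in auto)
   let ?t5 = "4 ::= V 34 ;; 3 ::= C 0 ;; Call 1 ;; ?t6"
   have a6: "wp ?Rg ?Rg ?M (adr 6) (wp ?Rg ?Rg ?M ?t5 J) (e5(26 := og + tot - j)) [] H n5 d5"
    if n5: "n5 <= n2 + 7" "d5 <= d2 + 7" for n5 d5
   proof (rule wp_adr[where tot = tot and lR = lR and La = La and Ra = Ra])
    have "wp ?Rg ?Rg ?M (Call 1) (wp ?Rg ?Rg ?M ?t6 J) e6 [] H (Suc (Suc (Suc (Suc (Suc n5))))) (Suc (Suc (Suc (Suc (Suc d5)))))"
     by (rule c6) (use n5 in auto)
    then show "wp ?Rg ?Rg ?M ?t5 J
     (e5(26 := og + tot - j, 32 := (e5(26 := og + tot - j)) 26 mod tot,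
      6 := adrv lR Ra La ((e5(26 := og + tot - j)) 26 mod tot))) [] H (Suc (Suc (Suc n5))) (Suc (Suc (Suc d5)))"
     using Bw by (simp add: wp_Seq wp_Assign e6_def e5_def Y_def)
   qed (use e2v t0 Bw in \<open>auto simp: e5_def\<close>)
   let ?t4 = "26 ::= V 29 [+] V 25 [-] V 33 ;; adr 6 ;; ?t5"
   have a5: "wp ?Rg ?Rg ?M (adr 5) (wp ?Rg ?Rg ?M ?t4 J) (e2(33 := j, 34 := lam, 26 := og + i)) [] H n4 d4"
    if n4: "n4 <= n2 + 3" "d4 <= d2 + 3" for n4 d4
   proof (rule wp_adr[where tot = tot and lR = lR and La = La and Ra = Ra])
    let ?e = "e2(33 := j, 34 := lam, 26 := og + i)"
    have "wp ?Rg ?Rg ?M (adr 6) (wp ?Rg ?Rg ?M ?t5 J) (e5(26 := og + tot - j)) [] H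
     (Suc (Suc (Suc (Suc n4)))) (Suc (Suc (Suc (Suc d4))))"
     by (rule a6) (use n4 in auto)
    moreover have "?e(32 := ?e 26 mod tot, 5 := adrv lR Ra La (?e 26 mod tot)) = e5"
     by (simp add: e5_def X_def)
    ultimately show "wp ?Rg ?Rg ?M ?t4 J (?e(32 := ?e 26 mod tot, 5 := adrv lR Ra La (?e 26 mod tot))) [] H
     (Suc (Suc (Suc n4))) (Suc (Suc (Suc d4)))"
     using Bw e2v by (simp add: wp_Seq wp_Assign e5_def)
   qed (use e2v t0 Bw in auto)
   have "wp ?Rg ?Rg ?M (adr 5) (wp ?Rg ?Rg ?M ?t4 J) (e2(33 := j, 34 := lam, 26 := og + i)) [] H
    (Suc (Suc (Suc n2))) (Suc (Suc (Suc d2)))"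
    by (rule a5) auto
   moreover have "(og + i) mod BS <= BS" using B0 by (simp add: less_imp_le)
   ultimately show ?thesis
    using Bw e2v i(2) lamv by (simp add: wp_Seq wp_Assign j_def)
  qed
  have ct: "wp ?Rg ?Rg ?M cut (wp ?Rg ?Rg ?M ?tl J) e1 [] H (Suc (Suc (Suc 0))) (Suc (Suc (Suc 0)))"
  proof (rule wp_cut[where a = a and La = La and Ra = Ra and Rb = Rb and F = F and h = h and bb = b and c = c])
   show "layout H (int La) (int Rb) (int F) (int Rb - int Ra) (int a + int b) c (int a) (int b)"
    using Suc.prems(9) by (simp add: layn_def)
   show "cell_of (int La) (int Rb) (int F) (int Rb - int Ra) (int a + int b) z \<in> ?Rg"
    if "- int b <= z" "z < int a" for z
    using cell_range[OF inv that] by simp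
  next
   fix e' n' d' i
   assume "i <= a" "i <= h" "h - i <= b"
    "0 < i ==> h - i < b ==> c (int i - 1) <= c (- int (h - i) - 1)"
    "0 < h - i ==> i < a ==> c (- int (h - i)) <= c (int i)"
    "e' 22 = i" "e' 28 = Rb - Ra" "e' 29 = Rb - Ra + (a + b) - F"
    "!!r. r < 22 \<or> r = 25 \<or> 32 < r ==> e' r = e1 r"
    "n' <= Suc (Suc (Suc 0)) + 12 * W + 8" "d' <= Suc (Suc (Suc 0)) + 12 * W + 8"
   then show "wp ?Rg ?Rg ?M ?tl J e' [] H n' d'"
    by (intro main) (assumption | simp)+
  qed (use e1 ab hBS ord Suc.prems(7) totN Fle in auto)
  have "tri ?Rg ?Rg ?M (purify self leaf) e H ?post ?n ?d"
  proof (rule tri_wpI)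
   have "tot div BS = cnt" using B0 by (simp add: tot_def)
   moreover have "BS < tot" using hBS B0 by linarith
   moreover have "Lb < 2 ^ w" "Rb < 2 ^ w" "tot < 2 ^ w" "h < 2 ^ w" "2 < (2::nat) ^ w"
    using totN hBS ord Suc.prems(7) by (auto intro!: small)
   ultimately have "wp ?Rg ?Rg ?M (purify self leaf) J e [] H 0 0"
    unfolding purify_def using ct Suc.prems(1,2) ord lens
    by (simp add: wp_Seq wp_Assign wp_If glob_def node_def e1_def c1_def[symmetric] h_def[symmetric])
   then show "wp ?Rg ?Rg ?M (purify self leaf) (%e' b' H' n' d'. n' <= ?n & d' <= ?d & ?post H') e [] H 0 0"
    by (simp add: J_def)
  qed
  then show ?thesis unfolding ps .
 qed
qed

end

section \<open>One level of the scheme: leaves, remainder and in-place permutation\<close>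

definition buf :: com where
 "buf = 37 ::= V 11 ;; 38 ::= V 12 ;; 39 ::= V 13 ;; bufsort"

definition leaf0 :: com where
 "leaf0 = If (V 14) (V 15) (11 ::= V 14) (11 ::= V 16) ;; 12 ::= V 20 ;;
   13 ::= (V 13 [+] V 20 [-] V 18) [mod] V 20 ;; Call 3 ;; 7 ::= V 11 ;; 8 ::= V 19 ;; wr"

text \<open>All positions below register 13 are settled. A block whose rank is greater is swapped to
  its home; otherwise it is at home, its word is erased and the scan advances.\<close>

definition perm0 :: com where
 "perm0 = 13 ::= C 0 ;; While (V 13) (V 12)
  (7 ::= V 14 [+] V 13 [*] V 20 ;; rd ;;
  If (V 13) (V 8)
   (3 ::= C 0 ;; 4 ::= V 20 ;; 5 ::= V 7 ;; 6 ::= V 14 [+] V 8 [*] V 20 ;; Call 1)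
   (clr ;; 13 ::= V 13 [+] C 1))"

text \<open>The length need not be a multiple of the block size. The \<open>l mod BS\<close> least
  elements are therefore cut off, gathered at the front and left to the solver \<open>lid\<close>.
  What remains is a ring with offset \<open>j\<close>, whose interval \<open>L\<close> has the
  length in register 34 and \<open>R\<close> follows it immediately.\<close>

definition solve :: "nat => nat => nat => nat => com" where
 "solve qr lid pid mid =
  20 ::= V qr ;;
  If (V 12) (V 20) (Call lid)
   (21 ::= V 12 [mod] V 20 ;; 14 ::= V 11 ;; 15 ::= V 11 [+] V 12 ;; 16 ::= V 15 ;; 17 ::= V 15 ;;
   18 ::= C 0 ;; 25 ::= V 12 ;; cut ;;
   33 ::= V 21 [-] V 22 ;; 3 ::= C 0 ;; 4 ::= V 33 ;; 5 ::= V 11 [+] V 22 ;; 6 ::= V 15 [-] V 33 ;; Call 1 ;;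
   34 ::= V 13 [-] V 22 ;; 35 ::= V 12 ;; 12 ::= V 21 ;; 13 ::= V 22 ;; Call lid ;;
   13 ::= V 34 ;; 14 ::= V 11 [+] V 21 ;; 18 ::= V 33 ;;
   If (V 13) (V 18) (34 ::= C 0) (34 ::= (V 13 [-] V 18 [+] V 20 [-] C 1) [div] V 20 [*] V 20) ;;
   15 ::= V 14 [+] V 34 ;; 16 ::= V 15 ;; 19 ::= C 0 ;; Call pid ;;
   12 ::= V 35 [div] V 20 ;; Call mid)"

lemma nth_concat_blocks:
 assumes "!!y. y < k ==> length (Xs y) = BS" "x < k" "i < BS"
 shows "concat (map Xs [0..<k]) ! (x * BS + i) = Xs x ! i" "length (concat (map Xs [0..<k])) = k * BS"
proof -
 have l: "length (concat (map Xs [0..<m])) = m * BS" if "m <= k" for m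
  using that assms(1) by (induction m) auto
 then show "length (concat (map Xs [0..<k])) = k * BS" by simp
 have "[0..<k] = [0..<x] @ x # [Suc x..<k]"
  using assms(2) by (metis le0 less_imp_le upt_add_eq_append upt_conv_Cons le_add_diff_inverse)
 then have "concat (map Xs [0..<k]) = concat (map Xs [0..<x]) @ Xs x @ concat (map Xs [Suc x..<k])"
  by simp
 then show "concat (map Xs [0..<k]) ! (x * BS + i) = Xs x ! i"
  using l[of x] assms by (simp add: nth_append)
qed

definition inp :: "(nat => 'a :: linorder cell) => nat => nat => (int => 'a) => nat => bool" where
 "inp H p l c a \<longleftrightarrow> a <= l & valley c (int a) (int l - int a) &
   (\<forall>x<l. H (p + x) = Elem (c (if x < a then int x else int x - int l)))"

definition outp :: "(nat => 'a :: linorder cell) => nat => nat => 'a multiset => bool" where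
 "outp H p l ms \<longleftrightarrow> (\<exists>xs. sorted xs & length xs = l & mset xs = ms & (\<forall>i<l. H (p + i) = Elem (xs ! i)))"

text \<open>\<open>D x\<close> is the rank stored in the block at position \<open>x\<close>, hence
  the position where this block belongs.\<close>

definition perm_state :: "((nat => 'a cell) => nat => 'a list => nat => bool) => nat => (nat => 'a :: linorder cell)
  => nat => nat => (nat => 'a list) => (nat => nat) => bool" where
 "perm_state LP BS H base k Xs D \<longleftrightarrow> bij_betw D {..<k} {..<k} &
   (\<forall>x<k. LP H (base + x * BS) (Xs (D x)) (D x)) & (\<forall>x<k. length (Xs x) = BS) &
   sorted (concat (map Xs [0..<k]))"

text \<open>When the blocks form one array, the stored ranks are the inverse of the placement
  \<open>f\<close>, read along the positions.\<close>

lemma PP_perm: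
 assumes "PP LP BS H {base + x * BS |x. x < k} 0 k ms" "0 < BS"
 obtains D Xs where "perm_state LP BS H base k Xs D" "mset (concat (map Xs [0..<k])) = ms"
proof -
 obtain f Xs where f: "bij_betw f {..<k} {base + x * BS |x. x < k}"
   "!!t. t < k ==> LP H (f t) (Xs t) t & length (Xs t) = BS"
   "sorted (concat (map Xs [0..<k]))" "mset (concat (map Xs [0..<k])) = ms"
  using assms(1) unfolding PP_def by auto
 have g: "bij_betw (%x. base + x * BS) {..<k} {base + x * BS |x. x < k}"
  using assms(2) by (auto simp: bij_betw_def inj_on_def)
 define D where "D = the_inv_into {..<k} f \<circ> (%x. base + x * BS)"
 have bD: "bij_betw D {..<k} {..<k}"
  unfolding D_def by (rule bij_betw_trans[OF g bij_betw_the_inv_into[OF f(1)]])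
 have "f (D x) = base + x * BS" if "x < k" for x
  unfolding D_def comp_def using f(1) that by (intro f_the_inv_into_f_bij_betw[of _ "{..<k}"]) auto
 moreover have "D x < k" if "x < k" for x using bD that by (auto simp: bij_betw_def)
 ultimately have "LP H (base + x * BS) (Xs (D x)) (D x)" if "x < k" for x
  using f(2)[of "D x"] that by metis
 then show ?thesis using that[of Xs D] bD f unfolding perm_state_def by blast
qed

lemma outp_concat:
 assumes "sorted (concat (map Xs [0..<k]))" "!!x. x < k ==> length (Xs x) = BS" "0 < BS"
  and "!!x i. x < k ==> i < BS ==> H (base + x * BS + i) = Elem (Xs x ! i)"
 shows "outp H base (k * BS) (mset (concat (map Xs [0..<k])))"
 unfolding outp_def
proof (intro exI[of _ "concat (map Xs [0..<k])"] conjI assms(1) refl allI impI)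
 have ll: "length (concat (map Xs [0..<m])) = m * BS" if "m <= k" for m
  using that assms(2) by (induction m) auto
 then show "length (concat (map Xs [0..<k])) = k * BS" by simp
 fix i assume "i < k * BS"
 then have i: "i div BS < k" "i mod BS < BS" "i = i div BS * BS + i mod BS"
  using assms(3) by (auto simp: less_mult_imp_div_less)
 have "concat (map Xs [0..<k]) ! i = Xs (i div BS) ! (i mod BS)"
  using nth_concat_blocks(1)[of k Xs BS "i div BS" "i mod BS", OF assms(2) i(1,2)] i(3) by simp
 moreover have "H (base + i) = Elem (Xs (i div BS) ! (i mod BS))"
  using assms(4)[OF i(1,2)] by (simp add: add.assoc)
 ultimately show "H (base + i) = Elem (concat (map Xs [0..<k]) ! i)" by simp
qed

lemma vmset_nat:
 assumes "a + b = l"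
 shows "image_mset (%x. c (int x - int b)) (mset_set {0..<l}) = vmset c (int a) (int b)"
proof -
 have "image_mset (%x. int x - int b) (mset_set {0..<l}) = mset_set {- int b..<int a}"
 proof (subst image_mset_mset_set)
  show "inj_on (%x. int x - int b) {0..<l}" by (auto simp: inj_on_def)
  have "z \<in> (%x. int x - int b) ` {0..<l}" if "- int b <= z" "z < int a" for z
   using that assms by (intro image_eqI[of _ _ "nat (z + int b)"]) auto
  then have "(%x. int x - int b) ` {0..<l} = {- int b..<int a}"
   using assms by auto
  then show "mset_set ((%x. int x - int b) ` {0..<l}) = mset_set {- int b..<int a}" by simp
 qed
 then show ?thesis
  unfolding vmset_def by (metis (no_types) comp_def multiset.map_comp image_mset_cong)
qed

text \<open>Left of the seam the sequence descends, so the left end is an upper bound; right of it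
  the right end is.\<close>

lemma valley_max:
 assumes "valley c (int a) (int b)" "a + b = l" "x <= y" "y <= z" "z < l"
 shows "c (int y - int b) <= max (c (int x - int b)) (c (int z - int b))"
proof (cases "y < b")
 case True
 then have "c (int y - int b) <= c (int x - int b)"
  using assms unfolding valley_def by auto
 then show ?thesis by (simp add: le_max_iff_disj)
next
 case False
 then have "c (int y - int b) <= c (int z - int b)"
  using assms unfolding valley_def by auto
 then show ?thesis by (simp add: le_max_iff_disj)
qed

context prog
begin

text \<open>The measure is an argument of the invariant here, as it may depend on objects that are
  not in any register, such as the permutation carried out by the loop.\<close>

lemma wp_While_ix:
 fixes m :: nat
 assumes "I m e b H n d"
  and step: "!!m e b H n d. I m e b H n d ==> length b <= M & ok w e a & ok w e a' &
   (if val e a < val e a'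
    then wp R U M c (%e' b' H' n' d'. \<exists>m'<m. I m' e' b' H' n' d') e b H (Suc n) (Suc d)
    else Q e b H (Suc n) (Suc d))"
 shows "wp R U M (While a a' c) Q e b H n d"
 using assms(1)
proof (induction m arbitrary: e b H n d rule: less_induct)
 case (less m)
 show ?case
 proof (cases "val e a < val e a'")
  case False
  then show ?thesis
   using step[OF less.prems] run_While_False[of b M w e a a' Pr R U c H] unfolding wp_def by force
 next
  case True
  then obtain e1 b1 H1 n1 d1 m1 where 1: "run w Pr R U M c e b H e1 b1 H1 n1 d1"
   "I m1 e1 b1 H1 (Suc n + n1) (Suc d + d1)" "m1 < m" "length b <= M" "ok w e a" "ok w e a'"
   using step[OF less.prems] unfolding wp_def by auto
  from less.IH[OF 1(3,2)] obtain e2 b2 H2 n2 d2 where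
   "run w Pr R U M (While a a' c) e1 b1 H1 e2 b2 H2 n2 d2"
   "Q e2 b2 H2 (Suc n + n1 + n2) (Suc d + d1 + d2)"
   unfolding wp_def by auto
  then show ?thesis
   using run_While_True[OF 1(4-6) True 1(1)] unfolding wp_def by (metis add.assoc add_Suc add_Suc_right)
 qed
qed

end

locale alg3 = alg2 +
 assumes P3: "Pr 3 = buf"
begin

text \<open>The common specification of the solvers: procedure \<open>pr\<close> turns every valley
  of fewer than \<open>L\<close> elements into sorted order, with work \<open>f l\<close> and depth
  \<open>d\<close>.\<close>

definition sol_ok :: "'a :: linorder itself => nat => nat => nat => (nat => nat) => nat => bool" where
 "sol_ok _ L pr M f d \<longleftrightarrow> (\<forall>e p l a (c :: int => 'a) H.
   e 0 = W --> e 1 = 2 * W + 3 --> e 2 = (2 * W + 3) * (2 * W + 3) --> e 11 = p --> e 12 = l --> e 13 = a -->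
   l < L --> p + l <= N --> inp H p l c a -->
   tri {p..<p + l} {p..<p + l} M (Pr pr) e H (%H'. outp H' p l (vmset c (int a) (int l - int a))) (f l) d)"

lemma sol_okD:
 fixes c :: "int => 'a :: linorder"
 assumes "sol_ok TYPE('a) L pr M f d" "e 0 = W" "e 1 = 2 * W + 3" "e 2 = (2 * W + 3) * (2 * W + 3)"
  "e 11 = p" "e 12 = l" "e 13 = a" "l < L" "p + l <= N" "inp H p l c a"
 shows "tri {p..<p + l} {p..<p + l} M (Pr pr) e H (%H'. outp H' p l (vmset c (int a) (int l - int a))) (f l) d"
 using assms unfolding sol_ok_def by blast

lemma buf_tri:
 fixes c :: "int => 'a :: linorder"
 assumes e: "e 11 = p" "e 12 = l" "e 13 = o'" and b: "p + l <= N" "o' <= N" and M: "l <= M"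
  and ab: "a + b = l" and v: "valley c (int a) (int b)"
  and u: "!!x. x < l ==> H (p + (o' + x) mod l) = Elem (c (int x - int b))"
 shows "tri {p..<p + l} {p..<p + l} M (Pr 3) e H (%H'. outp H' p l (vmset c (int a) (int b))) (9 * l + 11) (9 * l + 11)"
 unfolding P3
proof (rule tri_wpI)
 define e1 where "e1 = e(37 := p, 38 := l, 39 := o')"
 have "wp {p..<p + l} {p..<p + l} M bufsort
   (%e' b' H' n' d'. n' <= 9 * l + 11 & d' <= 9 * l + 11 & outp H' p l (vmset c (int a) (int b))) e1 [] H
   (Suc (Suc (Suc 0))) (Suc (Suc (Suc 0)))"
 proof (rule wp_tri[OF bufsort_tri[where u = "%x. c (int x - int b)" and p = p and l = l and o' = o' and M = M]])
  show "c (int y - int b) <= max (c (int x - int b)) (c (int z - int b))" if "x <= y" "y <= z" "z < l" for x y z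
   by (rule valley_max[OF v ab that])
 qed (use b M u vmset_nat[OF ab, of c] in \<open>auto simp: e1_def outp_def\<close>)
 moreover have "p < 2 ^ w" "l < 2 ^ w" "o' < 2 ^ w" using b by (auto intro!: small)
 ultimately show "wp {p..<p + l} {p..<p + l} M buf
   (%e' b' H' n' d'. n' <= 9 * l + 11 & d' <= 9 * l + 11 & outp H' p l (vmset c (int a) (int b))) e [] H 0 0"
  unfolding buf_def by (simp add: wp_Seq wp_Assign e e1_def)
qed

text \<open>The bottom of both levels. The least index \<open>- b\<close> of the valley is at cell
  \<open>a\<close>, so the array is the valley rotated by \<open>a\<close>.\<close>

lemma buf_sol: "sol_ok TYPE('a :: linorder) L 3 L (%l. 9 * l + 11) (9 * L + 11)"
 unfolding sol_ok_def
proof (intro allI impI)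
 fix e :: "nat => nat" and p l a :: nat and c :: "int => 'a" and H :: "nat => 'a cell"
 assume e: "e 0 = W" "e 1 = 2 * W + 3" "e 2 = (2 * W + 3) * (2 * W + 3)" "e 11 = p" "e 12 = l" "e 13 = a"
  and l: "l < L" "p + l <= N" and i: "inp H p l c a"
 have al: "a <= l" and v: "valley c (int a) (int (l - a))" using i by (auto simp: inp_def of_nat_diff)
 have "tri {p..<p + l} {p..<p + l} L (Pr 3) e H (%H'. outp H' p l (vmset c (int a) (int (l - a)))) (9 * l + 11) (9 * l + 11)"
 proof (rule buf_tri[OF e(4-6)])
  fix x assume x: "x < l"
  show "H (p + (a + x) mod l) = Elem (c (int x - int (l - a)))"
  proof (cases "a + x < l")
   case True
   then have "H (p + (a + x)) = Elem (c (if a + x < a then int (a + x) else int (a + x) - int l))"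
    using i unfolding inp_def by blast
   then show ?thesis using True al by (simp add: of_nat_diff algebra_simps)
  next
   case False
   then have m: "(a + x) mod l = a + x - l" using x al by (simp add: mod_if)
   have lt: "a + x - l < a" "a + x - l < l" using x False al by linarith+
   have "H (p + (a + x - l)) = Elem (c (if a + x - l < a then int (a + x - l) else int (a + x - l) - int l))"
    using i lt unfolding inp_def by blast
   moreover have "int (a + x - l) = int x - int (l - a)" using False al x by (simp add: of_nat_diff)
   ultimately show ?thesis using m lt by simp
  qed
 qed (use l al v in auto)
 then show "tri {p..<p + l} {p..<p + l} L (Pr 3) e H (%H'. outp H' p l (vmset c (int a) (int l - int a))) (9 * l + 11) (9 * L + 11)"
  using al l by (auto elim!: tri_mono simp: of_nat_diff)
qed

abbreviation q where "q \<equiv> 2 * W + 3"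

definition LP0 :: "(nat => 'a :: linorder cell) => nat => 'a list => nat => bool" where
 "LP0 H p xs t = grp W H p xs (Some t)"

lemma LP0_loc: "LP0 H p xs t ==> (!!a. a \<in> {p..<p + q} ==> H' a = H a) ==> LP0 H' p xs t"
 unfolding LP0_def by (erule grp_cong) auto

text \<open>In a leaf the valley starts at offset \<open>a - F\<close> of the block, with
  \<open>BS\<close> added so that the program can subtract.\<close>

lemma leaf_cell:
 fixes c :: "int => 'a :: linorder"
 assumes inv: "ninvn BS La Lb Ra Rb F a b" and ab: "a + b = BS" and lay: "layn H La Ra Rb F c a b"
  and p: "p = (if La < Lb then La else Ra)" and x: "x < BS"
 shows "H (p + ((a + BS - F) mod BS + x) mod BS) = Elem (c (int x - int b))"
proof -
 have i: "ninv (int BS) (int La) (int Lb) (int Ra) (int Rb) (int F) (int a) (int b)" using inv by (simp add: ninvn_def)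
 have F: "F < BS" using i by (auto simp: ninv_def)
 have "H (cell_of (int La) (int Rb) (int F) (int Rb - int Ra) (int BS) (- int b + int x)) = Elem (c (- int b + int x))"
 proof -
  have "- int b <= - int b + int x" "- int b + int x < int a" "int a + int b = int BS" using ab x by linarith+
  then show ?thesis using lay unfolding layn_def layout_def by metis
 qed
 moreover have "cell_of (int La) (int Rb) (int F) (int Rb - int Ra) (int BS) (- int b + int x)
   = nat (int p + (int a - int F + int x) mod int BS)"
  using single_block(1)[OF i, of "int x"] ab x p by simp
 moreover have "nat (int p + (int a - int F + int x) mod int BS) = p + ((a + BS - F) mod BS + x) mod BS"
 proof -
  have "((a + BS - F) mod BS + x) mod BS = (a + BS - F + x) mod BS" by (simp add: mod_simps)
  moreover have "int ((a + BS - F + x) mod BS) = (int a - int F + int x) mod int BS"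
  proof -
   have "int ((a + BS - F + x) mod BS) = (int a - int F + int x + int BS) mod int BS"
    using F by (simp add: zmod_int of_nat_diff algebra_simps)
   then show ?thesis by simp
  qed
  ultimately show ?thesis by (metis int_ops(5) nat_int)
 qed
 ultimately show ?thesis by simp
qed

lemma leaf_range:
 assumes "ninvn BS La Lb Ra Rb F a b" "a + b = BS" "p = (if La < Lb then La else Ra)"
 shows "p + BS <= Rb" "F < BS" "0 < BS"
proof -
 have i: "ninv (int BS) (int La) (int Lb) (int Ra) (int Rb) (int F) (int a) (int b)" using assms by (simp add: ninvn_def)
 then show "F < BS" "0 < BS" by (auto simp: ninv_def)
 show "p + BS <= Rb"
  using single_block(2,3)[OF i, of 0] assms i by (auto simp: ninv_def split: if_splits)
qed

lemma leaf0_ok: "leaf_ok q (LP0 :: (nat => 'a :: linorder cell) => _) leaf0 (115 + 2 * W) (26 * W + 60) (26 * W + 60)"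
 unfolding leaf_ok_def
proof (intro allI impI)
 fix e :: "nat => nat" and La Lb Ra Rb F a b T :: nat and c :: "int => 'a" and H :: "nat => 'a cell" and p :: nat
 assume g: "glob q e" and nd: "node e La Lb Ra Rb F a T" and inv: "ninvn q La Lb Ra Rb F a b" and ab: "a + b = q"
  and Rb: "Rb <= N" and T: "T < N" and lay: "layn H La Ra Rb F c a b" and v: "valley c (int a) (int b)"
  and p: "p = (if La < Lb then La else Ra)"
 note lr = leaf_range[OF inv ab p]
 let ?R = "{p..<p + q}"
 define J where "J = (%(e' :: nat => nat) (b' :: 'a cell list) H' n' d'. n' <= 26 * W + 60 & d' <= 26 * W + 60 &
  (\<exists>xs. LP0 H' p xs T & sorted xs & length xs = q & mset xs = vmset c (int a) (int b)))"
 define o' where "o' = (a + q - F) mod q"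
 have o': "o' < q" by (simp add: o'_def)
 have N: "q <= N" "p + q <= N" using lr Rb by auto
 define e1 where "e1 = e(11 := p, 12 := q, 13 := o')"
 have c3: "wp ?R ?R (115 + 2 * W) (Call 3) (wp ?R ?R (115 + 2 * W) (7 ::= V 11 ;; 8 ::= V 19 ;; wr) J) e1 [] H (Suc (Suc (Suc (Suc 0)))) (Suc (Suc (Suc (Suc 0))))"
 proof (rule wp_Call[OF buf_tri[where c = c and a = a and b = b and p = p and l = q and o' = o' and M = q]])
  show "H (p + (o' + x) mod q) = Elem (c (int x - int b))" if "x < q" for x
   unfolding o'_def by (rule leaf_cell[OF inv ab lay p that])
  fix H' assume "outp H' p q (vmset c (int a) (int b))"
  then obtain xs where xs: "sorted xs" "length xs = q" "mset xs = vmset c (int a) (int b)" "\<forall>i<q. H' (p + i) = Elem (xs ! i)"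
   unfolding outp_def by blast
  define e2 where "e2 = e1(7 := p, 8 := T)"
  have gl: "e2 0 = W" "e1 11 = p" "e1 19 = T" using g nd by (auto simp: e2_def e1_def glob_def node_def)
  have "wp ?R ?R (115 + 2 * W) wr J e2 [] H' (Suc (Suc (Suc (Suc (Suc (Suc 0))) + Suc (9 * q + 11))))
   (Suc (Suc (Suc (Suc (Suc (Suc 0))) + Suc (9 * q + 11))))"
  proof (rule wp_wr[where p = p and v = T and vo = None and xs = xs])
   show "grp W H' p xs None" using xs(4) by (simp add: grp_None_iff)
   show "p + q < 2 ^ w" using N by (intro small) simp
  qed (use gl xs T NW in \<open>auto simp: e2_def J_def LP0_def\<close>)
  moreover have "p < 2 ^ w" "T < 2 ^ w" using N T by (auto intro!: small)
  ultimately show "wp ?R ?R (115 + 2 * W) (7 ::= V 11 ;; 8 ::= V 19 ;; wr) J e1 [] H'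
   (Suc (Suc (Suc (Suc 0))) + Suc (9 * q + 11)) (Suc (Suc (Suc (Suc 0))) + Suc (9 * q + 11))"
   using gl by (simp add: wp_Seq wp_Assign e2_def)
 qed (use N o' ab v in \<open>auto simp: e1_def\<close>)
 have "La < 2 ^ w" "Lb < 2 ^ w" "Ra < 2 ^ w" "q < 2 ^ w" "a + q < 2 ^ w" "F <= a + q"
  using N lr inv Rb ab by (auto intro!: small simp: ninvn_def ninv_def)
 then have "wp ?R ?R (115 + 2 * W) leaf0 J e [] H 0 0"
  using c3 g nd unfolding leaf0_def
  by (cases "La < Lb") (simp_all add: wp_Seq wp_If wp_Assign e1_def glob_def node_def p o'_def)
 then show "tri ?R ?R (115 + 2 * W) leaf0 e H
   (%H'. \<exists>xs. LP0 H' p xs T & sorted xs & length xs = q & mset xs = vmset c (int a) (int b)) (26 * W + 60) (26 * W + 60)"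
  unfolding J_def by (rule tri_wpI)
qed

end

lemma sorted_block:
 assumes "sorted (concat (map Xs [0..<k]))" "x < k"
 shows "sorted (Xs x)"
proof -
 have "[0..<k] = [0..<x] @ x # [Suc x..<k]"
  using assms(2) by (metis le0 less_imp_le upt_add_eq_append upt_conv_Cons le_add_diff_inverse)
 with assms(1) show ?thesis by (simp add: sorted_append)
qed

lemma block_eq:
 assumes "y * BS + i \<in> {x * BS..<x * BS + BS}" "i < (BS :: nat)"
 shows "y = x"
proof -
 have "(y * BS + i) div BS = y" using assms(2) by simp
 moreover have "(y * BS + i) div BS = x" using assms by (intro div_nat_eqI) (auto simp: mult.commute)
 ultimately show ?thesis by simp
qed

context alg3
begin

definition perm_ok :: "nat => ((nat => 'a :: linorder cell) => nat => 'a list => nat => bool) => nat => nat => nat => nat => nat => bool" where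
 "perm_ok BS LP L pr M K d \<longleftrightarrow> (\<forall>e base k Xs D H. glob BS e --> e 14 = base --> e 12 = k --> k * BS < L -->
   1 <= k --> base + k * BS <= N --> perm_state LP BS H base k Xs D -->
   tri {base..<base + k * BS} {base..<base + k * BS} M (Pr pr) e H
    (%H'. outp H' base (k * BS) (mset (concat (map Xs [0..<k])))) (K * (k * BS)) d)"

text \<open>The measure adds the unsettled positions and the misplaced blocks. A swap brings one
  block home for good, and an erasure advances the scan, so there are at most \<open>2 * k\<close>
  rounds; each costs at most \<open>26 * q\<close>, the larger part of it for moving a
  block.\<close>

lemma perm0_ok:
 assumes P8: "Pr 8 = perm0"
 shows "perm_ok q (LP0 :: (nat => 'a :: linorder cell) => _) (q * q + 1) 8 (112 + 224 * W) 53 (53 * (q * q))"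
 unfolding perm_ok_def
proof (intro allI impI)
 fix e :: "nat => nat" and base k :: nat and Xs :: "nat => 'a list" and D0 :: "nat => nat" and H :: "nat => 'a cell"
 assume g: "glob q e" "e 14 = base" "e 12 = k" and k: "k * q < q * q + 1" "1 <= k" "base + k * q <= N"
  and st: "perm_state LP0 q H base k Xs D0"
 let ?R = "{base..<base + k * q}" and ?M = "112 + 224 * W"
 let ?ms = "mset (concat (map Xs [0..<k]))"
 define c where "c = 26 * q"
 define J where "J = (%(e' :: nat => nat) (b' :: 'a cell list) H' n' d'. n' <= 53 * (k * q) & d' <= 53 * (q * q) &
  outp H' base (k * q) ?ms)"
 define mis where "mis D = card {y \<in> {..<k}. D y ~= (y :: nat)}" for D
 define I where "I m e' b' H' n' d' \<longleftrightarrow> (\<exists>D x. bij_betw D {..<k} {..<k} & x <= k & e' 13 = x &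
   (\<forall>r\<in>{0,12,14,20}. e' r = e r) & b' = [] & (\<forall>y<x. D y = y) &
   (\<forall>y<k. grp W H' (base + y * q) (Xs (D y)) (if y < x then None else Some (D y))) &
   m = (k - x) + mis D & n' + m * c <= 2 + 2 * k * c & d' + m * c <= 2 + 2 * k * c)"
  for m and e' :: "nat => nat" and b' :: "'a cell list" and H' n' d'
 have len: "length (Xs x) = q" "sorted (Xs x)" if "x < k" for x
  using st that sorted_block[of Xs k x] by (auto simp: perm_state_def)
 have "k * 1 <= k * q" by (intro mult_le_mono) auto
 then have kN: "k <= N" "k * q <= N" using k(3) by linarith+
 have c0: "0 < k * c" "k * c = 26 * (k * q)" using k(2) by (auto simp: c_def)
 let ?sw = "3 ::= C 0 ;; 4 ::= V 20 ;; 5 ::= V 7 ;; 6 ::= V 14 [+] V 8 [*] V 20 ;; Call 1"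
 let ?body = "7 ::= V 14 [+] V 13 [*] V 20 ;; rd ;;
  If (V 13) (V 8) (?sw) (clr ;; 13 ::= V 13 [+] C 1)"
 have bound: "base + x * q + q <= base + k * q" if "x < k" for x
  using mult_le_mono1[of "Suc x" k q] that by simp
 have loop: "wp ?R ?R ?M (While (V 13) (V 12) ?body) J (e(13 := 0)) [] H (Suc 0) (Suc 0)"
 proof (rule wp_While_ix[where I = I and m = "k + mis D0"])
  have "mis D0 <= k" unfolding mis_def by (rule order_trans[OF card_mono[of "{..<k}"]]) auto
  then have "(k + mis D0) * c <= 2 * k * c" by (intro mult_le_mono1) simp
  then have "Suc 0 + (k + mis D0) * c <= 2 + 2 * k * c" by linarith
  then show "I (k + mis D0) (e(13 := 0)) [] H (Suc 0) (Suc 0)"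
   unfolding I_def using st by (intro exI[of _ D0] exI[of _ 0]) (auto simp: perm_state_def LP0_def)
 next
  fix m e' b' H' n' d' assume "I m e' b' H' n' d'"
  then obtain D x where D: "bij_betw D {..<k} {..<k}" and x: "x <= k" "e' 13 = x"
   and er: "!!r. r \<in> {0,12,14,20} ==> e' r = e r" and b: "b' = []" and home: "!!y. y < x ==> D y = y"
   and gr: "!!y. y < k ==> grp W H' (base + y * q) (Xs (D y)) (if y < x then None else Some (D y))"
   and m: "m = (k - x) + mis D" and nd: "n' + m * c <= 2 + 2 * k * c" "d' + m * c <= 2 + 2 * k * c"
   unfolding I_def by blast
  have ev: "e' 0 = W" "e' 12 = k" "e' 14 = base" "e' 20 = q" using er g by (auto simp: glob_def)
  have inj: "D y = D z ==> y < k ==> z < k ==> y = z" for y z using D by (auto simp: bij_betw_def inj_on_def)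
  have Dk: "D y < k" if "y < k" for y using D that by (auto simp: bij_betw_def)
  have kk: "x < 2 ^ w" "k < 2 ^ w" "x * q < 2 ^ w" "base + x * q < 2 ^ w"
  proof -
   have "x * q <= k * q" using x by simp
   then have "x <= N" "k <= N" "x * q <= N" "base + x * q <= N" using x(1) kN k(3) by linarith+
   then show "x < 2 ^ w" "k < 2 ^ w" "x * q < 2 ^ w" "base + x * q < 2 ^ w" by (simp_all add: small)
  qed
  show "length b' <= ?M & ok w e' (V 13) & ok w e' (V 12) & (if val e' (V 13) < val e' (V 12)
    then wp ?R ?R ?M ?body (%e' b' H' n' d'. \<exists>m'<m. I m' e' b' H' n' d') e' b' H' (Suc n') (Suc d')
    else J e' b' H' (Suc n') (Suc d'))"
  proof (cases "x < k")
   case False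
   then have xk: "x = k" using x by simp
   have "outp H' base (k * q) ?ms"
   proof (rule outp_concat)
    fix y i assume y: "y < k" "i < q"
    then have "grp W H' (base + y * q) (Xs y) None" using gr[of y] home[of y] xk by auto
    then show "H' (base + y * q + i) = Elem (Xs y ! i)" using y by (simp add: grp_None_iff)
   qed (use st len in \<open>auto simp: perm_state_def\<close>)
   moreover have "Suc n' <= 53 * (k * q)" "Suc d' <= 53 * (k * q)"
   proof -
    have "1 * 3 <= k * q" using k(2) by (intro mult_le_mono) auto
    moreover have "2 * k * c = 52 * (k * q)" by (simp only: c_def mult_ac)
    ultimately show "Suc n' <= 53 * (k * q)" "Suc d' <= 53 * (k * q)" using nd by linarith+
   qed
   moreover have "53 * (k * q) <= 53 * (q * q)" using k(1) by linarith
   ultimately have "J e' b' H' (Suc n') (Suc d')" unfolding J_def by linarith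
   then show ?thesis using xk x ev b kk by simp
  next
   case True
   define v where "v = D x"
   have vk: "v < k" using Dk True by (simp add: v_def)
   \<comment> \<open>A smaller rank is already taken by the settled block at that position.\<close>
   have xv: "x <= v"
   proof (rule ccontr)
    assume "\<not> x <= v"
    then have "D v = v" using home by simp
    then show False using inj[of x v] vk True \<open>\<not> x <= v\<close> by (simp add: v_def)
   qed
   have vw: "v < 2 ^ W" using vk kN NW by linarith
   define K where "K = (%(e' :: nat => nat) (b' :: 'a cell list) H' n' d'. \<exists>m'<m. I m' e' b' H' n' d')"
   have v2: "v * q < 2 ^ w" "base + v * q < 2 ^ w"
    using bound[OF vk] k(3) by (auto intro!: small)
   define e1 where "e1 = e'(7 := base + x * q)"
   have "wp ?R ?R ?M rd (wp ?R ?R ?M (If (V 13) (V 8) (?sw) (clr ;; 13 ::= V 13 [+] C 1)) K) e1 [] H'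
    (Suc (Suc n')) (Suc (Suc d'))"
   proof (rule wp_rd[where p = "base + x * q" and v = v and xs = "Xs v"])
    show "grp W H' (base + x * q) (Xs v) (Some v)" using gr[OF True] by (simp add: v_def)
    show "base + x * q + q < 2 ^ w" using bound[OF True] k(3) by (intro small) simp
    fix e2 n2 d2
    assume e2: "!!r. r \<notin> {8, 9} ==> e2 r = e1 r" "e2 8 = v"
     and n2: "n2 <= Suc (Suc n') + 5 * W + 6" "d2 <= Suc (Suc d') + 5 * W + 6"
    have e2v: "e2 0 = W" "e2 12 = k" "e2 14 = base" "e2 20 = q" "e2 13 = x" "e2 7 = base + x * q"
     using ev x(2) e2(1) by (auto simp: e1_def)
    show "wp ?R ?R ?M (If (V 13) (V 8) (?sw) (clr ;; 13 ::= V 13 [+] C 1)) K e2 [] H' n2 d2"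
    proof (cases "x < v")
     case sw: True
     define e3 where "e3 = e2(3 := 0, 4 := q, 5 := base + x * q, 6 := base + v * q)"
     have vx: "Suc x * q <= v * q" using sw by (intro mult_le_mono1) simp
     have "wp ?R ?R ?M (Call 1) K e3 [] H' (Suc (Suc (Suc (Suc (Suc n2))))) (Suc (Suc (Suc (Suc (Suc d2)))))"
     proof (rule wp_Call[OF swap_tri[where l = q and x = "base + x * q" and y = "base + v * q" and t = W]])
      show "q <= 2 ^ W"
      proof -
       have "q <= k * q" using mult_le_mono1[OF k(2), of q] by (simp only: mult_1)
       then show ?thesis by (meson kN(2) NW le_trans less_imp_le)
      qed
      show "{base + x * q..<base + x * q + q} \<inter> {base + v * q..<base + v * q + q} = {}"
       using vx by auto
      show "{base + x * q..<base + x * q + q} \<union> {base + v * q..<base + v * q + q} <= ?R"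
       using bound[OF True] bound[OF vk] by auto
      then show "{base + x * q..<base + x * q + q} \<union> {base + v * q..<base + v * q + q} <= ?R" .
      fix H1 assume s: "\<forall>i<q. H1 (base + x * q + i) = H' (base + v * q + i) & H1 (base + v * q + i) = H' (base + x * q + i)"
       and out: "!!a. a \<notin> {base + x * q..<base + x * q + q} \<union> {base + v * q..<base + v * q + q} ==> H1 a = H' a"
      define D' where "D' y = (if y = x then D v else if y = v then v else D y)" for y
      have b': "bij_betw D' {..<k} {..<k}"
      proof -
       define f where "f y = (if y = x then v else if y = v then x else y)" for y
       have "bij_betw f {..<k} {..<k}"
        by (rule bij_betwI[where g = f]) (use True vk in \<open>auto simp: f_def\<close>)
       then have "bij_betw (D \<circ> f) {..<k} {..<k}" using D by (rule bij_betw_trans)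
       moreover have "D \<circ> f = D'" by (auto simp: f_def D'_def v_def)
       ultimately show ?thesis by simp
      qed
      have gr': "grp W H1 (base + y * q) (Xs (D' y)) (if y < x then None else Some (D' y))" if y: "y < k" for y
      proof -
       consider "y = x" | "y = v" | "y ~= x" "y ~= v" by blast
       then show ?thesis
       proof cases
        case 1
        then show ?thesis using gr[OF vk] xv s sw by (auto simp: D'_def intro: grp_cong)
       next
        case 2
        then show ?thesis using gr[OF True] xv s sw by (auto simp: D'_def v_def[symmetric] intro: grp_cong)
       next
        case 3
        have "H1 (base + y * q + i) = H' (base + y * q + i)" if "i < q" for i
        proof (rule out)
         show "base + y * q + i \<notin> {base + x * q..<base + x * q + q} \<union> {base + v * q..<base + v * q + q}"
          using block_eq[of y q i x] block_eq[of y q i v] that 3 by auto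
        qed
        then show ?thesis using gr[OF y] 3 by (auto simp: D'_def intro: grp_cong)
       qed
      qed
      have ms: "mis D' < mis D"
       unfolding mis_def
      proof (rule psubset_card_mono)
       \<comment> \<open>The block at \<open>v\<close> was misplaced too, since its home is claimed
         by the block at \<open>x\<close>; after the swap \<open>v\<close> is no longer
         misplaced.\<close>
       have "D v ~= v" using inj[of x v] True vk sw by (auto simp: v_def)
       then have "v \<in> {y \<in> {..<k}. D y ~= y}" "v \<notin> {y \<in> {..<k}. D' y ~= y}" using vk sw by (auto simp: D'_def)
       moreover have "{y \<in> {..<k}. D' y ~= y} <= {y \<in> {..<k}. D y ~= y}"
        using sw by (auto simp: D'_def v_def split: if_splits)
       ultimately show "{y \<in> {..<k}. D' y ~= y} \<subset> {y \<in> {..<k}. D y ~= y}" by blast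
      qed simp
      define m' where "m' = (k - x) + mis D'"
      have mm: "m' < m" using ms m by (simp add: m'_def)
      then have "Suc m' * c <= m * c" by (intro mult_le_mono1) simp
      moreover have "5 * W + 21 * q + 19 <= c" "5 * W + 10 * W + 28 <= c" using W4 by (auto simp: c_def)
      ultimately have "I m' e3 [] H1 (Suc (Suc (Suc (Suc (Suc n2)))) + Suc (21 * q + 2)) (Suc (Suc (Suc (Suc (Suc d2)))) + Suc (10 * W + 11))"
       unfolding I_def using b' gr' x(1) e2v g n2 nd home sw m'_def
       by (intro exI[of _ D'] exI[of _ x]) (auto simp: e3_def glob_def D'_def)
      then show "K e3 [] H1 (Suc (Suc (Suc (Suc (Suc n2)))) + Suc (21 * q + 2)) (Suc (Suc (Suc (Suc (Suc d2)))) + Suc (10 * W + 11))"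
       unfolding K_def using mm by blast
     qed (use bound[OF True] bound[OF vk] k(3) in \<open>auto simp: e3_def\<close>)
     moreover have "q < 2 ^ w" using bound[OF True] k(3) by (intro small) simp
     ultimately show ?thesis using sw e2v e2(2) kk v2 by (simp add: wp_If wp_Seq wp_Assign e3_def)
    next
     case False
     then have xx: "v = x" using xv by simp
     have "wp ?R ?R ?M clr (wp ?R ?R ?M (13 ::= V 13 [+] C 1) K) e2 [] H' (Suc n2) (Suc d2)"
     proof (rule wp_clr[where p = "base + x * q" and xs = "Xs x" and vo = "Some x"])
      show "grp W H' (base + x * q) (Xs x) (Some x)" using gr[OF True] xx by (simp add: v_def)
      show "base + x * q + q < 2 ^ w" using bound[OF True] k(3) by (intro small) simp
      fix e3 H1 n3 d3
      assume e3: "!!r. r \<notin> {9} ==> e3 r = e2 r" and gx: "grp W H1 (base + x * q) (Xs x) None"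
       and out: "!!a. a \<notin> {base + x * q..<base + x * q + q} ==> H1 a = H' a"
       and n3: "n3 <= Suc n2 + 4 * W + 6" "d3 <= Suc d2 + 4 * W + 6"
      have gr': "grp W H1 (base + y * q) (Xs (D y)) (if y < Suc x then None else Some (D y))" if y: "y < k" for y
      proof (cases "y = x")
       case True
       then show ?thesis using gx xx by (simp add: v_def)
      next
       case yx: False
       have "H1 (base + y * q + i) = H' (base + y * q + i)" if "i < q" for i
        by (rule out) (use block_eq[of y q i x] that yx in auto)
       then show ?thesis using gr[OF y] yx by (auto intro: grp_cong split: if_splits)
      qed
      define m' where "m' = (k - Suc x) + mis D"
      have mm: "m = Suc m'" using m True by (simp add: m'_def)
      have "9 * W + 20 <= c" by (simp add: c_def)
      then have "I m' (e3(13 := Suc x)) [] H1 (Suc n3) (Suc d3)"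
       unfolding I_def using D gr' True e2v e3 g n2 n3 nd home xx m'_def mm
       by (intro exI[of _ D] exI[of _ "Suc x"]) (auto simp: glob_def v_def less_Suc_eq)
      then have "K (e3(13 := Suc x)) [] H1 (Suc n3) (Suc d3)" unfolding K_def mm by blast
      moreover have "Suc x < 2 ^ w" "1 < (2::nat) ^ w" using True kN by (auto intro!: small)
      ultimately show "wp ?R ?R ?M (13 ::= V 13 [+] C 1) K e3 [] H1 n3 d3"
       using e3[of 13] e2v by (simp add: wp_Assign)
     qed (use e2v len[OF True] bound[OF True] in auto)
     then show ?thesis using xx e2v e2(2) kk by (simp add: wp_If wp_Seq)
    qed
   qed (use ev len[OF vk] vw bound[OF True] in \<open>auto simp: e1_def\<close>)
   then have "wp ?R ?R ?M ?body K e' [] H' (Suc n') (Suc d')"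
    using ev x(2) kk by (simp add: wp_Seq wp_Assign e1_def)
   then show ?thesis using True x ev b kk by (simp add: K_def)
  qed
 qed
 have "wp ?R ?R ?M perm0 J e [] H 0 0"
  unfolding perm0_def using loop by (simp add: wp_Seq wp_Assign)
 then show "tri ?R ?R ?M (Pr 8) e H (%H'. outp H' base (k * q) ?ms) (53 * (k * q)) (53 * (q * q))"
  unfolding J_def P8 by (rule tri_wpI)
qed

end

section \<open>Cutting off the remainder\<close>

text \<open>\<open>L\<close> and \<open>R\<close> are adjacent, so that their blocks are the
  consecutive blocks of one array.\<close>

lemma blks_contig:
 assumes "BS dvd lL" "lL <= k * BS" "0 < BS"
 shows "blks BS La (La + lL) (La + lL) (La + k * BS) = {La + x * BS |x. x < k}"
proof (rule set_eqI)
 fix y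
 show "y \<in> blks BS La (La + lL) (La + lL) (La + k * BS) \<longleftrightarrow> y \<in> {La + x * BS |x. x < k}"
 proof
  assume "y \<in> blks BS La (La + lL) (La + lL) (La + k * BS)"
  then have y: "La <= y" "y < La + k * BS" "BS dvd y - La"
   using assms(1,2) dvd_add_right_iff[OF assms(1), of "y - (La + lL)"] unfolding blks_def by auto
  then obtain x where "y - La = BS * x" by (auto simp: dvd_def)
  then have yx: "y = La + x * BS" using y(1) by (metis le_add_diff_inverse mult.commute)
  then have "x * BS < k * BS" using y(2) by linarith
  then have "x < k" by simp
  with yx have "y = La + x * BS" "x < k" by auto
  then show "y \<in> {La + x * BS |x. x < k}" by auto
 next
  assume "y \<in> {La + x * BS |x. x < k}"
  then obtain x where x: "y = La + x * BS" "x < k" by blast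
  then show "y \<in> blks BS La (La + lL) (La + lL) (La + k * BS)"
   using assms(3) dvd_diff_nat[OF dvd_triv_right assms(1), of x] unfolding blks_def by auto
 qed
qed

text \<open>The least multiple of the block size that is at least \<open>a - F\<close> satisfies
  what \<open>ninv\<close> demands of the length of \<open>L\<close>.\<close>

lemma round_up:
 assumes "0 < (BS :: nat)" "lL = (if a < F then 0 else (a - F + BS - 1) div BS * BS)" "a <= k * BS" "F < BS"
 shows "BS dvd lL" "a <= lL + F" "lL + F < a + BS" "lL <= k * BS"
proof -
 define y where "y = a - F + BS - 1"
 have m: "y div BS * BS + y mod BS = y" "y mod BS < BS" using assms(1) by auto
 show "BS dvd lL" using assms(2) by auto
 show a: "a <= lL + F" "lL + F < a + BS"
 proof -
  have "a <= lL + F & lL + F < a + BS"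
  proof (cases "a < F")
   case False
   then have "lL = y div BS * BS" "y + F + 1 = a + BS" using assms(1,2) by (auto simp: y_def)
   then show ?thesis using m by linarith
  qed (use assms in auto)
  then show "a <= lL + F" "lL + F < a + BS" by auto
 qed
 have "lL < k * BS + BS" using a assms(3) by linarith
 then have "lL < Suc k * BS" by simp
 moreover obtain z where z: "lL = z * BS" using \<open>BS dvd lL\<close> by (metis dvd_def mult.commute)
 ultimately have "z < Suc k" using mult_less_cancel2 by blast
 then show "lL <= k * BS" using z by (simp add: less_Suc_eq_le)
qed

lemma outp_append:
 assumes "outp H p i ms1" "outp H (p + i) j ms2" "!!x y. x \<in># ms1 ==> y \<in># ms2 ==> x <= y"
 shows "outp H p (i + j) (ms1 + ms2)"
proof -
 obtain xs ys where x: "sorted xs" "length xs = i" "mset xs = ms1" "\<forall>k<i. H (p + k) = Elem (xs ! k)"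
  and y: "sorted ys" "length ys = j" "mset ys = ms2" "\<forall>k<j. H (p + i + k) = Elem (ys ! k)"
  using assms(1,2) unfolding outp_def by blast
 show ?thesis
  unfolding outp_def
 proof (intro exI[of _ "xs @ ys"] conjI allI impI)
  show "sorted (xs @ ys)" using x y assms(3) by (auto simp: sorted_append)
  fix k assume "k < i + j"
  then show "H (p + k) = Elem ((xs @ ys) ! k)"
   using x(2,4) y(4)[rule_format, of "k - i"] by (cases "k < i") (auto simp: nth_append add.assoc)
 qed (use x y in auto)
qed

lemma outp_cong: "outp H p l ms ==> (!!x. x \<in> {p..<p + l} ==> H' x = H x) ==> outp H' p l ms"
 unfolding outp_def by force

context alg3
begin

text \<open>
  The cells after the \<open>j\<close> low elements of \<open>B\<close> have been exchanged with the cells behind the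
  \<open>i\<close> low elements of \<open>A\<close>.
\<close>

lemma split_inp:
 fixes c :: "int => 'a :: linorder"
 assumes i: "inp H p l c a" and ij: "i <= a" "j <= l - a" and dj: "i + j + j <= l"
  and sw: "\<forall>t<j. H1 (p + i + t) = H (p + l - j + t) & H1 (p + l - j + t) = H (p + i + t)"
  and out: "!!x. x \<notin> {p + i..<p + i + j} \<union> {p + l - j..<p + l - j + j} ==> H1 x = H x"
 shows "inp H1 p (i + j) c i"
  and "lL + lR = l - (i + j) ==> a - i <= lL + j ==>
   layn H1 (p + (i + j)) (p + (i + j) + lL) (p + l) j (upper c (int i) (int j)) (a - i) (l - a - j)"
proof -
 have al: "a <= l" and v: "valley c (int a) (int l - int a)" using i by (auto simp: inp_def)
 \<comment> \<open>The element at offset \<open>x\<close> of the array before the swap, so that both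
   sides are treated alike.\<close>
 define G where "G x = (if x < int a then c x else c (x - int l))" for x
 have H: "H (nat (int p + x)) = Elem (G x)" if "0 <= x" "x < int l" for x
 proof -
  have "H (p + nat x) = Elem (c (if nat x < a then int (nat x) else int (nat x) - int l))"
   using i that unfolding inp_def by (metis nat_less_iff zless_nat_conj)
  moreover have "nat (int p + x) = p + nat x" using that by simp
  ultimately show ?thesis using that by (auto simp: G_def nat_less_iff)
 qed
 have H1a: "H1 (nat (int p + int i + t)) = Elem (G (int l - int j + t))" if "0 <= t" "t < int j" for t
 proof -
  have "H1 (p + i + nat t) = H (p + l - j + nat t)" using sw that by auto
  moreover have "nat (int p + int i + t) = p + i + nat t" "p + l - j + nat t = nat (int p + (int l - int j + t))"
   using that dj by auto
  ultimately show ?thesis using H[of "int l - int j + t"] that dj by simp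
 qed
 have H1b: "H1 (nat (int p + int l - int j + t)) = Elem (G (int i + t))" if "0 <= t" "t < int j" for t
 proof -
  have "H1 (p + l - j + nat t) = H (p + i + nat t)" using sw that by auto
  moreover have "nat (int p + int l - int j + t) = p + l - j + nat t" "p + i + nat t = nat (int p + (int i + t))"
   using that dj by auto
  ultimately show ?thesis using H[of "int i + t"] that dj by simp
 qed
 have H1c: "H1 (nat (int p + x)) = Elem (G x)" if "0 <= x" "x < int l" "x < int i \<or> int i + int j <= x" "x < int l - int j" for x
 proof -
  have "nat (int p + x) \<notin> {p + i..<p + i + j} \<union> {p + l - j..<p + l - j + j}" using that dj by auto
  then have "H1 (nat (int p + x)) = H (nat (int p + x))" by (rule out)
  then show ?thesis using H that by simp
 qed
 show "inp H1 p (i + j) c i"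
  unfolding inp_def
 proof (intro conjI allI impI)
  show "valley c (int i) (int (i + j) - int i)"
   using valley_low[OF v, of "int i" "int j"] ij al by (simp add: of_nat_diff)
  fix x assume x: "x < i + j"
  show "H1 (p + x) = Elem (c (if x < i then int x else int x - int (i + j)))"
  proof (cases "x < i")
   case True
   then show ?thesis using H1c[of "int x"] dj ij al by (simp add: G_def nat_int_add)
  next
   case False
   have "int p + int i + (int x - int i) = int (p + x)" by simp
   then have "H1 (p + x) = Elem (G (int l - int j + (int x - int i)))"
    using H1a[of "int x - int i"] x False by (metis nat_int diff_ge_0_iff_ge less_diff_eq of_nat_le_iff add.commute of_nat_add of_nat_less_iff diff_less_eq linorder_not_less)
   moreover have "\<not> int l - int j + (int x - int i) < int a" using ij al False by linarith
   ultimately show ?thesis using False by (simp add: G_def algebra_simps)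
  qed
 qed simp
 assume L: "lL + lR = l - (i + j)" "a - i <= lL + j"
 show "layn H1 (p + (i + j)) (p + (i + j) + lL) (p + l) j (upper c (int i) (int j)) (a - i) (l - a - j)"
  unfolding layn_def layout_def
 proof (intro allI impI)
  fix z assume z: "- int (l - a - j) <= z" "z < int (a - i)"
  define tot where "tot = int l - int i - int j"
  define z' where "z' = (if z < int j - int lR then z + tot else z)"
  have e1: "int (p + l) - int (p + (i + j) + lL) = int lR" "int (a - i) + int (l - a - j) = tot"
   "- (int l - int a - int j) <= z" "z < int a - int i" "int lL + int lR = tot" "int a - int i <= int lL + int j"
   using L ij al z dj by (auto simp: tot_def of_nat_diff)
  have cl: "cell_of (int (p + (i + j))) (int (p + l)) (int j) (int (p + l) - int (p + (i + j) + lL))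
    (int (a - i) + int (l - a - j)) z = nat ((if int j <= z' then int p + int i + int j else int p + int l) + z' - int j)"
   unfolding cell_of_def Let_def e1 z'_def by simp
  have up: "upper c (int i) (int j) z = (if 0 <= z then c (z + int i) else c (z - int j))" by (simp add: upper_def)
  have jt: "int j <= tot" using dj by (simp add: tot_def)
  have zz: "z' = z & int j - int lR <= z \<or> z' = z + tot & z < int j - int lR"
   by (auto simp: z'_def)
  have Gz: "G (int i + z) = upper c (int i) (int j) z" if "0 <= z"
   using that e1 by (simp add: up G_def add.commute)
  have Gz2: "G (int l - int j + z) = upper c (int i) (int j) z" if "z < 0"
   using that e1 by (simp add: up G_def algebra_simps)
  consider "tot <= z'" | "int j <= z'" "z' < tot" "0 <= z" | "int j <= z'" "z' < tot" "z < 0"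
   | "z' < int j" "z' < tot" "0 <= z'" "0 <= z" | "z' < int j" "0 <= z'" "z < 0" | "z' < int j" "z' < 0"
   by linarith
  then have "H1 (nat ((if int j <= z' then int p + int i + int j else int p + int l) + z' - int j)) = Elem (upper c (int i) (int j) z)"
  proof cases
   case 1
   then have 2: "z' = z + tot" "0 <= z" "z < int j" using zz e1 by auto
   then have eq: "(if int j <= z' then int p + int i + int j else int p + int l) + z' - int j = int p + int l - int j + z"
    using 1 jt by (simp add: tot_def)
   show ?thesis unfolding eq using H1b[OF 2(2,3)] Gz[OF 2(2)] by simp
  next
   case 2
   then have z2: "z' = z" using zz by auto
   have eq: "(if int j <= z' then int p + int i + int j else int p + int l) + z' - int j = int p + (int i + z)"
    using 2 z2 by simp
   show ?thesis unfolding eq using H1c[of "int i + z"] Gz[OF 2(3)] 2 z2 by (simp add: tot_def)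
  next
   case 3
   then have z3: "z' = z + tot" using zz by auto
   have eq: "(if int j <= z' then int p + int i + int j else int p + int l) + z' - int j = int p + (int l - int j + z)"
    using 3 z3 by (simp add: tot_def)
   show ?thesis unfolding eq using H1c[of "int l - int j + z"] Gz2[OF 3(3)] 3 z3 by (simp add: tot_def)
  next
   case 4
   then have z4: "z' = z" using zz jt by auto
   have eq: "(if int j <= z' then int p + int i + int j else int p + int l) + z' - int j = int p + int l - int j + z"
    using 4 z4 by simp
   show ?thesis unfolding eq using H1b[of z] Gz[OF 4(4)] 4 z4 by simp
  next
   case 5
   then have z5: "z' = z + tot" using zz by auto
   have eq: "(if int j <= z' then int p + int i + int j else int p + int l) + z' - int j = int p + int l - int j + (z + tot)"
    using 5 z5 by simp
   have eq2: "int i + (z + tot) = int l - int j + z" by (simp add: tot_def)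
   show ?thesis unfolding eq using H1b[of "z + tot", unfolded eq2] Gz2[OF 5(3)] 5 z5 by simp
  next
   case 6
   then have z6: "z' = z" "int j - int lR <= z" using zz e1 by (auto simp: tot_def)
   have eq: "(if int j <= z' then int p + int i + int j else int p + int l) + z' - int j = int p + (int l - int j + z)"
    using 6 z6 by simp
   have "int i + int j <= int l - int j + z" using z6 e1 by (simp add: tot_def)
   then show ?thesis unfolding eq using H1c[of "int l - int j + z"] Gz2 6 z6 by simp
  qed
  then show "H1 (cell_of (int (p + (i + j))) (int (p + l)) (int j) (int (p + l) - int (p + (i + j) + lL))
    (int (a - i) + int (l - a - j)) z) = Elem (upper c (int i) (int j) z)"
   unfolding cl .
 qed
qed

text \<open>Of the \<open>2 * K\<close> per element, one \<open>K\<close> pays for the splitting,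
  through the hypothesis on \<open>nl\<close>, and the other for the permutation; the summand 21 is
  the initial swap. The solver of the remainder, applied once, contributes the term
  \<open>K * W\<close>.\<close>

lemma solve_ok:
 fixes LP :: "(nat => 'a :: linorder cell) => nat => 'a list => nat => bool"
 assumes Prs: "Pr pr = solve qr lid pid mid" "Pr pid = purify pid leaf"
  and BS: "qr = 1 & BS = q \<or> qr = 2 & BS = q * q"
  and low: "sol_ok TYPE('a) BS lid ML fl d1"
  and leaf: "leaf_ok BS LP leaf M0 nl dl"
  and loc: "!!H H' p xs t. LP H p xs t ==> (!!a. a \<in> {p..<p + BS} ==> H' a = H a) ==> LP H' p xs t"
  and perm: "perm_ok BS LP L mid MP K d3"
  and fl: "!!r. r < BS ==> fl r <= K * r + K * W" and nl: "nl + 42 + 33 * BS <= K * BS"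
 shows "sol_ok TYPE('a) L pr (112 + max ML (max (max M0 (112 + 224 * W) + 224 * W) MP))
   (%l. (2 * K + 21) * l + (K + 31) * W) (d1 + (dl + 3 + W * (22 * W + 70)) + d3 + 22 * W + 80)"
 unfolding sol_ok_def
proof (intro allI impI)
 fix e :: "nat => nat" and p l a :: nat and c :: "int => 'a" and H :: "nat => 'a cell"
 assume e: "e 0 = W" "e 1 = q" "e 2 = q * q" "e 11 = p" "e 12 = l" "e 13 = a"
  and l: "l < L" "p + l <= N" and inp: "inp H p l c a"
 define M where "M = 112 + max ML (max (max M0 (112 + 224 * W) + 224 * W) MP)"
 have M: "112 + ML <= M" "112 + (max M0 (112 + 224 * W) + 224 * W) <= M" "112 + MP <= M" "112 + 224 * W <= M"
  by (auto simp: M_def)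
 have eqr: "e qr = BS" using BS e by auto
 have qq: "q <= q * q" by simp
 have BSq: "q <= BS" using BS qq by auto
 have WB: "W <= BS" "0 < BS" using BSq by auto
 have al: "a <= l" and v: "valley c (int a) (int l - int a)" using inp by (auto simp: inp_def)
 have BSw: "BS < 2 ^ w"
 proof -
  define x where "x = q * q"
  have "16 * (N + x + 300) <= 2 ^ w" using big by (simp only: x_def)
  moreover have "BS <= x" using BS qq by (auto simp: x_def)
  ultimately show ?thesis by (intro less_le_trans[of _ "16 * (N + x + 300)" "2 ^ w"]) simp_all
 qed
 let ?R = "{p..<p + l}"
 let ?n = "(2 * K + 21) * l + (K + 31) * W" and ?d = "d1 + (dl + 3 + W * (22 * W + 70)) + d3 + 22 * W + 80"
 define J where "J = (%(e' :: nat => nat) (b' :: 'a cell list) H' n' d'. n' <= ?n & d' <= ?d &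
  outp H' p l (vmset c (int a) (int l - int a)))"
 have lw: "p < 2 ^ w" "l < 2 ^ w" "p + l < 2 ^ w" "a < 2 ^ w" "0 < (2::nat) ^ w" "1 < (2::nat) ^ w"
  using l al by (auto intro!: small)
 define e0 where "e0 = e(20 := BS)"
 have qn: "qr ~= 20" "qr < 12" using BS by auto
 have e0: "e0 0 = W" "e0 1 = q" "e0 2 = q * q" "e0 11 = p" "e0 12 = l" "e0 13 = a" "e0 20 = BS" using e by (auto simp: e0_def)
 have "wp ?R ?R M (solve qr lid pid mid) J e [] H 0 0"
 proof (cases "l < BS")
  case True
  have "wp ?R ?R M (Call lid) J e0 [] H (Suc (Suc 0)) (Suc (Suc 0))"
  proof (rule wp_Call[OF sol_okD[OF low e0(1-6) True l(2) inp]])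
   fix H' assume o: "outp H' p l (vmset c (int a) (int l - int a))"
   have "fl l <= K * l + K * W" by (rule fl[OF True])
   moreover have "?n = 2 * (K * l) + 21 * l + K * W + 31 * W" by (simp add: algebra_simps)
   ultimately show "J e0 [] H' (Suc (Suc 0) + Suc (fl l)) (Suc (Suc 0) + Suc d1)"
    using o W4 by (simp add: J_def)
  qed (use M in auto)
  then show ?thesis
   unfolding solve_def using True eqr e lw BSw by (simp add: wp_Seq wp_Assign wp_If e0_def)
 next
  case False
  define r where "r = l mod BS"
  define k where "k = l div BS"
  have lk: "l = k * BS + r" "r < BS" "1 <= k" using False WB by (auto simp: r_def k_def div_greater_zero_iff Suc_le_eq)
  have rBS: "r + BS <= l" using lk mult_le_mono1[OF lk(3), of BS] by simp
  define b where "b = l - a"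
  have ib: "int l - int a = int b" using al by (simp add: b_def of_nat_diff)
  have ab: "a + b = l" using al by (simp add: b_def)
  define e1 where "e1 = e0(21 := r, 14 := p, 15 := p + l, 16 := p + l, 17 := p + l, 18 := 0, 25 := l)"
  let ?t3 = "13 ::= V 34 ;; 14 ::= V 11 [+] V 21 ;; 18 ::= V 33 ;;
   If (V 13) (V 18) (34 ::= C 0) (34 ::= (V 13 [-] V 18 [+] V 20 [-] C 1) [div] V 20 [*] V 20) ;;
   15 ::= V 14 [+] V 34 ;; 16 ::= V 15 ;; 19 ::= C 0 ;; Call pid ;;
   12 ::= V 35 [div] V 20 ;; Call mid"
  let ?t2 = "34 ::= V 13 [-] V 22 ;; 35 ::= V 12 ;; 12 ::= V 21 ;; 13 ::= V 22 ;; Call lid ;; ?t3"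
  let ?t1 = "33 ::= V 21 [-] V 22 ;; 3 ::= C 0 ;; 4 ::= V 33 ;; 5 ::= V 11 [+] V 22 ;; 6 ::= V 15 [-] V 33 ;; Call 1 ;; ?t2"
  \<comment> \<open>The whole array is a ring with empty \<open>R\<close> and offset 0, so the
    general search applies to it.\<close>
  have "wp ?R ?R M cut (wp ?R ?R M ?t1 J) e1 [] H (9::nat) (9::nat)"
  proof (rule wp_cut[where a = a and La = p and Ra = "p + l" and Rb = "p + l" and F = 0 and h = r and bb = b and c = c])
   have H: "H (p + x) = Elem (c (if x < a then int x else int x - int l))" if "x < l" for x
    using inp that by (auto simp: inp_def)
   have ce: "cell_of (int p) (int (p + l)) (int 0) (int (p + l) - int (p + l)) (int a + int b) z
     = p + nat (if z < 0 then z + int l else z)" if "- int b <= z" "z < int a" for z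
    using that ab by (auto simp: cell_of_def Let_def)
   have zl: "nat (if z < 0 then z + int l else z) < l" if "- int b <= z" "z < int a" for z
    using that ab by auto
   show "layout H (int p) (int (p + l)) (int 0) (int (p + l) - int (p + l)) (int a + int b) c (int a) (int b)"
    unfolding layout_def
   proof (intro allI impI)
    fix z assume z: "- int b <= z" "z < int a"
    have "(if nat (if z < 0 then z + int l else z) < a then int (nat (if z < 0 then z + int l else z))
     else int (nat (if z < 0 then z + int l else z)) - int l) = z"
     using z ab by auto
    then show "H (cell_of (int p) (int (p + l)) (int 0) (int (p + l) - int (p + l)) (int a + int b) z) = Elem (c z)"
     unfolding ce[OF z] using H[OF zl[OF z]] by simp
   qed
   show "cell_of (int p) (int (p + l)) (int 0) (int (p + l) - int (p + l)) (int a + int b) z \<in> ?R"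
    if "- int b <= z" "z < int a" for z
    unfolding ce[OF that] using zl[OF that] by simp
  next
   fix e2 n2 d2 i
   assume i: "i <= a" "i <= r" "r - i <= b"
    and sep: "0 < i ==> r - i < b ==> c (int i - 1) <= c (- int (r - i) - 1)"
     "0 < r - i ==> i < a ==> c (- int (r - i)) <= c (int i)"
    and e2: "e2 22 = i" "!!r. r < 22 \<or> r = 25 \<or> 32 < r ==> e2 r = e1 r"
    and n2: "n2 <= 9 + 12 * W + 8" "d2 <= 9 + 12 * W + 8"
   define j where "j = r - i"
   have ij: "i + j = r" "j <= b" using i by (auto simp: j_def)
   have e2v: "e2 0 = W" "e2 1 = q" "e2 2 = q * q" "e2 11 = p" "e2 12 = l" "e2 13 = a" "e2 20 = BS" "e2 21 = r"
     "e2 15 = p + l" "e2 17 = p + l"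
    using e2(2) e0 by (auto simp: e1_def)
   define e3 where "e3 = e2(33 := j, 3 := 0, 4 := j, 5 := p + i, 6 := p + l - j)"
   \<comment> \<open>Besides the \<open>r\<close> low elements at least one whole block remains and
     \<open>j < BS\<close>, so the two swapped ranges do not overlap.\<close>
   have dj: "i + j + j <= l" using ij lk(2) rBS by linarith
   have kN: "k <= N" "k <= 2 ^ W" "j <= 2 ^ W"
   proof -
    have "k * 1 <= k * BS" using WB by (intro mult_le_mono) auto
    then show "k <= N" using lk l by linarith
    then show "k <= 2 ^ W" using NW by linarith
    show "j <= 2 ^ W" using dj l NW by linarith
   qed
   have "wp ?R ?R M (Call 1) (wp ?R ?R M ?t2 J) e3 [] H (n2 + 5) (d2 + 5)"
   proof (rule wp_Call[OF swap_tri[where l = j and x = "p + i" and y = "p + l - j" and t = W]])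
    show "{p + i..<p + i + j} \<inter> {p + l - j..<p + l - j + j} = {}" using dj by auto
    show "{p + i..<p + i + j} \<union> {p + l - j..<p + l - j + j} <= ?R" using dj by auto
    then show "{p + i..<p + i + j} \<union> {p + l - j..<p + l - j + j} <= ?R" .
    fix H1
    assume sw: "\<forall>t<j. H1 (p + i + t) = H (p + l - j + t) & H1 (p + l - j + t) = H (p + i + t)"
     and out: "!!x. x \<notin> {p + i..<p + i + j} \<union> {p + l - j..<p + l - j + j} ==> H1 x = H x"
    note sp = split_inp[OF inp i(1) _ dj sw out]
    have inp1: "inp H1 p r c i" using sp(1) ij al by (simp add: b_def)
    define e4 where "e4 = e3(34 := a - i, 35 := l, 12 := r, 13 := i)"
    define n4 where "n4 = n2 + 5 + Suc (21 * j + 2) + 4"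
    define d4 where "d4 = d2 + 5 + Suc (10 * W + 11) + 4"
    have e4v: "e4 0 = W" "e4 1 = q" "e4 2 = q * q" "e4 11 = p" "e4 12 = r" "e4 13 = i"
     using e2v by (auto simp: e4_def e3_def)
    have rN: "p + r <= N" using rBS l by linarith
    have "wp ?R ?R M (Call lid) (wp ?R ?R M ?t3 J) e4 [] H1 n4 d4"
    proof (rule wp_Call[OF sol_okD[OF low e4v lk(2) rN inp1]])
     show "{p..<p + r} <= ?R" using rBS by auto
     then show "{p..<p + r} <= ?R" .
     fix H2 assume o2: "outp H2 p r (vmset c (int i) (int r - int i))"
      and out2: "!!x. x \<notin> {p..<p + r} ==> H2 x = H1 x"
     define a' where "a' = a - i"
     define b' where "b' = b - j"
     define lL where "lL = (if a' < j then 0 else (a' - j + BS - 1) div BS * BS)"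
     have ab': "a' + b' = k * BS" using ij i lk ab by (simp add: a'_def b'_def)
     have jB: "j < BS" using ij lk by linarith
     have "a' <= k * BS" using ab' by linarith
     note ru = round_up[OF WB(2) lL_def this jB]
     define La where "La = p + r"
     have pl: "p + l = La + k * BS" using lk by (simp add: La_def)
     define e5 where "e5 = e4(13 := a', 14 := La, 18 := j, 34 := lL, 15 := La + lL, 16 := La + lL, 19 := 0)"
     define n5 where "n5 = Suc (Suc (Suc (Suc (Suc (Suc (Suc (Suc (n4 + Suc (fl r)))))))))"
     define d5 where "d5 = Suc (Suc (Suc (Suc (Suc (Suc (Suc (Suc (d4 + Suc d1))))))))"
     define c' where "c' = upper c (int i) (int j)"
     have inv: "ninvn BS La (La + lL) (La + lL) (La + k * BS) j a' b'"
     proof -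
      have "int BS dvd int (La + k * BS) - int (La + lL)"
       using dvd_diff[of "int BS" "int (k * BS)" "int lL"] ru(1) by simp
      then show ?thesis
       using ru(2-4) ru(1) ab'[THEN arg_cong[where f = int]] jB WB(2) unfolding ninvn_def ninv_def by auto
     qed
     have lay: "layn H2 La (La + lL) (La + k * BS) j c' a' b'"
     proof -
      have 1: "layn H1 (p + (i + j)) (p + (i + j) + lL) (p + l) j c' (a - i) (l - a - j)"
       unfolding c'_def by (rule sp(2)[where lR = "k * BS - lL"]) (use ij lk ru i in \<open>auto simp: b_def a'_def\<close>)
      have 2: "layn H1 La (La + lL) (La + k * BS) j c' a' b'"
       using 1 pl ij unfolding La_def a'_def b'_def b_def by simp
      show ?thesis
       unfolding layn_def layout_def
      proof (intro allI impI)
       fix z assume z: "- int b' <= z" "z < int a'"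
       have "cell_of (int La) (int (La + k * BS)) (int j) (int (La + k * BS) - int (La + lL)) (int a' + int b') z \<in>
        {La..<La + lL} \<union> {La + lL..<La + k * BS}"
        using cell_range[OF inv[unfolded ninvn_def] z] by (simp only: nat_int)
       then show "H2 (cell_of (int La) (int (La + k * BS)) (int j) (int (La + k * BS) - int (La + lL)) (int a' + int b') z) = Elem (c' z)"
        using 2 z unfolding layn_def layout_def by (subst out2) (auto simp: La_def)
      qed
     qed
     have v': "valley c' (int a') (int b')"
      using valley_high[OF v[unfolded ib], of "int i" "int j"] i ij ab unfolding c'_def
      by (simp add: a'_def b'_def of_nat_diff)
     have g5: "glob BS e5" "node e5 La (La + lL) (La + lL) (La + k * BS) j a' 0"
      using e2v pl by (auto simp: e5_def e4_def e3_def glob_def node_def)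
     have kT: "La + k * BS <= N" "0 + k <= N" using l pl kN by auto
     let ?M1 = "max M0 (112 + 224 * W) + 224 * W"
     have "wp ?R ?R M (Call pid) (wp ?R ?R M (12 ::= V 35 [div] V 20 ;; Call mid) J) e5 [] H2 n5 d5"
     proof (rule wp_Call[OF purify_tri[OF Prs(2) leaf loc WB(1) g5 inv ab' lk(3) kN(2) kT lay v']])
      show "{La..<La + lL} \<union> {La + lL..<La + k * BS} <= ?R" using pl ru(4) by (auto simp: La_def)
      then show "{La..<La + lL} \<union> {La + lL..<La + k * BS} <= ?R" .
      fix H3
      let ?ms = "vmset c' (int a') (int b')"
      assume "PP LP BS H3 (blks BS La (La + lL) (La + lL) (La + k * BS)) 0 k ?ms"
       and out3: "!!x. x \<notin> {La..<La + lL} \<union> {La + lL..<La + k * BS} ==> H3 x = H2 x"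
      then have "PP LP BS H3 {La + x * BS |x. x < k} 0 k ?ms"
       unfolding blks_contig[OF ru(1,4) WB(2)] by simp
      then obtain D Xs where ps: "perm_state LP BS H3 La k Xs D" and ms: "mset (concat (map Xs [0..<k])) = ?ms"
       using PP_perm[OF _ WB(2)] by blast
      define e6 where "e6 = e5(12 := k)"
      define n6 where "n6 = n5 + Suc (k * (nl + 42 + 33 * BS) - (39 + 33 * BS)) + 1"
      define d6 where "d6 = d5 + Suc (dl + 3 + W * (22 * W + 70)) + 1"
      have g6: "glob BS e6" "e6 14 = La" "e6 12 = k"
       using g5 by (auto simp: e6_def glob_def node_def)
      have kL: "k * BS < L" using lk l by linarith
      have "wp ?R ?R M (Call mid) J e6 [] H3 n6 d6"
      proof (rule wp_Call[OF perm[unfolded perm_ok_def, rule_format, OF g6 kL lk(3) kT(1) ps]])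
       show "{La..<La + k * BS} <= ?R" using pl by (auto simp: La_def)
       then show "{La..<La + k * BS} <= ?R" .
       fix H4 assume o4: "outp H4 La (k * BS) (mset (concat (map Xs [0..<k])))"
        and out4: "!!x. x \<notin> {La..<La + k * BS} ==> H4 x = H3 x"
       have o2': "outp H4 p r (vmset c (int i) (int j))"
       proof (rule outp_cong)
        show "outp H2 p r (vmset c (int i) (int j))" using o2 ij by (simp add: j_def of_nat_diff)
        show "H4 x = H2 x" if "x \<in> {p..<p + r}" for x
         using out4[of x] out3[of x] that ru(4) by (auto simp: La_def)
       qed
       have i4: "0 <= int i" "int i <= int a" "0 <= int j" "int j <= int b" using i ij by auto
       have ai: "int a' = int a - int i" "int b' = int b - int j" using i ij by (auto simp: a'_def b'_def of_nat_diff)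
       have "outp H4 p (r + k * BS) (vmset c (int i) (int j) + ?ms)"
       proof (rule outp_append[OF o2'])
        show "outp H4 (p + r) (k * BS) ?ms" using o4 ms by (simp add: La_def)
        fix x y assume xy: "x \<in># vmset c (int i) (int j)" "y \<in># ?ms"
        have s1: "c (int i - 1) <= c (- int j - 1)" if "0 < int i" "int j < int b" using sep(1) that by (simp add: j_def)
        have s2: "c (- int j) <= c (int i)" if "0 < int j" "int i < int a" using sep(2) that by (simp add: j_def)
        show "x <= y"
         by (rule vmset_split_le[OF v[unfolded ib] i4 s1 s2 xy[unfolded c'_def ai]])
       qed
       moreover have "vmset c (int a) (int b) = vmset c (int i) (int j) + ?ms"
        unfolding c'_def ai by (rule vmset_split) (use i4 in auto)
       ultimately have oo4: "outp H4 p l (vmset c (int a) (int l - int a))"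
        unfolding ib using lk(1) by (simp only: add.commute)
       have "n6 + Suc (K * (k * BS)) <= ?n"
       proof -
        have "k * (nl + 42 + 33 * BS) <= k * (K * BS)" using nl by (intro mult_le_mono) auto
        moreover have "k * (K * BS) = K * (k * BS)" by simp
        moreover have "fl r <= K * r + K * W" by (rule fl[OF lk(2)])
        moreover have "?n = 2 * (K * (k * BS)) + 2 * (K * r) + 21 * l + K * W + 31 * W"
         unfolding lk(1) by (simp add: algebra_simps)
        moreover have "j <= l" using dj by simp
        ultimately show ?thesis using n2(1) W4 unfolding n6_def n5_def n4_def by linarith
       qed
       moreover have "d6 + Suc d3 <= ?d"
        using n2(2) unfolding d6_def d5_def d4_def by simp
       ultimately show "J e6 [] H4 (n6 + Suc (K * (k * BS))) (d6 + Suc d3)"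
        using oo4 by (simp add: J_def)
      qed (use M in auto)
      moreover have "e5 35 = l" "e5 20 = BS" using e2v by (auto simp: e5_def e4_def e3_def)
      ultimately show "wp ?R ?R M (12 ::= V 35 [div] V 20 ;; Call mid) J e5 [] H3
       (n5 + Suc (k * (nl + 42 + 33 * BS) - (39 + 33 * BS))) (d5 + Suc (dl + 3 + W * (22 * W + 70)))"
       using lw BSw by (simp add: wp_Seq wp_Assign e6_def n6_def d6_def k_def)
     qed (use M in auto)
     moreover have "e4 34 = a'" "e4 33 = j" "e4 11 = p" "e4 21 = r" "e4 20 = BS"
      using e2v by (auto simp: e4_def e3_def a'_def)
     moreover have "a' - j + BS < 2 ^ w" "lL < 2 ^ w" "La < 2 ^ w" "La + lL < 2 ^ w" "a' < 2 ^ w" "j < 2 ^ w"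
     proof -
      have "lL <= N" "La <= N" "La + lL <= N" "a' - j + BS <= N + N" "a' <= N" "j <= N"
       using ru(4) ab' lk l rBS ij dj unfolding La_def by linarith+
      then show "a' - j + BS < 2 ^ w" "lL < 2 ^ w" "La < 2 ^ w" "La + lL < 2 ^ w" "a' < 2 ^ w" "j < 2 ^ w"
       by (auto intro!: small)
     qed
     ultimately show "wp ?R ?R M ?t3 J e4 [] H2 (n4 + Suc (fl r)) (d4 + Suc d1)"
      using lw BSw WB by (cases "a' < j") (simp_all add: wp_Seq wp_Assign wp_If e5_def n5_def d5_def lL_def La_def)
    qed (use M in auto)
    moreover have "n4 = Suc (Suc (Suc (Suc (n2 + 5 + Suc (21 * j + 2)))))" "d4 = Suc (Suc (Suc (Suc (d2 + 5 + Suc (10 * W + 11)))))"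
     by (simp_all add: n4_def d4_def)
    moreover have "i < 2 ^ w" "r < 2 ^ w" using i lw lk by linarith+
    ultimately show "wp ?R ?R M ?t2 J e3 [] H1 (n2 + 5 + Suc (21 * j + 2)) (d2 + 5 + Suc (10 * W + 11))"
     using e2v e2(1) lw i(1) by (simp add: wp_Seq wp_Assign e4_def e3_def)
   qed (use M dj l kN in \<open>auto simp: e3_def\<close>)
   moreover have "n2 + 5 = Suc (Suc (Suc (Suc (Suc n2))))" "d2 + 5 = Suc (Suc (Suc (Suc (Suc d2))))" by simp_all
   moreover have "p + i < 2 ^ w" "r < 2 ^ w" "j < 2 ^ w" "j <= p + l" using i lw lk ij dj by linarith+
   ultimately show "wp ?R ?R M ?t1 J e2 [] H n2 d2"
    using e2v e2(1) lw i(2) by (simp add: wp_Seq wp_Assign e3_def j_def)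
  qed (use e0 ab l rBS in \<open>auto simp: e1_def\<close>)
  moreover have "(9::nat) = Suc (Suc (Suc (Suc (Suc (Suc (Suc (Suc (Suc 0))))))))" by simp
  ultimately show ?thesis
   unfolding solve_def using False eqr e lw BSw WB qn
   by (simp add: wp_Seq wp_Assign wp_If e1_def e0_def r_def)
 qed
 then show "tri ?R ?R (112 + max ML (max (max M0 (112 + 224 * W) + 224 * W) MP)) (Pr pr) e H
   (%H'. outp H' p l (vmset c (int a) (int l - int a))) ?n ?d"
  unfolding J_def M_def Prs(1) by (rule tri_wpI)
qed

end

section \<open>Parallel passes over the blocks of the second level\<close>

definition ld :: "nat => exp => nat => com" where
 "ld xr g t = 7 ::= V 14 [+] (V xr [*] V 20 [+] g) ;; rd ;; t ::= V 8"

definition st :: "exp => exp => com" where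
 "st g a = 8 ::= a ;; 7 ::= V 14 [+] (V 3 [*] V 20 [+] g) ;; wr"

text \<open>Register 12 is the number of blocks; stored as a partner, this number means that the
  iteration has nothing to swap.\<close>

definition swp_body :: com where
 "swp_body = ld 3 (V 33) 23 ;;
   If (V 23) (V 12)
   (5 ::= V 14 [+] (V 3 [*] V 20 [+] V 34) ;; 6 ::= V 14 [+] (V 23 [*] V 20 [+] V 34) ;;
    4 ::= V 35 ;; 3 ::= C 0 ;; Call 1) Skip"

text \<open>The partner of a block is stored in the block, yet it must not be moved while an
  iteration reads it. So the first pass moves everything but group 0 under the control of group 0.
  The second pass moves group 0 under the control of group 1, which has meanwhile been carried to
  the other end of the pair and is prepared accordingly.\<close>

definition invol :: com where
 "invol = 33 ::= C 0 ;; 34 ::= V 1 ;; 35 ::= V 20 [-] V 1 ;; Call 15 ;;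
   33 ::= V 1 ;; 34 ::= C 0 ;; 35 ::= V 1 ;; Call 15"

locale blk = alg3 +
 fixes base k Q1 S1 :: nat
 assumes kN: "base + k * S1 <= N" and k1: "1 <= k" and Q1: "Q1 = 2 * W + 3" and S1: "S1 = Q1 * Q1"
begin

text \<open>From \<open>4 <= W\<close> follows \<open>11 <= Q1\<close>, so there is room for ten
  groups of \<open>Q1\<close> elements in a block of \<open>Q1 * Q1\<close>.\<close>

lemma ten: "10 * Q1 <= S1" "0 < Q1" "0 < S1" "Q1 <= S1"
proof -
 have 11: "11 <= Q1" using Q1 W4 by simp
 then have "11 * Q1 <= S1" unfolding S1 by (intro mult_le_mono1)
 with 11 show "10 * Q1 <= S1" "0 < Q1" "0 < S1" "Q1 <= S1" by linarith+
qed

lemma kk: "k <= N" "k <= 2 ^ W" "k < 2 ^ W" "k < 2 ^ w" "S1 <= N" "S1 < 2 ^ w" "base < 2 ^ w"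
proof -
 have "k * 1 <= k * S1" "1 * S1 <= k * S1" using ten k1 by (intro mult_le_mono; simp)+
 then show k: "k <= N" and s: "S1 <= N" using kN by linarith+
 then show "k < 2 ^ W" "k <= 2 ^ W" using NW by linarith+
 show "k < 2 ^ w" "S1 < 2 ^ w" "base < 2 ^ w" using k s kN by (simp_all add: small)
qed

definition gc :: "nat => nat => nat set" where
 "gc x g = {base + (x * S1 + g * Q1)..<base + (x * S1 + g * Q1) + Q1}"

definition gx :: "'a list => nat => 'a list" where
 "gx ys g = take Q1 (drop (g * Q1) ys)"

text \<open>\<open>Y x\<close> is the sorted content that block \<open>x\<close> stands for and
  \<open>Z x g\<close> the word woven into its group \<open>g\<close>. The elements behind the ten
  groups are stored plainly.\<close>

definition ST :: "(nat => 'a :: linorder list) => (nat => nat => nat option) => (nat => 'a cell) => bool" where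
 "ST Y Z H \<longleftrightarrow> (\<forall>x<k. length (Y x) = S1 & sorted (Y x)) &
   (\<forall>x<k. \<forall>g<10. grp W H (base + (x * S1 + g * Q1)) (gx (Y x) g) (Z x g)) &
   (\<forall>x<k. \<forall>i<S1. 10 * Q1 <= i --> H (base + (x * S1 + i)) = Elem (Y x ! i))"

lemma gq10: "g < 10 ==> g * Q1 + Q1 <= 10 * Q1"
proof -
 assume "g < 10"
 then have "Suc g * Q1 <= 10 * Q1" by (intro mult_le_mono1) simp
 then show ?thesis unfolding mult_Suc by linarith
qed

lemma gq: "g < 10 ==> g * Q1 + Q1 <= S1"
 using gq10 ten(1) le_trans by blast

lemma gx: "length ys = S1 ==> sorted ys ==> g < 10 ==> length (gx ys g) = 2 * W + 3 & sorted (gx ys g)"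
 using gq[of g] by (simp add: gx_def sorted_wrt_take sorted_wrt_drop Q1[symmetric])

lemma blk_le: "x < k ==> base + (x * S1 + S1) <= base + k * S1"
 using mult_le_mono1[of "Suc x" k S1] by simp

lemma cell_eq:
 assumes "base + (x * S1 + i) = base + (y * S1 + i')" "i < S1" "i' < S1"
 shows "x = y" "i = i'"
proof -
 have "x * S1 + i = y * S1 + i'" using assms(1) by simp
 moreover from this have "x = y" using block_eq[of x S1 i y] assms by simp
 ultimately show "x = y" "i = i'" by auto
qed

lemma gcE:
 assumes "a \<in> gc x g" "g < 10"
 obtains i where "a = base + (x * S1 + i)" "g * Q1 <= i" "i < g * Q1 + Q1" "i < S1"
proof -
 have "a = base + (x * S1 + (a - base - x * S1))" "g * Q1 <= a - base - x * S1" "a - base - x * S1 < g * Q1 + Q1"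
  using assms(1) by (auto simp: gc_def)
 then show ?thesis using that gq[OF assms(2)] by (meson order_less_le_trans)
qed

lemma gc_disj: "a \<in> gc x g ==> a \<in> gc y h ==> g < 10 ==> h < 10 ==> x = y & g = h"
proof -
 assume a: "a \<in> gc x g" "a \<in> gc y h" "g < 10" "h < 10"
 obtain i where i: "a = base + (x * S1 + i)" "g * Q1 <= i" "i < g * Q1 + Q1" "i < S1" using gcE a by metis
 obtain i' where i': "a = base + (y * S1 + i')" "h * Q1 <= i'" "i' < h * Q1 + Q1" "i' < S1" using gcE a by metis
 have e: "x = y" "i = i'" using cell_eq[of x i y i'] i i' by auto
 have "g = h" using block_eq[of g Q1 "i - g * Q1" h] i i' e by simp
 with e show ?thesis by simp
qed

lemma gc_sub: "x < k ==> g < 10 ==> gc x g <= {base..<base + k * S1}"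
 using blk_le[of x] gq[of g] unfolding gc_def by auto

lemma wp_ld:
 assumes e: "e 0 = W" "e 14 = base" "e 20 = S1" "e xr = x" "val e ge = g * Q1" "ok w e ge"
  and x: "x < k" "g < 10" and gr: "ST Y Z H" "Z x g = Some v" and v: "v < 2 ^ W"
  and R: "gc x g <= R" and Q: "!!e' n' d'. (!!r. r \<notin> {7, 8, 9, t} ==> e' r = e r) ==> e' t = v ==>
   n' <= n + 5 * W + 8 ==> d' <= d + 5 * W + 8 ==> Q e' [] H n' d'"
 shows "wp R U M (ld xr ge t) Q e [] H n d"
proof -
 define p where "p = base + (x * S1 + g * Q1)"
 have pN: "p + (2 * W + 3) <= N" using blk_le[OF x(1)] gq[OF x(2)] kN by (simp add: p_def Q1[symmetric])
 have "x < 2 ^ w" "x * S1 < 2 ^ w" "x * S1 + g * Q1 < 2 ^ w" "p < 2 ^ w" "p + (2 * W + 3) < 2 ^ w"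
 proof -
  have "x <= N" "x * S1 <= N" "x * S1 + g * Q1 <= N" "p <= N" using x kk(1) pN by (auto simp: p_def)
  then show "x < 2 ^ w" "x * S1 < 2 ^ w" "x * S1 + g * Q1 < 2 ^ w" "p < 2 ^ w" "p + (2 * W + 3) < 2 ^ w"
   using pN by (simp_all add: small)
 qed
 note b = this
 have YY: "length (Y x) = S1" "sorted (Y x)" using gr x by (auto simp: ST_def)
 have "wp R U M rd (wp R U M (t ::= V 8) Q) (e(7 := p)) [] H (Suc n) (Suc d)"
 proof (rule wp_rd[where p = p and v = v and xs = "gx (Y x) g"])
  show "grp W H p (gx (Y x) g) (Some v)" using gr x unfolding ST_def p_def by metis
  show "{p..<p + (2 * W + 3)} <= R" using R by (simp add: gc_def p_def Q1[symmetric])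
  fix e' n' d'
  assume e': "!!r. r \<notin> {8, 9} ==> e' r = (e(7 := p)) r" "e' 8 = v"
   and n': "n' <= Suc n + 5 * W + 6" "d' <= Suc d + 5 * W + 6"
  have "v < 2 ^ w" using v WW by linarith
  moreover have "Q (e'(t := v)) [] H (Suc n') (Suc d')"
   by (rule Q) (use e' n' in auto)
  ultimately show "wp R U M (t ::= V 8) Q e' [] H n' d'" using e' by (simp add: wp_Assign)
 qed (use e b gx[OF YY x(2)] v in auto)
 then show ?thesis unfolding ld_def using e b kk by (simp add: wp_Seq wp_Assign p_def)
qed

lemma ST_upd:
 assumes st: "ST Y Z H" and x: "x < k" "g < 10" and g: "grp W H' (base + (x * S1 + g * Q1)) (gx (Y x) g) vo"
  and out: "!!a. a \<notin> gc x g ==> H' a = H a"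
 shows "ST Y (Z(x := (Z x)(g := vo))) H'"
 unfolding ST_def
proof (intro conjI allI impI)
 fix y h assume y: "y < k" "h < (10::nat)"
 show "grp W H' (base + (y * S1 + h * Q1)) (gx (Y y) h) ((Z(x := (Z x)(g := vo))) y h)"
 proof (cases "y = x & h = g")
  case False
  have "H' (base + (y * S1 + h * Q1) + i) = H (base + (y * S1 + h * Q1) + i)" if "i < 2 * W + 3" for i
  proof (rule out)
   have "base + (y * S1 + h * Q1) + i \<in> gc y h" using that by (auto simp: gc_def Q1[symmetric])
   then show "base + (y * S1 + h * Q1) + i \<notin> gc x g" using gc_disj x y False by blast
  qed
  moreover have "grp W H (base + (y * S1 + h * Q1)) (gx (Y y) h) (Z y h)" using st y by (auto simp: ST_def)
  ultimately show ?thesis using False by (auto intro: grp_cong)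
 qed (use g in auto)
next
 fix y i assume y: "y < k" "i < S1" "10 * Q1 <= i"
 have "H' (base + (y * S1 + i)) = H (base + (y * S1 + i))"
 proof (rule out)
  show "base + (y * S1 + i) \<notin> gc x g"
  proof
   assume "base + (y * S1 + i) \<in> gc x g"
   then obtain i' where c: "base + (y * S1 + i) = base + (x * S1 + i')" "i' < g * Q1 + Q1" "i' < S1"
    using gcE[OF _ x(2)] by metis
   then show False using cell_eq[of y i x i'] y gq10[OF x(2)] by linarith
  qed
 qed
 then show "H' (base + (y * S1 + i)) = Elem (Y y ! i)" using st y by (auto simp: ST_def)
qed (use st in \<open>auto simp: ST_def\<close>)

lemma wp_st:
 assumes e: "e 0 = W" "e 14 = base" "e 20 = S1" "e 3 = x" "val e ge = g * Q1" "ok w e ge" "ok w e a" "val e a = v"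
  and ge: "!!u. val (e(8 := u)) ge = val e ge" "!!u. ok w (e(8 := u)) ge = ok w e ge"
  and x: "x < k" "g < 10" and gr: "ST Y Z H" and v: "v < 2 ^ W"
  and U: "gc x g <= U" "U <= R" and Q: "!!e' H' n' d'. (!!r. r \<notin> {7, 8, 9, 10} ==> e' r = e r) ==>
   ST Y (Z(x := (Z x)(g := Some v))) H' ==>
   n' <= n + 8 * W + 8 ==> d' <= d + 8 * W + 8 ==> Q e' [] H' n' d'"
 shows "wp R U M (st ge a) Q e [] H n d"
proof -
 define p where "p = base + (x * S1 + g * Q1)"
 have pN: "p + (2 * W + 3) <= N" using blk_le[OF x(1)] gq[OF x(2)] kN by (simp add: p_def Q1[symmetric])
 have "x < 2 ^ w" "x * S1 < 2 ^ w" "x * S1 + g * Q1 < 2 ^ w" "p < 2 ^ w" "p + (2 * W + 3) < 2 ^ w"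
 proof -
  have "x <= N" "x * S1 <= N" "x * S1 + g * Q1 <= N" "p <= N" using x kk(1) pN by (auto simp: p_def)
  then show "x < 2 ^ w" "x * S1 < 2 ^ w" "x * S1 + g * Q1 < 2 ^ w" "p < 2 ^ w" "p + (2 * W + 3) < 2 ^ w"
   using pN by (simp_all add: small)
 qed
 note b = this
 have YY: "length (Y x) = S1" "sorted (Y x)" using gr x by (auto simp: ST_def)
 have "wp R U M wr Q (e(8 := v, 7 := p)) [] H (Suc (Suc n)) (Suc (Suc d))"
 proof (rule wp_wr[where p = p and v = v and xs = "gx (Y x) g" and vo = "Z x g"])
  show "grp W H p (gx (Y x) g) (Z x g)" using gr x unfolding ST_def p_def by metis
  show "{p..<p + (2 * W + 3)} <= U" using U by (simp add: gc_def p_def Q1[symmetric])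
  fix e' H' n' d'
  assume e': "!!r. r \<notin> {8, 9, 10} ==> e' r = (e(8 := v, 7 := p)) r" and g: "grp W H' p (gx (Y x) g) (Some v)"
   and out: "!!a. a \<notin> {p..<p + (2 * W + 3)} ==> H' a = H a"
   and n': "n' <= Suc (Suc n) + 8 * W + 6" "d' <= Suc (Suc d) + 8 * W + 6"
  show "Q e' [] H' n' d'"
  proof (rule Q)
   show "ST Y (Z(x := (Z x)(g := Some v))) H'"
    by (rule ST_upd[OF gr x g[unfolded p_def]]) (use out in \<open>simp add: gc_def p_def Q1[symmetric]\<close>)
  qed (use e' n' in auto)
 qed (use e b gx[OF YY x(2)] v U in auto)
 then show ?thesis unfolding st_def using e b kk ge by (simp add: wp_Seq wp_Assign p_def)
qed

text \<open>In a pass the iteration for block \<open>x\<close> may look at the groups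
  \<open>RG\<close> of every block and at all of its own groups, and it writes to its own groups
  \<open>WG\<close>.\<close>

definition RR :: "nat set => nat => nat set" where
 "RR RG x = (\<Union>y\<in>{..<k}. \<Union>g\<in>RG. gc y g) \<union> (\<Union>g\<in>{..<10}. gc x g)"
definition UU :: "nat set => nat => nat set" where
 "UU WG x = (\<Union>g\<in>WG. gc x g)"
text \<open>The most expensive pass reads six words at \<open>5 * W\<close> and writes three at
  \<open>8 * W\<close>.\<close>

definition nb :: nat where "nb = 54 * W + 120"

text \<open>The iterations do not interfere because no group that is read from other blocks is
  written in the same pass. This is what forces the doubling rounds to alternate between two sets of
  groups.\<close>

lemma pass_tri:
 fixes Y :: "nat => 'a :: linorder list"
 assumes P: "Pr pn = pfor pn body" and e: "e 3 = 0" "e 4 = k" and s: "ST Y Z H"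
  and WG: "WG <= {..<10}" "RG <= {..<10}" "WG \<inter> RG = {}"
  and body: "!!x e'. x < k ==> e' 3 = x ==> (!!r. r ~= 3 ==> r ~= 4 ==> e' r = e r) ==>
   wp (RR RG x) (UU WG x) 0 body (%e' b' H' n' d'. n' <= nb & d' <= nb &
    (\<exists>Z'. ST Y Z' H' & (\<forall>g\<in>WG. Z' x g = F x g))) e' [] H 0 0"
 shows "tri {base..<base + k * S1} {base..<base + k * S1} (224 * W) (Pr pn) e H
  (ST Y (%x g. if g \<in> WG then F x g else Z x g)) (k * (nb + 20) + 2) (nb + 10 * W + 10)"
proof -
 let ?Q = "%x H'. \<forall>g\<in>WG. grp W H' (base + (x * S1 + g * Q1)) (gx (Y x) g) (F x g)"
 have "tri (\<Union>i\<in>{0..<0+k}. RR RG i) (\<Union>i\<in>{0..<0+k}. UU WG i) (0 + 224 * W) (Pr pn) e H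
   (%H'. \<forall>i\<in>{0..<0+k}. ?Q i H') (sum (%_. nb) {0..<0+k} + (20 * k - 12) + 2) (nb + 10 * W + 10)"
 proof (rule pfor_tri[OF P e])
  show "0 + k < 2 ^ w" "k <= 2 ^ W" using kk by auto
  show "UU WG i <= RR RG i" for i using WG unfolding UU_def RR_def by blast
  show "UU WG i \<inter> RR RG j = {}" if "i ~= j" for i j
  proof -
   have False if "a \<in> gc i g" "g \<in> WG" "a \<in> RR RG j" for a g
   proof -
    have g: "g < 10" using that WG by auto
    from that(3) consider y h where "h \<in> RG" "a \<in> gc y h" | h where "h < 10" "a \<in> gc j h"
     unfolding RR_def by auto
    then show False
    proof cases
     case 1
     then have "h < 10" using WG by auto
     then show False using gc_disj[OF that(1) 1(2) g] 1 that(2) WG(3) by blast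
    next
     case 2
     then show False using gc_disj[OF that(1) 2(2) g] \<open>i ~= j\<close> by blast
    qed
   qed
   then show ?thesis unfolding UU_def by blast
  qed
 next
  fix i e' assume i: "i \<in> {0..<0 + k}" and e': "e' 3 = i" "!!r. r ~= 3 ==> r ~= 4 ==> e' r = e r"
  show "tri (RR RG i) (UU WG i) 0 body e' H (?Q i) nb nb"
  proof (rule tri_wpI, rule wp_mono[OF body[OF _ e']])
   show "i < k" using i by simp
   fix e' b' H' n' d' assume "n' <= nb & d' <= nb & (\<exists>Z'. ST Y Z' H' & (\<forall>g\<in>WG. Z' i g = F i g))"
   then obtain Z' where z: "n' <= nb" "d' <= nb" "ST Y Z' H'" "!!g. g \<in> WG ==> Z' i g = F i g" by blast
   have "grp W H' (base + (i * S1 + g * Q1)) (gx (Y i) g) (F i g)" if "g \<in> WG" for g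
   proof -
    have "g < 10" using that WG by auto
    then have "grp W H' (base + (i * S1 + g * Q1)) (gx (Y i) g) (Z' i g)" using z(3) i by (auto simp: ST_def)
    then show ?thesis using z(4)[OF that] by simp
   qed
   with z show "n' <= nb & d' <= nb & ?Q i H'" by blast
  qed
 next
  fix i K K' assume i: "i \<in> {0..<0+k}" "?Q i K" "!!a. a \<in> UU WG i ==> K' a = K a"
  show "?Q i K'"
  proof
   fix g assume g: "g \<in> WG"
   have "K' (base + (i * S1 + g * Q1) + j) = K (base + (i * S1 + g * Q1) + j)" if "j < 2 * W + 3" for j
    by (rule i(3)) (use g that in \<open>auto simp: UU_def gc_def Q1[symmetric] intro!: bexI[of _ g]\<close>)
   then show "grp W K' (base + (i * S1 + g * Q1)) (gx (Y i) g) (F i g)" using i(2) g by (auto intro: grp_cong)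
  qed
 qed
 then show ?thesis
 proof (rule tri_mono)
  show "(\<Union>i\<in>{0..<0+k}. RR RG i) <= {base..<base + k * S1}"
  proof
   fix a assume "a \<in> (\<Union>i\<in>{0..<0+k}. RR RG i)"
   then obtain i where "i \<in> {0..<0+k}" "a \<in> RR RG i" by (rule UN_E)
   then consider y h where "y < k" "h \<in> RG" "a \<in> gc y h" | h where "i < k" "h < 10" "a \<in> gc i h"
    unfolding RR_def by auto
   then obtain y h where "y < k" "h < 10" "a \<in> gc y h" using WG(2) by cases (blast, blast)
   then show "a \<in> {base..<base + k * S1}" using gc_sub by blast
  qed
  show "(\<Union>i\<in>{0..<0+k}. UU WG i) <= {base..<base + k * S1}"
  proof
   fix a assume "a \<in> (\<Union>i\<in>{0..<0+k}. UU WG i)"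
   then obtain i where "i \<in> {0..<0+k}" "a \<in> UU WG i" by (rule UN_E)
   then obtain h where "i < k" "h \<in> WG" "a \<in> gc i h" unfolding UU_def by auto
   then obtain y h where "y < k" "h < 10" "a \<in> gc y h" using WG(1) by blast
   then show "a \<in> {base..<base + k * S1}" using gc_sub by blast
  qed
  fix H' assume Q: "\<forall>i\<in>{0..<0+k}. ?Q i H'" and out: "!!a. a \<notin> (\<Union>i\<in>{0..<0+k}. UU WG i) ==> H' a = H a"
  show "ST Y (%x g. if g \<in> WG then F x g else Z x g) H'"
   unfolding ST_def
  proof (intro conjI allI impI)
   fix x g assume x: "x < k" "g < (10::nat)"
   show "grp W H' (base + (x * S1 + g * Q1)) (gx (Y x) g) (if g \<in> WG then F x g else Z x g)"
   proof (cases "g \<in> WG")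
    case False
    have "H' (base + (x * S1 + g * Q1) + i) = H (base + (x * S1 + g * Q1) + i)" if "i < 2 * W + 3" for i
    proof (rule out)
     have a: "base + (x * S1 + g * Q1) + i \<in> gc x g" using that by (auto simp: gc_def Q1[symmetric])
     show "base + (x * S1 + g * Q1) + i \<notin> (\<Union>i\<in>{0..<0+k}. UU WG i)"
      using gc_disj[OF a _ x(2)] False WG unfolding UU_def by blast
    qed
    moreover have "grp W H (base + (x * S1 + g * Q1)) (gx (Y x) g) (Z x g)" using s x by (auto simp: ST_def)
    ultimately show ?thesis using False by (auto intro: grp_cong)
   qed (use Q x in auto)
  next
   fix y i assume y: "y < k" "i < S1" "10 * Q1 <= i"
   have "H' (base + (y * S1 + i)) = H (base + (y * S1 + i))"
   proof (rule out)
    have False if ag: "base + (y * S1 + i) \<in> gc x g" "g \<in> WG" for x g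
    proof -
     have g: "g < 10" using ag WG by auto
     then obtain i' where "base + (y * S1 + i) = base + (x * S1 + i')" "i' < g * Q1 + Q1" "i' < S1"
      using gcE[OF ag(1) g] by metis
     then show False using cell_eq[of y i x i'] y gq10[OF g] by linarith
    qed
    then show "base + (y * S1 + i) \<notin> (\<Union>i\<in>{0..<0+k}. UU WG i)" unfolding UU_def by blast
   qed
   then show "H' (base + (y * S1 + i)) = Elem (Y y ! i)" using s y by (auto simp: ST_def)
  qed (use s in \<open>auto simp: ST_def\<close>)
 qed (use k1 in \<open>auto simp: algebra_simps\<close>)
qed

text \<open>Of two partners only the one with the smaller number acts; it owns the moved cells of
  both. The group that stores the partner lies outside the moved range, so the iteration of the
  other partner can read it at the same time.\<close>

lemma swp_tri:
 fixes H :: "nat => 'a :: linorder cell"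
 assumes P: "Pr 15 = pfor 15 swp_body" and e: "e 3 = 0" "e 4 = k"
  and env: "e 0 = W" "e 12 = k" "e 14 = base" "e 20 = S1" "e 33 = g * Q1" "e 34 = off" "e 35 = l"
  and p: "!!x. x < k ==> p x < k" "!!x. x < k ==> p (p x) = x"
  and g: "g < 10" and dj: "off + l <= S1" "off + l <= g * Q1 \<or> g * Q1 + Q1 <= off"
  and ct: "!!x. x < k ==> grp W H (base + (x * S1 + g * Q1)) (ys x) (Some (if x < p x then p x else k)) &
   sorted (ys x) & length (ys x) = 2 * W + 3"
 shows "tri {base..<base + k * S1} {base..<base + k * S1} (112 + 448 * W) (Pr 15) e H
  (%H'. \<forall>x<k. \<forall>i<S1. H' (base + (x * S1 + i)) =
    (if off <= i & i < off + l then H (base + (p x * S1 + i)) else H (base + (x * S1 + i))))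
  (k * (21 * S1 + 5 * W + 60) + 2) (25 * W + 50)"
proof -
 define rg where "rg x = {base + (x * S1 + off)..<base + (x * S1 + off) + l}" for x
 define U where "U x = (if x < p x then rg x \<union> rg (p x) else {})" for x
 define R where "R x = gc x g \<union> U x" for x
 let ?Q = "%x H'. x < p x --> (\<forall>i<l. H' (base + (x * S1 + off) + i) = H (base + (p x * S1 + off) + i) &
   H' (base + (p x * S1 + off) + i) = H (base + (x * S1 + off) + i))"
 have rgE: "\<exists>i. a = base + (x * S1 + i) & off <= i & i < off + l & i < S1" if "a \<in> rg x" for a x
  using that dj(1) by (intro exI[of _ "a - base - x * S1"]) (auto simp: rg_def)
 have rgD: "x = y" if "a \<in> rg x" "a \<in> rg y" for a x y
  using rgE[OF that(1)] rgE[OF that(2)] cell_eq(1) by blast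
 have rg_gc: False if a: "a \<in> rg x" "a \<in> gc y g" for a x y
 proof -
  obtain i where "a = base + (x * S1 + i)" "off <= i" "i < off + l" "i < S1" using rgE[OF a(1)] by blast
  moreover obtain i' where "a = base + (y * S1 + i')" "g * Q1 <= i'" "i' < g * Q1 + Q1" "i' < S1"
   using gcE[OF a(2) g] by blast
  ultimately show False using cell_eq[of x i y i'] dj(2) by auto
 qed
 have rg_sub: "rg x <= {base..<base + k * S1}" if "x < k" for x
  using blk_le[OF that] dj(1) by (auto simp: rg_def)
 have "tri (\<Union>i\<in>{0..<0+k}. R i) (\<Union>i\<in>{0..<0+k}. U i) ((112 + 224 * W) + 224 * W) (Pr 15) e H
   (%H'. \<forall>i\<in>{0..<0+k}. ?Q i H') (sum (%_. 21 * S1 + 5 * W + 40) {0..<0+k} + (20 * k - 12) + 2)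
   ((15 * W + 40) + 10 * W + 10)"
 proof (rule pfor_tri[OF P e])
  show "0 + k < 2 ^ w" "k <= 2 ^ W" using kk by auto
  show "U i <= R i" for i by (auto simp: R_def)
  show "U i \<inter> R j = {}" if "i ~= j" "i \<in> {0..<0+k}" "j \<in> {0..<0+k}" for i j
  proof -
   have ij: "i < k" "j < k" using that by auto
   have False if "a \<in> U i" "a \<in> R j" for a
   proof -
    have ip: "i < p i" "a \<in> rg i \<or> a \<in> rg (p i)" using that(1) by (auto simp: U_def split: if_splits)
    then have "a \<notin> gc j g" using rg_gc by blast
    then have jp: "j < p j" "a \<in> rg j \<or> a \<in> rg (p j)" using that(2) by (auto simp: R_def U_def split: if_splits)
    have "p i ~= p j" using p(2)[OF ij(1)] p(2)[OF ij(2)] \<open>i ~= j\<close> by metis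
    moreover have "i ~= p j" using ip(1) jp(1) p(2)[OF ij(2)] by auto
    moreover have "p i ~= j" using ip(1) jp(1) p(2)[OF ij(1)] by auto
    ultimately show False using ip(2) jp(2) rgD \<open>i ~= j\<close> by metis
   qed
   then show ?thesis by blast
  qed
 next
  fix x e' assume xi: "x \<in> {0..<0 + k}" and e': "e' 3 = x" "!!r. r ~= 3 ==> r ~= 4 ==> e' r = e r"
  have x: "x < k" using xi by simp
  define J where "J = (%(e' :: nat => nat) (b' :: 'a cell list) H' n' d'. n' <= 21 * S1 + 5 * W + 40 & d' <= 15 * W + 40 & ?Q x H')"
  let ?M = "112 + 224 * W"
  let ?v = "if x < p x then p x else k"
  let ?sw = "5 ::= V 14 [+] (V 3 [*] V 20 [+] V 34) ;; 6 ::= V 14 [+] (V 23 [*] V 20 [+] V 34) ;;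
    4 ::= V 35 ;; 3 ::= C 0 ;; Call 1"
  define gp where "gp = base + (x * S1 + g * Q1)"
  have pN: "gp + (2 * W + 3) <= N" using blk_le[OF x] gq[OF g] kN by (simp add: gp_def Q1[symmetric])
  have pw: "x < 2 ^ w" "x * S1 < 2 ^ w" "x * S1 + g * Q1 < 2 ^ w" "gp < 2 ^ w" "gp + (2 * W + 3) < 2 ^ w" "g * Q1 < 2 ^ w"
  proof -
   have "x <= N" "x * S1 <= N" "x * S1 + g * Q1 <= N" "gp <= N" "g * Q1 <= N" using x kk(1) pN by (auto simp: gp_def)
   then show "x < 2 ^ w" "x * S1 < 2 ^ w" "x * S1 + g * Q1 < 2 ^ w" "gp < 2 ^ w" "gp + (2 * W + 3) < 2 ^ w" "g * Q1 < 2 ^ w"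
    using pN by (simp_all add: small)
  qed
  have ev: "e' 0 = W" "e' 12 = k" "e' 14 = base" "e' 20 = S1" "e' 33 = g * Q1" "e' 34 = off" "e' 35 = l"
   using e'(2) env by auto
  have "wp (R x) (U x) ?M rd (wp (R x) (U x) ?M (23 ::= V 8) (wp (R x) (U x) ?M (If (V 23) (V 12) (?sw) Skip) J))
   (e'(7 := gp)) [] H (Suc 0) (Suc 0)"
  proof (rule wp_rd[where p = gp and v = ?v and xs = "ys x"])
   show "grp W H gp (ys x) (Some ?v)" using ct[OF x] by (simp add: gp_def)
   show "?v < 2 ^ W" using p(1)[OF x] kk by auto
   show "{gp..<gp + (2 * W + 3)} <= R x" by (auto simp: R_def gc_def gp_def Q1[symmetric])
   fix e2 n2 d2
   assume e2: "!!r. r \<notin> {8, 9} ==> e2 r = (e'(7 := gp)) r" "e2 8 = ?v"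
    and n2: "n2 <= Suc 0 + 5 * W + 6" "d2 <= Suc 0 + 5 * W + 6"
   have vw: "?v < 2 ^ w" using p(1)[OF x] kk by auto
   have e2v: "e2 0 = W" "e2 12 = k" "e2 14 = base" "e2 20 = S1" "e2 34 = off" "e2 35 = l" "e2 3 = x"
    using e2(1) ev e'(1) by auto
   show "wp (R x) (U x) ?M (23 ::= V 8) (wp (R x) (U x) ?M (If (V 23) (V 12) (?sw) Skip) J) e2 [] H n2 d2"
   proof (cases "x < p x")
    case False
    then have "J (e2(23 := k)) [] H (Suc (Suc n2)) (Suc (Suc d2))" using n2 by (simp add: J_def)
    then show ?thesis using False e2 e2v vw kk by (simp add: wp_Assign wp_If wp_Skip)
   next
    case True
    define y where "y = p x"
    have y: "y < k" "x < y" using p(1)[OF x] True by (auto simp: y_def)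
    have yb: "base + (y * S1 + off) + l <= N" "base + (x * S1 + off) + l <= N"
     using blk_le[OF y(1)] blk_le[OF x] dj(1) kN by linarith+
    have yw: "y < 2 ^ w" "y * S1 < 2 ^ w" "y * S1 + off < 2 ^ w" "base + (y * S1 + off) < 2 ^ w"
      "x * S1 + off < 2 ^ w" "base + (x * S1 + off) < 2 ^ w" "off < 2 ^ w" "l < 2 ^ w"
    proof -
     have "y <= N" "y * S1 <= N" "y * S1 + off <= N" "base + (y * S1 + off) <= N"
      "x * S1 + off <= N" "base + (x * S1 + off) <= N" "off <= N" "l <= N" using yb y(1) kk(1) by linarith+
     then show "y < 2 ^ w" "y * S1 < 2 ^ w" "y * S1 + off < 2 ^ w" "base + (y * S1 + off) < 2 ^ w"
      "x * S1 + off < 2 ^ w" "base + (x * S1 + off) < 2 ^ w" "off < 2 ^ w" "l < 2 ^ w" by (simp_all add: small)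
    qed
    define e3 where "e3 = e2(23 := y, 5 := base + (x * S1 + off), 6 := base + (y * S1 + off), 4 := l, 3 := 0)"
    have "wp (R x) (U x) ?M (Call 1) J e3 [] H (Suc (Suc (Suc (Suc (Suc (Suc n2)))))) (Suc (Suc (Suc (Suc (Suc (Suc d2))))))"
    proof (rule wp_Call[OF swap_tri[where l = l and x = "base + (x * S1 + off)" and y = "base + (y * S1 + off)" and t = W]])
     show "{base + (x * S1 + off)..<base + (x * S1 + off) + l} \<inter> {base + (y * S1 + off)..<base + (y * S1 + off) + l} = {}"
      using rgD[of _ x y] y(2) unfolding rg_def by blast
     show "l <= 2 ^ W" using dj(1) kk(5) NW by linarith
     show "{base + (x * S1 + off)..<base + (x * S1 + off) + l} \<union> {base + (y * S1 + off)..<base + (y * S1 + off) + l} <= R x"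
      "{base + (x * S1 + off)..<base + (x * S1 + off) + l} \<union> {base + (y * S1 + off)..<base + (y * S1 + off) + l} <= U x"
      using True by (auto simp: R_def U_def rg_def y_def)
     fix H' assume "\<forall>i<l. H' (base + (x * S1 + off) + i) = H (base + (y * S1 + off) + i) &
      H' (base + (y * S1 + off) + i) = H (base + (x * S1 + off) + i)"
     moreover have "l <= S1" using dj(1) by simp
     ultimately show "J e3 [] H' (Suc (Suc (Suc (Suc (Suc (Suc n2))))) + Suc (21 * l + 2)) (Suc (Suc (Suc (Suc (Suc (Suc d2))))) + Suc (10 * W + 11))"
      using n2 by (simp add: J_def y_def)
    qed (use yb in \<open>auto simp: e3_def\<close>)
    then show ?thesis using True y e2 e2v yw kk pw by (simp add: wp_Seq wp_Assign wp_If e3_def y_def[symmetric])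
   qed
  qed (use ev pw ct[OF x] in auto)
  then have "wp (R x) (U x) ?M swp_body J e' [] H 0 0"
   unfolding swp_body_def ld_def using ev e'(1) pw kk by (simp add: wp_Seq wp_Assign gp_def)
  then show "tri (R x) (U x) ?M swp_body e' H (?Q x) (21 * S1 + 5 * W + 40) (15 * W + 40)"
   unfolding J_def by (rule tri_wpI)
 next
  fix i K K' assume "?Q i K" "!!a. a \<in> U i ==> K' a = K a"
  then show "?Q i K'" by (auto simp: U_def rg_def)
 qed
 then show ?thesis
 proof (rule tri_mono)
  have "gc x g <= {base..<base + k * S1}" "U x <= {base..<base + k * S1}" if "x < k" for x
   using gc_sub[OF that g] rg_sub[OF that] rg_sub[OF p(1)[OF that]] by (auto simp: U_def)
  then show "(\<Union>i\<in>{0..<0+k}. R i) <= {base..<base + k * S1}" "(\<Union>i\<in>{0..<0+k}. U i) <= {base..<base + k * S1}"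
   unfolding R_def by fastforce+
  fix H' assume Q: "\<forall>i\<in>{0..<0+k}. ?Q i H'" and out: "!!a. a \<notin> (\<Union>i\<in>{0..<0+k}. U i) ==> H' a = H a"
  show "\<forall>x<k. \<forall>i<S1. H' (base + (x * S1 + i)) =
    (if off <= i & i < off + l then H (base + (p x * S1 + i)) else H (base + (x * S1 + i)))"
  proof (intro allI impI)
   fix x i assume x: "x < k" "i < S1"
   show "H' (base + (x * S1 + i)) = (if off <= i & i < off + l then H (base + (p x * S1 + i)) else H (base + (x * S1 + i)))"
   proof (cases "off <= i & i < off + l")
    case True
    then obtain i' where i': "i = off + i'" "i' < l" by (metis add_less_cancel_left le_Suc_ex)
    consider "x < p x" | "p x < x" | "p x = x" by linarith
    then show ?thesis
    proof cases
     case 1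
     then show ?thesis using Q x(1) i' True by (simp add: add.assoc)
    next
     case 2
     moreover have "?Q (p x) H'" by (rule bspec[OF Q]) (use p(1)[OF x(1)] in simp)
     moreover have "p x < p (p x)" using 2 p(2)[OF x(1)] by simp
     ultimately show ?thesis using i' True p(2)[OF x(1)] by (simp add: add.assoc)
    next
     case 3
     have "base + (x * S1 + i) \<notin> U y" if "y < k" for y
     proof
      assume a: "base + (x * S1 + i) \<in> U y"
      then have "y < p y" "base + (x * S1 + i) \<in> rg y \<or> base + (x * S1 + i) \<in> rg (p y)" by (auto simp: U_def split: if_splits)
      moreover have "base + (x * S1 + i) \<in> rg x" using True by (auto simp: rg_def)
      ultimately have "y < p y" "x = y \<or> x = p y" using rgD by blast+
      then show False using 3 p(2)[OF that] by auto
     qed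
     then have "H' (base + (x * S1 + i)) = H (base + (x * S1 + i))" by (intro out) auto
     then show ?thesis using 3 by simp
    qed
   next
    case False
    have "base + (x * S1 + i) \<notin> rg y" for y
    proof
     assume "base + (x * S1 + i) \<in> rg y"
     then obtain i' where "base + (x * S1 + i) = base + (y * S1 + i')" "off <= i'" "i' < off + l" "i' < S1" using rgE by blast
     then show False using cell_eq[of x i y i'] x(2) False by auto
    qed
    then have "H' (base + (x * S1 + i)) = H (base + (x * S1 + i))" by (intro out) (auto simp: U_def)
    then show ?thesis using False by auto
   qed
  qed
 qed (use k1 in \<open>auto simp: algebra_simps\<close>)
qed

lemma wp_invol:
 fixes Y :: "nat => 'a :: linorder list"
 assumes P: "Pr 15 = pfor 15 swp_body" and e: "e 3 = 0" "e 4 = k"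
  and env: "e 0 = W" "e 1 = Q1" "e 12 = k" "e 14 = base" "e 20 = S1"
  and p: "!!x. x < k ==> p x < k" "!!x. x < k ==> p (p x) = x"
  and s: "ST Y Z H" and z: "!!x. x < k ==> Z x 0 = Some (if x < p x then p x else k)"
   "!!x. x < k ==> Z x 1 = Some (if p x < x then x else k)"
  and M: "224 + 448 * W <= M" and R: "{base..<base + k * S1} <= R" "{base..<base + k * S1} <= U"
  and Q: "!!e' H' n' d'. (!!r. r \<notin> {33, 34, 35} ==> e' r = e r) ==> ST (%x. Y (p x)) (%x. Z (p x)) H' ==>
   n' <= n + 12 + 2 * (k * (21 * S1 + 5 * W + 60)) ==> d' <= d + 50 * W + 110 ==> Q e' [] H' n' d'"
 shows "wp R U M invol Q e [] H n d"
proof -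
 have len: "length (gx (Y x) g) = 2 * W + 3 & sorted (gx (Y x) g)" if "x < k" "g < 10" for x g
  using gx[of "Y x" g] s that by (auto simp: ST_def)
 have gr: "grp W H (base + (x * S1 + g * Q1)) (gx (Y x) g) (Z x g)" if "x < k" "g < 10" for x g
  using s that by (auto simp: ST_def)
 define e1 where "e1 = e(33 := 0, 34 := Q1, 35 := S1 - Q1)"
 define e2 where "e2 = e1(33 := Q1, 34 := 0, 35 := Q1)"
 let ?c2 = "33 ::= V 1 ;; 34 ::= C 0 ;; 35 ::= V 1 ;; Call 15"
 let ?N = "k * (21 * S1 + 5 * W + 60) + 2" and ?D = "25 * W + 50"
 have qs: "Q1 < 2 ^ w" "0 < (2::nat) ^ w" using ten kk by auto
 have "wp R U M (Call 15) (wp R U M ?c2 Q) e1 [] H (Suc (Suc (Suc n))) (Suc (Suc (Suc d)))"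
 proof (rule wp_Call[OF swp_tri[OF P, where p = p and g = 0 and off = Q1 and l = "S1 - Q1" and ys = "%x. gx (Y x) 0"]])
  show "grp W H (base + (x * S1 + 0 * Q1)) (gx (Y x) 0) (Some (if x < p x then p x else k)) &
    sorted (gx (Y x) 0) & length (gx (Y x) 0) = 2 * W + 3" if "x < k" for x
   using gr[OF that, of 0] z(1)[OF that] len[OF that, of 0] by simp
  fix H1 assume H1: "\<forall>x<k. \<forall>i<S1. H1 (base + (x * S1 + i)) =
    (if Q1 <= i & i < Q1 + (S1 - Q1) then H (base + (p x * S1 + i)) else H (base + (x * S1 + i)))"
  have "wp R U M (Call 15) Q e2 [] H1 (Suc (Suc (Suc (Suc (Suc (Suc n)) + Suc ?N)))) (Suc (Suc (Suc (Suc (Suc (Suc d)) + Suc ?D))))"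
  proof (rule wp_Call[OF swp_tri[OF P, where p = p and g = 1 and off = 0 and l = Q1 and ys = "%x. gx (Y (p x)) 1"]])
   fix x assume x: "x < k"
   have "grp W H1 (base + (x * S1 + 1 * Q1)) (gx (Y (p x)) 1) (Z (p x) 1)"
   proof (rule grp_cong[OF gr[OF p(1)[OF x], of 1]])
    fix i assume "i < 2 * W + 3"
    then have i: "i < Q1" "Q1 + i < S1" using ten Q1 by auto
    show "H1 (base + (x * S1 + 1 * Q1) + i) = H (base + (p x * S1 + 1 * Q1) + i)"
     using H1[rule_format, OF x i(2)] i by (simp add: add.assoc)
   qed simp
   \<comment> \<open>After the first pass, group 1 of block \<open>x\<close> is the one that was
     prepared in block \<open>p x\<close>, with the roles of the partners exchanged.\<close>
   moreover have "Z (p x) 1 = Some (if x < p x then p x else k)" using z(2)[OF p(1)[OF x]] p(2)[OF x] by simp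
   ultimately show "grp W H1 (base + (x * S1 + 1 * Q1)) (gx (Y (p x)) 1) (Some (if x < p x then p x else k)) &
     sorted (gx (Y (p x)) 1) & length (gx (Y (p x)) 1) = 2 * W + 3"
    using len[OF p(1)[OF x], of 1] by simp
  next
   fix H2 assume H2: "\<forall>x<k. \<forall>i<S1. H2 (base + (x * S1 + i)) =
     (if 0 <= i & i < 0 + Q1 then H1 (base + (p x * S1 + i)) else H1 (base + (x * S1 + i)))"
   have all: "H2 (base + (x * S1 + i)) = H (base + (p x * S1 + i))" if "x < k" "i < S1" for x i
    using H2[rule_format, OF that] H1[rule_format, OF that] H1[rule_format, OF p(1)[OF that(1)] that(2)] that(2)
    by (cases "i < Q1") auto
   show "Q e2 [] H2 (Suc (Suc (Suc (Suc (Suc (Suc n)) + Suc ?N))) + Suc ?N) (Suc (Suc (Suc (Suc (Suc (Suc d)) + Suc ?D))) + Suc ?D)"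
   proof (rule Q)
    show "ST (%x. Y (p x)) (%x. Z (p x)) H2"
     unfolding ST_def
    proof (intro conjI allI impI)
     fix x g assume x: "x < k" "g < (10::nat)"
     show "grp W H2 (base + (x * S1 + g * Q1)) (gx (Y (p x)) g) (Z (p x) g)"
     proof (rule grp_cong[OF gr[OF p(1)[OF x(1)] x(2)]])
      fix i assume "i < 2 * W + 3"
      then have i: "g * Q1 + i < S1" using gq[OF x(2)] Q1 by simp
      show "H2 (base + (x * S1 + g * Q1) + i) = H (base + (p x * S1 + g * Q1) + i)"
       using all[OF x(1) i] by (simp add: add.assoc)
     qed
    next
     fix x i assume x: "x < k" "i < S1" "10 * Q1 <= i"
     show "H2 (base + (x * S1 + i)) = Elem (Y (p x) ! i)"
      using all[OF x(1,2)] s p(1)[OF x(1)] x by (auto simp: ST_def)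
    qed (use s p in \<open>auto simp: ST_def\<close>)
   qed (auto simp: e2_def e1_def)
  qed (use e env p ten M R in \<open>auto simp: e2_def e1_def\<close>)
  then show "wp R U M ?c2 Q e1 [] H1 (Suc (Suc (Suc n)) + Suc ?N) (Suc (Suc (Suc d)) + Suc ?D)"
   using env qs by (simp add: wp_Seq wp_Assign e2_def e1_def)
 qed (use e env p ten M R in \<open>auto simp: e1_def\<close>)
 then show ?thesis unfolding invol_def using env qs kk ten by (simp add: wp_Seq wp_Assign e1_def)
qed

end

section \<open>Pointer jumping along the cycles of a permutation\<close>

lemma bij_betw_funpow': "bij_betw f A A ==> bij_betw (f ^^ n) A A"
proof (induction n)
 case (Suc n)
 then show ?case using bij_betw_trans[of "f ^^ n" A A f A] by (simp add: comp_def)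
qed (simp add: bij_betw_def id_def)

text \<open>
  Every cyclic permutation is a product of two reflections: with the least element of the cycle as
  the origin, moving one step along \<open>D\<close> is the reflection \<open>r \<mapsto> - r\<close> followed by \<open>r \<mapsto> 1 - r\<close>.
\<close>

lemma reflections:
 fixes D m od :: "nat => nat"
 assumes D: "bij_betw D {..<k} {..<k}" and m: "!!x. x < k ==> (D ^^ od x) x = m x"
  and mi: "!!x i. x < k ==> i < T ==> m x <= (D ^^ i) x" and T: "k <= T" and x: "x < k"
 defines "p \<equiv> %x. (D ^^ od x) (m x)"
 shows "m x < k" "p x < k" "p (p x) = x" "D (p x) < k" "D (p (D (p x))) = x"
proof -
 have Dn: "bij_betw (D ^^ n) {..<k} {..<k}" for n by (rule bij_betw_funpow'[OF D])
 have Dk: "(D ^^ n) y < k" if "y < k" for n y using Dn[of n] that by (auto simp: bij_betw_def)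
 have inj: "y = z" if "(D ^^ n) y = (D ^^ n) z" "y < k" "z < k" for n y z
  using Dn[of n] that by (auto simp: bij_betw_def inj_on_def)
 have D1: "D y < k" if "y < k" for y using Dk[OF that, of 1] by simp
 have add: "(D ^^ a) ((D ^^ b) y) = (D ^^ (a + b)) y" for a b y by (simp add: funpow_add)
 \<comment> \<open>Among \<open>k + 1\<close> iterates in \<open>k\<close> places two agree, and
   injectivity cancels the common part.\<close>
 have per: "\<exists>t\<ge>1. t <= k & (D ^^ t) y = y" if y: "y < k" for y
 proof -
  have "\<not> inj_on (%i. (D ^^ i) y) {..k}"
  proof (rule pigeonhole)
   have "(%i. (D ^^ i) y) ` {..k} <= {..<k}" using Dk[OF y] by auto
   then have "card ((%i. (D ^^ i) y) ` {..k}) <= k" using card_mono[of "{..<k}"] by fastforce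
   then show "card ((%i. (D ^^ i) y) ` {..k}) < card {..k}" by simp
  qed
  then obtain i i' where i: "i < i'" "i' <= k" "(D ^^ i) y = (D ^^ i') y"
   unfolding inj_on_def by (metis atMost_iff linorder_neq_iff)
  have "(D ^^ i) ((D ^^ (i' - i)) y) = (D ^^ i) y" using i by (simp add: add)
  then have "(D ^^ (i' - i)) y = y" using inj[of i] Dk[OF y] y by blast
  then show ?thesis using i by (intro exI[of _ "i' - i"]) auto
 qed
 \<comment> \<open>A period does not exceed \<open>k <= T\<close>, so the first \<open>T\<close>
   iterates already run through the whole cycle.\<close>
 have mall: "m y <= (D ^^ i) y" if y: "y < k" for y i
 proof -
  obtain t where t: "1 <= t" "t <= k" "(D ^^ t) y = y" using per[OF y] by blast
  have "(D ^^ (n * t)) y = y" for n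
   by (induction n) (use t in \<open>simp_all add: funpow_add\<close>)
  then have "(D ^^ (i mod t)) ((D ^^ (i div t * t)) y) = (D ^^ (i mod t)) y" by simp
  then have "(D ^^ i) y = (D ^^ (i mod t)) y" by (simp add: add)
  moreover have "i mod t < t" using t(1) by simp
  then have "i mod t < T" using t(2) T by linarith
  ultimately show ?thesis using mi[OF y] by simp
 qed
 have mk: "m y < k" if "y < k" for y using m[OF that] Dk[OF that] by metis
 \<comment> \<open>\<open>y\<close> and \<open>D y\<close> have the same cycle; going once around
   expresses the iterates of either through those of the other.\<close>
 have mD: "m (D y) = m y" if y: "y < k" for y
 proof (rule antisym)
  have "(D ^^ od (D y)) (D y) = (D ^^ (od (D y) + 1)) y" by (simp add: funpow_swap1)
  then show "m y <= m (D y)" using m[OF D1[OF y]] mall[OF y] by metis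
  obtain t where t: "1 <= t" "(D ^^ t) y = y" using per[OF y] by blast
  have "(D ^^ (od y + t - 1)) (D y) = (D ^^ Suc (od y + t - 1)) y" by (simp add: funpow_swap1)
  also have "Suc (od y + t - 1) = od y + t" using t by simp
  also have "(D ^^ (od y + t)) y = m y" using t m[OF y] by (simp add: funpow_add)
  finally show "m (D y) <= m y" using mall[OF D1[OF y]] by metis
 qed
 have mDn: "m ((D ^^ n) y) = m y" if y: "y < k" for y n
  by (induction n) (use mD Dk[OF y] in auto)
 have pk: "p y < k" if "y < k" for y unfolding p_def using Dk mk that by simp
 \<comment> \<open>Used with \<open>u = 0\<close> and \<open>u = 1\<close> for the two reflections.
   Since \<open>z\<close> lies on the cycle of \<open>y\<close>, both have the same minimum, and the
   power \<open>od z\<close> cancels the displacement by which \<open>z\<close> was defined.\<close>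
 have key: "(D ^^ u) (p z) = y" if y: "y < k" and z: "z = (D ^^ (u + od y)) (m y)" for y z u
 proof -
  have zk: "z < k" using Dk mk y z by simp
  have mz: "m z = m y" using mDn[OF mk[OF y]] mDn[OF y, of "od y"] m[OF y] z by metis
  have "(D ^^ od z) ((D ^^ (u + od y)) (m y)) = m y" using m[OF zk] z mz by simp
  then have "(D ^^ (od y)) ((D ^^ u) ((D ^^ od z) (m y))) = m y" by (simp add: add add_ac)
  then have "(D ^^ (od y)) ((D ^^ u) (p z)) = (D ^^ od y) y" using m[OF y] mz by (simp add: p_def)
  then show ?thesis using inj Dk pk[OF zk] y by metis
 qed
 show "m x < k" "p x < k" "D (p x) < k" using mk pk D1 x by auto
 show "p (p x) = x" using key[OF x, of "p x" 0] by (simp add: p_def)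
 show "D (p (D (p x))) = x" using key[OF x, of "D (p x)" 1] by (simp add: p_def)
qed

text \<open>The use of the ten groups: 2 holds the rank. The triples 4, 5, 6 and 7, 8, 9 hold in
  turn a pointer, the least position seen so far and its distance. Later, 0 holds the remaining bits
  of the distance and 3 a position that is moved along the cycle, with the pointer alternating
  between 4 and 7. At the end 0 and 1 hold the partners for \<open>invol\<close>.\<close>

definition init1 :: com where
 "init1 = ld 3 (C 2 [*] V 1) 23 ;; st (C 4 [*] V 1) (V 23) ;; st (C 5 [*] V 1) (V 3) ;; st (C 6 [*] V 1) (C 0)"

text \<open>Register 22 is the length \<open>2 ^ j\<close> of the pointers. A smaller minimum found
  through the pointer is that much farther away.\<close>

definition round1 :: com where
 "round1 = ld 3 (V 33) 23 ;; ld 3 (V 33 [+] V 1) 24 ;; ld 3 (V 33 [+] C 2 [*] V 1) 25 ;;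
   ld 23 (V 33) 26 ;; ld 23 (V 33 [+] V 1) 27 ;; ld 23 (V 33 [+] C 2 [*] V 1) 28 ;;
   If (V 27) (V 24) (24 ::= V 27 ;; 25 ::= V 22 [+] V 28) Skip ;;
   st (V 34) (V 26) ;; st (V 34 [+] V 1) (V 24) ;; st (V 34 [+] C 2 [*] V 1) (V 25)"

definition init2 :: com where
 "init2 = ld 3 (V 33 [+] V 1) 23 ;; ld 3 (V 33 [+] C 2 [*] V 1) 24 ;; ld 3 (C 2 [*] V 1) 25 ;;
   st (C 3 [*] V 1) (V 23) ;; st (C 0) (V 24) ;; st (V 34) (V 25)"

text \<open>Binary exponentiation: the pointer is the \<open>2 ^ j\<close>-th power of the
  permutation, and it is applied to the position in group 3 if bit \<open>j\<close> of the distance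
  is set.\<close>

definition round2 :: com where
 "round2 = ld 3 (V 33) 23 ;; ld 3 (C 0) 24 ;; ld 3 (C 3 [*] V 1) 25 ;; ld 23 (V 33) 26 ;; ld 25 (V 33) 27 ;;
   If (C 0) (V 24 [mod] C 2) (25 ::= V 27) Skip ;;
   st (C 0) (V 24 [div] C 2) ;; st (C 3 [*] V 1) (V 25) ;; st (V 34) (V 26)"

text \<open>In each pair the smaller block records its partner in group 0 and the greater one
  records itself in group 1; all other entries say that there is no partner.\<close>

definition prep :: com where
 "prep = ld 3 (V 33) 23 ;;
   If (V 3) (V 23) (24 ::= V 23) (24 ::= V 12) ;; If (V 23) (V 3) (25 ::= V 3) (25 ::= V 12) ;;
   st (C 0) (V 24) ;; st (V 1) (V 25)"

definition clear :: com where
 "clear = 23 ::= C 0 ;; While (V 23) (C 10)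
   (7 ::= V 14 [+] (V 3 [*] V 20 [+] V 23 [*] V 1) ;; clr ;; 23 ::= V 23 [+] C 1)"

context blk
begin

definition env :: "(nat => nat) => bool" where
 "env e \<longleftrightarrow> e 0 = W & e 1 = Q1 & e 12 = k & e 14 = base & e 20 = S1"

definition keep :: "nat => (nat => nat) => (nat => nat) => bool" where
 "keep t e e' \<longleftrightarrow> e' 3 = e 3 & e' 22 = e 22 & e' 33 = e 33 & e' 34 = e 34 & (t ~= 23 --> e' 23 = e 23) &
   (t ~= 24 --> e' 24 = e 24) & (t ~= 25 --> e' 25 = e 25) & (t ~= 26 --> e' 26 = e 26) &
   (t ~= 27 --> e' 27 = e 27) & (t ~= 28 --> e' 28 = e 28)"

lemma envD: "env e ==> e 0 = W & e 1 = Q1 & e (Suc 0) = Q1 & e 12 = k & e 14 = base & e 20 = S1"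
 by (simp add: env_def)

lemma ldS:
 assumes "env e" "e xr = x" "val e ge = g * Q1" "ok w e ge"
  and "x < k" "g < 10" and "ST Y Z H" "Z x g = Some v" and "v < 2 ^ W"
  and "gc x g <= R" and t: "t \<in> {23, 24, 25, 26, 27, 28}"
  and Q: "!!e' n' d'. env e' ==> keep t e e' ==> e' t = v ==>
   n' <= n + 5 * W + 8 ==> d' <= d + 5 * W + 8 ==> wp R U M c Q e' [] H n' d'"
 shows "wp R U M (ld xr ge t ;; c) Q e [] H n d"
 unfolding wp_Seq
proof (rule wp_ld[where x = x and g = g and Y = Y and Z = Z and v = v])
 fix e' n' d' assume a: "!!r. r \<notin> {7, 8, 9, t} ==> e' r = e r" "e' t = v" "n' <= n + 5 * W + 8" "d' <= d + 5 * W + 8"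
 have "env e'" using assms(1) t a(1)[of 0] a(1)[of 1] a(1)[of 12] a(1)[of 14] a(1)[of 20] unfolding env_def by auto
 moreover have "keep t e e'" using t unfolding keep_def by (auto intro!: a(1))
 ultimately show "wp R U M c Q e' [] H n' d'" using Q a by blast
qed (use assms in \<open>auto simp: env_def\<close>)

lemma stS:
 assumes "env e" "e 3 = x" "val e ge = g * Q1" "ok w e ge" "ok w e a" "val e a = v"
  and "!!u. val (e(8 := u)) ge = val e ge" "!!u. ok w (e(8 := u)) ge = ok w e ge"
  and "x < k" "g < 10" and "ST Y Z H" and "v < 2 ^ W" and "gc x g <= U" "U <= R"
  and Z1: "Z1 = Z(x := (Z x)(g := Some v))"
  and Q: "!!e' H' n' d'. env e' ==> keep 0 e e' ==> ST Y Z1 H' ==>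
   n' <= n + 8 * W + 8 ==> d' <= d + 8 * W + 8 ==> wp R U M c Q e' [] H' n' d'"
 shows "wp R U M (st ge a ;; c) Q e [] H n d"
 unfolding wp_Seq
proof (rule wp_st[where x = x and g = g and Y = Y and Z = Z and v = v])
 fix e' H' n' d' assume a: "!!r. r \<notin> {7, 8, 9, 10} ==> e' r = e r"
  "ST Y (Z(x := (Z x)(g := Some v))) H'" "n' <= n + 8 * W + 8" "d' <= d + 8 * W + 8"
 have "env e'" using assms(1) a(1) unfolding env_def by auto
 moreover have "keep 0 e e'" using a(1) unfolding keep_def by simp
 ultimately show "wp R U M c Q e' [] H' n' d'" using Q a unfolding Z1 by blast
qed (use assms in \<open>auto simp: env_def\<close>)

lemma stL:
 assumes "env e" "e 3 = x" "val e ge = g * Q1" "ok w e ge" "ok w e a" "val e a = v"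
  and "!!u. val (e(8 := u)) ge = val e ge" "!!u. ok w (e(8 := u)) ge = ok w e ge"
  and "x < k" "g < 10" and "ST Y Z H" and "v < 2 ^ W" and "gc x g <= U" "U <= R"
  and Z1: "Z1 = Z(x := (Z x)(g := Some v))"
  and Q: "!!e' H' n' d'. env e' ==> keep 0 e e' ==> ST Y Z1 H' ==>
   n' <= n + 8 * W + 8 ==> d' <= d + 8 * W + 8 ==> Q e' [] H' n' d'"
 shows "wp R U M (st ge a) Q e [] H n d"
proof (rule wp_st[where x = x and g = g and Y = Y and Z = Z and v = v])
 fix e' H' n' d' assume a: "!!r. r \<notin> {7, 8, 9, 10} ==> e' r = e r"
  "ST Y (Z(x := (Z x)(g := Some v))) H'" "n' <= n + 8 * W + 8" "d' <= d + 8 * W + 8"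
 have "env e'" using assms(1) a(1) unfolding env_def by auto
 moreover have "keep 0 e e'" using a(1) unfolding keep_def by simp
 ultimately show "Q e' [] H' n' d'" using Q a unfolding Z1 by blast
qed (use assms in \<open>auto simp: env_def\<close>)

lemma offs:
 assumes "g < 10"
 shows "g * Q1 < 2 ^ w" "g * Q1 + Q1 < 2 ^ w" "Q1 < 2 ^ w"
 using gq[OF assms] kk(6) ten by linarith+

lemma numw: "(1 :: nat) < 2 ^ w" "(2 :: nat) < 2 ^ w" "(3 :: nat) < 2 ^ w" "(4 :: nat) < 2 ^ w" "(5 :: nat) < 2 ^ w"
  "(6 :: nat) < 2 ^ w" "(10 :: nat) < 2 ^ w" "Suc 0 < 2 ^ w"
 by (rule small; simp)+

lemma Q2w: "2 * Q1 < 2 ^ w" "3 * Q1 < 2 ^ w" "4 * Q1 < 2 ^ w" "5 * Q1 < 2 ^ w" "6 * Q1 < 2 ^ w" "7 * Q1 < 2 ^ w"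
 using ten kk(6) by linarith+

lemma xw: "x < k ==> x < 2 ^ W & x < 2 ^ w"
 using kk by linarith

lemma ww: "(v :: nat) < 2 ^ W ==> v < 2 ^ w"
 using WW by linarith

lemma URR: "WG <= {..<10} ==> UU WG x <= RR RG x"
 unfolding UU_def RR_def by blast

lemma gcR: "g < 10 ==> gc x g <= RR RG x" "g \<in> RG ==> y < k ==> gc y g <= RR RG x" "g \<in> WG ==> gc x g <= UU WG x"
 unfolding UU_def RR_def by blast+

abbreviation Bpost :: "(nat => 'a :: linorder list) => nat set => (nat => nat => nat option) => nat
  => (nat => nat) => 'a cell list => (nat => 'a cell) => nat => nat => bool" where
 "Bpost Y WG F x \<equiv> %e' b' H' n' d'. n' <= nb & d' <= nb & (\<exists>Z'. ST Y Z' H' & (\<forall>g\<in>WG. Z' x g = F x g))"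

lemma init1_body:
 assumes e: "env e" "e 3 = x" and x: "x < k" and s: "ST Y Z H" and z: "Z x 2 = Some D" "D < 2 ^ W"
 shows "wp (RR {} x) (UU {4,5,6} x) 0 init1
  (Bpost Y {4,5,6} (%x g. Some (if g = 4 then D else if g = 5 then x else 0)) x) e [] H 0 0"
proof -
 define Z1 where "Z1 = Z(x := (Z x)(4 := Some D))"
 define Z2 where "Z2 = Z1(x := (Z1 x)(5 := Some x))"
 define Z3 where "Z3 = Z2(x := (Z2 x)(6 := Some 0))"
 note F = gcR URR numw Q2w ww xw[OF x] x z
 show ?thesis
  unfolding init1_def
 proof (rule ldS[where x = x and g = 2 and Y = Y and Z = Z and v = D], goal_cases)
  case c1: (12 e1 n1 d1)
  note r1 = c1(2)[unfolded keep_def, simplified e(2-2)] c1(3) envD[OF c1(1)]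
  show ?case
  proof (rule stS[where x = x and g = 4 and Y = Y and Z = Z and v = D and ?Z1.0 = Z1], goal_cases)
   case c2: (16 e2 H2 n2 d2)
   note r2 = c2(2)[unfolded keep_def, simplified r1] c2(3) envD[OF c2(1)]
   show ?case
   proof (rule stS[where x = x and g = 5 and Y = Y and Z = Z1 and v = x and ?Z1.0 = Z2], goal_cases)
    case c3: (16 e3 H3 n3 d3)
    note r3 = c3(2)[unfolded keep_def, simplified r2] c3(3) envD[OF c3(1)]
    show ?case
    proof (rule stL[where x = x and g = 6 and Y = Y and Z = Z2 and v = 0 and ?Z1.0 = Z3], goal_cases)
     case fin: (16 e4 H4 n4 d4)
     have "n4 <= nb" "d4 <= nb" using fin(4,5) c1(4,5) c2(4,5) c3(4,5) unfolding nb_def by linarith+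
     then show ?case using fin(3) by (auto simp: Z3_def Z2_def Z1_def intro!: exI[of _ Z3])
    qed (simp_all add: F s r3 c3(1) Z3_def)
   qed (simp_all add: F s r2 c2(1) Z2_def)
  qed (simp_all add: F s r1 c1(1) Z1_def)
 qed (simp_all add: F e s envD[OF e(1)])
qed

lemma round1_body:
 assumes e: "env e" "e 3 = x" "e 33 = ga * Q1" "e 34 = gb * Q1" "e 22 = T" and x: "x < k"
  and gab: "ga + 2 < 10" "gb + 2 < 10" "{ga, Suc ga, Suc (Suc ga)} \<inter> {gb, Suc gb, Suc (Suc gb)} = {}" and s: "ST Y Z H"
  and z: "!!y. y < k ==> Z y ga = Some (P y)" "!!y. y < k ==> Z y (Suc ga) = Some (m y)"
   "!!y. y < k ==> Z y (Suc (Suc ga)) = Some (od y)" "!!y. y < k ==> P y < k" "!!y. y < k ==> m y < k"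
   "!!y. y < k ==> od y < T" and T: "T + T <= 2 ^ W"
 shows "wp (RR {ga, Suc ga, Suc (Suc ga)} x) (UU {gb, Suc gb, Suc (Suc gb)} x) 0 round1
  (Bpost Y {gb, Suc gb, Suc (Suc gb)} (%x g. Some (if g = gb then P (P x)
    else if g = Suc gb then (if m (P x) < m x then m (P x) else m x)
    else (if m (P x) < m x then T + od (P x) else od x))) x) e [] H 0 0"
proof -
 let ?R = "RR {ga, Suc ga, Suc (Suc ga)} x" and ?U = "UU {gb, Suc gb, Suc (Suc gb)} x"
 let ?mm = "if m (P x) < m x then m (P x) else m x" and ?oo = "if m (P x) < m x then T + od (P x) else od x"
 let ?F = "%x g. Some (if g = gb then P (P x)
    else if g = Suc gb then (if m (P x) < m x then m (P x) else m x)
    else (if m (P x) < m x then T + od (P x) else od x))"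
 have Px: "P x < k" "P (P x) < k" "m x < k" "m (P x) < k" using z x by auto
 have vW: "P x < 2 ^ W" "P (P x) < 2 ^ W" "m x < 2 ^ W" "m (P x) < 2 ^ W" "od x < 2 ^ W" "od (P x) < 2 ^ W" "T + od (P x) < 2 ^ W"
  using xw Px z(6)[OF x] z(6)[OF Px(1)] T by auto
 have vw: "P x < 2 ^ w" "P (P x) < 2 ^ w" "m x < 2 ^ w" "m (P x) < 2 ^ w" "od x < 2 ^ w" "od (P x) < 2 ^ w" "T + od (P x) < 2 ^ w"
  using vW ww by auto
 have o1: "ga * Q1 < 2 ^ w" "ga * Q1 + Q1 < 2 ^ w" "ga * Q1 + 2 * Q1 < 2 ^ w" "gb * Q1 < 2 ^ w" "gb * Q1 + Q1 < 2 ^ w" "gb * Q1 + 2 * Q1 < 2 ^ w"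
  using offs[of "Suc ga"] offs[of "Suc gb"] gab by auto
 define Z1 where "Z1 = Z(x := (Z x)(gb := Some (P (P x))))"
 define Z2 where "Z2 = Z1(x := (Z1 x)(Suc gb := Some ?mm))"
 define Z3 where "Z3 = Z2(x := (Z2 x)(Suc (Suc gb) := Some ?oo))"
 note F = gcR URR numw Q2w xw[OF x] x z Px vW vw o1 offs(3)[of 0]
 have fin: "wp ?R ?U 0 (st (V 34) (V 26) ;; st (V 34 [+] V 1) (V 24) ;; st (V 34 [+] C 2 [*] V 1) (V 25))
   (Bpost Y {gb, Suc gb, Suc (Suc gb)} ?F x) e1 [] H n1 d1"
  if c1: "env e1" "e1 3 = x" "e1 34 = gb * Q1" "e1 26 = P (P x)" "e1 24 = ?mm" "e1 25 = ?oo" "n1 <= 30 * W + 60" "d1 <= 30 * W + 60" for e1 n1 d1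
 proof (rule stS[where x = x and g = gb and Y = Y and Z = Z and v = "P (P x)" and ?Z1.0 = Z1], goal_cases)
  case c2: (16 e2 H2 n2 d2)
  note r2 = c2(2)[unfolded keep_def, simplified c1(2-6)] c2(3) envD[OF c2(1)]
  show ?case
  proof (rule stS[where x = x and g = "Suc gb" and Y = Y and Z = Z1 and v = ?mm and ?Z1.0 = Z2], goal_cases)
   case c3: (16 e3 H3 n3 d3)
   note r3 = c3(2)[unfolded keep_def, simplified r2] c3(3) envD[OF c3(1)]
   show ?case
   proof (rule stL[where x = x and g = "Suc (Suc gb)" and Y = Y and Z = Z2 and v = ?oo and ?Z1.0 = Z3], goal_cases)
    case fin: (16 e4 H4 n4 d4)
    have "n4 <= nb" "d4 <= nb" using fin(4,5) c1(7,8) c2(4,5) c3(4,5) unfolding nb_def by linarith+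
    then show ?case using fin(3) by (auto simp: Z3_def Z2_def Z1_def intro!: exI[of _ Z3])
   qed (use gab in \<open>simp_all add: F s r3 c3(1) Z3_def\<close>)
  qed (use gab in \<open>simp_all add: F s r2 c2(1) Z2_def\<close>)
 qed (use gab in \<open>simp_all add: F c1(1-6) s envD[OF c1(1)] Z1_def\<close>)
 show ?thesis
  unfolding round1_def
 proof (rule ldS[where x = x and g = ga and Y = Y and Z = Z and v = "P x"], goal_cases)
  case c1: (12 e1 n1 d1)
  note r1 = c1(2)[unfolded keep_def, simplified e(2-5)] c1(3) envD[OF c1(1)]
  show ?case
  proof (rule ldS[where x = x and g = "Suc ga" and Y = Y and Z = Z and v = "m x"], goal_cases)
   case c2: (12 e2 n2 d2)
   note r2 = c2(2)[unfolded keep_def, simplified r1] c2(3) envD[OF c2(1)]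
   show ?case
   proof (rule ldS[where x = x and g = "Suc (Suc ga)" and Y = Y and Z = Z and v = "od x"], goal_cases)
    case c3: (12 e3 n3 d3)
    note r3 = c3(2)[unfolded keep_def, simplified r2] c3(3) envD[OF c3(1)]
    show ?case
    proof (rule ldS[where x = "P x" and g = ga and Y = Y and Z = Z and v = "P (P x)"], goal_cases)
     case c4: (12 e4 n4 d4)
     note r4 = c4(2)[unfolded keep_def, simplified r3] c4(3) envD[OF c4(1)]
     show ?case
     proof (rule ldS[where x = "P x" and g = "Suc ga" and Y = Y and Z = Z and v = "m (P x)"], goal_cases)
      case c5: (12 e5 n5 d5)
      note r5 = c5(2)[unfolded keep_def, simplified r4] c5(3) envD[OF c5(1)]
      show ?case
      proof (rule ldS[where x = "P x" and g = "Suc (Suc ga)" and Y = Y and Z = Z and v = "od (P x)"], goal_cases)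
       case c6: (12 e6 n6 d6)
       note r6 = c6(2)[unfolded keep_def, simplified r5] c6(3) envD[OF c6(1)]
       have v6: "e6 3 = x" "e6 34 = gb * Q1" "e6 26 = P (P x)" "e6 24 = m x" "e6 25 = od x" "e6 27 = m (P x)" "e6 28 = od (P x)" "e6 22 = T"
        by (simp_all add: r6)
       have n6: "n6 <= 30 * W + 48" "d6 <= 30 * W + 48" using c1(4,5) c2(4,5) c3(4,5) c4(4,5) c5(4,5) c6(4,5) by linarith+
       show ?case
       proof (cases "m (P x) < m x")
        case True
        have "wp ?R ?U 0 (st (V 34) (V 26) ;; st (V 34 [+] V 1) (V 24) ;; st (V 34 [+] C 2 [*] V 1) (V 25))
         (Bpost Y {gb, Suc gb, Suc (Suc gb)} ?F x) (e6(24 := m (P x), 25 := T + od (P x))) [] H (Suc (Suc (Suc n6))) (Suc (Suc (Suc d6)))"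
         by (rule fin) (use True v6 n6 c6(1) in \<open>auto simp: env_def\<close>)
        then show ?thesis using True v6 vw by (simp add: wp_Seq wp_If wp_Assign)
       next
        case False
        have "wp ?R ?U 0 (st (V 34) (V 26) ;; st (V 34 [+] V 1) (V 24) ;; st (V 34 [+] C 2 [*] V 1) (V 25))
         (Bpost Y {gb, Suc gb, Suc (Suc gb)} ?F x) e6 [] H (Suc n6) (Suc d6)"
         by (rule fin) (use False v6 n6 c6(1) in auto)
        then show ?thesis using False v6 vw by (simp add: wp_Seq wp_If wp_Skip)
       qed
      qed (use gab in \<open>simp_all add: F s r5 c5(1)\<close>)
     qed (use gab in \<open>simp_all add: F s r4 c4(1)\<close>)
    qed (use gab in \<open>simp_all add: F s r3 c3(1)\<close>)
   qed (use gab in \<open>simp_all add: F s r2 c2(1)\<close>)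
  qed (use gab in \<open>simp_all add: F s r1 c1(1)\<close>)
 qed (use gab in \<open>simp_all add: F e s envD[OF e(1)]\<close>)
qed

lemma init2_body:
 assumes e: "env e" "e 3 = x" "e 33 = ga * Q1" "e 34 = gb * Q1" and x: "x < k"
  and gab: "ga + 2 < 10" "gb < 10" "gb ~= 0" "gb ~= 3" and s: "ST Y Z H"
  and z: "Z x 2 = Some D" "Z x (Suc ga) = Some m" "Z x (Suc (Suc ga)) = Some od" "D < 2 ^ W" "m < 2 ^ W" "od < 2 ^ W"
 shows "wp (RR {} x) (UU {0, 3, gb} x) 0 init2
  (Bpost Y {0, 3, gb} (%x g. Some (if g = 0 then od else if g = 3 then m else D)) x) e [] H 0 0"
proof -
 have o1: "ga * Q1 < 2 ^ w" "ga * Q1 + Q1 < 2 ^ w" "ga * Q1 + 2 * Q1 < 2 ^ w" "gb * Q1 < 2 ^ w"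
  using offs[of "Suc ga"] offs[of gb] gab by auto
 define Z1 where "Z1 = Z(x := (Z x)(3 := Some m))"
 define Z2 where "Z2 = Z1(x := (Z1 x)(0 := Some od))"
 define Z3 where "Z3 = Z2(x := (Z2 x)(gb := Some D))"
 note F = gcR URR numw Q2w ww xw[OF x] x z o1 offs(3)[of 0]
 show ?thesis
  unfolding init2_def
 proof (rule ldS[where x = x and g = "Suc ga" and Y = Y and Z = Z and v = m], goal_cases)
  case c1: (12 e1 n1 d1)
  note r1 = c1(2)[unfolded keep_def, simplified e(2-4)] c1(3) envD[OF c1(1)]
  show ?case
  proof (rule ldS[where x = x and g = "Suc (Suc ga)" and Y = Y and Z = Z and v = od], goal_cases)
   case c2: (12 e2 n2 d2)
   note r2 = c2(2)[unfolded keep_def, simplified r1] c2(3) envD[OF c2(1)]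
   show ?case
   proof (rule ldS[where x = x and g = 2 and Y = Y and Z = Z and v = D], goal_cases)
    case c3: (12 e3 n3 d3)
    note r3 = c3(2)[unfolded keep_def, simplified r2] c3(3) envD[OF c3(1)]
    show ?case
    proof (rule stS[where x = x and g = 3 and Y = Y and Z = Z and v = m and ?Z1.0 = Z1], goal_cases)
     case c4: (16 e4 H4 n4 d4)
     note r4 = c4(2)[unfolded keep_def, simplified r3] c4(3) envD[OF c4(1)]
     show ?case
     proof (rule stS[where x = x and g = 0 and Y = Y and Z = Z1 and v = od and ?Z1.0 = Z2], goal_cases)
      case c5: (16 e5 H5 n5 d5)
      note r5 = c5(2)[unfolded keep_def, simplified r4] c5(3) envD[OF c5(1)]
      show ?case
      proof (rule stL[where x = x and g = gb and Y = Y and Z = Z2 and v = D and ?Z1.0 = Z3], goal_cases)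
       case fin: (16 e6 H6 n6 d6)
       have "n6 <= nb" "d6 <= nb" using fin(4,5) c1(4,5) c2(4,5) c3(4,5) c4(4,5) c5(4,5) unfolding nb_def by linarith+
       then show ?case using fin(3) gab by (auto simp: Z3_def Z2_def Z1_def intro!: exI[of _ Z3])
      qed (use gab in \<open>simp_all add: F s r5 c5(1) Z3_def\<close>)
     qed (use gab in \<open>simp_all add: F s r4 c4(1) Z2_def\<close>)
    qed (use gab in \<open>simp_all add: F s r3 c3(1) Z1_def\<close>)
   qed (use gab in \<open>simp_all add: F s r2 c2(1)\<close>)
  qed (use gab in \<open>simp_all add: F s r1 c1(1)\<close>)
 qed (use gab in \<open>simp_all add: F e s envD[OF e(1)]\<close>)
qed

lemma round2_body:
 assumes e: "env e" "e 3 = x" "e 33 = ga * Q1" "e 34 = gb * Q1" and x: "x < k"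
  and gab: "ga < 10" "gb < 10" "gb ~= 0" "gb ~= 3" and s: "ST Y Z H"
  and z: "!!y. y < k ==> Z y ga = Some (P y)" "Z x 0 = Some od" "Z x 3 = Some tg"
   "!!y. y < k ==> P y < k" "od < 2 ^ W" "tg < k"
 shows "wp (RR {ga} x) (UU {0, 3, gb} x) 0 round2
  (Bpost Y {0, 3, gb} (%x g. Some (if g = 0 then od div 2 else if g = 3 then (if odd od then P tg else tg) else P (P x))) x) e [] H 0 0"
proof -
 let ?R = "RR {ga} x" and ?U = "UU {0, 3, gb} x"
 let ?tt = "if odd od then P tg else tg"
 let ?F = "%x g. Some (if g = 0 then od div 2 else if g = 3 then (if odd od then P tg else tg) else P (P x))"
 have Px: "P x < k" "P (P x) < k" "P tg < k" using z x by auto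
 have vW: "P x < 2 ^ W" "P (P x) < 2 ^ W" "P tg < 2 ^ W" "tg < 2 ^ W" "od div 2 < 2 ^ W"
  using xw Px z(6) z(5) by auto
 have vw: "P x < 2 ^ w" "P (P x) < 2 ^ w" "P tg < 2 ^ w" "tg < 2 ^ w" "od < 2 ^ w"
  using vW ww z(5) by auto
 have o1: "ga * Q1 < 2 ^ w" "gb * Q1 < 2 ^ w"
  using offs[of ga] offs[of gb] gab by auto
 define Z1 where "Z1 = Z(x := (Z x)(0 := Some (od div 2)))"
 define Z2 where "Z2 = Z1(x := (Z1 x)(3 := Some ?tt))"
 define Z3 where "Z3 = Z2(x := (Z2 x)(gb := Some (P (P x))))"
 note F = gcR URR numw Q2w xw[OF x] x z Px vW vw o1 offs(3)[of 0]
 let ?t = "st (C 0) (V 24 [div] C 2) ;; st (C 3 [*] V 1) (V 25) ;; st (V 34) (V 26)"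
 have fin: "wp ?R ?U 0 ?t (Bpost Y {0, 3, gb} ?F x) e1 [] H n1 d1"
  if c1: "env e1" "e1 3 = x" "e1 34 = gb * Q1" "e1 26 = P (P x)" "e1 24 = od" "e1 25 = ?tt" "n1 <= 25 * W + 60" "d1 <= 25 * W + 60" for e1 n1 d1
 proof (rule stS[where x = x and g = 0 and Y = Y and Z = Z and v = "od div 2" and ?Z1.0 = Z1], goal_cases)
  case c2: (16 e2 H2 n2 d2)
  note r2 = c2(2)[unfolded keep_def, simplified c1(2-6)] c2(3) envD[OF c2(1)]
  show ?case
  proof (rule stS[where x = x and g = 3 and Y = Y and Z = Z1 and v = ?tt and ?Z1.0 = Z2], goal_cases)
   case c3: (16 e3 H3 n3 d3)
   note r3 = c3(2)[unfolded keep_def, simplified r2] c3(3) envD[OF c3(1)]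
   show ?case
   proof (rule stL[where x = x and g = gb and Y = Y and Z = Z2 and v = "P (P x)" and ?Z1.0 = Z3], goal_cases)
    case fin: (16 e4 H4 n4 d4)
    have "n4 <= nb" "d4 <= nb" using fin(4,5) c1(7,8) c2(4,5) c3(4,5) unfolding nb_def by linarith+
    then show ?case using fin(3) gab by (auto simp: Z3_def Z2_def Z1_def intro!: exI[of _ Z3])
   qed (use gab in \<open>simp_all add: F s r3 c3(1) Z3_def\<close>)
  qed (use gab in \<open>simp_all add: F s r2 c2(1) Z2_def\<close>)
 qed (use gab in \<open>simp_all add: F c1(1-6) s envD[OF c1(1)] Z1_def\<close>)
 show ?thesis
  unfolding round2_def
 proof (rule ldS[where x = x and g = ga and Y = Y and Z = Z and v = "P x"], goal_cases)
  case c1: (12 e1 n1 d1)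
  note r1 = c1(2)[unfolded keep_def, simplified e(2-4)] c1(3) envD[OF c1(1)]
  show ?case
  proof (rule ldS[where x = x and g = 0 and Y = Y and Z = Z and v = od], goal_cases)
   case c2: (12 e2 n2 d2)
   note r2 = c2(2)[unfolded keep_def, simplified r1] c2(3) envD[OF c2(1)]
   show ?case
   proof (rule ldS[where x = x and g = 3 and Y = Y and Z = Z and v = tg], goal_cases)
    case c3: (12 e3 n3 d3)
    note r3 = c3(2)[unfolded keep_def, simplified r2] c3(3) envD[OF c3(1)]
    show ?case
    proof (rule ldS[where x = "P x" and g = ga and Y = Y and Z = Z and v = "P (P x)"], goal_cases)
     case c4: (12 e4 n4 d4)
     note r4 = c4(2)[unfolded keep_def, simplified r3] c4(3) envD[OF c4(1)]
     show ?case
     proof (rule ldS[where x = tg and g = ga and Y = Y and Z = Z and v = "P tg"], goal_cases)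
      case c6: (12 e6 n6 d6)
      note r6 = c6(2)[unfolded keep_def, simplified r4] c6(3) envD[OF c6(1)]
      have v6: "e6 3 = x" "e6 34 = gb * Q1" "e6 26 = P (P x)" "e6 24 = od" "e6 25 = tg" "e6 27 = P tg"
       by (simp_all add: r6)
      have n6: "n6 <= 25 * W + 40" "d6 <= 25 * W + 40" using c1(4,5) c2(4,5) c3(4,5) c4(4,5) c6(4,5) by linarith+
      show ?case
      proof (cases "odd od")
       case True
       have "wp ?R ?U 0 ?t (Bpost Y {0, 3, gb} ?F x) (e6(25 := P tg)) [] H (Suc (Suc n6)) (Suc (Suc d6))"
        by (rule fin) (use True v6 n6 c6(1) in \<open>auto simp: env_def\<close>)
       then show ?thesis using True v6 vw numw by (simp add: wp_Seq wp_If wp_Assign odd_iff_mod_2_eq_one)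
      next
       case False
       have "wp ?R ?U 0 ?t (Bpost Y {0, 3, gb} ?F x) e6 [] H (Suc n6) (Suc d6)"
        by (rule fin) (use False v6 n6 c6(1) in auto)
       then show ?thesis using False v6 vw numw by (simp add: wp_Seq wp_If wp_Skip even_iff_mod_2_eq_zero)
      qed
     qed (use gab in \<open>simp_all add: F s r4 c4(1)\<close>)
    qed (use gab in \<open>simp_all add: F s r3 c3(1)\<close>)
   qed (use gab in \<open>simp_all add: F s r2 c2(1)\<close>)
  qed (use gab in \<open>simp_all add: F s r1 c1(1)\<close>)
 qed (use gab in \<open>simp_all add: F e s envD[OF e(1)]\<close>)
qed

lemma prep_body:
 assumes e: "env e" "e 3 = x" "e 33 = ga * Q1" and x: "x < k" "ga < 10" and s: "ST Y Z H"
  and z: "Z x ga = Some v" "v < k"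
 shows "wp (RR {} x) (UU {0, 1} x) 0 prep
  (Bpost Y {0, 1} (%x g. Some (if g = 0 then (if x < v then v else k) else (if v < x then x else k))) x) e [] H 0 0"
proof -
 let ?a = "if x < v then v else k" and ?b = "if v < x then x else k"
 let ?F = "%x g. Some (if g = 0 then (if x < v then v else k) else (if v < x then x else k))"
 define Z1 where "Z1 = Z(x := (Z x)(0 := Some ?a))"
 define Z2 where "Z2 = Z1(x := (Z1 x)(1 := Some ?b))"
 note F = gcR URR numw Q2w xw[OF x(1)] xw[OF z(2)] x z offs(1)[OF x(2)] offs(3)[of 0] kk
 have fin: "wp (RR {} x) (UU {0, 1} x) 0 (st (C 0) (V 24) ;; st (V 1) (V 25)) (Bpost Y {0, 1} ?F x) e1 [] H n1 d1"
  if c1: "env e1" "e1 3 = x" "e1 24 = ?a" "e1 25 = ?b" "n1 <= 5 * W + 30" "d1 <= 5 * W + 30" for e1 n1 d1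
 proof (rule stS[where x = x and g = 0 and Y = Y and Z = Z and v = ?a and ?Z1.0 = Z1], goal_cases)
  case c2: (16 e2 H2 n2 d2)
  note r2 = c2(2)[unfolded keep_def, simplified c1(2-4)] c2(3) envD[OF c2(1)]
  show ?case
  proof (rule stL[where x = x and g = 1 and Y = Y and Z = Z1 and v = ?b and ?Z1.0 = Z2], goal_cases)
   case fin: (16 e4 H4 n4 d4)
   have "n4 <= nb" "d4 <= nb" using fin(4,5) c1(5,6) c2(4,5) unfolding nb_def by linarith+
   then show ?case using fin(3) by (auto simp: Z2_def Z1_def intro!: exI[of _ Z2])
  qed (simp_all add: F s r2 c2(1) Z2_def)
 qed (simp_all add: F c1(1-4) s envD[OF c1(1)] Z1_def)
 show ?thesis
  unfolding prep_def
 proof (rule ldS[where x = x and g = ga and Y = Y and Z = Z and v = v], goal_cases)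
  case c1: (12 e1 n1 d1)
  note r1 = c1(2)[unfolded keep_def, simplified e(2-3)] c1(3) envD[OF c1(1)]
  have v1: "e1 3 = x" "e1 12 = k" "e1 23 = v" by (simp_all add: r1)
  have "wp (RR {} x) (UU {0, 1} x) 0 (st (C 0) (V 24) ;; st (V 1) (V 25)) (Bpost Y {0, 1} ?F x) (e1(24 := ?a, 25 := ?b)) [] H
   (Suc (Suc (Suc (Suc n1)))) (Suc (Suc (Suc (Suc d1))))"
   by (rule fin) (use e c1 v1 in \<open>auto simp: env_def\<close>)
  then show ?case using v1 xw[OF x(1)] xw[OF z(2)] kk
   by (cases "x < v"; cases "v < x") (simp_all add: wp_Seq wp_If wp_Assign)
 qed (simp_all add: F e s envD[OF e(1)])
qed

lemma clear_body:
 fixes Y :: "nat => 'a :: linorder list"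
 assumes e: "env e" "e 3 = x" and x: "x < k" and s: "ST Y Z H"
 shows "wp (RR {} x) (UU {..<10} x) 0 clear (Bpost Y {..<10} (%_ _. None) x) e [] H 0 0"
proof -
 let ?I = "%(e' :: nat => nat) (b' :: 'a cell list) H' n' d'. \<exists>g\<le>10. e' 23 = g & env e' & e' 3 = x & b' = [] &
   (\<exists>Z. ST Y Z H' & (\<forall>h<g. Z x h = None)) & n' <= 1 + g * (4 * W + 10) & d' <= 1 + g * (4 * W + 10)"
 have "wp (RR {} x) (UU {..<10} x) 0 (While (V 23) (C 10)
   (7 ::= V 14 [+] (V 3 [*] V 20 [+] V 23 [*] V 1) ;; clr ;; 23 ::= V 23 [+] C 1))
   (Bpost Y {..<10} (%_ _. None) x) (e(23 := 0)) [] H (Suc 0) (Suc 0)"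
 proof (rule wp_While[where I = ?I and f = "%e b H. 10 - e 23"], goal_cases)
  case 1
  then show ?case using e s by (auto simp: env_def)
 next
  case (2 e1 b1 H1 n1 d1)
  then obtain g Z1 where g: "g <= 10" "e1 23 = g" and e1: "env e1" "e1 3 = x" and b1: "b1 = []"
   and z1: "ST Y Z1 H1" "!!h. h < g ==> Z1 x h = None" and n1: "n1 <= 1 + g * (4 * W + 10)" "d1 <= 1 + g * (4 * W + 10)" by blast
  show ?case
  proof (cases "g < 10")
   case False
   then have "g = 10" using g by simp
   then show ?thesis using g n1 z1 b1 numw by (auto simp: nb_def intro!: exI[of _ Z1])
  next
   case True
   define p where "p = base + (x * S1 + g * Q1)"
   have pN: "p + (2 * W + 3) <= N" using blk_le[OF x(1)] gq[OF True] kN by (simp add: p_def Q1[symmetric])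
   have pw: "x < 2 ^ w" "x * S1 < 2 ^ w" "x * S1 + g * Q1 < 2 ^ w" "p < 2 ^ w" "p + (2 * W + 3) < 2 ^ w" "g * Q1 < 2 ^ w" "Suc g < 2 ^ w"
   proof -
    have "x <= N" "x * S1 <= N" "x * S1 + g * Q1 <= N" "p <= N" "g * Q1 <= N" using x kk(1) pN by (auto simp: p_def)
    then show "x < 2 ^ w" "x * S1 < 2 ^ w" "x * S1 + g * Q1 < 2 ^ w" "p < 2 ^ w" "p + (2 * W + 3) < 2 ^ w" "g * Q1 < 2 ^ w" "Suc g < 2 ^ w"
     using pN True by (simp_all add: small)
   qed
   have YY: "length (Y x) = S1" "sorted (Y x)" using s x by (auto simp: ST_def)
   define J where "J = (%(e' :: nat => nat) b' H' n' d'. ?I e' b' H' n' d' & 10 - e' 23 < 10 - e1 23)"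
   have ev: "e1 0 = W" "e1 1 = Q1" "e1 14 = base" "e1 20 = S1" using e1 by (auto simp: env_def)
   have "wp (RR {} x) (UU {..<10} x) 0 clr (wp (RR {} x) (UU {..<10} x) 0 (23 ::= V 23 [+] C 1) J) (e1(7 := p)) [] H1 (Suc (Suc n1)) (Suc (Suc d1))"
   proof (rule wp_clr[where p = p and xs = "gx (Y x) g" and vo = "Z1 x g"])
    show "grp W H1 p (gx (Y x) g) (Z1 x g)" using z1(1) x True by (simp add: ST_def p_def)
    show "{p..<p + (2 * W + 3)} <= UU {..<10} x" using gcR(3)[of g "{..<10}" x] True by (simp add: gc_def p_def Q1[symmetric])
    show "UU {..<10} x <= RR {} x" by (rule URR) simp
    fix e2 H2 n2 d2
    assume e2: "!!r. r \<notin> {9} ==> e2 r = (e1(7 := p)) r" and gg: "grp W H2 p (gx (Y x) g) None"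
     and out: "!!a. a \<notin> {p..<p + (2 * W + 3)} ==> H2 a = H1 a"
     and n2: "n2 <= Suc (Suc n1) + 4 * W + 6" "d2 <= Suc (Suc d1) + 4 * W + 6"
    have "ST Y (Z1(x := (Z1 x)(g := None))) H2"
     by (rule ST_upd[OF z1(1) x True gg[unfolded p_def]]) (use out in \<open>simp add: gc_def p_def Q1[symmetric]\<close>)
    moreover have "(Suc g) * (4 * W + 10) = g * (4 * W + 10) + 4 * W + 10" by simp
    then have "Suc n2 <= 1 + Suc g * (4 * W + 10)" "Suc d2 <= 1 + Suc g * (4 * W + 10)" using n1 n2 by linarith+
    ultimately have "J (e2(23 := Suc g)) [] H2 (Suc n2) (Suc d2)"
     unfolding J_def using True g e1 e2 z1(2)
     by (intro conjI exI[of _ "Suc g"] exI[of _ "Z1(x := (Z1 x)(g := None))"]) (auto simp: env_def less_Suc_eq)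
    then show "wp (RR {} x) (UU {..<10} x) 0 (23 ::= V 23 [+] C 1) J e2 [] H2 n2 d2"
     using e2[of 23] g pw numw by (simp add: wp_Assign)
   qed (use ev gx[OF YY True] pw in auto)
   then show ?thesis using True g b1 ev e1 pw numw kk by (simp add: wp_Seq wp_Assign J_def p_def)
  qed
 qed
 then show ?thesis unfolding clear_def by (simp add: wp_Seq wp_Assign)
qed

end

section \<open>Permuting the blocks of the second level\<close>

text \<open>Registers 33 and 34 are the offsets of the groups to be read and to be written; they
  trade places after each round.\<close>

definition flip :: "com => com" where
 "flip c = 35 ::= V 33 ;; 33 ::= V 34 ;; 34 ::= V 35 ;; c"

text \<open>After \<open>W\<close> doublings the pointers have jumped \<open>2 ^ W >= k\<close>
  places, so the minima are those of the whole cycles. The second reflection needs no computation: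
  the ranks in group 2 travel with the blocks, and after the first reflection they are its
  partners.\<close>

definition perm1 :: com where
 "perm1 = 3 ::= C 0 ;; 4 ::= V 12 ;; Call 10 ;;
   33 ::= C 4 [*] V 1 ;; 34 ::= C 7 [*] V 1 ;; 22 ::= C 1 ;; 21 ::= C 0 ;;
   While (V 21) (V 0) (Call 11 ;; flip (22 ::= V 22 [+] V 22 ;; 21 ::= V 21 [+] C 1)) ;;
   Call 12 ;; flip (21 ::= C 0 ;;
   While (V 21) (V 0) (Call 13 ;; flip (21 ::= V 21 [+] C 1)) ;;
   33 ::= C 3 [*] V 1 ;; Call 14 ;; invol ;; 33 ::= C 2 [*] V 1 ;; Call 14 ;; invol ;; Call 16)"

text \<open>A leaf is a rotation of its valley and too large for the buffer. Three reversals undo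
  the rotation in place, so that the first-level solver applies.\<close>

definition leaf1 :: com where
 "leaf1 = If (V 14) (V 15) (11 ::= V 14) (11 ::= V 16) ;; 12 ::= V 20 ;; 26 ::= (V 20 [-] V 18) [mod] V 20 ;;
   3 ::= C 0 ;; 4 ::= V 26 [div] C 2 ;; 5 ::= V 11 ;; 6 ::= V 11 [+] V 26 ;; Call 2 ;;
   4 ::= (V 20 [-] V 26) [div] C 2 ;; 5 ::= V 11 [+] V 26 ;; 6 ::= V 11 [+] V 20 ;; Call 2 ;;
   4 ::= V 20 [div] C 2 ;; 5 ::= V 11 ;; 6 ::= V 11 [+] V 20 ;; Call 2 ;;
   Call 5 ;; 7 ::= V 11 [+] C 2 [*] V 1 ;; 8 ::= V 19 ;; wr"

text \<open>The first \<open>2 ^ Suc j\<close> iterates of \<open>y\<close> are the first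
  \<open>2 ^ j\<close> of \<open>y\<close> followed by the first \<open>2 ^ j\<close> of
  \<open>P y\<close>.\<close>

lemma doubling:
 fixes D m od :: "nat => nat"
 assumes "!!y. y < k ==> m y < k & od y < 2 ^ j & (D ^^ od y) y = m y & (\<forall>i<2 ^ j. m y <= (D ^^ i) y)"
  and "!!y. y < k ==> (D ^^ 2 ^ j) y < k" and y: "y < k"
 defines "P \<equiv> D ^^ 2 ^ j"
 defines "m' \<equiv> %y. if m (P y) < m y then m (P y) else m y"
  and "od' \<equiv> %y. if m (P y) < m y then 2 ^ j + od (P y) else od y"
 shows "m' y < k & od' y < 2 ^ Suc j & (D ^^ od' y) y = m' y & (\<forall>i<2 ^ Suc j. m' y <= (D ^^ i) y)"
  "P (P y) = (D ^^ 2 ^ Suc j) y"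
proof -
 note a = assms(1)[OF y] and b = assms(1)[OF assms(2)[OF y], folded P_def]
 show "P (P y) = (D ^^ 2 ^ Suc j) y"
  unfolding P_def by (simp add: mult_2 funpow_add)
 have "m' y <= (D ^^ i) y" if "i < 2 ^ Suc j" for i
 proof (cases "i < 2 ^ j")
  case True
  then have "m y <= (D ^^ i) y" using a by blast
  then show ?thesis by (simp add: m'_def)
 next
  case False
  then obtain i' where i': "i = i' + 2 ^ j" by (metis le_Suc_ex linorder_not_less add.commute)
  then have "i' < 2 ^ j" using that by simp
  then have "m (P y) <= (D ^^ i') (P y)" using b by blast
  then have "m (P y) <= (D ^^ i) y" by (simp add: i' P_def funpow_add)
  then show ?thesis by (auto simp: m'_def)
 qed
 moreover have "(D ^^ od' y) y = m' y"
 proof (cases "m (P y) < m y")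
  case True
  have "(D ^^ (od (P y) + 2 ^ j)) y = (D ^^ od (P y)) (P y)" by (simp add: P_def funpow_add)
  then show ?thesis using True b by (simp add: od'_def m'_def add.commute)
 qed (use a in \<open>simp add: od'_def m'_def\<close>)
 ultimately show "m' y < k & od' y < 2 ^ Suc j & (D ^^ od' y) y = m' y & (\<forall>i<2 ^ Suc j. m' y <= (D ^^ i) y)"
  using a b by (auto simp: m'_def od'_def)
qed

context blk
begin

lemma perm1_tri:
 fixes Xs :: "nat => 'a :: linorder list" and H0 :: "nat => 'a cell"
 assumes Prs: "Pr 10 = pfor 10 init1" "Pr 11 = pfor 11 round1" "Pr 12 = pfor 12 init2" "Pr 13 = pfor 13 round2"
   "Pr 14 = pfor 14 prep" "Pr 15 = pfor 15 swp_body" "Pr 16 = pfor 16 clear"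
  and e0: "env e0" and D: "bij_betw D {..<k} {..<k}"
  and Y0: "ST (%x. Xs (D x)) Z0 H0" and Z0: "!!x. x < k ==> Z0 x 2 = Some (D x)"
  and so: "sorted (concat (map Xs [0..<k]))" and len: "!!x. x < k ==> length (Xs x) = S1"
 shows "tri {base..<base + k * S1} {base..<base + k * S1} (224 + 448 * W) perm1 e0 H0
  (%H'. outp H' base (k * S1) (mset (concat (map Xs [0..<k])))) (400 * (k * S1)) (400 * (W * W))"
proof -
 let ?R = "{base..<base + k * S1}" and ?M = "224 + 448 * W"
 define CP where "CP = k * (nb + 20) + 3"
 define DP where "DP = nb + 10 * W + 11"
 define IC where "IC = 12 + 2 * (k * (21 * S1 + 5 * W + 60))"
 define ID where "ID = 50 * W + 110"
 define NN where "NN = 400 * (k * S1)"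
 define DD where "DD = 400 * (W * W)"
 \<comment> \<open>Reserves for the stages to come, which are treated from the last to the first:
   \<open>B5\<close> and \<open>E5\<close> from the moment when the reflection is known,
   \<open>B3\<close> and \<open>E3\<close> from the end of the doubling rounds.\<close>
 define B5 where "B5 = 2 + 3 * CP + 2 * IC"
 define E5 where "E5 = 2 + 3 * DP + 2 * ID"
 define B3 where "B3 = CP + 5 + W * (CP + 6) + B5"
 define E3 where "E3 = DP + 5 + W * (DP + 6) + E5"
 define J where "J = (%(e' :: nat => nat) (b' :: 'a cell list) H' n' d'. n' <= NN & d' <= DD &
  outp H' base (k * S1) (mset (concat (map Xs [0..<k]))))"
 define mst where "mst e \<longleftrightarrow> env e & e 3 = 0 & e 4 = k" for e :: "nat => nat"
 \<comment> \<open>There are \<open>2 * W\<close> rounds and a constant number of other passes, each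
   with work \<open>O(k * W)\<close> and depth \<open>O(W)\<close>. Since \<open>S1\<close> is about
   \<open>4 * W * W\<close>, the work is linear in the number \<open>k * S1\<close> of
   elements.\<close>
 have bud: "2 + CP + 4 + W * (CP + 7) + 1 + B3 <= NN" "2 + DP + 4 + W * (DP + 7) + 1 + E3 <= DD"
 proof -
  define V where "V = W * W"
  have V: "4 * W <= V" unfolding V_def using W4 by simp
  have V16: "16 <= V" using V W4 by linarith
  have S1V: "S1 = 4 * V + 12 * W + 9" by (simp add: S1 Q1 V_def algebra_simps)
  have DPv: "DP = 64 * W + 131" by (simp add: DP_def nb_def)
  have "W * (DP + 7) = 64 * V + 138 * W" "W * (DP + 6) = 64 * V + 137 * W" by (simp_all add: DPv V_def algebra_simps)
  moreover define A1 A2 where "A1 = W * (DP + 7)" and "A2 = W * (DP + 6)"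
  ultimately show "2 + DP + 4 + W * (DP + 7) + 1 + E3 <= DD"
   unfolding E3_def E5_def ID_def DD_def V_def[symmetric] A1_def[symmetric] A2_def[symmetric]
  proof -
   assume a: "A1 = 64 * V + 138 * W" "A2 = 64 * V + 137 * W"
   have "2 + DP + 4 + A1 + 1 + (DP + 5 + A2 + (2 + 3 * DP + 2 * (50 * W + 110))) = 128 * V + 695 * W + 889"
    unfolding a DPv by simp
   moreover have "695 * W <= 174 * V" using V by linarith
   moreover have "889 <= 56 * V" using V16 by linarith
   ultimately show "2 + DP + 4 + A1 + 1 + (DP + 5 + A2 + (2 + 3 * DP + 2 * (50 * W + 110))) <= 400 * V" by linarith
  qed
  have CPv: "CP = 54 * (k * W) + 140 * k + 3" by (simp add: CP_def nb_def algebra_simps)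
  have "k * W * W = k * V" by (simp add: V_def)
  then have "W * (CP + 7) = 54 * (k * V) + 140 * (k * W) + 10 * W" "W * (CP + 6) = 54 * (k * V) + 140 * (k * W) + 9 * W"
   by (simp_all add: CPv algebra_simps)
  moreover have "IC = 12 + 168 * (k * V) + 514 * (k * W) + 498 * k" by (simp add: IC_def S1V algebra_simps)
  moreover have "NN = 1600 * (k * V) + 4800 * (k * W) + 3600 * k" by (simp add: NN_def S1V algebra_simps)
  moreover have "W <= k * W" "V <= k * V" "4 * k <= k * W" using k1 W4 by auto
  moreover define A1 A2 where "A1 = W * (CP + 7)" and "A2 = W * (CP + 6)"
  ultimately show "2 + CP + 4 + W * (CP + 7) + 1 + B3 <= NN"
   unfolding B3_def B5_def A1_def[symmetric] A2_def[symmetric] using CPv k1 W4 V16 by linarith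
 qed
 have D1: "D x < k" if "x < k" for x using D that by (auto simp: bij_betw_def)
 have Dn: "(D ^^ n) x < k" if "x < k" for x n using bij_betw_funpow'[OF D, of n] that by (auto simp: bij_betw_def)
 have eb: "env e'" "e' 33 = e 33" "e' 34 = e 34" "e' 22 = e 22" if "mst e" "!!r. r ~= 3 ==> r ~= 4 ==> e' r = e r" for e e'
  using that unfolding mst_def env_def by auto
 have mE: "e 0 = W & e 1 = Q1 & e (Suc 0) = Q1 & e 12 = k & e 14 = base & e 20 = S1 & e 3 = 0 & e 4 = k"
  "e 3 = 0" "e 4 = k" if "mst e" for e
  using that unfolding mst_def env_def by simp_all
 have mu: "mst (e(r := v)) = mst e" if "r \<notin> {0, 1, 3, 4, 12, 14, 20}" for e r v
  using that unfolding mst_def env_def by auto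
 have Cc: "n + Suc (k * (nb + 20) + 2) = n + CP" "d + Suc (nb + 10 * W + 10) = d + DP" for n d
  by (simp_all add: CP_def DP_def)
 have Mc: "112 + 224 * W <= ?M" by simp
 have call: "wp ?R ?R ?M (Call pn) Q e [] H n d"
  if "tri ?R ?R (224 * W) (Pr pn) e H (ST Y Z) (k * (nb + 20) + 2) (nb + 10 * W + 10)"
   "!!H'. ST Y Z H' ==> Q e [] H' (n + CP) (d + DP)" for pn Q e H n d Y and Z :: "nat => nat => nat option"
 proof (rule wp_Call[OF that(1)])
  fix H' assume "ST Y Z H'"
  then show "Q e [] H' (n + Suc (k * (nb + 20) + 2)) (d + Suc (nb + 10 * W + 10))" unfolding Cc by (rule that(2))
 qed auto
 have st7: "wp ?R ?R ?M (Call 16) J e [] H n d"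
  if m: "mst e" and s: "ST Y Z H" and Y: "!!x. x < k ==> Y x = Xs x" and n: "n + CP <= NN" "d + DP <= DD" for e H n d Y Z
 proof (rule call)
  show "tri ?R ?R (224 * W) (Pr 16) e H (ST Y (%x g. if g \<in> {..<10} then None else Z x g)) (k * (nb + 20) + 2) (nb + 10 * W + 10)"
   by (rule pass_tri[OF Prs(7) mE(2,3)[OF m] s, where RG = "{}" and F = "%_ _. None"])
    (auto intro!: clear_body[OF eb(1)[OF m] _ _ s])
  fix H' assume st: "ST Y (%x g. if g \<in> {..<10} then None else Z x g) H'"
  have "outp H' base (k * S1) (mset (concat (map Xs [0..<k])))"
  proof (rule outp_concat[OF so len])
   fix x i assume x: "x < k" "i < S1"
   show "H' (base + x * S1 + i) = Elem (Xs x ! i)"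
   proof (cases "i < 10 * Q1")
    case False
    then show ?thesis using st x Y[OF x(1)] by (auto simp: ST_def add.assoc)
   next
    case True
    define g where "g = i div Q1"
    have g: "g < 10" "i = g * Q1 + i mod Q1" "i mod Q1 < Q1"
     using True ten(2) by (auto simp: g_def less_mult_imp_div_less)
    have "grp W H' (base + (x * S1 + g * Q1)) (gx (Xs x) g) None" using st x g Y[OF x(1)] by (auto simp: ST_def)
    then have "H' (base + (x * S1 + g * Q1) + i mod Q1) = Elem (gx (Xs x) g ! (i mod Q1))"
     using g(3) by (simp add: grp_None_iff Q1)
    moreover have "gx (Xs x) g ! (i mod Q1) = Xs x ! i"
     using g len[OF x(1)] gq[OF g(1)] by (simp add: gx_def)
    moreover have "base + (x * S1 + g * Q1) + i mod Q1 = base + x * S1 + i" using g(2) by simp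
    ultimately show ?thesis by simp
   qed
  qed (use ten in auto)
  then show "J e [] H' (n + CP) (d + DP)" using n by (simp add: J_def)
 qed
 have involp: "wp ?R ?R ?M (33 ::= C c [*] V 1 ;; Call 14 ;; invol ;; cc) J e [] H n d"
  if m: "mst e" and c: "c = 2 \<or> c = 3" and s: "ST Y Z H" and zc: "!!x. x < k ==> Z x c = Some (p x)"
   and p: "!!x. x < k ==> p x < k" "!!x. x < k ==> p (p x) = x"
   and cc: "!!e' H' n' d' Z'. mst e' ==> ST (%x. Y (p x)) Z' H' ==> (!!x. x < k ==> Z' x 2 = Z (p x) 2) ==>
    n' <= n + 1 + CP + IC ==> d' <= d + 1 + DP + ID ==> wp ?R ?R ?M cc J e' [] H' n' d'"
  for e c Y Z H p cc n d
 proof -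
  define e1 where "e1 = e(33 := c * Q1)"
  have m1: "mst e1" using m by (simp add: mst_def e1_def env_def)
  define F where "F x g = Some (if g = (0::nat) then (if x < p x then p x else k) else (if p x < x then x else k))" for x g
  have bd: "wp (RR {} x) (UU {0, 1} x) 0 prep (Bpost Y {0, 1} F x) e' [] H 0 0"
   if "x < k" "e' 3 = x" "!!r. r ~= 3 ==> r ~= 4 ==> e' r = e1 r" for x e'
  proof -
   have "wp (RR {} x) (UU {0, 1} x) 0 prep (Bpost Y {0, 1} (%x' g. Some (if g = 0 then (if x' < p x then p x else k) else (if p x < x' then x' else k))) x) e' [] H 0 0"
    by (rule prep_body[where ga = c and Z = Z])
     (use that eb[OF m1 that(3)] c s zc p in \<open>auto simp: e1_def\<close>)
   then show ?thesis by (simp add: F_def)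
  qed
  have "wp ?R ?R ?M (Call 14) (wp ?R ?R ?M (invol ;; cc) J) e1 [] H (Suc n) (Suc d)"
  proof (rule call)
   show "tri ?R ?R (224 * W) (Pr 14) e1 H (ST Y (%x g. if g \<in> {0, 1} then F x g else Z x g)) (k * (nb + 20) + 2) (nb + 10 * W + 10)"
    by (rule pass_tri[OF Prs(5) mE(2,3)[OF m1] s, where RG = "{}"]) (use bd in auto)
   fix H1 assume s1: "ST Y (%x g. if g \<in> {0, 1} then F x g else Z x g) H1"
   show "wp ?R ?R ?M (invol ;; cc) J e1 [] H1 (Suc n + CP) (Suc d + DP)"
    unfolding wp_Seq
   proof (rule wp_invol[OF Prs(6), where p = p and Y = Y and Z = "%x g. if g \<in> {0, 1} then F x g else Z x g"])
    fix e' H' n' d'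
    assume a: "!!r. r \<notin> {33, 34, 35} ==> e' r = e1 r" "ST (%x. Y (p x)) (%x. (%g. if g \<in> {0, 1} then F (p x) g else Z (p x) g)) H'"
     "n' <= Suc n + CP + 12 + 2 * (k * (21 * S1 + 5 * W + 60))" "d' <= Suc d + DP + 50 * W + 110"
    show "wp ?R ?R ?M cc J e' [] H' n' d'"
    proof (rule cc[OF _ a(2)])
     show "mst e'" using m1 a(1) by (simp add: mst_def env_def)
     show "n' <= n + 1 + CP + IC" "d' <= d + 1 + DP + ID" using a(3,4) unfolding IC_def ID_def by linarith+
    qed simp
   qed (use p s1 in \<open>auto simp: mE[OF m1] F_def\<close>)
  qed
  moreover have "c * Q1 < 2 ^ w" "c < 2 ^ w" using c Q2w numw by auto
  moreover have "Q1 < 2 ^ w" using offs(3)[of 0] by simp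
  ultimately show ?thesis using m by (simp add: wp_Seq wp_Assign e1_def mst_def env_def mult.commute)
 qed
 \<comment> \<open>The outcome of the doubling rounds, in the form that \<open>reflections\<close>
   asks for.\<close>
 define RES where "RES m od \<longleftrightarrow> (\<forall>y<k. m y < k & od y < 2 ^ W & (D ^^ od y) y = m y & (\<forall>i<2 ^ W. m y <= (D ^^ i) y))"
  for m od :: "nat => nat"
 let ?t5 = "33 ::= C 3 [*] V 1 ;; Call 14 ;; invol ;; 33 ::= C 2 [*] V 1 ;; Call 14 ;; invol ;; Call 16"
 have st5: "wp ?R ?R ?M (?t5) J e [] H n d"
  if m: "mst e" and s: "ST (%x. Xs (D x)) Z H" and z: "!!y. y < k ==> Z y 2 = Some (D y)"
   "!!y. y < k ==> Z y 3 = Some ((D ^^ od y) (mm y))" and res: "RES mm od"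
   and n: "n + B5 <= NN" "d + E5 <= DD" for e Z H mm od n d
 proof -
  define p where "p y = (D ^^ od y) (mm y)" for y
  have rf: "p y < k" "p (p y) = y" "D (p y) < k" "D (p (D (p y))) = y" if "y < k" for y
   using reflections[OF D, of od mm "2 ^ W" y] res kk(2) that unfolding RES_def p_def by auto
  have zp: "Z x 3 = Some (p x)" if "x < k" for x using z(2)[OF that] by (simp add: p_def)
  show ?thesis
  proof (rule involp[OF m disjI2[OF refl] s zp rf(1,2)])
   fix e1 H1 n1 d1 Z1
   assume a: "mst e1" "ST (%x. Xs (D (p x))) Z1 H1" "!!x. x < k ==> Z1 x 2 = Z (p x) 2"
    "n1 <= n + 1 + CP + IC" "d1 <= d + 1 + DP + ID"
   \<comment> \<open>The rank has moved with its block, so group 2 now displays the second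
     reflection.\<close>
   have z2: "Z1 x 2 = Some (D (p x))" if "x < k" for x using a(3)[OF that] z(1)[OF rf(1)[OF that]] by simp
   show "wp ?R ?R ?M (33 ::= C 2 [*] V 1 ;; Call 14 ;; invol ;; Call 16) J e1 [] H1 n1 d1"
   proof (rule involp[OF a(1) disjI1[OF refl] a(2) z2 rf(3,4)])
    fix e2 H2 n2 d2 Z2
    assume b: "mst e2" "ST (%x. Xs (D (p (D (p x))))) Z2 H2"
     "n2 <= n1 + 1 + CP + IC" "d2 <= d1 + 1 + DP + ID"
    show "wp ?R ?R ?M (Call 16) J e2 [] H2 n2 d2"
     by (rule st7[OF b(1,2)]) (use rf n a(4,5) b(3,4) in \<open>auto simp: B5_def E5_def\<close>)
   qed
  qed
 qed
 have qw: "Q1 < 2 ^ w" using offs(3)[of 0] by simp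
 have gw: "g * Q1 < 2 ^ w" if "g = 4 \<or> g = 7" for g using that Q2w by auto
 have WW': "W < 2 ^ w" using kk NW W_big by linarith
 let ?b4 = "Call 13 ;; flip (21 ::= V 21 [+] C 1)"
 have st4: "wp ?R ?R ?M (While (V 21) (V 0) (?b4)) (wp ?R ?R ?M (?t5) J) e [] H n d"
  if m: "mst e" "e 21 = 0" and g: "(ga, gb) \<in> {(4, 7), (7, 4)}" "e 33 = ga * Q1" "e 34 = gb * Q1"
   and s: "ST (%x. Xs (D x)) Z H" and z: "!!y. y < k ==> Z y 2 = Some (D y) & Z y ga = Some (D y) &
    Z y 0 = Some (od y) & Z y 3 = Some (mm y)" and res: "RES mm od"
   and n: "n + W * (CP + 6) + 1 + B5 <= NN" "d + W * (DP + 6) + 1 + E5 <= DD" for e Z H mm od n d ga gb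
 \<comment> \<open>After \<open>j\<close> rounds the pointers are \<open>D ^^ 2 ^ j\<close>, and the
   lowest \<open>j\<close> bits of the distance \<open>od y\<close> have been applied to the minimum
   \<open>mm y\<close>.\<close>
 proof (rule wp_While[where I = "%e' b' H' n' d'. \<exists>j ga gb Z. j <= W & e' 21 = j & mst e' & (ga, gb) \<in> {(4, 7), (7, 4)} &
   e' 33 = ga * Q1 & e' 34 = gb * Q1 & b' = [] & ST (%x. Xs (D x)) Z H' &
   (\<forall>y<k. Z y 2 = Some (D y) & Z y ga = Some ((D ^^ 2 ^ j) y) & Z y 0 = Some (od y div 2 ^ j) &
    Z y 3 = Some ((D ^^ (od y mod 2 ^ j)) (mm y))) &
   n' + (W - j) * (CP + 6) + 1 + B5 <= NN & d' + (W - j) * (DP + 6) + 1 + E5 <= DD" and f = "%e b H. W - e 21"], goal_cases)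
  case 1
  show ?case
   by (intro exI[of _ 0] exI[of _ ga] exI[of _ gb] exI[of _ Z] conjI allI impI) (use m g s z n in auto)
 next
  case (2 e1 b1 H1 n1 d1)
  then obtain j ga gb Z where j: "j <= W" "e1 21 = j" and m1: "mst e1" and g: "(ga, gb) \<in> {(4, 7), (7, 4)}" "e1 33 = ga * Q1" "e1 34 = gb * Q1"
   and b1: "b1 = []" and s1: "ST (%x. Xs (D x)) Z H1"
   and z: "!!y. y < k ==> Z y 2 = Some (D y) & Z y ga = Some ((D ^^ 2 ^ j) y) & Z y 0 = Some (od y div 2 ^ j) &
    Z y 3 = Some ((D ^^ (od y mod 2 ^ j)) (mm y))"
   and n1: "n1 + (W - j) * (CP + 6) + 1 + B5 <= NN" "d1 + (W - j) * (DP + 6) + 1 + E5 <= DD" by blast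
  have e0: "e1 0 = W" using m1 by (simp add: mst_def env_def)
  show ?case
  proof (cases "j < W")
   case False
   then have jW: "j = W" using j by simp
   have "wp ?R ?R ?M (?t5) J e1 [] H1 (Suc n1) (Suc d1)"
   proof (rule st5[OF m1 s1 _ _ res])
    show "Z y 3 = Some ((D ^^ od y) (mm y))" if "y < k" for y
     using z[OF that] res that jW unfolding RES_def by auto
   qed (use z n1 jW in auto)
   then show ?thesis using jW j b1 e0 WW' by simp
  next
   case True
   define P where "P = D ^^ 2 ^ j"
   define F where "F x h = Some (if h = (0::nat) then od x div 2 ^ j div 2 else if h = 3 then
     (if odd (od x div 2 ^ j) then P ((D ^^ (od x mod 2 ^ j)) (mm x)) else (D ^^ (od x mod 2 ^ j)) (mm x)) else P (P x))" for x h
   have bd: "wp (RR {ga} x) (UU {0, 3, gb} x) 0 round2 (Bpost (%x. Xs (D x)) {0, 3, gb} F x) e' [] H1 0 0"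
    if "x < k" "e' 3 = x" "!!r. r ~= 3 ==> r ~= 4 ==> e' r = e1 r" for x e'
   proof -
    have "od x div 2 ^ j < 2 ^ W" using res that(1) unfolding RES_def by (meson div_le_dividend le_less_trans)
    moreover have "mm x < k" using res that(1) unfolding RES_def by blast
    ultimately have "wp (RR {ga} x) (UU {0, 3, gb} x) 0 round2 (Bpost (%x. Xs (D x)) {0, 3, gb}
     (%x' h. Some (if h = 0 then od x div 2 ^ j div 2 else if h = 3 then
     (if odd (od x div 2 ^ j) then P ((D ^^ (od x mod 2 ^ j)) (mm x)) else (D ^^ (od x mod 2 ^ j)) (mm x)) else P (P x'))) x) e' [] H1 0 0"
     by (intro round2_body[where Z = Z]) (use that eb[OF m1 that(3)] g s1 z Dn in \<open>auto simp: P_def\<close>)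
    then show ?thesis by (simp add: F_def)
   qed
   define Z' where "Z' x h = (if h \<in> {0, 3, gb} then F x h else Z x h)" for x h
   define K where "K = (%(e' :: nat => nat) (b' :: 'a cell list) H' n' d'. (\<exists>j ga gb Z. j <= W & e' 21 = j & mst e' & (ga, gb) \<in> {(4, 7), (7, 4)} &
    e' 33 = ga * Q1 & e' 34 = gb * Q1 & b' = [] & ST (%x. Xs (D x)) Z H' &
    (\<forall>y<k. Z y 2 = Some (D y) & Z y ga = Some ((D ^^ 2 ^ j) y) & Z y 0 = Some (od y div 2 ^ j) &
     Z y 3 = Some ((D ^^ (od y mod 2 ^ j)) (mm y))) &
    n' + (W - j) * (CP + 6) + 1 + B5 <= NN & d' + (W - j) * (DP + 6) + 1 + E5 <= DD) & W - e' 21 < W - e1 21)"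
   have "wp ?R ?R ?M (Call 13) (wp ?R ?R ?M (flip (21 ::= V 21 [+] C 1)) K) e1 [] H1 (Suc n1) (Suc d1)"
   proof (rule call)
    show "tri ?R ?R (224 * W) (Pr 13) e1 H1 (ST (%x. Xs (D x)) Z') (k * (nb + 20) + 2) (nb + 10 * W + 10)"
     unfolding Z'_def by (rule pass_tri[OF Prs(4) mE(2,3)[OF m1] s1, where RG = "{ga}"]) (use g(1) bd in auto)
    fix H' assume s': "ST (%x. Xs (D x)) Z' H'"
    have zz: "Z' y 2 = Some (D y) & Z' y gb = Some ((D ^^ 2 ^ Suc j) y) & Z' y 0 = Some (od y div 2 ^ Suc j) &
     Z' y 3 = Some ((D ^^ (od y mod 2 ^ Suc j)) (mm y))" if "y < k" for y
    proof -
     have "od y mod 2 ^ Suc j = 2 ^ j * (od y div 2 ^ j mod 2) + od y mod 2 ^ j"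
      using mod_mult2_eq[of "od y" "2 ^ j" 2] by (simp add: mult.commute)
     then have "(if odd (od y div 2 ^ j) then P ((D ^^ (od y mod 2 ^ j)) (mm y)) else (D ^^ (od y mod 2 ^ j)) (mm y))
       = (D ^^ (od y mod 2 ^ Suc j)) (mm y)"
      by (cases "odd (od y div 2 ^ j)") (simp_all add: P_def funpow_add odd_iff_mod_2_eq_one even_iff_mod_2_eq_zero del: power_Suc)
     moreover have "od y div 2 ^ j div 2 = od y div 2 ^ Suc j" by (simp add: div_mult2_eq[symmetric] mult.commute)
     moreover have "P (P y) = (D ^^ 2 ^ Suc j) y" unfolding P_def by (simp add: mult_2 funpow_add)
     ultimately show ?thesis using z[OF that] g(1) by (auto simp: Z'_def F_def simp del: power_Suc)
    qed
    have W1: "W - j = Suc (W - Suc j)" using True by simp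
    have "K (e1(35 := ga * Q1, 33 := gb * Q1, 34 := ga * Q1, 21 := Suc j)) [] H' (Suc (Suc (Suc (Suc (Suc n1 + CP))))) (Suc (Suc (Suc (Suc (Suc d1 + DP)))))"
     unfolding K_def
     by (intro conjI exI[of _ "Suc j"] exI[of _ gb] exI[of _ ga] exI[of _ Z'] allI impI)
      (use True j m1 g s' zz n1[unfolded W1] in \<open>auto simp: mu\<close>)
    then show "wp ?R ?R ?M (flip (21 ::= V 21 [+] C 1)) K e1 [] H' (Suc n1 + CP) (Suc d1 + DP)"
     unfolding flip_def using g j True gw WW' numw by (auto simp: wp_Seq wp_Assign)
   qed
   then have "wp ?R ?R ?M (?b4) K e1 [] H1 (Suc n1) (Suc d1)" by (simp add: wp_Seq)
   then show ?thesis using True j b1 e0 WW' by (simp add: K_def)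
  qed
 qed
 let ?t3 = "Call 12 ;; flip (21 ::= C 0 ;; While (V 21) (V 0) (?b4) ;; ?t5)"
 have st3: "wp ?R ?R ?M (?t3) J e [] H n d"
  if m: "mst e" and g: "(ga, gb) \<in> {(4, 7), (7, 4)}" "e 33 = ga * Q1" "e 34 = gb * Q1"
   and s: "ST (%x. Xs (D x)) Z H" and z: "!!y. y < k ==> Z y 2 = Some (D y) & Z y (Suc ga) = Some (mm y) & Z y (Suc (Suc ga)) = Some (od y)"
   and res: "RES mm od" and n: "n + B3 <= NN" "d + E3 <= DD" for e Z H mm od n d ga gb
 proof -
  define F where "F x h = Some (if h = (0::nat) then od x else if h = 3 then mm x else D x)" for x h
  have bd: "wp (RR {} x) (UU {0, 3, gb} x) 0 init2 (Bpost (%x. Xs (D x)) {0, 3, gb} F x) e' [] H 0 0"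
   if "x < k" "e' 3 = x" "!!r. r ~= 3 ==> r ~= 4 ==> e' r = e r" for x e'
  proof -
   have v: "D x < 2 ^ W" "mm x < 2 ^ W" "od x < 2 ^ W" using res that(1) D1[OF that(1)] xw unfolding RES_def by blast+
   have "wp (RR {} x) (UU {0, 3, gb} x) 0 init2 (Bpost (%x. Xs (D x)) {0, 3, gb}
    (%x' h. Some (if h = 0 then od x else if h = 3 then mm x else D x)) x) e' [] H 0 0"
    by (rule init2_body[where ga = ga and Z = Z]) (use that eb[OF m that(3)] g s z v in auto)
   then show ?thesis by (simp add: F_def)
  qed
  define Z' where "Z' x h = (if h \<in> {0, 3, gb} then F x h else Z x h)" for x h
  have "wp ?R ?R ?M (Call 12) (wp ?R ?R ?M (flip (21 ::= C 0 ;; While (V 21) (V 0) (?b4) ;; ?t5)) J) e [] H n d"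
  proof (rule call)
   show "tri ?R ?R (224 * W) (Pr 12) e H (ST (%x. Xs (D x)) Z') (k * (nb + 20) + 2) (nb + 10 * W + 10)"
    unfolding Z'_def by (rule pass_tri[OF Prs(3) mE(2,3)[OF m] s, where RG = "{}"]) (use g(1) bd in auto)
   fix H' assume s': "ST (%x. Xs (D x)) Z' H'"
   define e2 where "e2 = e(35 := ga * Q1, 33 := gb * Q1, 34 := ga * Q1, 21 := 0)"
   have a1: "mst e2" "e2 21 = 0" and a2: "(gb, ga) \<in> {(4, 7), (7, 4)}" "e2 33 = gb * Q1" "e2 34 = ga * Q1"
    using m g(1) by (auto simp: e2_def mu)
   have a3: "Z' y 2 = Some (D y) & Z' y gb = Some (D y) & Z' y 0 = Some (od y) & Z' y 3 = Some (mm y)" if "y < k" for y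
    using z[OF that] g(1) by (auto simp: Z'_def F_def)
   have "wp ?R ?R ?M (While (V 21) (V 0) (?b4)) (wp ?R ?R ?M (?t5) J) e2 [] H' (Suc (Suc (Suc (Suc (n + CP))))) (Suc (Suc (Suc (Suc (d + DP)))))"
    by (rule st4[OF a1 a2 s' a3 res]) (use n in \<open>auto simp: B3_def E3_def\<close>)
   then show "wp ?R ?R ?M (flip (21 ::= C 0 ;; While (V 21) (V 0) (?b4) ;; ?t5)) J e [] H' (n + CP) (d + DP)"
    unfolding flip_def e2_def using g gw by (auto simp: wp_Seq wp_Assign)
  qed
  then show ?thesis by (simp add: wp_Seq)
 qed
 let ?b2 = "Call 11 ;; flip (22 ::= V 22 [+] V 22 ;; 21 ::= V 21 [+] C 1)"
 let ?I2 = "%e' b' H' n' d'. \<exists>j ga gb Z m od. j <= W & e' 21 = j & e' 22 = 2 ^ j & mst e' & (ga, gb) \<in> {(4, 7), (7, 4)} &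
   e' 33 = ga * Q1 & e' 34 = gb * Q1 & b' = [] & ST (%x. Xs (D x)) Z H' &
   (\<forall>y<k. Z y 2 = Some (D y) & Z y ga = Some ((D ^^ 2 ^ j) y) & Z y (Suc ga) = Some (m y) & Z y (Suc (Suc ga)) = Some (od y)) &
   (\<forall>y<k. m y < k & od y < 2 ^ j & (D ^^ od y) y = m y & (\<forall>i<2 ^ j. m y <= (D ^^ i) y)) &
   n' + (W - j) * (CP + 7) + 1 + B3 <= NN & d' + (W - j) * (DP + 7) + 1 + E3 <= DD"
 have st2: "wp ?R ?R ?M (While (V 21) (V 0) (?b2)) (wp ?R ?R ?M (?t3) J) e [] H n d"
  if m: "mst e" "e 21 = 0" "e 22 = 1" and g: "e 33 = 4 * Q1" "e 34 = 7 * Q1"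
   and s: "ST (%x. Xs (D x)) Z H" and z: "!!y. y < k ==> Z y 2 = Some (D y) & Z y 4 = Some (D y) &
    Z y 5 = Some y & Z y 6 = Some 0"
   and n: "n + W * (CP + 7) + 1 + B3 <= NN" "d + W * (DP + 7) + 1 + E3 <= DD" for e Z H n d
 proof (rule wp_While[where I = ?I2 and f = "%e b H. W - e 21"], goal_cases)
  case 1
  show ?case
   \<comment> \<open>Before the first round only the iterate \<open>D ^^ 0\<close> counts: the
     minimum is \<open>y\<close> itself, at distance 0.\<close>
   by (intro exI[of _ 0] exI[of _ 4] exI[of _ 7] exI[of _ Z] exI[of _ "%y. y"] exI[of _ "%_. 0"] conjI allI impI)
    (use m g s z n in auto)
 next
  case (2 e1 b1 H1 n1 d1)
  then obtain j ga gb Z m od where j: "j <= W" "e1 21 = j" "e1 22 = 2 ^ j" and m1: "mst e1" and g: "(ga, gb) \<in> {(4, 7), (7, 4)}" "e1 33 = ga * Q1" "e1 34 = gb * Q1"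
   and b1: "b1 = []" and s1: "ST (%x. Xs (D x)) Z H1"
   and z: "!!y. y < k ==> Z y 2 = Some (D y) & Z y ga = Some ((D ^^ 2 ^ j) y) & Z y (Suc ga) = Some (m y) & Z y (Suc (Suc ga)) = Some (od y)"
   and mo: "!!y. y < k ==> m y < k & od y < 2 ^ j & (D ^^ od y) y = m y & (\<forall>i<2 ^ j. m y <= (D ^^ i) y)"
   and n1: "n1 + (W - j) * (CP + 7) + 1 + B3 <= NN" "d1 + (W - j) * (DP + 7) + 1 + E3 <= DD" by blast
  have e0: "e1 0 = W" using m1 by (simp add: mst_def env_def)
  show ?case
  proof (cases "j < W")
   case False
   then have jW: "j = W" using j by simp
   have "wp ?R ?R ?M (?t3) J e1 [] H1 (Suc n1) (Suc d1)"
   proof (rule st3[OF m1 g s1])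
    show "Z y 2 = Some (D y) & Z y (Suc ga) = Some (m y) & Z y (Suc (Suc ga)) = Some (od y)" if "y < k" for y
     using z[OF that] by blast
    show "RES m od" using mo jW by (auto simp: RES_def)
   qed (use n1 jW in auto)
   then show ?thesis using jW j b1 e0 WW' by simp
  next
   case True
   define P where "P = D ^^ 2 ^ j"
   define m' where "m' y = (if m (P y) < m y then m (P y) else m y)" for y
   define od' where "od' y = (if m (P y) < m y then 2 ^ j + od (P y) else od y)" for y
   have dbl: "m' y < k & od' y < 2 ^ Suc j & (D ^^ od' y) y = m' y & (\<forall>i<2 ^ Suc j. m' y <= (D ^^ i) y)"
    "P (P y) = (D ^^ 2 ^ Suc j) y" if "y < k" for y
    using doubling[of k m od j D y, OF mo Dn that] unfolding m'_def od'_def P_def by auto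
   have jp: "(2::nat) ^ j + 2 ^ j <= 2 ^ W"
    using power_increasing[of "Suc j" W "2::nat"] True by simp
   define F where "F x h = Some (if h = gb then P (P x) else if h = Suc gb then m' x else od' x)" for x h
   have bd: "wp (RR {ga, Suc ga, Suc (Suc ga)} x) (UU {gb, Suc gb, Suc (Suc gb)} x) 0 round1
     (Bpost (%x. Xs (D x)) {gb, Suc gb, Suc (Suc gb)} F x) e' [] H1 0 0"
    if "x < k" "e' 3 = x" "!!r. r ~= 3 ==> r ~= 4 ==> e' r = e1 r" for x e'
    unfolding F_def m'_def od'_def
    by (rule round1_body[where Z = Z and P = P and m = m and od = od and T = "2 ^ j"])
     (use that eb[OF m1 that(3)] g j s1 z mo Dn jp in \<open>auto simp: P_def\<close>)
   define Z' where "Z' x h = (if h \<in> {gb, Suc gb, Suc (Suc gb)} then F x h else Z x h)" for x h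
   define K where "K = (%(e' :: nat => nat) (b' :: 'a cell list) H' n' d'. ?I2 e' b' H' n' d' & W - e' 21 < W - e1 21)"
   have "wp ?R ?R ?M (Call 11) (wp ?R ?R ?M (flip (22 ::= V 22 [+] V 22 ;; 21 ::= V 21 [+] C 1)) K) e1 [] H1 (Suc n1) (Suc d1)"
   proof (rule call)
    show "tri ?R ?R (224 * W) (Pr 11) e1 H1 (ST (%x. Xs (D x)) Z') (k * (nb + 20) + 2) (nb + 10 * W + 10)"
     unfolding Z'_def by (rule pass_tri[OF Prs(2) mE(2,3)[OF m1] s1, where RG = "{ga, Suc ga, Suc (Suc ga)}"]) (use g(1) bd in auto)
    fix H' assume s': "ST (%x. Xs (D x)) Z' H'"
    have zz: "Z' y 2 = Some (D y) & Z' y gb = Some ((D ^^ 2 ^ Suc j) y) & Z' y (Suc gb) = Some (m' y) & Z' y (Suc (Suc gb)) = Some (od' y)" if "y < k" for y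
     using z[OF that] dbl(2)[OF that] g(1) by (auto simp: Z'_def F_def simp del: power_Suc)
    have W1: "W - j = Suc (W - Suc j)" using True by simp
    have "K (e1(35 := ga * Q1, 33 := gb * Q1, 34 := ga * Q1, 22 := 2 ^ Suc j, 21 := Suc j)) [] H' (Suc (Suc (Suc (Suc (Suc (Suc n1 + CP)))))) (Suc (Suc (Suc (Suc (Suc (Suc d1 + DP))))))"
     unfolding K_def
    proof (rule conjI, rule exI[of _ "Suc j"], rule exI[of _ gb], rule exI[of _ ga], rule exI[of _ Z'], rule exI[of _ m'],
      rule exI[of _ od'], intro conjI)
     show "\<forall>y<k. Z' y 2 = Some (D y) & Z' y gb = Some ((D ^^ 2 ^ Suc j) y) & Z' y (Suc gb) = Some (m' y) & Z' y (Suc (Suc gb)) = Some (od' y)"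
      using zz by blast
     show "\<forall>y<k. m' y < k & od' y < 2 ^ Suc j & (D ^^ od' y) y = m' y & (\<forall>i<2 ^ Suc j. m' y <= (D ^^ i) y)"
      using dbl(1) by blast
    qed (use True j m1 g s' n1[unfolded W1] in \<open>auto simp: mu\<close>)
    moreover have "(2::nat) ^ j + 2 ^ j < 2 ^ w" using jp WW zero_less_power[of "2::nat" W] by linarith
    ultimately show "wp ?R ?R ?M (flip (22 ::= V 22 [+] V 22 ;; 21 ::= V 21 [+] C 1)) K e1 [] H' (Suc n1 + CP) (Suc d1 + DP)"
     unfolding flip_def using g j True gw WW' numw by (auto simp: wp_Seq wp_Assign mult_2)
   qed
   then have "wp ?R ?R ?M (?b2) K e1 [] H1 (Suc n1) (Suc d1)" by (simp add: wp_Seq)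
   then show ?thesis using True j b1 e0 WW' by (simp add: K_def)
  qed
 qed
 define e1 where "e1 = e0(3 := 0, 4 := k)"
 have m1: "mst e1" using e0 by (simp add: mst_def e1_def env_def)
 define F where "F x h = Some (if h = (4::nat) then D x else if h = 5 then x else 0)" for x h
 have bd: "wp (RR {} x) (UU {4, 5, 6} x) 0 init1 (Bpost (%x. Xs (D x)) {4, 5, 6} F x) e' [] H0 0 0"
  if "x < k" "e' 3 = x" "!!r. r ~= 3 ==> r ~= 4 ==> e' r = e1 r" for x e'
 proof -
  have v: "D x < 2 ^ W" using D1[OF that(1)] xw by blast
  have "wp (RR {} x) (UU {4, 5, 6} x) 0 init1 (Bpost (%x. Xs (D x)) {4, 5, 6}
   (%x' h. Some (if h = 4 then D x else if h = 5 then x' else 0)) x) e' [] H0 0 0"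
   by (rule init1_body[where Z = Z0]) (use that eb[OF m1 that(3)] Y0 Z0 v in auto)
  then show ?thesis by (simp add: F_def)
 qed
 let ?t2 = "33 ::= C 4 [*] V 1 ;; 34 ::= C 7 [*] V 1 ;; 22 ::= C 1 ;; 21 ::= C 0 ;; While (V 21) (V 0) (?b2) ;; ?t3"
 define Z' where "Z' x h = (if h \<in> {4, 5, 6} then F x h else Z0 x h)" for x h
 have n7: "(7::nat) < 2 ^ w" by (rule small) simp
 have "wp ?R ?R ?M (Call 10) (wp ?R ?R ?M (?t2) J) e1 [] H0 (Suc (Suc 0)) (Suc (Suc 0))"
 proof (rule call)
  show "tri ?R ?R (224 * W) (Pr 10) e1 H0 (ST (%x. Xs (D x)) Z') (k * (nb + 20) + 2) (nb + 10 * W + 10)"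
   unfolding Z'_def by (rule pass_tri[OF Prs(1) mE(2,3)[OF m1] Y0, where RG = "{}"]) (use bd in auto)
  fix H' assume s': "ST (%x. Xs (D x)) Z' H'"
  define e2 where "e2 = e1(33 := 4 * Q1, 34 := 7 * Q1, 22 := 1, 21 := 0)"
  have a1: "mst e2" "e2 21 = 0" "e2 22 = 1" "e2 33 = 4 * Q1" "e2 34 = 7 * Q1" using m1 by (auto simp: e2_def mu)
  have a3: "Z' y 2 = Some (D y) & Z' y 4 = Some (D y) & Z' y 5 = Some y & Z' y 6 = Some 0" if "y < k" for y
   using Z0[OF that] by (auto simp: Z'_def F_def)
  have "wp ?R ?R ?M (While (V 21) (V 0) (?b2)) (wp ?R ?R ?M (?t3) J) e2 [] H' (Suc (Suc (Suc (Suc (Suc (Suc 0) + CP))))) (Suc (Suc (Suc (Suc (Suc (Suc 0) + DP)))))"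
   by (rule st2[OF a1 s' a3]) (use bud in auto)
  moreover have "e1 1 = Q1" using m1 by (simp add: mst_def env_def)
  ultimately show "wp ?R ?R ?M (?t2) J e1 [] H' (Suc (Suc 0) + CP) (Suc (Suc 0) + DP)"
   using Q2w numw n7 qw by (simp add: wp_Seq wp_Assign e2_def)
 qed
 then have "wp ?R ?R ?M perm1 J e0 [] H0 0 0"
  unfolding perm1_def using e0 kk by (simp add: wp_Seq wp_Assign e1_def env_def)
 then show ?thesis unfolding J_def NN_def DD_def by (rule tri_wpI)
qed

end

section \<open>The main program and the two levels combined\<close>

text \<open>The program has to compute \<open>W\<close> itself: register 28 runs through the powers
  of two from \<open>2 ^ 4\<close> until it exceeds the number of elements. Register 26 saves the
  length of \<open>B\<close>, as registers 0 to 2 are needed for \<open>W\<close>,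
  \<open>2 * W + 3\<close> and its square.\<close>

definition mainc :: com where
 "mainc = 12 ::= V 0 [+] V 1 ;; 13 ::= V 0 ;; 26 ::= V 1 ;; 27 ::= C 4 ;; 28 ::= C 16 ;;
   While (V 28) (V 12 [+] C 1) (28 ::= V 28 [+] V 28 ;; 27 ::= V 27 [+] C 1) ;;
   0 ::= V 27 ;; 1 ::= C 2 [*] V 0 [+] C 3 ;; 2 ::= V 1 [*] V 1 ;; 11 ::= C 0 ;;
   3 ::= C 0 ;; 4 ::= V 26 [div] C 2 ;; 5 ::= V 13 ;; 6 ::= V 12 ;; Call 2 ;; Call 7"

text \<open>The position in the list is the number used by \<open>Call\<close>. Procedure 7 solves
  the second level and falls back on 5, the solver of the first level, which in turn falls back on
  the buffer sort 3.\<close>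

definition procs :: "com list" where
 "procs = [Skip, pfor 1 swap_body, pfor 2 mirror_body, buf, purify 4 leaf0, solve 1 3 4 8, purify 6 leaf1,
   solve 2 5 6 9, perm0, perm1, pfor 10 init1, pfor 11 round1, pfor 12 init2, pfor 13 round2,
   pfor 14 prep, pfor 15 swp_body, pfor 16 clear]"

definition proc :: "nat => com" where
 "proc p = (if p < 17 then procs ! p else Skip)"

locale alg4 = alg3 +
 assumes Prp: "Pr = proc"
begin

lemma PrN: "Pr 4 = purify 4 leaf0" "Pr 5 = solve 1 3 4 8" "Pr 6 = purify 6 leaf1" "Pr 7 = solve 2 5 6 9" "Pr 8 = perm0" "Pr 9 = perm1"
 "Pr 10 = pfor 10 init1" "Pr 11 = pfor 11 round1" "Pr 12 = pfor 12 init2" "Pr 13 = pfor 13 round2"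
 "Pr 14 = pfor 14 prep" "Pr 15 = pfor 15 swp_body" "Pr 16 = pfor 16 clear"
 by (simp_all add: Prp proc_def procs_def)

text \<open>Only group 2 carries a word; the other nine are plain and serve as scratch space of
  \<open>perm1\<close>.\<close>

definition LP1 :: "(nat => 'a :: linorder cell) => nat => 'a list => nat => bool" where
 "LP1 H p xs t \<longleftrightarrow> (\<forall>g<10. grp W H (p + g * q) (take q (drop (g * q) xs)) (if g = 2 then Some t else None)) &
   (\<forall>i<q * q. 10 * q <= i --> H (p + i) = Elem (xs ! i))"

lemma gq1: "g < 10 ==> g * q + q <= q * q"
proof -
 assume "g < 10"
 then have "Suc g * q <= q * q" using W4 by (intro mult_le_mono1) simp
 then show ?thesis unfolding mult_Suc by linarith
qed

lemma LP1_loc: "LP1 H p xs t ==> (!!a. a \<in> {p..<p + q * q} ==> H' a = H a) ==> LP1 H' p xs t"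
 unfolding LP1_def
proof (intro conjI allI impI)
 assume a: "(\<forall>g<10. grp W H (p + g * q) (take q (drop (g * q) xs)) (if g = 2 then Some t else None)) &
   (\<forall>i<q * q. 10 * q <= i --> H (p + i) = Elem (xs ! i))" and b: "!!a. a \<in> {p..<p + q * q} ==> H' a = H a"
 show "grp W H' (p + g * q) (take q (drop (g * q) xs)) (if g = 2 then Some t else None)" if g: "g < (10::nat)" for g
 proof (rule grp_cong)
  show "grp W H (p + g * q) (take q (drop (g * q) xs)) (if g = 2 then Some t else None)" using a g by blast
  fix i assume "i < 2 * W + 3"
  then have "p + g * q + i < p + q * q" using gq1[OF g] by linarith
  then show "H' (p + g * q + i) = H (p + g * q + i)" by (intro b) simp
 qed
 show "H' (p + i) = Elem (xs ! i)" if "i < q * q" "10 * q <= i" for i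
  using a b[of "p + i"] that by auto
qed

lemma perm1_ok: "perm_ok (q * q) (LP1 :: (nat => 'a :: linorder cell) => _) L 9 (224 + 448 * W) 400 (400 * (W * W))"
 unfolding perm_ok_def
proof (intro allI impI)
 fix e :: "nat => nat" and base k :: nat and Xs :: "nat => 'a list" and D :: "nat => nat" and H :: "nat => 'a cell"
 assume g: "glob (q * q) e" "e 14 = base" "e 12 = k" and k: "k * (q * q) < L" "1 <= k" "base + k * (q * q) <= N"
  and ps: "perm_state LP1 (q * q) H base k Xs D"
 define S1 where "S1 = q * q"
 define Q1 where "Q1 = q"
 interpret b: blk w Pr W N base k Q1 S1
  by unfold_locales (use k in \<open>simp_all add: S1_def Q1_def\<close>)
 have D: "bij_betw D {..<k} {..<k}" and Dk: "D x < k" if "x < k" for x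
  using ps that by (auto simp: perm_state_def bij_betw_def)
 have bD: "bij_betw D {..<k} {..<k}" using ps by (auto simp: perm_state_def)
 have len: "length (Xs x) = S1" "sorted (Xs x)" if "x < k" for x
  using ps that sorted_block[of Xs k x] by (auto simp: perm_state_def S1_def)
 have lp: "LP1 H (base + x * S1) (Xs (D x)) (D x)" if "x < k" for x
  using ps that by (auto simp: perm_state_def S1_def)
 have st: "b.ST (%x. Xs (D x)) (%x g. if g = 2 then Some (D x) else None) H"
  unfolding b.ST_def b.gx_def
 proof (intro conjI allI impI)
  fix x assume x: "x < k"
  show "length (Xs (D x)) = S1" "sorted (Xs (D x))" using len Dk[OF x] by auto
  show "grp W H (base + (x * S1 + g * Q1)) (take Q1 (drop (g * Q1) (Xs (D x)))) (if g = 2 then Some (D x) else None)"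
   if "g < 10" for g :: nat
   using lp[OF x, unfolded LP1_def, folded S1_def Q1_def] that by (simp only: add.assoc)
  show "H (base + (x * S1 + i)) = Elem (Xs (D x) ! i)" if "i < S1" "10 * Q1 <= i" for i
   using lp[OF x, unfolded LP1_def, folded S1_def Q1_def] that by (simp only: add.assoc)
 qed
 have "e 0 = W" "e 1 = Q1" "e 20 = S1" using g(1) by (auto simp: glob_def Q1_def S1_def)
 then have env: "b.env e" using g(2,3) unfolding b.env_def by blast
 show "tri {base..<base + k * (q * q)} {base..<base + k * (q * q)} (224 + 448 * W) (Pr 9) e H
    (%H'. outp H' base (k * (q * q)) (mset (concat (map Xs [0..<k])))) (400 * (k * (q * q))) (400 * (W * W))"
  unfolding PrN(6) S1_def[symmetric]
  by (rule b.perm1_tri[OF PrN(7-13) env bD st]) (use ps len in \<open>auto simp: perm_state_def\<close>)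
qed

text \<open>Reversing two adjacent parts and then the whole restores the order within each part and
  exchanges the parts.\<close>

lemma rotate:
 fixes H :: "nat => 'c"
 assumes "\<forall>i<o'. H1 (p + i) = H (p + (o' - Suc i))" "!!a. a \<notin> {p..<p + o'} ==> H1 a = H a"
  and "\<forall>i<l - o'. H2 (p + o' + i) = H1 (p + o' + (l - o' - Suc i))" "!!a. a \<notin> {p + o'..<p + o' + (l - o')} ==> H2 a = H1 a"
  and "\<forall>i<l. H3 (p + i) = H2 (p + (l - Suc i))" and o': "o' < l" and y: "y < l"
 shows "H3 (p + y) = H (p + (o' + y) mod l)"
proof (cases "o' <= l - Suc y")
 case True
 define i where "i = l - Suc y - o'"
 have i: "i < l - o'" "l - Suc y = o' + i" "l - o' - Suc i = y" "o' + y < l" using True y by (auto simp: i_def)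
 have "H3 (p + y) = H2 (p + o' + i)" using assms(5) y i(2) by (metis add.assoc)
 also have "\<dots> = H1 (p + o' + y)" using assms(3) i(1,3) by metis
 also have "\<dots> = H (p + o' + y)" by (rule assms(2)) simp
 finally show ?thesis using i by (simp add: add.assoc)
next
 case False
 define i where "i = l - Suc y"
 have i: "i < o'" "o' - Suc i = o' + y - l" "l <= o' + y" using False y by (auto simp: i_def)
 have m: "(o' + y) mod l = o' + y - l" using i y o' by (simp add: mod_if)
 have "H3 (p + y) = H2 (p + i)" using assms(5) y by (simp add: i_def)
 also have "\<dots> = H1 (p + i)" by (rule assms(4)) (use i in simp)
 also have "\<dots> = H (p + (o' - Suc i))" using assms(1) i by blast
 finally show ?thesis using i m by simp
qed

lemma leaf1_ok:
 assumes sol: "sol_ok TYPE('a :: linorder) (q * q + 1) 5 M5 f5 d5"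
 shows "leaf_ok (q * q) (LP1 :: (nat => 'a cell) => _) leaf1 (112 + max M5 (224 * W))
  (22 * (q * q) + f5 (q * q) + 8 * W + 60) (d5 + 38 * W + 100)"
 unfolding leaf_ok_def
proof (intro allI impI)
 fix e :: "nat => nat" and La Lb Ra Rb F a b T :: nat and c :: "int => 'a" and H :: "nat => 'a cell" and p :: nat
 assume g: "glob (q * q) e" and nd: "node e La Lb Ra Rb F a T" and inv: "ninvn (q * q) La Lb Ra Rb F a b" and ab0: "a + b = q * q"
  and Rb: "Rb <= N" and T: "T < N" and lay: "layn H La Ra Rb F c a b" and v: "valley c (int a) (int b)"
  and p: "p = (if La < Lb then La else Ra)"
 define S1 where "S1 = q * q"
 define Q1 where "Q1 = q"
 have ab: "a + b = S1" using ab0 by (simp add: S1_def)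
 note lr = leaf_range[OF inv ab0 p, folded S1_def]
 let ?R = "{p..<p + S1}" and ?M = "112 + max M5 (224 * W)"
 let ?n = "22 * S1 + f5 S1 + 8 * W + 60" and ?d = "d5 + 38 * W + 100"
 define J where "J = (%(e' :: nat => nat) (b' :: 'a cell list) H' n' d'. n' <= ?n & d' <= ?d &
  (\<exists>xs. LP1 H' p xs T & sorted xs & length xs = S1 & mset xs = vmset c (int a) (int b)))"
 \<comment> \<open>Index 0 of the valley lies at offset \<open>- F\<close> modulo the block size;
   the rotation by \<open>o'\<close> brings it to the front, as \<open>inp\<close> requires.\<close>
 define o' where "o' = (S1 - F) mod S1"
 have o': "o' < S1" using lr by (simp add: o'_def)
 have N: "S1 <= N" "p + S1 <= N" using lr Rb by auto
 have tW: "l <= 2 ^ W" if "l <= S1" for l using that N NW by linarith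
 have q3: "Q1 <= S1" "3 * Q1 <= S1" "10 * Q1 <= S1" using gq1[of 2] gq1[of 9] by (auto simp: S1_def Q1_def)
 have bw: "p < 2 ^ w" "S1 < 2 ^ w" "p + S1 < 2 ^ w" "p + o' < 2 ^ w" "T < 2 ^ w" "a < 2 ^ w" "Q1 < 2 ^ w" "2 * Q1 < 2 ^ w"
   "p + 2 * Q1 < 2 ^ w" "(2::nat) < 2 ^ w" "0 < (2::nat) ^ w" "p + 2 * Q1 + Q1 < 2 ^ w"
 proof -
  have "p <= N" "S1 <= N" "p + S1 <= N" "p + o' <= N" "T <= N" "a <= N" "Q1 <= N" "2 * Q1 <= N" "p + 2 * Q1 <= N" "p + 2 * Q1 + Q1 <= N"
   using N o' T ab q3 by linarith+
  then show "p < 2 ^ w" "S1 < 2 ^ w" "p + S1 < 2 ^ w" "p + o' < 2 ^ w" "T < 2 ^ w" "a < 2 ^ w" "Q1 < 2 ^ w" "2 * Q1 < 2 ^ w"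
   "p + 2 * Q1 < 2 ^ w" "(2::nat) < 2 ^ w" "0 < (2::nat) ^ w" "p + 2 * Q1 + Q1 < 2 ^ w" by (simp_all add: small)
 qed
 have ge: "e 0 = W" "e 1 = Q1" "e (Suc 0) = Q1" "e 2 = S1" "e 20 = S1" "e 13 = a" "e 18 = F" "e 19 = T" "e 14 = La" "e 15 = Lb" "e 16 = Ra"
  using g nd by (auto simp: glob_def node_def S1_def Q1_def)
 define e1 where "e1 = e(11 := p, 12 := S1, 26 := o', 3 := 0, 4 := o' div 2, 5 := p, 6 := p + o')"
 define e2 where "e2 = e1(4 := (S1 - o') div 2, 5 := p + o', 6 := p + S1)"
 define e3 where "e3 = e2(4 := S1 div 2, 5 := p, 6 := p + S1)"
 define e4 where "e4 = e3(7 := p + 2 * Q1, 8 := T)"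
 let ?t4 = "7 ::= V 11 [+] C 2 [*] V 1 ;; 8 ::= V 19 ;; wr"
 let ?t3 = "Call 5 ;; ?t4"
 let ?t2 = "4 ::= V 20 [div] C 2 ;; 5 ::= V 11 ;; 6 ::= V 11 [+] V 20 ;; Call 2 ;; ?t3"
 let ?t1 = "4 ::= (V 20 [-] V 26) [div] C 2 ;; 5 ::= V 11 [+] V 26 ;; 6 ::= V 11 [+] V 20 ;; Call 2 ;; ?t2"
 have "wp ?R ?R ?M (Call 2) (wp ?R ?R ?M (?t1) J) e1 [] H (Suc (Suc (Suc (Suc (Suc (Suc (Suc (Suc 0)))))))) (Suc (Suc (Suc (Suc (Suc (Suc (Suc (Suc 0))))))))"
 proof (rule wp_Call[OF reverse_tri[where l = o' and x = p and t = W]])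
  fix H1 assume r1: "\<forall>i<o'. H1 (p + i) = H (p + (o' - Suc i))" "!!a. a \<notin> {p..<p + o'} ==> H1 a = H a"
  define n1 where "n1 = Suc (Suc (Suc (Suc (Suc (Suc (Suc (Suc 0))))))) + Suc (11 * o' + 2)"
  define d1 where "d1 = Suc (Suc (Suc (Suc (Suc (Suc (Suc (Suc 0))))))) + Suc (10 * W + 11)"
  have "wp ?R ?R ?M (Call 2) (wp ?R ?R ?M (?t2) J) e2 [] H1 (Suc (Suc (Suc n1))) (Suc (Suc (Suc d1)))"
  proof (rule wp_Call[OF reverse_tri[where l = "S1 - o'" and x = "p + o'" and t = W]])
   fix H2 assume r2: "\<forall>i<S1 - o'. H2 (p + o' + i) = H1 (p + o' + (S1 - o' - Suc i))"
    "!!a. a \<notin> {p + o'..<p + o' + (S1 - o')} ==> H2 a = H1 a"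
   define n2 where "n2 = Suc (Suc (Suc n1)) + Suc (11 * (S1 - o') + 2)"
   define d2 where "d2 = Suc (Suc (Suc d1)) + Suc (10 * W + 11)"
   have "wp ?R ?R ?M (Call 2) (wp ?R ?R ?M (?t3) J) e3 [] H2 (Suc (Suc (Suc n2))) (Suc (Suc (Suc d2)))"
   proof (rule wp_Call[OF reverse_tri[where l = S1 and x = p and t = W]])
    fix H3 assume r3: "\<forall>i<S1. H3 (p + i) = H2 (p + (S1 - Suc i))"
    have rot: "H3 (p + y) = H (p + (o' + y) mod S1)" if "y < S1" for y
     by (rule rotate[OF r1 r2 r3 o' that])
    have inp3: "inp H3 p S1 c a"
     unfolding inp_def
    proof (intro conjI allI impI)
     show "a <= S1" using ab by simp
     show "valley c (int a) (int S1 - int a)" using v ab by (simp add: ab[symmetric])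
     fix y assume y: "y < S1"
     \<comment> \<open>\<open>x\<close> counts the same element from the least index
       \<open>- b\<close> of the valley, which is the numbering of \<open>leaf_cell\<close>.\<close>
     define x where "x = (if y < a then y + b else y - a)"
     have x: "x < S1" using y ab by (auto simp: x_def)
     have lc: "H (p + ((a + S1 - F) mod S1 + x) mod S1) = Elem (c (int x - int b))"
      using leaf_cell[OF inv ab0 lay p] x unfolding S1_def by blast
     have "((a + S1 - F) mod S1 + x) mod S1 = (a + S1 - F + x) mod S1" by (simp add: mod_simps)
     also have "\<dots> = (S1 - F + y) mod S1"
     proof (cases "y < a")
      case True
      then have "a + S1 - F + x = (S1 - F + y) + S1" using ab lr(2) by (simp add: x_def)
      then show ?thesis by simp
     next
      case False
      then have "a + S1 - F + x = S1 - F + y" using lr(2) by (simp add: x_def)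
      then show ?thesis by simp
     qed
     also have "\<dots> = (o' + y) mod S1" by (simp add: o'_def mod_simps)
     finally have "H3 (p + y) = Elem (c (int x - int b))" using rot[OF y] lc by simp
     moreover have "int x - int b = (if y < a then int y else int y - int S1)"
      using ab by (auto simp: x_def of_nat_diff)
     ultimately show "H3 (p + y) = Elem (c (if y < a then int y else int y - int S1))" by simp
    qed
    define n3 where "n3 = Suc (Suc (Suc n2)) + Suc (11 * S1 + 2)"
    define d3 where "d3 = Suc (Suc (Suc d2)) + Suc (10 * W + 11)"
    have e3v: "e3 0 = W" "e3 1 = q" "e3 2 = q * q" "e3 11 = p" "e3 12 = S1" "e3 13 = a" "e3 19 = T" "e3 (Suc 0) = Q1"
     using ge by (auto simp: e3_def e2_def e1_def S1_def Q1_def)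
    have "wp ?R ?R ?M (Call 5) (wp ?R ?R ?M (?t4) J) e3 [] H3 n3 d3"
    proof (rule wp_Call[OF sol_okD[OF sol e3v(1-6) _ N(2) inp3]])
     show "S1 < q * q + 1" by (simp add: S1_def)
     fix H4 assume "outp H4 p S1 (vmset c (int a) (int S1 - int a))"
     moreover have "int S1 - int a = int b" by (simp add: ab[symmetric])
     ultimately obtain xs where xs: "sorted xs" "length xs = S1" "mset xs = vmset c (int a) (int b)" "!!i. i < S1 ==> H4 (p + i) = Elem (xs ! i)"
      unfolding outp_def by auto
     have gr: "grp W H4 (p + g * Q1) (take Q1 (drop (g * Q1) xs)) None" if "g < 10" for g
     proof -
      have gg: "g * Q1 + Q1 <= S1" using gq1[OF that] by (simp add: S1_def Q1_def)
      show ?thesis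
       unfolding grp_None_iff
      proof (intro allI impI)
       fix i assume "i < 2 * W + 3"
       then have i: "i < Q1" "g * Q1 + i < S1" using gg by (auto simp: Q1_def)
       then show "H4 (p + g * Q1 + i) = Elem (take Q1 (drop (g * Q1) xs) ! i)"
        using xs(4)[OF i(2)] xs(2) gg by (simp add: add.assoc)
      qed
     qed
     define n4 where "n4 = n3 + Suc (f5 S1)"
     define d4 where "d4 = d3 + Suc d5"
     have "wp ?R ?R ?M wr J e4 [] H4 (Suc (Suc n4)) (Suc (Suc d4))"
     proof (rule wp_wr[where p = "p + 2 * Q1" and v = T and vo = None and xs = "take Q1 (drop (2 * Q1) xs)"])
      show "grp W H4 (p + 2 * Q1) (take Q1 (drop (2 * Q1) xs)) None" by (rule gr) simp
      show "sorted (take Q1 (drop (2 * Q1) xs))" using xs(1) by (simp add: sorted_wrt_take sorted_wrt_drop)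
      show "length (take Q1 (drop (2 * Q1) xs)) = 2 * W + 3" using xs(2) q3 by (simp add: Q1_def)
      show "p + 2 * Q1 + (2 * W + 3) < 2 ^ w" using bw(12) by (simp add: Q1_def)
      show "{p + 2 * Q1..<p + 2 * Q1 + (2 * W + 3)} <= ?R" using q3 by (auto simp: Q1_def)
      fix e' H' n' d'
      assume gT: "grp W H' (p + 2 * Q1) (take Q1 (drop (2 * Q1) xs)) (Some T)"
       and out: "!!a. a \<notin> {p + 2 * Q1..<p + 2 * Q1 + (2 * W + 3)} ==> H' a = H4 a"
       and n': "n' <= Suc (Suc n4) + 8 * W + 6" "d' <= Suc (Suc d4) + 8 * W + 6"
      have "LP1 H' p xs T"
       unfolding LP1_def S1_def[symmetric]
       unfolding Q1_def[symmetric]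
      proof (intro conjI allI impI)
       fix g :: nat assume g10: "g < 10"
       show "grp W H' (p + g * Q1) (take Q1 (drop (g * Q1) xs)) (if g = 2 then Some T else None)"
       proof (cases "g = 2")
        case False
        have "H' (p + g * Q1 + i) = H4 (p + g * Q1 + i)" if "i < 2 * W + 3" for i
        proof (rule out)
         have iQ: "i < Q1" using that by (simp add: Q1_def)
         have "g * Q1 + i \<notin> {2 * Q1..<2 * Q1 + Q1}" using block_eq[of g Q1 i 2] False iQ by blast
         then show "p + g * Q1 + i \<notin> {p + 2 * Q1..<p + 2 * Q1 + (2 * W + 3)}" by (auto simp: Q1_def)
        qed
        then show ?thesis using gr[OF g10] False by (auto intro: grp_cong)
       qed (use gT in simp)
      next
       fix i assume i: "i < S1" "10 * Q1 <= i"
       have "H' (p + i) = H4 (p + i)" by (rule out) (use i(2) in \<open>auto simp: Q1_def\<close>)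
       then show "H' (p + i) = Elem (xs ! i)" using xs(4) i by simp
      qed
      moreover have "n' <= ?n" using n' o' unfolding n4_def n3_def n2_def n1_def by simp
      moreover have "d' <= ?d" using n' unfolding d4_def d3_def d2_def d1_def by simp
      ultimately show "J e' [] H' n' d'" unfolding J_def using xs by blast
     qed (use T NW e3v in \<open>auto simp: e4_def Q1_def\<close>)
     then show "wp ?R ?R ?M (?t4) J e3 [] H4 (n3 + Suc (f5 S1)) (d3 + Suc d5)"
      using bw e3v by (simp add: wp_Seq wp_Assign e4_def n4_def d4_def mult.commute)
    qed auto
    then show "wp ?R ?R ?M (?t3) J e3 [] H3 (Suc (Suc (Suc n2)) + Suc (11 * S1 + 2)) (Suc (Suc (Suc d2)) + Suc (10 * W + 11))"
     by (simp add: wp_Seq n3_def d3_def)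
   qed (use N tW in \<open>auto simp: e3_def e2_def e1_def\<close>)
   moreover have "e2 20 = S1" "e2 11 = p" using ge by (auto simp: e2_def e1_def)
   ultimately show "wp ?R ?R ?M (?t2) J e2 [] H2 (Suc (Suc (Suc n1)) + Suc (11 * (S1 - o') + 2)) (Suc (Suc (Suc d1)) + Suc (10 * W + 11))"
    using bw by (simp add: wp_Seq wp_Assign e3_def n2_def d2_def)
  qed (use N tW o' in \<open>auto simp: e2_def e1_def\<close>)
  moreover have "e1 20 = S1" "e1 11 = p" "e1 26 = o'" using ge by (auto simp: e1_def)
  moreover have "o' < 2 ^ w" using o' bw by linarith
  ultimately show "wp ?R ?R ?M (?t1) J e1 [] H1 (Suc (Suc (Suc (Suc (Suc (Suc (Suc (Suc 0))))))) + Suc (11 * o' + 2)) (Suc (Suc (Suc (Suc (Suc (Suc (Suc (Suc 0))))))) + Suc (10 * W + 11))"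
   using bw o' by (simp add: wp_Seq wp_Assign e2_def n1_def d1_def)
 qed (use N tW o' in \<open>auto simp: e1_def\<close>)
 moreover have "La < 2 ^ w" "Lb < 2 ^ w" "Ra < 2 ^ w" "F <= S1" "F < 2 ^ w" "o' < 2 ^ w"
  using N lr inv Rb ab o' bw by (auto intro!: small simp: ninvn_def ninv_def)
 ultimately have "wp ?R ?R ?M leaf1 J e [] H 0 0"
  using ge bw unfolding leaf1_def
  by (cases "La < Lb") (simp_all add: wp_Seq wp_If wp_Assign e1_def p o'_def)
 then show "tri {p..<p + q * q} {p..<p + q * q} ?M leaf1 e H
   (%H'. \<exists>xs. LP1 H' p xs T & sorted xs & length xs = q * q & mset xs = vmset c (int a) (int b))
   (22 * (q * q) + f5 (q * q) + 8 * W + 60) ?d"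
  unfolding J_def S1_def by (rule tri_wpI)
qed

lemma sol_mono:
 assumes "sol_ok TYPE('a :: linorder) L pr M f d" "L' <= L"
 shows "sol_ok TYPE('a) L' pr M f d"
 unfolding sol_ok_def
 by (intro allI impI, rule sol_okD[OF assms(1)]) (use assms(2) in simp_all)

text \<open>On the first level the sequential permutation is harmless: with regions of at most
  \<open>q * q\<close> elements its depth of \<open>53 * (q * q)\<close> is \<open>O(W * W)\<close>.
  The remainder and the leaves are sorted through the buffer, whose length is
  \<open>O(W)\<close>.\<close>

lemma sol0: "sol_ok TYPE('a :: linorder) (q * q + 1) 5 (112 + max q (max (max (115 + 2 * W) (112 + 224 * W) + 224 * W) (112 + 224 * W)))
  (%l. (2 * 53 + 21) * l + (53 + 31) * W) ((9 * q + 11) + ((26 * W + 60) + 3 + W * (22 * W + 70)) + 53 * (q * q) + 22 * W + 80)"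
 by (rule solve_ok[OF PrN(2,1) _ buf_sol leaf0_ok LP0_loc perm0_ok[OF PrN(5)]]) (use W4 in auto)

text \<open>On the second level the length is arbitrary; the remainder and the leaves are at most
  one region of the first level, and the permutation is parallel. So the depth stays
  \<open>O(W * W)\<close>.\<close>

lemma sol1:
 assumes "M5 = 112 + max q (max (max (115 + 2 * W) (112 + 224 * W) + 224 * W) (112 + 224 * W))"
  and "d5 = (9 * q + 11) + ((26 * W + 60) + 3 + W * (22 * W + 70)) + 53 * (q * q) + 22 * W + 80"
 shows "sol_ok TYPE('a :: linorder) L 7 (112 + max M5 (max (max (112 + max M5 (224 * W)) (112 + 224 * W) + 224 * W) (224 + 448 * W)))
  (%l. (2 * 400 + 21) * l + (400 + 31) * W) (d5 + ((d5 + 38 * W + 100) + 3 + W * (22 * W + 70)) + 400 * (W * W) + 22 * W + 80)"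
proof (rule solve_ok[OF PrN(4,3) _ sol_mono[OF sol0[folded assms]] leaf1_ok[OF sol0[folded assms]] LP1_loc perm1_ok])
 define x where "x = q * q"
 \<comment> \<open>The cost of a leaf is 149 per element plus lower terms; these are absorbed by
   \<open>400 * x\<close>, as a block has at least 121 elements and \<open>W <= x\<close>.\<close>
 have "11 * 11 <= x" unfolding x_def using W4 by (intro mult_le_mono) auto
 moreover have "W <= x" unfolding x_def by (rule order_trans[of _ q]) simp_all
 ultimately have "22 * x + ((2 * 53 + 21) * x + (53 + 31) * W) + 8 * W + 60 + 42 + 33 * x <= 400 * x"
  by simp
 then show "22 * (q * q) + ((2 * 53 + 21) * (q * q) + (53 + 31) * W) + 8 * W + 60 + 42 + 33 * (q * q) <= 400 * (q * q)"
  unfolding x_def .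
qed auto

end

lemma vmset_input:
 fixes A B :: "'a list"
 defines "c \<equiv> %z :: int. if 0 <= z then A ! nat z else B ! nat (- z - 1)"
 shows "vmset c (int (length A)) (int (length B)) = mset (A @ B)"
proof -
 have "map (%x. c (int x - int (length B))) [0..<length A + length B] = rev B @ A"
 proof (rule nth_equalityI)
  fix i assume "i < length (map (%x. c (int x - int (length B))) [0..<length A + length B])"
  then have i: "i < length A + length B" by simp
  show "map (%x. c (int x - int (length B))) [0..<length A + length B] ! i = (rev B @ A) ! i"
  proof (cases "i < length B")
   case True
   then have "nat (- (int i - int (length B)) - 1) = length B - Suc i" by auto
   then show ?thesis using True i by (simp add: c_def nth_append rev_nth)
  next
   case False
   then have "nat (int i - int (length B)) = i - length B" by auto
   then show ?thesis using False i by (simp add: c_def nth_append)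
  qed
 qed simp
 then have "mset (map (%x. c (int x - int (length B))) [0..<length A + length B]) = mset (A @ B)" by simp
 then show ?thesis using vmset_nat[of "length A" "length B" "length A + length B" c] by (simp add: mset_map)
qed

context alg4
begin

text \<open>The minimality of \<open>W\<close> identifies the parameter of the analysis with the
  value at which the loop of \<open>mainc\<close> stops.\<close>

lemma main_tri:
 fixes A B :: "'a :: linorder list"
 assumes min: "!!u. 4 <= u ==> N < 2 ^ u ==> W <= u" and N: "N = length A + length B" and s: "sorted A" "sorted B"
  and e: "e 0 = length A" "e 1 = length B" and H: "!!i. i < N ==> H i = Elem ((A @ B) ! i)"
 shows "tri {0..<N} {0..<N} (4000 * W) mainc e H (%H'. outp H' 0 N (mset (A @ B))) (900 * N + 500 * W) (3000 * (W * W))"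
proof -
 let ?R = "{0..<N}" and ?M = "4000 * W"
 define c where "c z = (if 0 <= z then A ! nat z else B ! nat (- z - 1))" for z :: int
 define VV where "VV = W * W"
 have VV: "4 * W <= VV" unfolding VV_def using W4 by simp
 have V16: "16 <= VV" using VV W4 by linarith
 define M5 where "M5 = 112 + max q (max (max (115 + 2 * W) (112 + 224 * W) + 224 * W) (112 + 224 * W))"
 define d5 where "d5 = (9 * q + 11) + ((26 * W + 60) + 3 + W * (22 * W + 70)) + 53 * (q * q) + 22 * W + 80"
 define M7 where "M7 = 112 + max M5 (max (max (112 + max M5 (224 * W)) (112 + 224 * W) + 224 * W) (224 + 448 * W))"
 define d7 where "d7 = d5 + ((d5 + 38 * W + 100) + 3 + W * (22 * W + 70)) + 400 * (W * W) + 22 * W + 80"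
 have sol: "sol_ok TYPE('a) (N + 1) 7 M7 (%l. (2 * 400 + 21) * l + (400 + 31) * W) d7"
  unfolding M7_def d7_def by (rule sol1[OF M5_def d5_def])
 have M5: "M5 <= 300 + 448 * W" using W4 by (simp add: M5_def)
 have M7: "M7 <= 600 + 672 * W" using M5 by (simp add: M7_def)
 have d5: "d5 = 234 * VV + 772 * W + 658" by (simp add: d5_def VV_def algebra_simps)
 have "W * (22 * W + 70) = 22 * VV + 70 * W" by (simp add: VV_def algebra_simps)
 then have d7: "d7 = 890 * VV + 1674 * W + 1499" by (simp add: d7_def d5 VV_def)
 define J where "J = (%(e' :: nat => nat) (b' :: 'a cell list) H' n' d'. n' <= 900 * N + 500 * W & d' <= 3000 * (W * W) &
  outp H' 0 N (mset (A @ B)))"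
 have tW: "length B <= 2 ^ W" using N NW by linarith
 have qw: "q < 2 ^ w" "q * q < 2 ^ w" "2 * W < 2 ^ w" "W < 2 ^ w" "2 * W + 3 < 2 ^ w"
 proof -
  define x where "x = q * q"
  have "16 * (N + x + 300) <= 2 ^ w" using big by (simp only: x_def)
  moreover have "q <= x" by (simp add: x_def)
  ultimately have "q < 2 ^ w" "x < 2 ^ w" by (auto intro!: less_le_trans[of _ "16 * (N + x + 300)" "2 ^ w"])
  then show "q < 2 ^ w" "q * q < 2 ^ w" "2 * W < 2 ^ w" "W < 2 ^ w" "2 * W + 3 < 2 ^ w" unfolding x_def by linarith+
 qed
 have bw: "length A < 2 ^ w" "length B < 2 ^ w" "N < 2 ^ w" "Suc N < 2 ^ w" "(1::nat) < 2 ^ w" "(2::nat) < 2 ^ w" "(3::nat) < 2 ^ w" "(4::nat) < 2 ^ w" "(16::nat) < 2 ^ w" "0 < (2::nat) ^ w"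
  using N by (auto intro!: small)
 let ?t2 = "0 ::= V 27 ;; 1 ::= C 2 [*] V 0 [+] C 3 ;; 2 ::= V 1 [*] V 1 ;; 11 ::= C 0 ;;
   3 ::= C 0 ;; 4 ::= V 26 [div] C 2 ;; 5 ::= V 13 ;; 6 ::= V 12 ;; Call 2 ;; Call 7"
 have t2: "wp ?R ?R ?M (?t2) J e1 [] H n1 d1"
  if e1: "e1 27 = W" "e1 12 = N" "e1 13 = length A" "e1 26 = length B" and n1: "n1 <= 3 * W + 7" "d1 <= 3 * W + 7" for e1 n1 d1
 proof -
  define e2 where "e2 = e1(0 := W, 1 := q, 2 := q * q, 11 := 0, 3 := 0, 4 := length B div 2, 5 := length A, 6 := N)"
  define n2 where "n2 = Suc (Suc (Suc (Suc (Suc (Suc (Suc (Suc n1)))))))"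
  define d2 where "d2 = Suc (Suc (Suc (Suc (Suc (Suc (Suc (Suc d1)))))))"
  have "wp ?R ?R ?M (Call 2) (wp ?R ?R ?M (Call 7) J) e2 [] H n2 d2"
  proof (rule wp_Call[OF reverse_tri[where l = "length B" and x = "length A" and t = W]])
   fix H1 assume r: "\<forall>i<length B. H1 (length A + i) = H (length A + (length B - Suc i))"
    and out: "!!a. a \<notin> {length A..<length A + length B} ==> H1 a = H a"
   have inp1: "inp H1 0 N c (length A)"
    unfolding inp_def
   proof (intro conjI allI impI)
    show "length A <= N" using N by simp
    have "int N - int (length A) = int (length B)" using N by simp
    then show "valley c (int (length A)) (int N - int (length A))"
     using s unfolding valley_def c_def by (auto intro!: sorted_nth_mono)
    fix x assume x: "x < N"
    show "H1 (0 + x) = Elem (c (if x < length A then int x else int x - int N))"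
    proof (cases "x < length A")
     case True
     then show ?thesis using H[OF x] out[of x] by (simp add: c_def nth_append)
    next
     case False
     define i where "i = x - length A"
     have i: "x = length A + i" "i < length B" "length A + (length B - Suc i) < N" using False x N by (auto simp: i_def)
     have "H1 x = Elem (B ! (length B - Suc i))"
      using r i(1,2) H[OF i(3)] nth_append_length_plus[of A B "length B - Suc i"] by metis
     moreover have "nat (- (int x - int N) - 1) = length B - Suc i" using i N by auto
     ultimately show ?thesis using False x by (simp add: c_def)
    qed
   qed
   define n3 where "n3 = n2 + Suc (11 * length B + 2)"
   define d3 where "d3 = d2 + Suc (10 * W + 11)"
   have e2v: "e2 0 = W" "e2 1 = q" "e2 2 = q * q" "e2 11 = 0" "e2 12 = N" "e2 13 = length A"
    using e1 by (auto simp: e2_def)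
   have "wp ?R ?R ?M (Call 7) J e2 [] H1 n3 d3"
   proof (rule wp_Call[OF sol_okD[OF sol e2v _ _ inp1]])
    fix H' assume o: "outp H' 0 N (vmset c (int (length A)) (int N - int (length A)))"
    have "int N - int (length A) = int (length B)" using N by simp
    then have "outp H' 0 N (mset (A @ B))" using o vmset_input[of A B] unfolding c_def[abs_def] by simp
    moreover have "n3 + Suc ((2 * 400 + 21) * N + (400 + 31) * W) <= 900 * N + 500 * W"
     using n1 N W4 unfolding n3_def n2_def by simp
    moreover have "d3 + Suc d7 <= 3000 * VV"
     using n1 VV V16 W4 unfolding d3_def d2_def d7 by simp
    ultimately show "J e2 [] H' (n3 + Suc ((2 * 400 + 21) * N + (400 + 31) * W)) (d3 + Suc d7)"
     by (simp add: J_def VV_def)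
   qed (use M7 W4 in auto)
   then show "wp ?R ?R ?M (Call 7) J e2 [] H1 (n2 + Suc (11 * length B + 2)) (d2 + Suc (10 * W + 11))"
    by (simp add: n3_def d3_def)
  qed (use N tW W4 in \<open>auto simp: e2_def\<close>)
  then show ?thesis using e1 bw qw by (simp add: wp_Seq wp_Assign e2_def n2_def d2_def)
 qed
 define e1 where "e1 = e(12 := N, 13 := length A, 26 := length B, 27 := 4, 28 := 16)"
 have "wp ?R ?R ?M (While (V 28) (V 12 [+] C 1) (28 ::= V 28 [+] V 28 ;; 27 ::= V 27 [+] C 1)) (wp ?R ?R ?M (?t2) J) e1 [] H (Suc (Suc (Suc (Suc (Suc 0))))) (Suc (Suc (Suc (Suc (Suc 0)))))"
 proof (rule wp_While[where I = "%e' b' H' n' d'. \<exists>u. 4 <= u & u <= W & e' 27 = u & e' 28 = 2 ^ u & e' 12 = N &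
   e' 13 = length A & e' 26 = length B & b' = [] & H' = H & n' <= 5 + 3 * (u - 4) & d' <= 5 + 3 * (u - 4)"
   and f = "%e b H. W - e 27"], goal_cases)
  case 1
  then show ?case using W4 by (auto simp: e1_def)
 next
  case (2 e' b' H' n' d')
  then obtain u where u: "4 <= u" "u <= W" "e' 27 = u" "e' 28 = 2 ^ u" and r: "e' 12 = N" "e' 13 = length A" "e' 26 = length B"
   "b' = []" "H' = H" and n': "n' <= 5 + 3 * (u - 4)" "d' <= 5 + 3 * (u - 4)" by blast
  show ?case
  proof (cases "2 ^ u < Suc N")
   case False
   then have "W <= u" using min[OF u(1)] by simp
   then have uW: "u = W" using u by simp
   have "wp ?R ?R ?M (?t2) J e' [] H (Suc n') (Suc d')"
    by (rule t2) (use u r n' uW in auto)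
   then show ?thesis using False u r bw by simp
  next
   case True
   have uW: "u < W"
   proof (rule ccontr)
    assume "\<not> u < W"
    then have "u = W" using u by simp
    then show False using True NW by simp
   qed
   have "2 ^ u + 2 ^ u < (2::nat) ^ w" by (rule small) (use True in simp)
   moreover have "Suc u < 2 ^ w" using uW qw(4) by linarith
   ultimately show ?thesis using True u r bw n' uW by (auto simp: wp_Seq wp_Assign mult_2 intro!: exI[of _ "Suc u"])
  qed
 qed
 then have "wp ?R ?R ?M mainc J e [] H 0 0"
  unfolding mainc_def using e bw N by (simp add: wp_Seq wp_Assign e1_def)
 then show ?thesis unfolding J_def by (rule tri_wpI)
qed

end

section \<open>Assembling the machine program, and the final constants\<close>

text \<open>Numbers from 17 on denote \<open>Skip\<close>. Their entry point is the
  \<open>Halt\<close> behind the main program, so that \<open>compiled\<close> holds for all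
  procedure numbers.\<close>

definition ent :: "nat => nat" where
 "ent p = (if p < 17 then 3 + clen mainc + (\<Sum>i<p. clen (proc i) + 1) else 2 + clen mainc)"

text \<open>The two cells with the lengths and the 53 new ones form a frame of 55 cells, and cell 40
  receives its height.\<close>

definition merge_prog :: program where
 "merge_prog = [Alloc 53, Const 40 55] @ comp ent (2 + clen mainc) 2 mainc @ [Halt] @
   concat (map (%p. comp ent (2 + clen mainc) (ent p) (proc p) @ [Halt]) [0..<17])"

lemma code_at_here: "code_at (xs @ ys @ zs) (length xs) ys"
 by (auto simp: code_at_def nth_append)

lemma merge_prog_code:
 "code_at merge_prog 2 (comp ent (2 + clen mainc) 2 mainc)" "merge_prog ! (2 + clen mainc) = Halt" "2 + clen mainc < length merge_prog"
 "merge_prog ! 0 = Alloc 53" "merge_prog ! 1 = Const 40 55"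
 "code_at merge_prog (ent p) (comp ent (2 + clen mainc) (ent p) (proc p) @ [Halt])"
proof -
 let ?hl = "2 + clen mainc"
 let ?f = "%p. comp ent ?hl (ent p) (proc p) @ [Halt]"
 show "code_at merge_prog 2 (comp ent ?hl 2 mainc)"
 proof -
  have l: "length [Alloc 53, Const 40 55] = 2" by simp
  show ?thesis unfolding merge_prog_def by (rule code_at_here[of "[Alloc 53, Const 40 55]", unfolded l])
 qed
 show h: "merge_prog ! ?hl = Halt" "?hl < length merge_prog"
  by (simp_all add: merge_prog_def nth_append)
 show "merge_prog ! 0 = Alloc 53" "merge_prog ! 1 = Const 40 55" by (simp_all add: merge_prog_def)
 show "code_at merge_prog (ent p) (?f p)"
 proof (cases "p < 17")
  case False
  then show ?thesis using h by (simp add: ent_def proc_def code_at_def)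
 next
  case True
  have "[0..<17] = [0..<p] @ p # [Suc p..<17]"
   using True by (metis le0 less_imp_le upt_add_eq_append upt_conv_Cons le_add_diff_inverse)
  then have l: "map ?f [0..<17] = map ?f [0..<p] @ ?f p # map ?f [Suc p..<17]" by simp
  define xs where "xs = [Alloc 53, Const 40 55] @ comp ent ?hl 2 mainc @ [Halt] @ concat (map ?f [0..<p])"
  have mp: "merge_prog = xs @ ?f p @ concat (map ?f [Suc p..<17])"
   unfolding merge_prog_def xs_def l by simp
  have "length (concat (map ?f [0..<m])) = (\<Sum>i<m. clen (proc i) + 1)" for m by (induction m) auto
  then have ln: "length xs = ent p" using True by (simp add: xs_def ent_def)
  have "code_at (xs @ ?f p @ concat (map ?f [Suc p..<17])) (length xs) (?f p)" by (rule code_at_here)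
  then show ?thesis by (simp only: mp[symmetric] ln)
 qed
qed

lemma wfc_main: "wfc mainc"
 by (simp add: mainc_def wfa_def)

lemma wfc_parts: "wfc rd" "wfc wr" "wfc clr" "wfc cut" "wfc bufsort" "wfc swap_body" "wfc mirror_body" "wfc invol"
 by (simp add: rd_def wfa_def, simp add: wr_def wfa_def, simp add: clr_def wfa_def, simp add: cut_def adr_def wfa_def,
  simp add: bufsort_def wfa_def, simp add: swap_body_def wfa_def, simp add: mirror_body_def wfa_def, simp add: invol_def wfa_def)

lemma wfc_pfor: "wfc body ==> wfc (pfor p body)"
 by (simp add: pfor_def wfa_def)

lemma wfc_adr: "t < 40 ==> wfc (adr t)"
 by (simp add: adr_def wfa_def)

lemma wfc_ld_st:
 "xr < 40 ==> t < 40 ==> wfe 46 g ==> esize g <= 10 ==> wfc (ld xr g t)"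
 "wfa a ==> wfe 46 g ==> esize g <= 10 ==> wfc (st g a)"
 by (simp_all add: ld_def st_def wfa_def wfc_parts)

lemma wfc_passes: "wfc init1" "wfc round1" "wfc init2" "wfc round2" "wfc prep" "wfc swp_body" "wfc clear"
 by (simp_all add: init1_def round1_def init2_def round2_def prep_def swp_body_def clear_def wfc_ld_st wfc_parts wfa_def)

lemma wfc_solve: "qr < 40 ==> wfc (solve qr lid pid mid)"
 by (simp add: solve_def wfc_parts wfa_def)

lemma wfc_purify: "wfc leaf ==> wfc (purify self leaf)"
 by (simp add: purify_def wfc_parts wfc_adr wfa_def)

lemma wfc_rest: "wfc buf" "wfc leaf0" "wfc leaf1" "wfc perm0" "wfc perm1"
 by (simp_all add: buf_def leaf0_def leaf1_def perm0_def perm1_def flip_def wfc_parts wfa_def)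

lemma wfc_proc: "wfc (proc p)"
proof (cases "p < 17")
 case True
 have "list_all wfc procs"
  by (simp add: procs_def wfc_parts wfc_pfor wfc_passes wfc_solve wfc_purify wfc_rest)
 moreover have "p < length procs" using True by (simp add: procs_def)
 ultimately show ?thesis using True by (simp add: proc_def list_all_length)
qed (simp add: proc_def)

text \<open>The summand 3 counts the two instructions of the prologue and the final
  \<open>Halt\<close>; 57 is the initial frame with the extra words granted by
  \<open>comp_correct\<close>.\<close>

lemma merge_ev:
 fixes A B :: "'a :: linorder list"
 assumes AB: "sorted A" "sorted B" and w8: "256 <= (2::nat) ^ w" and W: "4 <= W" "length A + length B < 2 ^ W"
  and min: "!!u. 4 <= u ==> length A + length B < 2 ^ u ==> W <= u"
  and WW: "2 * 2 ^ W <= (2::nat) ^ w" and big: "16 * (length A + length B + (2 * W + 3) * (2 * W + 3) + 300) <= (2::nat) ^ w"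
 shows "computes_merge merge_prog 0 w A B om"
  and "real (50 * (900 * (length A + length B) + 500 * W) + 3) <= bd ==> work_le merge_prog 0 w A B bd om"
  and "real (50 * (3000 * (W * W)) + 3) <= bd ==> span_le merge_prog 0 w A B bd om"
  and "real (57 + 4000 * W) <= bd ==> seq_stack_le merge_prog 0 w A B bd om"
proof -
 define N where "N = length A + length B"
 interpret a: alg4 w proc W N
  by unfold_locales (use w8 W WW big in \<open>simp_all add: N_def proc_def procs_def\<close>)
 interpret c: compiled w merge_prog proc ent "2 + clen mainc"
  by unfold_locales (use merge_prog_code wfc_proc in auto)
 define s0 :: "'a cell list" where "s0 = [Word (length A), Word (length B)]"
 define h0 :: "'a cell list" where "h0 = map Elem (A @ B)"
 define e :: "nat => nat" where "e i = (if i = 0 then length A else if i = 1 then length B else 0)" for i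
 have "a.tri {0..<N} {0..<N} (4000 * W) mainc e ((!) h0) (%H'. outp H' 0 N (mset (A @ B))) (900 * N + 500 * W) (3000 * (W * W))"
  by (rule a.main_tri) (use AB min in \<open>auto simp: N_def e_def h0_def nth_append\<close>)
 then obtain e' b' H' n' d' where r: "run w proc {0..<N} {0..<N} (4000 * W) mainc e [] ((!) h0) e' b' H' n' d'"
  and n': "n' <= 900 * N + 500 * W" "d' <= 3000 * (W * W)" and o: "outp H' 0 N (mset (A @ B))"
  unfolding a.tri_def by blast
 let ?M = "55 + 2 + 4000 * W"
 have bl: "length b' <= Suc (4000 * W)" using run_buf[OF r] by simp
 define s1 where "s1 = s0 @ replicate 53 (Word 0)"
 have w55: "55 mod 2 ^ w = (55::nat)" using w8 by simp
 have rel: "rel (s1[40 := Word 55]) e []"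
  unfolding rel_def
 proof (intro conjI allI impI)
  fix i :: nat assume "i < 40"
  then show "s1[40 := Word 55] ! i = Word (e i)"
   by (cases i; cases "i - 1") (auto simp: s1_def s0_def e_def nth_append)
 qed (auto simp: s1_def s0_def)
 have "ev w merge_prog {0..<N} {0..<N} ?M 2 (s1[40 := Word 55]) ((!) h0) H' (50 * n' + 1) (50 * d' + 1)"
 proof (rule c.comp_correct[OF r _ wfc_main merge_prog_code(1) rel])
  fix s' assume rl: "rel s' e' b'"
  show "ev w merge_prog {0..<N} {0..<N} ?M (2 + clen mainc) s' H' H' 1 1"
   by (rule ev_halt) (use merge_prog_code(2,3) rl bl in \<open>auto simp: rel_def\<close>)
 qed auto
 note ev2 = this
 have l2: "0 < length merge_prog" "Suc 0 < length merge_prog" using merge_prog_code(3) by linarith+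
 have px1: "px w {0..<N} {0..<N} (Const 40 55) (Suc 0, s1, (!) h0) (2, s1[40 := Word 55], (!) h0)"
  using px_Const[of 40 s1 w "{0..<N}" "{0..<N}" 55 "Suc 0" "(!) h0"] w55 by (simp add: s1_def s0_def numeral_2_eq_2)
 have ev1: "ev w merge_prog {0..<N} {0..<N} ?M (Suc 0) s1 ((!) h0) H' (Suc (50 * n' + 1)) (Suc (50 * d' + 1))"
  by (rule ev_I[OF px1 _ _ _ ev2]) (use l2 merge_prog_code(5) in \<open>simp_all add: s1_def s0_def\<close>)
 have px0: "px w {0..<N} {0..<N} (Alloc 53) (0, s0, (!) h0) (Suc 0, s1, (!) h0)"
  unfolding s1_def by (rule px_Alloc)
 have "ev w merge_prog {0..<N} {0..<N} ?M 0 s0 ((!) h0) H' (Suc (Suc (50 * n' + 1))) (Suc (Suc (50 * d' + 1)))"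
  by (rule ev_I[OF px0 _ _ _ ev1]) (use l2 merge_prog_code(4) in \<open>simp_all add: s0_def\<close>)
 then have ev: "ev w merge_prog {0..<N} {0..<N} ?M 0 s0 ((!) h0) H' (50 * (900 * N + 500 * W) + 3) (50 * (3000 * (W * W)) + 3)"
  by (rule ev_mono) (use n' in auto)
 have R: "{0..<N} <= {..<length h0}" by (auto simp: h0_def N_def)
 have init: "init 0 A B = (Running [] 0 0 s0, h0)" by (simp add: init_def s0_def h0_def)
 have post: "holds_merge h A B" if "length h = length h0" "(!) h = H'" for h
 proof -
  obtain xs where "sorted xs" "length xs = N" "mset xs = mset (A @ B)" "\<forall>i<N. H' i = Elem (xs ! i)"
   using o unfolding outp_def by auto
  moreover from this have "take (length A + length B) h = map Elem xs"
   using that by (intro nth_equalityI) (auto simp: h0_def N_def)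
  ultimately show ?thesis unfolding holds_merge_def by blast
 qed
 note sound = ev_sound[OF ev R subset_refl init post]
 show "computes_merge merge_prog 0 w A B om" by (rule sound(1))
 show "real (50 * (900 * (length A + length B) + 500 * W) + 3) <= bd ==> work_le merge_prog 0 w A B bd om"
  by (rule sound(2)) (simp_all add: N_def)
 show "real (50 * (3000 * (W * W)) + 3) <= bd ==> span_le merge_prog 0 w A B bd om"
  by (rule sound(3)) simp_all
 show "real (57 + 4000 * W) <= bd ==> seq_stack_le merge_prog 0 w A B bd om"
  by (rule sound(4)) simp_all
qed

text \<open>With \<open>X = 2 ^ c > N\<close> a word ranges over \<open>X ^ 20\<close> values,
  whereas the addresses of the analysis are of order \<open>X * X\<close>. Since
  \<open>N < 2 ^ c\<close>, the least admissible \<open>W\<close> is at most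
  \<open>c + 4\<close>.\<close>

lemma word_size:
 fixes N :: nat
 defines "w \<equiv> word_bits 20 N"
 obtains W where "4 <= W" "N < 2 ^ W" "!!u. 4 <= u ==> N < 2 ^ u ==> W <= u" "256 <= (2::nat) ^ w" "2 * 2 ^ W <= (2::nat) ^ w"
  "16 * (N + (2 * W + 3) * (2 * W + 3) + 300) <= (2::nat) ^ w" "real W <= log 2 (real N + 2) + 5"
proof -
 define c where "c = nat \<lceil>log 2 (real N + 2)\<rceil>"
 have l1: "1 <= log 2 (real N + 2)" by (simp add: le_log_iff)
 have c1: "log 2 (real N + 2) <= real c" "real c < log 2 (real N + 2) + 1" unfolding c_def using l1 by linarith+
 have cpos: "1 <= c" using l1 c1(1) by linarith
 define X where "X = (2::nat) ^ c"
 have "real N + 2 = 2 powr (log 2 (real N + 2))" by simp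
 also have "\<dots> <= 2 powr real c" using c1 by (intro powr_mono) auto
 also have "\<dots> = real X" by (simp add: X_def powr_realpow)
 finally have NX: "N + 2 <= X" by linarith
 have cX: "c < X" unfolding X_def by (rule less_exp)
 define W where "W = (LEAST u. 4 <= u & N < 2 ^ u)"
 have "4 <= c + 4 & N < 2 ^ (c + 4)" using NX by (simp add: X_def power_add)
 then have Wp: "4 <= W & N < 2 ^ W" and Wc: "W <= c + 4" unfolding W_def by (rule LeastI, rule Least_le)
 have min: "W <= u" if "4 <= u" "N < 2 ^ u" for u unfolding W_def using that by (intro Least_le) auto
 have wX: "(2::nat) ^ w = X ^ 20" by (simp add: w_def word_bits_def c_def[symmetric] X_def power_mult[symmetric] mult.commute)
 have w20: "w = 20 * c" by (simp add: w_def word_bits_def c_def)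
 have X2: "2 <= X" using NX by simp
 have "(2::nat) ^ 8 <= 2 ^ w" by (rule power_increasing) (use w20 cpos in auto)
 then have A: "256 <= (2::nat) ^ w" by simp
 have "(2::nat) ^ Suc W <= 2 ^ w" by (rule power_increasing) (use w20 cpos Wc in auto)
 then have B: "2 * 2 ^ W <= (2::nat) ^ w" by simp
 have C: "16 * (N + (2 * W + 3) * (2 * W + 3) + 300) <= (2::nat) ^ w"
 proof -
  have "2 * W + 3 <= 8 * X" using Wc cX X2 by linarith
  then have "(2 * W + 3) * (2 * W + 3) <= 8 * X * (8 * X)" by (intro mult_le_mono)
  moreover have "N <= X * X" "300 <= 75 * (X * X)"
  proof -
   have "X * 1 <= X * X" "2 * 2 <= X * X" using X2 by (intro mult_le_mono; simp)+
   then show "N <= X * X" "300 <= 75 * (X * X)" using NX by linarith+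
  qed
  moreover have "8 * X * (8 * X) = 64 * (X * X)" by simp
  moreover have "16 * (N + z + 300) <= 2240 * y" if "z <= 64 * y" "N <= y" "300 <= 75 * y" for z y :: nat
   using that by simp
  \<comment> \<open>The constant is \<open>16 * (1 + 64 + 75)\<close>. It is at most
    \<open>2 ^ 18\<close>, hence at most \<open>X ^ 18\<close>, and this determines the choice of
    20.\<close>
  ultimately have "16 * (N + (2 * W + 3) * (2 * W + 3) + 300) <= 2240 * (X * X)" by metis
  also have "\<dots> <= 2 ^ 18 * (X * X)" by (intro mult_le_mono1) simp
  also have "\<dots> <= X ^ 18 * (X * X)" using X2 by (intro mult_le_mono1 power_mono) auto
  also have "\<dots> = X ^ 20" by (simp add: power_add[symmetric] power2_eq_square[symmetric])
  finally show ?thesis by (simp only: wX)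
 qed
 have "real W <= log 2 (real N + 2) + 5" using Wc c1 by linarith
 with Wp min A B C show ?thesis by (intro that[of W]) auto
qed

lemma prob_space_tapes: "prob_space (tapes w)"
 unfolding tapes_def
 by (intro prob_space_PiM prob_space_uniform_count_measure) (auto simp: lessThan_empty_iff)

theorem theorem4p1:
  "\<exists>(P :: program) (S :: nat) (\<kappa> :: nat) (K :: real). \<kappa> \<ge> 1 \<and> K > 0 \<and>
    (\<forall>(A :: 'a :: linorder list) (B :: 'a list) n m w.
      sorted A \<longrightarrow> sorted B \<longrightarrow> length A = n \<longrightarrow> length B = m \<longrightarrow> m \<le> n \<longrightarrow>
      w = word_bits \<kappa> (n + m) \<longrightarrow>
      (\<forall>\<omega> \<in> space (tapes w). computes_merge P S w A B \<omega>) \<and>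
      (n \<ge> 2 \<longrightarrow>
        (\<forall>\<omega> \<in> space (tapes w). work_le P S w A B (K * real n) \<omega>) \<and>
        (\<forall>\<omega> \<in> space (tapes w). seq_stack_le P S w A B (K * log 2 (real n)) \<omega>) \<and>
        (\<forall>c::real. c \<ge> 1 \<longrightarrow>
          measure (tapes w)
            {\<omega> \<in> space (tapes w). span_le P S w A B (c * (K * (log 2 (real n))\<^sup>2)) \<omega>}
            \<ge> 1 - real n powr (- c))))"
\<comment> \<open>No extra cells are used. The largest demand on the constant comes from the span,
  \<open>50 * 3000 * 64\<close> with \<open>W <= 8 * Lg\<close>; the value chosen is far above
  it.\<close>
proof (rule exI[of _ merge_prog], rule exI[of _ 0], rule exI[of _ 20], rule exI[of _ 100000000], intro conjI allI impI ballI)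
 fix A B :: "'a list" and n m w
 assume a: "sorted A" "sorted B" "length A = n" "length B = m" "m <= n" "w = word_bits 20 (n + m)"
 obtain W where W: "4 <= W" "n + m < 2 ^ W" "!!u. 4 <= u ==> n + m < 2 ^ u ==> W <= u" "256 <= (2::nat) ^ w" "2 * 2 ^ W <= (2::nat) ^ w"
  "16 * (n + m + (2 * W + 3) * (2 * W + 3) + 300) <= (2::nat) ^ w" "real W <= log 2 (real (n + m) + 2) + 5"
  using word_size[of "n + m"] a(6) by metis
 note me = merge_ev[OF a(1,2) W(4,1), unfolded a(3,4), OF W(2,3,5,6)]
 show "computes_merge merge_prog 0 w A B \<omega>" for \<omega> by (rule me(1))
 assume n: "2 <= n"
 define Lg where "Lg = log 2 (real n)"
 have L1: "1 <= Lg" unfolding Lg_def using n by (simp add: le_log_iff)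
 have "log 2 (real (n + m) + 2) <= log 2 (4 * real n)" using a(5) n by simp
 also have "\<dots> = 2 + Lg"
 proof -
  have "log 2 (4::real) = 2" using log_pow_cancel[of "2::real" 2] by simp
  then show ?thesis using n by (simp add: Lg_def log_mult)
 qed
 \<comment> \<open>\<open>W\<close> is at most \<open>Lg + 7\<close>, and \<open>1 <= Lg\<close>
   because \<open>2 <= n\<close>.\<close>
 finally have WL: "real W <= 8 * Lg" using W(7) L1 by linarith
 have Ln: "Lg <= real n"
 proof -
  have "real n < real (2 ^ n)" using less_exp[of n] by (simp only: of_nat_less_iff)
  also have "real (2 ^ n) = 2 powr real n" by (simp add: powr_realpow)
  finally have "real n <= 2 powr real n" by simp
  then show ?thesis unfolding Lg_def using n by (simp add: log_le_iff)
 qed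
 show "work_le merge_prog 0 w A B (100000000 * real n) \<omega>" for \<omega>
 proof (rule me(2))
  have "real m <= real n" using a(5) by simp
  moreover have "2 <= real n" using n by simp
  ultimately show "real (50 * (900 * (n + m) + 500 * W) + 3) <= 100000000 * real n" using WL Ln by simp
 qed
 show "seq_stack_le merge_prog 0 w A B (100000000 * log 2 (real n)) \<omega>" for \<omega>
 proof (rule me(4))
  have "real (57 + 4000 * W) = 57 + 4000 * real W" by simp
  also have "\<dots> <= 100000000 * Lg" using WL L1 by linarith
  finally show "real (57 + 4000 * W) <= 100000000 * log 2 (real n)" by (simp add: Lg_def)
 qed
 fix c :: real assume c: "1 <= c"
 have W2: "real W * real W <= 64 * (Lg * Lg)"
 proof -
  have "real W * real W <= 8 * Lg * (8 * Lg)" using WL L1 by (intro mult_mono) auto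
  then show ?thesis by simp
 qed
 have LL: "1 <= Lg * Lg" using mult_mono[of 1 Lg 1 Lg] L1 by simp
 have "span_le merge_prog 0 w A B (c * (100000000 * Lg\<^sup>2)) \<omega>" for \<omega>
 proof (rule me(3))
  have "real (50 * (3000 * (W * W)) + 3) <= 100000000 * Lg\<^sup>2" using W2 LL by (simp add: power2_eq_square)
  also have "\<dots> <= c * (100000000 * Lg\<^sup>2)" using mult_right_mono[OF c, of "100000000 * Lg\<^sup>2"] by simp
  finally show "real (50 * (3000 * (W * W)) + 3) <= c * (100000000 * Lg\<^sup>2)" .
 qed
 then have "{\<omega> \<in> space (tapes w). span_le merge_prog 0 w A B (c * (100000000 * (log 2 (real n))\<^sup>2)) \<omega>} = space (tapes w)"
  by (auto simp: Lg_def)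
 then show "1 - real n powr - c <= measure (tapes w) {\<omega> \<in> space (tapes w). span_le merge_prog 0 w A B (c * (100000000 * (log 2 (real n))\<^sup>2)) \<omega>}"
  using prob_space.prob_space[OF prob_space_tapes, of w] by simp
qed auto

end
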